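(* Let $k_n=k$ for all $n=1,\dots,N$. Let $(u,p)$ be the solution of the mixed parabolic problem (MP) and $(U,P)\in\mathcal P^b(I;\mathcal U)\times\mathcal P^b(I;\mathcal Q_1)$ the solution of the time-discrete mixed problem (DMP) (both defined in the context). Assume that $u\in H^m(I;\mathcal U)$ and $p\in H^m(I;\mathcal Q_1)$ for an integer $m$ with $1\le m\le q$. Then $$\|p-P\|_{L^2(I;\mathcal Q_1)}\le c\,k^{m-\frac12}\big(\|u^{(m)}\|_{L^2(I;\mathcal U)}+k^{\frac12}\|p^{(m)}\|_{L^2(I;\mathcal Q_1)}\big)$$ with a constant $c$ which depends only on $q$, $\gamma$, $\Gamma$ and $\beta$.
   Context: Abstract setting. $\mathcal U,\mathcal H$ are real separable Hilbert spaces with a dense continuous embedding $\mathcal U\hookrightarrow\mathcal H$; $\mathcal Q=\mathcal Q_1\times\mathcal Q_2$ is a product of real Hilbert spaces with $\mathcal Q_1\ne\{0\}$ ($\mathcal Q_2=\{0\}$ allowed); $b_i:\mathcal U\times\mathcal Q_i\to\mathbb R$ ($i=1,2$) are continuous bilinear forms with operators $B_i:\mathcal U\to\mathcal Q_i'$, $(B_iu)(r_i)=b_i(u,r_i)$; $b(u,(r_1,r_2))=b_1(u,r_1)+b_2(u,r_2)$ with operator $B:\mathcal U\to\mathcal Q'$, assumed surjective. $\mathcal V:=\ker B$, $\mathcal V_i:=\ker B_i$ (so $\mathcal V=\mathcal V_1\cap\mathcal V_2$), all with norm $\|\cdot\|_{\mathcal U}$. Surjectivity of $B$ implies the inf-sup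 property $\inf_{0\ne r\in\mathcal Q_1}\sup_{0\ne v\in\mathcal V_2}\frac{b_1(v,r)}{\|v\|_{\mathcal U}\|r\|_{\mathcal Q_1}}\ge\beta$ for some $\beta>0$, which is fixed. $B_1':\mathcal Q_1\to\mathcal V_2'$, $(B_1'r)(v)=b_1(v,r)$. $a:\mathcal U\times\mathcal U\to\mathbb R$ is a symmetric bilinear form with $|a(u,v)|\le\Gamma\|u\|_{\mathcal U}\|v\|_{\mathcal U}$ for $u,v\in\mathcal U$ and $a(v,v)\ge\gamma\|v\|_{\mathcal U}^2$ for $v\in\mathcal V$, where $\gamma,\Gamma>0$; $(Au)(v)=a(u,v)$. $a$ and $b$ do not depend on time. $I=(0,T)$. An element $w\in\mathcal H$ acts as an element of $\mathcal V_2'$ by $v\mapsto(w,v)_{\mathcal H}$. $W^1(\mathcal U;\mathcal V_2')=\{u\in L^2(I;\mathcal U): u'\in L^2(I;\mathcal V_2')\}$. (MP): given $f\in L^2(I;\mathcal V_2')$, $g\in L^2(I;\mathcal Q')$, $u_0\in\mathcal H$, the pair $u\in W^1(\mathcal U;\mathcal V_2')$, $p\in L^2(I;\mathcal Q_1)$ satisfies $u(0)=u_0$, $u'+Au+B_1'p=f$ in $L^2(I;\mathcal V_2')$, and $Bu=g$ in $L^2(I;\mathcal Q')$. Time discretization. $q\ge1$ is an integer; $0=t_0<\dots<t_N=T$, $I_n=(t_{n-1},t_n]$, $k_n=t_n-t_{n-1}$, $k=\max_nk_n\le1$. For a Hilbert space $\hat{\mathcal H}$, $\mathcal P^b(I;\hat{\mathcal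 H})$ is the space of functions on $I$ whose restriction to each $I_n$ is a polynomial of degree $\le q-1$ with values in $\hat{\mathcal H}$, and $H^{1,b}(I;\hat{\mathcal H})$ the space of functions whose restriction to each $I_n$ lies in $H^1(I_n;\hat{\mathcal H})$. For such a function $Y$: $Y^n=Y|_{I_n}(t_n)$, $Y_+^{n-1}=\lim_{t\downarrow t_{n-1}}Y|_{I_n}(t)$, $[Y]^n=Y^n_+-Y^n$ ($1\le n\le N-1$), and $Y'$ is the derivative taken on each $I_n$ separately. Set $$D_{\mathcal H}(Y,X)=\sum_{n=1}^N\int_{I_n}(Y',X)_{\mathcal H}+\sum_{n=1}^{N-1}([Y]^n,X^n_+)_{\mathcal H}+(Y^0_+,X^0_+)_{\mathcal H},\qquad K(Y,X)=D_{\mathcal H}(Y,X)+\int_I a(Y,X).$$ $L^2_c(I;\hat{\mathcal H})$ denotes functions in $L^2(I;\hat{\mathcal H})$ whose restriction to each $I_n$ is continuous at $t_n$. The projection $\mathcal I_q:L_c^2(I;\hat{\mathcal H})\to\mathcal P^b(I;\hat{\mathcal H})$ is defined on each $I_n$ by $(\mathcal I_q\phi)|_{I_n}(t_n)=\phi|_{I_n}(t_n)$ and $\int_{I_n}(\mathcal I_q\phi-\phi)\psi=0$ for all scalar polynomials $\psi$ of degree $\le q-2$ (only the first condition if $q=1$). (DMP): $U\in\mathcal P^b(I;\mathcal U)$, $P\in\mathcal P^b(I;\mathcal Q_1)$ satisfy $K(U,X)+\int_I b_1(X,P)=\int_I f(X)+(u_0,X_+^0)_{\mathcal H}$ for all $X\in\mathcal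 P^b(I;\mathcal V_2)$, and $\int_I b(U,R)=\int_I(\mathcal I_qg)(R)$ for all $R\in\mathcal P^b(I;\mathcal Q)$ (equivalently $BU=\mathcal I_qg$).
   Formalization: The constant c may also depend on a bound κ for the norm of the embedding of U into H; with dependence on q, γ, Γ, β alone the claim fails (a two-dimensional example with a skewed inner product on H makes P arbitrarily large). *)

theory Defs
  imports "HOL-Analysis.Analysis" "HOL-Computational_Algebra.Polynomial"
begin

text \<open>
  Every Hilbert space of the setting is a closed linear subspace of an ambient complete inner
  product space given by a type. The whole type (\<open>UNIV\<close>) is allowed. The spaces are sets rather
  than types so that they can be quantified inside the scope of the constant of an error estimate,
  which therefore cannot depend on them.

  The ambient types are second countable, which makes their closed subspaces separable. For
  \<open>\<Q>\<^sub>1\<close> and \<open>\<Q>\<^sub>2\<close> this is no restriction: \<open>B\<close> maps the separable space \<open>\<U>\<close> onto \<open>\<Q>'\<close>, so \<open>\<Q>'\<close>,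
  and with it \<open>\<Q>\<close>, is separable.
\<close>

definition hilbert_subspace :: "'a::{real_inner, complete_space} set \<Rightarrow> bool" where
  "hilbert_subspace S \<longleftrightarrow> subspace S \<and> closed S"

definition linear_on :: "'a::real_vector set \<Rightarrow> ('a \<Rightarrow> 'b::real_vector) \<Rightarrow> bool" where
  "linear_on S F \<longleftrightarrow>
     (\<forall>x\<in>S. \<forall>y\<in>S. F (x + y) = F x + F y) \<and> (\<forall>c. \<forall>x\<in>S. F (c *\<^sub>R x) = c *\<^sub>R F x)"

definition bilinear_on ::
    "'a::real_vector set \<Rightarrow> 'b::real_vector set \<Rightarrow> ('a \<Rightarrow> 'b \<Rightarrow> real) \<Rightarrow> bool" where
  "bilinear_on S R b \<longleftrightarrow>
     (\<forall>r\<in>R. linear_on S (\<lambda>u. b u r)) \<and> (\<forall>u\<in>S. linear_on R (b u))"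

definition continuous_bilinear_on ::
    "'a::real_normed_vector set \<Rightarrow> 'b::real_normed_vector set \<Rightarrow> ('a \<Rightarrow> 'b \<Rightarrow> real) \<Rightarrow> bool" where
  "continuous_bilinear_on S R b \<longleftrightarrow>
     bilinear_on S R b \<and> (\<exists>C. \<forall>u\<in>S. \<forall>r\<in>R. \<bar>b u r\<bar> \<le> C * norm u * norm r)"


section \<open>Dual spaces\<close>

text \<open>
  An element of \<open>S'\<close> is represented by any function on the ambient type whose restriction to \<open>S\<close> is
  linear and bounded. Its values off \<open>S\<close> are irrelevant: below, functionals are evaluated at
  points of \<open>S\<close> only, and they are compared on \<open>S\<close> only.
\<close>

definition dual :: "'a::real_normed_vector set \<Rightarrow> ('a \<Rightarrow> real) set" where
  "dual S = {F. linear_on S F \<and> (\<exists>C. \<forall>v\<in>S. \<bar>F v\<bar> \<le> C * norm v)}"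

definition dual_norm :: "'a::real_normed_vector set \<Rightarrow> ('a \<Rightarrow> real) \<Rightarrow> real" where
  "dual_norm S F = (SUP v\<in>{v\<in>S. norm v \<le> 1}. \<bar>F v\<bar>)"


section \<open>Bochner and Sobolev spaces on an interval\<close>

definition L2 :: "real set \<Rightarrow> 'a::{real_inner, complete_space, second_countable_topology} set
    \<Rightarrow> (real \<Rightarrow> 'a) set" where
  "L2 I S = {f. (\<forall>t\<in>I. f t \<in> S) \<and> f \<in> borel_measurable (lebesgue_on I)
     \<and> integrable (lebesgue_on I) (\<lambda>t. (norm (f t))\<^sup>2)}"

definition L2_norm :: "real set \<Rightarrow> (real \<Rightarrow> 'a::real_normed_vector) \<Rightarrow> real" where
  "L2_norm I f = sqrt (LINT t|lebesgue_on I. (norm (f t))\<^sup>2)"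

text \<open>Strong (Bochner) measurability of a function with values in \<open>S'\<close>.\<close>

definition dual_measurable :: "real set \<Rightarrow> 'a::real_normed_vector set \<Rightarrow> (real \<Rightarrow> 'a \<Rightarrow> real) \<Rightarrow> bool" where
  "dual_measurable I S f \<longleftrightarrow>
     (\<exists>s :: nat \<Rightarrow> real \<Rightarrow> 'a \<Rightarrow> real.
        (\<forall>i. simple_function (lebesgue_on I) (s i) \<and> s i ` I \<subseteq> dual S) \<and>
        (AE t in lebesgue_on I. (\<lambda>i. dual_norm S (\<lambda>v. s i t v - f t v)) \<longlonglongrightarrow> 0))"

definition L2_dual :: "real set \<Rightarrow> 'a::real_normed_vector set \<Rightarrow> (real \<Rightarrow> 'a \<Rightarrow> real) set" where
  "L2_dual I S = {f. (\<forall>t\<in>I. f t \<in> dual S) \<and> dual_measurable I S f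
     \<and> integrable (lebesgue_on I) (\<lambda>t. (dual_norm S (f t))\<^sup>2)}"

definition test_functions :: "real set \<Rightarrow> (real \<Rightarrow> real) set" where
  "test_functions I = {\<phi>. (\<forall>j x. (deriv ^^ j) \<phi> differentiable (at x))
     \<and> (\<exists>K. compact K \<and> K \<subseteq> I \<and> (\<forall>x. x \<notin> K \<longrightarrow> \<phi> x = 0))}"

definition is_weak_deriv :: "real set \<Rightarrow> nat
    \<Rightarrow> (real \<Rightarrow> 'a::{real_inner, complete_space, second_countable_topology}) \<Rightarrow> (real \<Rightarrow> 'a) \<Rightarrow> bool" where
  "is_weak_deriv I j u w \<longleftrightarrow>
     (\<forall>\<phi>\<in>test_functions I.
        (LINT t|lebesgue_on I. (deriv ^^ j) \<phi> t *\<^sub>R u t)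
        = (-1) ^ j *\<^sub>R (LINT t|lebesgue_on I. \<phi> t *\<^sub>R w t))"

definition Hm :: "real set \<Rightarrow> 'a::{real_inner, complete_space, second_countable_topology} set
    \<Rightarrow> nat \<Rightarrow> (real \<Rightarrow> 'a) set" where
  "Hm I S m = {u \<in> L2 I S. \<forall>j\<in>{1..m}. \<exists>w\<in>L2 I S. is_weak_deriv I j u w}"

text \<open>The weak derivative \<open>u\<^sup>(\<^sup>j\<^sup>)\<close>, determined up to a null set when it exists in \<open>L2\<close>.\<close>

definition weak_deriv :: "real set \<Rightarrow> nat
    \<Rightarrow> (real \<Rightarrow> 'a::{real_inner, complete_space, second_countable_topology}) \<Rightarrow> real \<Rightarrow> 'a" where
  "weak_deriv I j u = (SOME w. w \<in> L2 I UNIV \<and> is_weak_deriv I j u w)"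

text \<open>
  First weak derivative of a function with values in \<open>S'\<close>. The \<open>S'\<close>-valued integrals are
  evaluated at \<open>v\<close>, which commutes with Bochner integration.
\<close>

definition is_weak_deriv_dual ::
    "real set \<Rightarrow> 'a::real_normed_vector set \<Rightarrow> (real \<Rightarrow> 'a \<Rightarrow> real) \<Rightarrow> (real \<Rightarrow> 'a \<Rightarrow> real) \<Rightarrow> bool" where
  "is_weak_deriv_dual I S z w \<longleftrightarrow>
     (\<forall>\<phi>\<in>test_functions I. \<forall>v\<in>S.
        (LINT t|lebesgue_on I. deriv \<phi> t * z t v) = - (LINT t|lebesgue_on I. \<phi> t * w t v))"


section \<open>The abstract setting\<close>

definition b_sum :: "('u \<Rightarrow> 'q1 \<Rightarrow> real) \<Rightarrow> ('u \<Rightarrow> 'q2 \<Rightarrow> real) \<Rightarrow> 'u \<Rightarrow> 'q1 \<times> 'q2 \<Rightarrow> real" where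
  "b_sum b1 b2 u r = b1 u (fst r) + b2 u (snd r)"

definition ker_form :: "'u set \<Rightarrow> 'q set \<Rightarrow> ('u \<Rightarrow> 'q \<Rightarrow> real) \<Rightarrow> 'u set" where
  "ker_form \<U> \<Q> b = {u\<in>\<U>. \<forall>r\<in>\<Q>. b u r = 0}"

text \<open>
  The map \<open>\<iota>\<close> is the embedding of \<open>\<U>\<close> into \<open>\<H>\<close>, and \<open>\<kappa>\<close> is a bound for its norm. The bound is a
  named parameter because the constant in the pressure estimate has to depend on it: take
  \<open>T = k = 1\<close>, \<open>q = m = 1\<close>, \<open>\<U> = \<H> = \<real>\<^sup>2\<close>, \<open>a\<close> the Euclidean product, \<open>\<Q>\<^sub>1 = \<real>\<close>, \<open>\<Q>\<^sub>2 = {0}\<close>,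
  \<open>b\<^sub>1(u,r) = u\<^sub>2 r\<close>, \<open>u(t) = (t,0)\<close>, \<open>p = 0\<close>, and the inner product on \<open>\<H>\<close> with Gram matrix
  \<open>((1, \<lambda>/2), (\<lambda>/2, \<lambda>\<^sup>2))\<close>. Here \<open>\<gamma> = \<Gamma> = \<beta> = 1\<close>, and the discrete pressure is \<open>P = \<lambda>/8\<close>.
  With \<open>\<kappa> = 1\<close> the embedding is normalised to \<open>\<parallel>v\<parallel>\<^sub>\<H> \<le> \<parallel>v\<parallel>\<^sub>\<U>\<close>.
\<close>

locale mixed_setting =
  fixes \<U> :: "'u::{real_inner, complete_space, second_countable_topology} set"
    and \<H> :: "'h::{real_inner, complete_space, second_countable_topology} set"
    and \<Q>\<^sub>1 :: "'q1::{real_inner, complete_space, second_countable_topology} set"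
    and \<Q>\<^sub>2 :: "'q2::{real_inner, complete_space, second_countable_topology} set"
    and \<iota> :: "'u \<Rightarrow> 'h"
    and a :: "'u \<Rightarrow> 'u \<Rightarrow> real"
    and b1 :: "'u \<Rightarrow> 'q1 \<Rightarrow> real"
    and b2 :: "'u \<Rightarrow> 'q2 \<Rightarrow> real"
    and \<gamma> \<Gamma> \<beta> \<kappa> :: real
  assumes hilbert: "hilbert_subspace \<U>" "hilbert_subspace \<H>" "hilbert_subspace \<Q>\<^sub>1" "hilbert_subspace \<Q>\<^sub>2"
    and Q1_nontrivial: "\<Q>\<^sub>1 \<noteq> {0}"
    and embedding_linear: "linear_on \<U> \<iota>"
    and embedding_inj: "inj_on \<iota> \<U>"
    and embedding_dense: "closure (\<iota> ` \<U>) = \<H>"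
    and embedding_bound: "\<And>v. v \<in> \<U> \<Longrightarrow> norm (\<iota> v) \<le> \<kappa> * norm v"
    and b1: "continuous_bilinear_on \<U> \<Q>\<^sub>1 b1"
    and b2: "continuous_bilinear_on \<U> \<Q>\<^sub>2 b2"
    and B_surjective:
      "\<And>F. F \<in> dual (\<Q>\<^sub>1 \<times> \<Q>\<^sub>2) \<Longrightarrow> \<exists>u\<in>\<U>. \<forall>r\<in>\<Q>\<^sub>1 \<times> \<Q>\<^sub>2. b_sum b1 b2 u r = F r"
    and beta_pos: "\<beta> > 0"
    and inf_sup:
      "(INF r\<in>\<Q>\<^sub>1 - {0}. SUP v\<in>ker_form \<U> \<Q>\<^sub>2 b2 - {0}. b1 v r / (norm v * norm r)) \<ge> \<beta>"
    and a_bilinear: "bilinear_on \<U> \<U> a"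
    and a_symmetric: "\<And>u v. u \<in> \<U> \<Longrightarrow> v \<in> \<U> \<Longrightarrow> a u v = a v u"
    and gamma_pos: "\<gamma> > 0"
    and Gamma_pos: "\<Gamma> > 0"
    and a_bounded: "\<And>u v. u \<in> \<U> \<Longrightarrow> v \<in> \<U> \<Longrightarrow> \<bar>a u v\<bar> \<le> \<Gamma> * norm u * norm v"
    and a_coercive:
      "\<And>v. v \<in> ker_form \<U> (\<Q>\<^sub>1 \<times> \<Q>\<^sub>2) (b_sum b1 b2) \<Longrightarrow> a v v \<ge> \<gamma> * (norm v)\<^sup>2"


section \<open>The mixed parabolic problem\<close>

text \<open>An element \<open>w\<close> of \<open>\<H>\<close> acting on \<open>\<V>\<^sub>2\<close>.\<close>

definition H_functional :: "('u \<Rightarrow> 'h::real_inner) \<Rightarrow> 'h \<Rightarrow> 'u \<Rightarrow> real" where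
  "H_functional \<iota> w v = w \<bullet> \<iota> v"

definition W1 :: "real set \<Rightarrow> 'u::{real_inner, complete_space, second_countable_topology} set
    \<Rightarrow> 'u set \<Rightarrow> ('u \<Rightarrow> 'h::real_inner) \<Rightarrow> (real \<Rightarrow> 'u) set" where
  "W1 I \<U> \<V>\<^sub>2 \<iota> = {u \<in> L2 I \<U>. \<exists>w\<in>L2_dual I \<V>\<^sub>2.
     is_weak_deriv_dual I \<V>\<^sub>2 (\<lambda>t. H_functional \<iota> (\<iota> (u t))) w}"

text \<open>
  \<open>u(0) = u\<^sub>0\<close> for \<open>u\<close> in \<open>W1\<close>. Such a function has a representative continuous on \<open>[0,T]\<close> with
  values in \<open>\<V>\<^sub>2'\<close>, and it need not have one with values in \<open>\<H>\<close>, so the equality is taken in \<open>\<V>\<^sub>2'\<close>.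
  It is implied by equality in \<open>\<H>\<close> wherever the latter makes sense, and is equivalent to it when
  \<open>\<V>\<^sub>2\<close> is dense in \<open>\<H>\<close>.
\<close>

definition initial_value :: "real \<Rightarrow> 'u::real_normed_vector set \<Rightarrow> ('u \<Rightarrow> 'h::real_inner)
    \<Rightarrow> (real \<Rightarrow> 'u) \<Rightarrow> 'h \<Rightarrow> bool" where
  "initial_value T \<V>\<^sub>2 \<iota> u u0 \<longleftrightarrow>
     (\<exists>z :: real \<Rightarrow> 'u \<Rightarrow> real.
        (\<forall>t\<in>{0..T}. z t \<in> dual \<V>\<^sub>2) \<and>
        (\<forall>t\<in>{0..T}. ((\<lambda>s. dual_norm \<V>\<^sub>2 (\<lambda>v. z s v - z t v)) \<longlongrightarrow> 0) (at t within {0..T})) \<and>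
        (AE t in lebesgue_on {0<..<T}. \<forall>v\<in>\<V>\<^sub>2. z t v = H_functional \<iota> (\<iota> (u t)) v) \<and>
        (\<forall>v\<in>\<V>\<^sub>2. z 0 v = H_functional \<iota> u0 v))"

definition MP_solution ::
    "'u::{real_inner, complete_space, second_countable_topology} set \<Rightarrow> 'h::real_inner set
     \<Rightarrow> 'q1::{real_inner, complete_space, second_countable_topology} set
     \<Rightarrow> 'q2::{real_inner, complete_space, second_countable_topology} set
     \<Rightarrow> ('u \<Rightarrow> 'h) \<Rightarrow> ('u \<Rightarrow> 'u \<Rightarrow> real) \<Rightarrow> ('u \<Rightarrow> 'q1 \<Rightarrow> real) \<Rightarrow> ('u \<Rightarrow> 'q2 \<Rightarrow> real)
     \<Rightarrow> real \<Rightarrow> (real \<Rightarrow> 'u \<Rightarrow> real) \<Rightarrow> (real \<Rightarrow> 'q1 \<times> 'q2 \<Rightarrow> real) \<Rightarrow> 'h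
     \<Rightarrow> (real \<Rightarrow> 'u) \<Rightarrow> (real \<Rightarrow> 'q1) \<Rightarrow> bool" where
  "MP_solution \<U> \<H> \<Q>\<^sub>1 \<Q>\<^sub>2 \<iota> a b1 b2 T f g u0 u p \<longleftrightarrow>
     (let I = {0<..<T}; \<V>\<^sub>2 = ker_form \<U> \<Q>\<^sub>2 b2 in
        f \<in> L2_dual I \<V>\<^sub>2 \<and> g \<in> L2_dual I (\<Q>\<^sub>1 \<times> \<Q>\<^sub>2) \<and> u0 \<in> \<H> \<and>
        u \<in> W1 I \<U> \<V>\<^sub>2 \<iota> \<and> p \<in> L2 I \<Q>\<^sub>1 \<and>
        initial_value T \<V>\<^sub>2 \<iota> u u0 \<and>
        (\<exists>u'\<in>L2_dual I \<V>\<^sub>2. is_weak_deriv_dual I \<V>\<^sub>2 (\<lambda>t. H_functional \<iota> (\<iota> (u t))) u' \<and>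
           (AE t in lebesgue_on I. \<forall>v\<in>\<V>\<^sub>2. u' t v + a (u t) v + b1 v (p t) = f t v)) \<and>
        (AE t in lebesgue_on I. \<forall>r\<in>\<Q>\<^sub>1 \<times> \<Q>\<^sub>2. b_sum b1 b2 (u t) r = g t r))"


section \<open>Time discretization\<close>

definition time_grid :: "real \<Rightarrow> nat \<Rightarrow> (nat \<Rightarrow> real) \<Rightarrow> bool" where
  "time_grid T N t \<longleftrightarrow> 0 < N \<and> t 0 = 0 \<and> t N = T \<and> (\<forall>n\<in>{1..N}. t (n - 1) < t n)"

definition cell :: "(nat \<Rightarrow> real) \<Rightarrow> nat \<Rightarrow> real set" where
  "cell t n = {t (n - 1)<..t n}"

text \<open>Piecewise polynomials of degree at most \<open>q - 1\<close> with values in \<open>S\<close>, respectively in \<open>S'\<close>.\<close>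

definition Pb :: "nat \<Rightarrow> nat \<Rightarrow> (nat \<Rightarrow> real) \<Rightarrow> 'a::real_vector set \<Rightarrow> (real \<Rightarrow> 'a) set" where
  "Pb q N t S = {Y. \<forall>n\<in>{1..N}. \<exists>c. (\<forall>j<q. c j \<in> S) \<and>
     (\<forall>s\<in>cell t n. Y s = (\<Sum>j<q. s ^ j *\<^sub>R c j))}"

definition Pb_dual :: "nat \<Rightarrow> nat \<Rightarrow> (nat \<Rightarrow> real) \<Rightarrow> 'a::real_normed_vector set
    \<Rightarrow> (real \<Rightarrow> 'a \<Rightarrow> real) set" where
  "Pb_dual q N t S = {G. \<forall>n\<in>{1..N}. \<exists>c. (\<forall>j<q. c j \<in> dual S) \<and>
     (\<forall>s\<in>cell t n. \<forall>r\<in>S. G s r = (\<Sum>j<q. s ^ j * c j r))}"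

text \<open>\<open>right_limit t Y n\<close> is \<open>Y\<^sub>+\<^sup>n\<close>; the left value \<open>Y\<^sup>n\<close> is \<open>Y (t n)\<close>.\<close>

definition right_limit :: "(nat \<Rightarrow> real) \<Rightarrow> (real \<Rightarrow> 'a::t2_space) \<Rightarrow> nat \<Rightarrow> 'a" where
  "right_limit t Y n = Lim (at_right (t n)) Y"

definition jump :: "(nat \<Rightarrow> real) \<Rightarrow> (real \<Rightarrow> 'a::real_normed_vector) \<Rightarrow> nat \<Rightarrow> 'a" where
  "jump t Y n = right_limit t Y n - Y (t n)"

definition D_H :: "nat \<Rightarrow> (nat \<Rightarrow> real) \<Rightarrow> (real \<Rightarrow> 'h::real_inner) \<Rightarrow> (real \<Rightarrow> 'h) \<Rightarrow> real" where
  "D_H N t Y X =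
     (\<Sum>n = 1..N. LINT s|lebesgue_on (cell t n).
        vector_derivative Y (at s within cell t n) \<bullet> X s)
     + (\<Sum>n = 1..N - 1. jump t Y n \<bullet> right_limit t X n)
     + right_limit t Y 0 \<bullet> right_limit t X 0"

definition K_form :: "('u \<Rightarrow> 'h::real_inner) \<Rightarrow> ('u \<Rightarrow> 'u \<Rightarrow> real) \<Rightarrow> real \<Rightarrow> nat \<Rightarrow> (nat \<Rightarrow> real)
    \<Rightarrow> (real \<Rightarrow> 'u) \<Rightarrow> (real \<Rightarrow> 'u) \<Rightarrow> real" where
  "K_form \<iota> a T N t Y X =
     D_H N t (\<lambda>s. \<iota> (Y s)) (\<lambda>s. \<iota> (X s)) + (LINT s|lebesgue_on {0<..<T}. a (Y s) (X s))"

definition L2c_dual :: "real \<Rightarrow> nat \<Rightarrow> (nat \<Rightarrow> real) \<Rightarrow> 'a::real_normed_vector set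
    \<Rightarrow> (real \<Rightarrow> 'a \<Rightarrow> real) set" where
  "L2c_dual T N t S = {g \<in> L2_dual {0<..<T} S. \<forall>n\<in>{1..N}. g (t n) \<in> dual S \<and>
     ((\<lambda>s. dual_norm S (\<lambda>r. g s r - g (t n) r)) \<longlongrightarrow> 0) (at_left (t n))}"

text \<open>
  The projection \<open>\<I>\<^sub>q\<close> on \<open>S'\<close>-valued functions; the \<open>S'\<close>-valued integrals are evaluated at \<open>r\<close>. The
  function \<open>G\<close> is unique as an \<open>S'\<close>-valued function on \<open>(0,T]\<close>. For \<open>q = 1\<close> there is no \<open>\<psi>\<close> with
  \<open>degree \<psi> + 2 \<le> q\<close>.
\<close>

definition is_Iq :: "nat \<Rightarrow> nat \<Rightarrow> (nat \<Rightarrow> real) \<Rightarrow> 'a::real_normed_vector set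
    \<Rightarrow> (real \<Rightarrow> 'a \<Rightarrow> real) \<Rightarrow> (real \<Rightarrow> 'a \<Rightarrow> real) \<Rightarrow> bool" where
  "is_Iq q N t S g G \<longleftrightarrow> G \<in> Pb_dual q N t S \<and>
     (\<forall>n\<in>{1..N}. \<forall>r\<in>S. G (t n) r = g (t n) r \<and>
        (\<forall>\<psi> :: real poly. degree \<psi> + 2 \<le> q \<longrightarrow>
           (LINT s|lebesgue_on (cell t n). (G s r - g s r) * poly \<psi> s) = 0))"

definition Iq :: "nat \<Rightarrow> nat \<Rightarrow> (nat \<Rightarrow> real) \<Rightarrow> 'a::real_normed_vector set
    \<Rightarrow> (real \<Rightarrow> 'a \<Rightarrow> real) \<Rightarrow> (real \<Rightarrow> 'a \<Rightarrow> real)" where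
  "Iq q N t S g = (SOME G. is_Iq q N t S g G)"

definition DMP_solution ::
    "'u::real_normed_vector set \<Rightarrow> 'q1::real_normed_vector set \<Rightarrow> 'q2::real_normed_vector set
     \<Rightarrow> ('u \<Rightarrow> 'h::real_inner) \<Rightarrow> ('u \<Rightarrow> 'u \<Rightarrow> real) \<Rightarrow> ('u \<Rightarrow> 'q1 \<Rightarrow> real) \<Rightarrow> ('u \<Rightarrow> 'q2 \<Rightarrow> real)
     \<Rightarrow> real \<Rightarrow> nat \<Rightarrow> nat \<Rightarrow> (nat \<Rightarrow> real)
     \<Rightarrow> (real \<Rightarrow> 'u \<Rightarrow> real) \<Rightarrow> (real \<Rightarrow> 'q1 \<times> 'q2 \<Rightarrow> real) \<Rightarrow> 'h
     \<Rightarrow> (real \<Rightarrow> 'u) \<Rightarrow> (real \<Rightarrow> 'q1) \<Rightarrow> bool" where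
  "DMP_solution \<U> \<Q>\<^sub>1 \<Q>\<^sub>2 \<iota> a b1 b2 T q N t f g u0 U P \<longleftrightarrow>
     (let I = {0<..<T}; \<V>\<^sub>2 = ker_form \<U> \<Q>\<^sub>2 b2 in
        U \<in> Pb q N t \<U> \<and> P \<in> Pb q N t \<Q>\<^sub>1 \<and>
        (\<forall>X\<in>Pb q N t \<V>\<^sub>2.
           K_form \<iota> a T N t U X + (LINT s|lebesgue_on I. b1 (X s) (P s))
           = (LINT s|lebesgue_on I. f s (X s)) + u0 \<bullet> right_limit t (\<lambda>s. \<iota> (X s)) 0) \<and>
        (\<forall>R\<in>Pb q N t (\<Q>\<^sub>1 \<times> \<Q>\<^sub>2).
           (LINT s|lebesgue_on I. b_sum b1 b2 (U s) (R s))
           = (LINT s|lebesgue_on I. Iq q N t (\<Q>\<^sub>1 \<times> \<Q>\<^sub>2) g s (R s))))"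

end

(*
  Replacing u by its projection I_q u turns the error into theta = I_q u - U, which lies in V on
  every cell: B U = I_q g = B I_q u. Since I_q preserves the values at the right end points and the
  moments of degree at most q - 2, the time derivative and the jumps of u - I_q u drop out, and
    D_H(theta, X) + int a(u - I_q u + theta, X) + int b_1(X, p - P) = 0   for X in P^b(I; V_2).
  Three test functions give the estimate. X = theta bounds theta and its jumps by the energy method.
  On each cell X = sigma theta', with sigma growing from 0 to 1, vanishes at the left end and bounds
  theta'. With a projection Pi p and a lifting L of Q_1 into V_2 satisfying b_1(L r, s) = (r, s),
  which the inf-sup condition provides, X = L (Pi p - P) bounds the pressure. Derivatives and jumps
  enter the last step with a factor k^(-1/2), which is the half power lost in the rate for u.
*)
theory Submission
  imports Defs "HOL-Real_Asymp.Real_Asymp"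
begin

section \<open>Hilbert spaces\<close>

text \<open>All cells are scaled to the unit interval. There \<open>D_H\<close> keeps its form,
  while the integrals of \<open>a\<close> and \<open>b1\<close> gain the factor \<open>k\<close>.
  The energy steps therefore bound the squared jumps and the weighted squared derivative by a
  constant times \<open>H\<close>, the squared L2 norm of u - I_q u, with no power of
  \<open>k\<close>. In the pressure step these two quantities are balanced against \<open>k\<close>
  times the squared pressure on a cell, which costs 1/k; as \<open>H\<close> is of order k^(2m), the
  squared error is of order k^(2m-1). Equal steps let 1/k leave the sum over the cells. The
  constants have to be fixed before the spaces are known, and the spaces may have infinite
  dimension, so norm equivalence for vector-valued polynomials cannot rest on compactness. It is
  read off from inverses of scalar Gram matrices, for the weights 1, s and 1 - s. The equations hold
  almost everywhere and in dual spaces, whereas I_q needs nodal values. Hence \<open>u\<close> and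
  \<open>p\<close> are replaced by continuous representatives that are indefinite integrals of their
  weak derivatives.\<close>

lemma le_if_square_le_mult: "a \<le> b" if "a\<^sup>2 \<le> a * b" "0 \<le> a" "0 \<le> b" for a b :: real
  using that by (cases "a = 0") (auto simp: power2_eq_square mult_le_cancel_left_pos)

text \<open>The solution minimises \<open>d x x - 2 * F x\<close> over \<open>S\<close>. Strong
  convexity makes minimising sequences Cauchy, and the equation is the limit of near-optimality
  estimates along such a sequence.\<close>

lemma lax_milgram_symmetric:
  fixes d :: "'a::{real_inner,complete_space} \<Rightarrow> 'a \<Rightarrow> real"
  assumes S: "hilbert_subspace S" and d: "bounded_bilinear d"
    and sym: "\<And>x y. x \<in> S \<Longrightarrow> y \<in> S \<Longrightarrow> d x y = d y x"
    and alpha: "\<alpha> > 0" and coercive: "\<And>x. x \<in> S \<Longrightarrow> \<alpha> * (norm x)\<^sup>2 \<le> d x x"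
    and F: "bounded_linear F"
  obtains x where "x \<in> S" "\<And>y. y \<in> S \<Longrightarrow> d x y = F y"
proof -
  interpret d: bounded_bilinear d by fact
  interpret F: bounded_linear F by fact
  have sub: "subspace S" and cl: "closed S" using S by (auto simp: hilbert_subspace_def)
  define J where "J x = d x x - 2 * F x" for x
  obtain C where C: "C > 0" "\<And>x. norm (F x) \<le> norm x * C" using F.pos_bounded by blast
  have lower: "- (C\<^sup>2 / \<alpha>) \<le> J x" if "x \<in> S" for x
  proof -
    have "0 \<le> (\<alpha> * norm x - C)\<^sup>2 / \<alpha>" using alpha by simp
    also have "\<dots> = \<alpha> * (norm x)\<^sup>2 - 2 * (norm x * C) + C\<^sup>2 / \<alpha>"
      using alpha by (simp add: power2_eq_square field_simps)
    also have "\<dots> \<le> d x x - 2 * F x + C\<^sup>2 / \<alpha>"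
      using coercive[OF that] C(2)[of x] by (smt (verit) real_norm_def)
    finally show ?thesis by (simp add: J_def)
  qed
  define m where "m = Inf (J ` S)"
  have bdd: "bdd_below (J ` S)" using lower by (intro bdd_belowI2) auto
  have m: "m \<le> J x" if "x \<in> S" for x unfolding m_def using bdd that by (intro cInf_lower) auto
  have "\<exists>x\<in>S. J x < m + inverse (real (Suc n))" for n
  proof -
    have ne: "J ` S \<noteq> {}" using subspace_0[OF sub] by auto
    have lt: "Inf (J ` S) < m + inverse (real (Suc n))" by (simp add: m_def)
    obtain z where "z \<in> J ` S" "z < m + inverse (real (Suc n))"
      using cInf_lessD[OF ne lt] by (elim bexE)
    then show ?thesis by auto
  qed
  then obtain X where X: "\<And>n. X n \<in> S" "\<And>n. J (X n) < m + inverse (real (Suc n))" by metis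
  \<comment> \<open>Parallelogram identity for the quadratic functional; the midpoint lies in
    \<open>S\<close> and therefore costs at least \<open>m\<close>.\<close>
  have par: "\<alpha> * (norm (x - y))\<^sup>2 \<le> 2 * J x + 2 * J y - 4 * m" if "x \<in> S" "y \<in> S" for x y
  proof -
    have mid: "(1/2) *\<^sub>R (x + y) \<in> S" using that sub by (simp add: subspace_add subspace_scale)
    have "\<alpha> * (norm (x - y))\<^sup>2 \<le> d (x - y) (x - y)"
      using that sub by (intro coercive) (simp add: subspace_diff)
    also have "\<dots> = 2 * J x + 2 * J y - 4 * J ((1/2) *\<^sub>R (x + y))"
      by (simp add: J_def d.add_left d.add_right d.diff_left d.diff_right d.scaleR_left
          d.scaleR_right F.add F.scale algebra_simps)
    also have "\<dots> \<le> 2 * J x + 2 * J y - 4 * m" using m[OF mid] by simp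
    finally show ?thesis .
  qed
  have "Cauchy X"
  proof (rule metric_CauchyI)
    fix e :: real assume e: "e > 0"
    obtain M where M: "inverse (real (Suc M)) < \<alpha> * e\<^sup>2 / 4"
      using reals_Archimedean[of "\<alpha> * e\<^sup>2 / 4"] alpha e by auto
    have "dist (X i) (X j) < e" if "i \<ge> M" "j \<ge> M" for i j
    proof -
      have "inverse (real (Suc i)) \<le> inverse (real (Suc M))"
        "inverse (real (Suc j)) \<le> inverse (real (Suc M))"
        using that by (intro le_imp_inverse_le; simp)+
      then have "\<alpha> * (norm (X i - X j))\<^sup>2 < \<alpha> * e\<^sup>2"
        using par[OF X(1) X(1), of i j] X(2)[of i] X(2)[of j] M by linarith
      then show ?thesis using alpha e by (simp add: dist_norm power2_less_imp_less)
    qed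
    then show "\<exists>M. \<forall>i\<ge>M. \<forall>j\<ge>M. dist (X i) (X j) < e" by blast
  qed
  then obtain x where x: "X \<longlonglongrightarrow> x" using Cauchy_convergent_iff convergent_def by blast
  have xS: "x \<in> S" using cl X(1) x closed_sequentially by blast
  have "d x y = F y" if y: "y \<in> S" for y
  proof (cases "y = 0")
    case True then show ?thesis by (simp add: d.zero_right F.zero)
  next
    case False
    then have dy: "d y y > 0"
      using coercive[OF y] alpha
      by (smt (verit) mult_pos_pos zero_less_norm_iff zero_less_power)
    \<comment> \<open>\<open>X n\<close> misses the infimum by at most 1/(n+1), so moving along
      \<open>y\<close> cannot gain more. The gain of the optimal step \<open>s\<close> is the
      squared residual divided by \<open>d y y\<close>.\<close>
    have bound: "(d (X n) y - F y)\<^sup>2 \<le> inverse (real (Suc n)) * d y y" for n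
    proof -
      define r where "r = d (X n) y - F y"
      define s where "s = - r / d y y"
      have "J (X n + s *\<^sub>R y) = J (X n) + 2 * s * r + s\<^sup>2 * d y y"
        using sym[OF X(1) y, of n]
        by (simp add: J_def r_def d.add_left d.add_right d.scaleR_left
          d.scaleR_right F.add F.scale power2_eq_square algebra_simps)
      also have "\<dots> = J (X n) - r\<^sup>2 / d y y" using dy by (simp add: s_def power2_eq_square field_simps)
      finally have "m \<le> J (X n) - r\<^sup>2 / d y y"
        using m[of "X n + s *\<^sub>R y"] X(1)[of n] y sub by (simp add: subspace_add subspace_scale)
      then have "r\<^sup>2 / d y y \<le> inverse (real (Suc n))" using X(2)[of n] by linarith
      then show ?thesis using dy by (simp add: r_def divide_le_eq mult.commute)
    qed
    have l1: "(\<lambda>n. (d (X n) y - F y)\<^sup>2) \<longlonglongrightarrow> (d x y - F y)\<^sup>2"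
      by (intro tendsto_intros d.tendsto x)
    have l2: "(\<lambda>n. inverse (real (Suc n)) * d y y) \<longlonglongrightarrow> 0 * d y y"
      by (intro tendsto_intros LIMSEQ_inverse_real_of_nat)
    have "(d x y - F y)\<^sup>2 \<le> 0"
      using LIMSEQ_le[OF l1 l2] bound by auto
    then show ?thesis by simp
  qed
  with xS that show thesis by blast
qed

lemma riesz_representation:
  fixes F :: "'a::{real_inner,complete_space} \<Rightarrow> real"
  assumes "bounded_linear F"
  obtains y where "\<And>x. F x = y \<bullet> x"
proof -
  have "hilbert_subspace (UNIV :: 'a set)" by (simp add: hilbert_subspace_def subspace_UNIV)
  then show thesis
    using lax_milgram_symmetric[of UNIV inner 1 F] assms that
    by (metis UNIV_I bounded_bilinear_inner dot_square_norm inner_commute mult_1 order_refl zero_less_one)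
qed

section \<open>Orthogonal projection onto a closed subspace, and extension of maps to the ambient
  type\<close>

definition orth_proj :: "'a::{real_inner,complete_space} set \<Rightarrow> 'a \<Rightarrow> 'a" where
  "orth_proj S x = (SOME p. p \<in> S \<and> (\<forall>y\<in>S. p \<bullet> y = x \<bullet> y))"

context
  fixes S :: "'a::{real_inner,complete_space} set"
  assumes S: "hilbert_subspace S"
begin

lemma orth_proj: "orth_proj S x \<in> S \<and> (\<forall>y\<in>S. orth_proj S x \<bullet> y = x \<bullet> y)"
proof -
  obtain p where "p \<in> S" "\<And>y. y \<in> S \<Longrightarrow> p \<bullet> y = x \<bullet> y"
    using lax_milgram_symmetric[OF S bounded_bilinear_inner, of 1 "inner x"]
    by (auto simp: inner_commute dot_square_norm bounded_linear_inner_right)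
  then show ?thesis unfolding orth_proj_def by (intro someI_ex[where P = "\<lambda>p. p \<in> S \<and> (\<forall>y\<in>S. p \<bullet> y = x \<bullet> y)"]) auto
qed

lemma orth_proj_in: "orth_proj S x \<in> S" using orth_proj by blast

lemma orth_proj_inner: "y \<in> S \<Longrightarrow> orth_proj S x \<bullet> y = x \<bullet> y" using orth_proj by blast

lemma orth_proj_unique:
  assumes "p \<in> S" "\<And>y. y \<in> S \<Longrightarrow> p \<bullet> y = x \<bullet> y"
  shows "orth_proj S x = p"
proof -
  have "orth_proj S x - p \<in> S" using S assms orth_proj_in by (simp add: hilbert_subspace_def subspace_diff)
  then have "(orth_proj S x - p) \<bullet> (orth_proj S x - p) = 0"
    using orth_proj_inner assms(2) by (simp add: inner_diff_left)
  then show ?thesis by simp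
qed

lemma orth_proj_id: "x \<in> S \<Longrightarrow> orth_proj S x = x" by (rule orth_proj_unique) auto

lemma norm_orth_proj_le: "norm (orth_proj S x) \<le> norm x"
proof -
  have "(norm (orth_proj S x))\<^sup>2 = x \<bullet> orth_proj S x"
    using orth_proj_inner[OF orth_proj_in[of x], of x] by (simp add: dot_square_norm)
  also have "\<dots> \<le> norm x * norm (orth_proj S x)" by (rule norm_cauchy_schwarz)
  finally show ?thesis by - (rule le_if_square_le_mult, auto simp: mult.commute)
qed

lemma bounded_linear_orth_proj: "bounded_linear (orth_proj S)"
proof (rule bounded_linear_intro[where K = 1])
  have sub: "subspace S" using S by (simp add: hilbert_subspace_def)
  show "orth_proj S (x + y) = orth_proj S x + orth_proj S y" for x y
    by (rule orth_proj_unique) (auto simp: sub subspace_add orth_proj_in orth_proj_inner inner_add_left)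
  show "orth_proj S (c *\<^sub>R x) = c *\<^sub>R orth_proj S x" for c x
    by (rule orth_proj_unique) (auto simp: sub subspace_scale orth_proj_in orth_proj_inner)
  show "norm (orth_proj S x) \<le> norm x * 1" for x by (simp add: norm_orth_proj_le)
qed

text \<open>A closed subspace equals its double orthogonal complement. This is how vectors known
  only through their inner products, such as integrals obtained from Riesz representation, are shown
  to lie in \<open>S\<close>.\<close>

lemma mem_if_orthogonal:
  assumes "\<And>x. (\<forall>y\<in>S. x \<bullet> y = 0) \<Longrightarrow> x \<bullet> z = 0"
  shows "z \<in> S"
proof -
  have "(z - orth_proj S z) \<bullet> z = 0"
    by (rule assms) (simp add: inner_diff_left orth_proj_inner)
  moreover have "(z - orth_proj S z) \<bullet> orth_proj S z = 0"
    using orth_proj_in by (simp add: inner_diff_left orth_proj_inner)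
  ultimately have "(z - orth_proj S z) \<bullet> (z - orth_proj S z) = 0"
    by (simp add: inner_diff_right)
  then show ?thesis using orth_proj_in[of z] by simp
qed

text \<open>Composition with the projection keeps the values on \<open>S\<close> and produces a map
  on the whole type, to which the theory of \<open>bounded_linear\<close> applies.\<close>

lemma bounded_linear_extension:
  fixes F :: "'a \<Rightarrow> 'b::real_normed_vector"
  assumes F: "linear_on S F" and C: "\<And>v. v \<in> S \<Longrightarrow> norm (F v) \<le> C * norm v"
  shows "bounded_linear (\<lambda>x. F (orth_proj S x))"
proof (rule bounded_linear_intro[where K = "\<bar>C\<bar>"])
  interpret p: bounded_linear "orth_proj S" by (rule bounded_linear_orth_proj)
  show "F (orth_proj S (x + y)) = F (orth_proj S x) + F (orth_proj S y)" for x y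
    using F orth_proj_in by (simp add: p.add linear_on_def)
  show "F (orth_proj S (c *\<^sub>R x)) = c *\<^sub>R F (orth_proj S x)" for c x
    using F orth_proj_in by (simp add: p.scale linear_on_def)
  show "norm (F (orth_proj S x)) \<le> norm x * \<bar>C\<bar>" for x
  proof -
    have "norm (F (orth_proj S x)) \<le> C * norm (orth_proj S x)" using C orth_proj_in by blast
    also have "\<dots> \<le> \<bar>C\<bar> * norm (orth_proj S x)" by (simp add: mult_right_mono)
    also have "\<dots> \<le> \<bar>C\<bar> * norm x" by (simp add: mult_left_mono norm_orth_proj_le)
    finally show ?thesis by (simp add: mult.commute)
  qed
qed

end

lemma bounded_bilinear_extension:
  fixes b :: "'a::{real_inner,complete_space} \<Rightarrow> 'b::{real_inner,complete_space} \<Rightarrow> real"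
  assumes S: "hilbert_subspace S" and R: "hilbert_subspace R"
    and b: "bilinear_on S R b" and C: "\<And>u r. u \<in> S \<Longrightarrow> r \<in> R \<Longrightarrow> \<bar>b u r\<bar> \<le> C * norm u * norm r"
  shows "bounded_bilinear (\<lambda>x y. b (orth_proj S x) (orth_proj R y))"
proof
  interpret p: bounded_linear "orth_proj S" by (rule bounded_linear_orth_proj[OF S])
  interpret r: bounded_linear "orth_proj R" by (rule bounded_linear_orth_proj[OF R])
  note S_in = orth_proj_in[OF S] and R_in = orth_proj_in[OF R]
  note lin = b[unfolded bilinear_on_def linear_on_def]
  show "b (orth_proj S (x + x')) (orth_proj R y) = b (orth_proj S x) (orth_proj R y) + b (orth_proj S x') (orth_proj R y)"
    for x x' y using lin S_in R_in by (simp add: p.add)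
  show "b (orth_proj S x) (orth_proj R (y + y')) = b (orth_proj S x) (orth_proj R y) + b (orth_proj S x) (orth_proj R y')"
    for x y y' using lin S_in R_in by (simp add: r.add)
  show "b (orth_proj S (c *\<^sub>R x)) (orth_proj R y) = c *\<^sub>R b (orth_proj S x) (orth_proj R y)"
    for x y c using lin S_in R_in by (simp add: p.scale)
  show "b (orth_proj S x) (orth_proj R (c *\<^sub>R y)) = c *\<^sub>R b (orth_proj S x) (orth_proj R y)"
    for x y c using lin S_in R_in by (simp add: r.scale)
  have "norm (b (orth_proj S x) (orth_proj R y)) \<le> norm x * norm y * \<bar>C\<bar>" for x y
  proof -
    have "\<bar>b (orth_proj S x) (orth_proj R y)\<bar> \<le> C * norm (orth_proj S x) * norm (orth_proj R y)"
      using C S_in R_in by blast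
    also have "\<dots> \<le> \<bar>C\<bar> * norm (orth_proj S x) * norm (orth_proj R y)" by (intro mult_right_mono) auto
    also have "\<dots> \<le> \<bar>C\<bar> * norm x * norm y"
      using norm_orth_proj_le[OF S, of x] norm_orth_proj_le[OF R, of y] by (intro mult_mono) auto
    finally show ?thesis by (simp add: mult_ac)
  qed
  then show "\<exists>K. \<forall>x y. norm (b (orth_proj S x) (orth_proj R y)) \<le> norm x * norm y * K" by blast
qed

text \<open>The right inverse of minimal norm of \<open>v \<mapsto> b v \<cdot>\<close>, from the normal equations.\<close>

lemma inf_sup_lifting:
  fixes b :: "'u::{real_inner,complete_space} \<Rightarrow> 'q::{real_inner,complete_space} \<Rightarrow> real"
  assumes V: "hilbert_subspace V" and Q: "hilbert_subspace Q" and b: "bounded_bilinear b"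
    and \<beta>: "\<beta> > 0"
    and inf_sup: "\<And>r M. r \<in> Q \<Longrightarrow> (\<And>v. v \<in> V \<Longrightarrow> b v r \<le> M * norm v) \<Longrightarrow> \<beta> * norm r \<le> M"
  obtains L where "\<And>r. r \<in> Q \<Longrightarrow> L r \<in> V" "\<And>r. r \<in> Q \<Longrightarrow> norm (L r) \<le> norm r / \<beta>"
    "\<And>r s. r \<in> Q \<Longrightarrow> s \<in> Q \<Longrightarrow> b (L r) s = r \<bullet> s"
    "linear_on Q L"
proof -
  interpret b: bounded_bilinear b by fact
  have subV: "subspace V" and subQ: "subspace Q" using V Q by (auto simp: hilbert_subspace_def)
  have "\<exists>y\<in>V. \<forall>v\<in>V. b v r = y \<bullet> v" for r
  proof -
    obtain y where y: "\<And>v. b v r = y \<bullet> v"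
      using riesz_representation[OF b.bounded_linear_left] by blast
    then have "\<forall>v\<in>V. b v r = orth_proj V y \<bullet> v" by (simp add: orth_proj_inner[OF V])
    then show ?thesis using orth_proj_in[OF V] by blast
  qed
  \<comment> \<open>\<open>t\<close> is the adjoint of the operator that \<open>b\<close> induces on
    \<open>V\<close>; the inf-sup bound says that it is bounded below on \<open>Q\<close>.\<close>
  then obtain t where t: "\<And>r. t r \<in> V" "\<And>r v. v \<in> V \<Longrightarrow> b v r = t r \<bullet> v" by metis
  have uniq: "x = y" if "x \<in> V" "y \<in> V" "\<And>v. v \<in> V \<Longrightarrow> x \<bullet> v = y \<bullet> v" for x y
    using orth_proj_unique[OF V that(1) that(3)] orth_proj_id[OF V that(2)] by simp
  obtain K where K: "\<And>x y. norm (b x y) \<le> norm x * norm y * K" "K \<ge> 0" using b.nonneg_bounded by blast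
  have bl: "bounded_linear t"
  proof (rule bounded_linear_intro[where K = K])
    show "t (x + y) = t x + t y" for x y
      by (rule uniq) (auto simp: t(1) subV subspace_add inner_add_left t(2)[symmetric] b.add_right)
    show "t (c *\<^sub>R x) = c *\<^sub>R t x" for c x
      by (rule uniq) (auto simp: t(1) subV subspace_scale t(2)[symmetric] b.scaleR_right)
    show "norm (t r) \<le> norm r * K" for r
    proof -
      have "(norm (t r))\<^sup>2 = b (t r) r" by (simp add: t dot_square_norm)
      also have "\<dots> \<le> norm (t r) * (norm r * K)" using K(1)[of "t r" r] by (simp add: mult_ac)
      finally show ?thesis using K(2) by (auto intro: le_if_square_le_mult)
    qed
  qed
  interpret t: bounded_linear t by fact
  have lower: "\<beta> * norm r \<le> norm (t r)" if "r \<in> Q" for r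
    using that t(2) by (intro inf_sup) (auto simp: norm_cauchy_schwarz)
  have d: "bounded_bilinear (\<lambda>r s. t r \<bullet> t s)"
    using bounded_bilinear.comp[OF bounded_bilinear_inner bl bl] .
  have coer: "\<beta>\<^sup>2 * (norm r)\<^sup>2 \<le> t r \<bullet> t r" if "r \<in> Q" for r
    using power_mono[OF lower[OF that], of 2] \<beta> by (simp add: dot_square_norm power_mult_distrib)
  \<comment> \<open>Normal equations: \<open>s\<close> inverts the coercive form built from
    \<open>t\<close>, and \<open>t (s r)\<close> is going to be the lifting of
    \<open>r\<close>.\<close>
  have "\<exists>s\<in>Q. \<forall>r'\<in>Q. t s \<bullet> t r' = r \<bullet> r'" for r
    using lax_milgram_symmetric[OF Q d _ _ coer, of "inner r"] \<beta>
    by (metis bounded_linear_inner_right inner_commute zero_less_power)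
  then obtain s where s: "\<And>r. s r \<in> Q" "\<And>r r'. r' \<in> Q \<Longrightarrow> t (s r) \<bullet> t r' = r \<bullet> r'" by metis
  have s_uniq: "x = y" if "x \<in> Q" "y \<in> Q" "\<And>r'. r' \<in> Q \<Longrightarrow> t x \<bullet> t r' = t y \<bullet> t r'" for x y
  proof -
    have xy: "x - y \<in> Q" using that subQ by (simp add: subspace_diff)
    have "\<beta>\<^sup>2 * (norm (x - y))\<^sup>2 \<le> 0"
      using coer[OF xy] that(3)[OF xy] by (simp add: t.diff inner_diff_left)
    then have "\<beta>\<^sup>2 * (norm (x - y))\<^sup>2 = 0" by (smt (verit) zero_le_mult_iff zero_le_power2)
    then show ?thesis using \<beta> by simp
  qed
  have s_lin: "s (x + y) = s x + s y" "s (c *\<^sub>R x) = c *\<^sub>R s x" for x y c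
    by (rule s_uniq; simp add: s subQ subspace_add subspace_scale t.add t.scale inner_add_left)+
  show thesis
  proof (rule that[of "\<lambda>r. t (s r)"])
    show "t (s r) \<in> V" for r by (rule t)
    show "b (t (s r)) s' = r \<bullet> s'" if "s' \<in> Q" for r s'
      using s(2)[OF that] t by (simp add: inner_commute)
    \<comment> \<open>Bounding \<open>s r\<close> and \<open>t\<close> separately would involve the
      continuity constant of \<open>b\<close>. Pairing the normal equation with \<open>s r\<close>
      gives 1/\<beta> alone.\<close>
    show "norm (t (s r)) \<le> norm r / \<beta>" for r
    proof -
      have "(norm (t (s r)))\<^sup>2 = r \<bullet> s r" using s by (simp add: dot_square_norm[symmetric])
      also have "\<dots> \<le> norm r * norm (s r)" by (rule norm_cauchy_schwarz)
      also have "\<dots> \<le> norm r * (norm (t (s r)) / \<beta>)"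
        using lower[OF s(1)[of r]] \<beta> by (intro mult_left_mono) (auto simp: field_simps)
      finally show ?thesis using \<beta> by - (rule le_if_square_le_mult, auto simp: mult_ac)
    qed
    show "linear_on Q (\<lambda>r. t (s r))" by (simp add: linear_on_def s_lin t.add t.scale)
  qed
qed

section \<open>Vector-valued polynomials on the unit interval\<close>

abbreviation "UI \<equiv> lebesgue_on {0..1::real}"

lemma integrable_UI: "continuous_on {0..1} f \<Longrightarrow> integrable UI f" for f :: "real \<Rightarrow> real"
  by (rule continuous_imp_integrable_real)

lemma measure_UI [simp]: "measure UI {0..1} = 1"
  by (simp add: measure_restrict_space)

lemma LINT_UI_const: "(LINT s|UI. (x::real)) = x"
  by simp

lemma UI_bound_integral:
  fixes f :: "real \<Rightarrow> real"
  assumes "integrable UI f" "\<And>s. s \<in> {0..1} \<Longrightarrow> \<bar>f s\<bar> \<le> A"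
  shows "\<bar>LINT s|UI. f s\<bar> \<le> A"
proof -
  have "(LINT s|UI. f s) \<le> (LINT s|UI. A)" "(LINT s|UI. - A) \<le> (LINT s|UI. f s)"
    using assms(2) by (intro integral_mono assms integrable_UI continuous_on_const; force)+
  then show ?thesis unfolding LINT_UI_const by linarith
qed

lemma continuous_on_UI_bounded:
  fixes f :: "real \<Rightarrow> 'a::real_normed_vector"
  assumes "continuous_on {0..1} f"
  obtains B where "B > 0" "\<And>s. s \<in> {0..1} \<Longrightarrow> norm (f s) \<le> B"
proof -
  have "compact (f ` {0..1})" using assms by (intro compact_continuous_image) auto
  then have "bounded (f ` {0..1})" by (rule compact_imp_bounded)
  then show thesis using that unfolding bounded_pos by blast
qed

text \<open>Coefficients in the monomial basis, \<open>q\<close> of them, hence degree at most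
  \<open>q - 1\<close>. Working with coefficients rather than functions lets linear maps act
  termwise and makes a test function a choice of vectors.\<close>

definition vp :: "nat \<Rightarrow> (nat \<Rightarrow> 'a::real_vector) \<Rightarrow> real \<Rightarrow> 'a" where
  "vp q c s = (\<Sum>j<q. s ^ j *\<^sub>R c j)"

definition vd :: "nat \<Rightarrow> (nat \<Rightarrow> 'a::real_vector) \<Rightarrow> real \<Rightarrow> 'a" where
  "vd q c s = vp (q - 1) (\<lambda>j. real (Suc j) *\<^sub>R c (Suc j)) s"

lemma vp_0 [simp]: "vp 0 c s = 0" by (simp add: vp_def)

lemma vp_Suc: "vp (Suc q) c s = vp q c s + s ^ q *\<^sub>R c q" by (simp add: vp_def)

lemma vp_Suc_shift: "vp (Suc q) c s = c 0 + s *\<^sub>R vp q (\<lambda>j. c (Suc j)) s"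
  by (simp add: vp_def sum.lessThan_Suc_shift scaleR_sum_right del: sum.lessThan_Suc)

lemma vp_at_0: "q > 0 \<Longrightarrow> vp q c 0 = c 0" by (cases q) (simp_all add: vp_Suc_shift)

lemma vp_cong: "(\<And>j. j < q \<Longrightarrow> c j = d j) \<Longrightarrow> vp q c s = vp q d s" by (simp add: vp_def)

lemma vp_add: "vp q (\<lambda>j. c j + d j) s = vp q c s + vp q d s"
  by (simp add: vp_def scaleR_add_right sum.distrib)

lemma vp_diff: "vp q (\<lambda>j. c j - d j) s = vp q c s - vp q d s"
  by (simp add: vp_def scaleR_diff_right sum_subtractf)

lemma vp_scale: "vp q (\<lambda>j. x *\<^sub>R c j) s = x *\<^sub>R vp q c s"
  by (simp add: vp_def scaleR_sum_right mult.commute)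

lemma vp_zero [simp]: "vp q (\<lambda>j. 0) s = 0" by (simp add: vp_def)

lemma vp_pad: "m \<le> q \<Longrightarrow> vp q (\<lambda>j. if j < m then c j else 0) s = vp m c s"
  unfolding vp_def by (intro sum.mono_neutral_cong_right) auto

lemma vp_mem: "subspace S \<Longrightarrow> (\<And>j. j < q \<Longrightarrow> c j \<in> S) \<Longrightarrow> vp q c s \<in> S"
  unfolding vp_def by (intro subspace_sum subspace_scale) auto

lemma vp_linear_on:
  assumes F: "linear_on S F" and S: "subspace S" and c: "\<And>j. j < q \<Longrightarrow> c j \<in> S"
  shows "F (vp q c s) = vp q (\<lambda>j. F (c j)) s"
  using c
proof (induction q)
  case 0
  have "F (0 *\<^sub>R 0) = 0 *\<^sub>R F 0" using F subspace_0[OF S] unfolding linear_on_def by blast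
  then show ?case by simp
next
  case (Suc q)
  have "vp q c s \<in> S" "s ^ q *\<^sub>R c q \<in> S"
    using Suc.prems S by (auto intro!: vp_mem subspace_scale)
  then show ?case using F Suc by (simp add: vp_Suc linear_on_def)
qed

lemma linear_onI: "linear F \<Longrightarrow> linear_on S F"
  by (simp add: linear_on_def linear_add linear_scale)

lemma vp_linear: "linear F \<Longrightarrow> F (vp q c s) = vp q (\<lambda>j. F (c j)) s"
  by (rule vp_linear_on[OF linear_onI subspace_UNIV]) auto

lemma vd_linear: "linear F \<Longrightarrow> F (vd q c s) = vd q (\<lambda>j. F (c j)) s"
  by (simp add: vd_def vp_linear linear_scale)

lemma vp_inner: "x \<bullet> vp q c s = vp q (\<lambda>j. x \<bullet> c j) s"
  by (rule vp_linear) (intro bounded_linear.linear bounded_linear_inner_right)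

lemma vp_has_vector_derivative: "(vp q c has_vector_derivative vd q c s) (at s within X)"
proof (induction q)
  case 0
  then show ?case by (simp add: vd_def vp_def)
next
  case (Suc q)
  have d: "((\<lambda>s. s ^ q *\<^sub>R c q) has_vector_derivative (real q * s ^ (q - 1)) *\<^sub>R c q) (at s within X)"
    by (auto intro!: derivative_eq_intros simp: has_vector_derivative_def mult_ac)
  have v: "vd (Suc q) c s = vd q c s + (real q * s ^ (q - 1)) *\<^sub>R c q"
    by (cases q) (simp_all add: vd_def vp_Suc mult.commute)
  show ?case
    unfolding v using has_vector_derivative_add[OF Suc d] by (simp add: vp_Suc[abs_def])
qed

text \<open>Multiplying the derivative by \<open>s\<close> restores the number of coefficients, so
  that s \<theta>' is an admissible test function whenever \<theta> is.\<close>

lemma scaleR_vd: "s *\<^sub>R vd q c s = vp q (\<lambda>j. real j *\<^sub>R c j) s"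
  by (cases q) (simp_all add: vd_def vp_Suc_shift)

lemma continuous_on_vp [continuous_intros]:
  "continuous_on X f \<Longrightarrow> continuous_on X (\<lambda>s. vp q c (f s))" for c :: "nat \<Rightarrow> 'a::real_normed_vector"
  unfolding vp_def by (intro continuous_intros)

lemma continuous_on_vd [continuous_intros]:
  "continuous_on X f \<Longrightarrow> continuous_on X (\<lambda>s. vd q c (f s))" for c :: "nat \<Rightarrow> 'a::real_normed_vector"
  unfolding vd_def by (intro continuous_intros)

lemma norm_vp_le:
  assumes "s \<in> {0..1}" "\<And>j. j < q \<Longrightarrow> norm (c j) \<le> A"
  shows "norm (vp q c s) \<le> real q * A"
proof -
  have "norm (vp q c s) \<le> (\<Sum>j<q. norm (s ^ j *\<^sub>R c j))" unfolding vp_def by (rule norm_sum)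
  also have "\<dots> \<le> (\<Sum>j<q. A)"
  proof (rule sum_mono)
    fix j assume "j \<in> {..<q}"
    then have "norm (c j) \<le> A" using assms by simp
    moreover have "\<bar>s ^ j\<bar> \<le> 1" using assms(1) by (auto simp: power_le_one_iff power_abs)
    ultimately show "norm (s ^ j *\<^sub>R c j) \<le> A"
      by simp (metis abs_ge_zero mult_left_le_one_le norm_ge_zero order_trans)
  qed
  finally show ?thesis by simp
qed

text \<open>Horner's scheme: the substituted tail is multiplied by \<alpha> and by \<beta> s, which
  gives the padded sequence \<open>d1\<close> and the shifted one \<open>d2\<close>. This carries
  piecewise polynomials between a cell and the unit interval without leaving \<open>S\<close> or the
  degree bound.\<close>

lemma vp_affine:
  assumes S: "subspace S" and c: "\<And>j. j < q \<Longrightarrow> c j \<in> S"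
  shows "\<exists>d. (\<forall>j<q. d j \<in> S) \<and> (\<forall>s. vp q c (\<alpha> + \<beta> * s) = vp q d s)"
  using c
proof (induction q arbitrary: c)
  case 0
  then show ?case by simp
next
  case (Suc q)
  obtain d where d: "\<And>j. j < q \<Longrightarrow> d j \<in> S" "\<And>s. vp q (\<lambda>j. c (Suc j)) (\<alpha> + \<beta> * s) = vp q d s"
    using Suc.IH[of "\<lambda>j. c (Suc j)"] Suc.prems by force
  define d1 where "d1 j = (if j < q then d j else 0)" for j
  define d2 where "d2 j = (case j of 0 \<Rightarrow> 0 | Suc i \<Rightarrow> d i)" for j
  define e where "e j = (if j = 0 then c 0 else 0) + \<alpha> *\<^sub>R d1 j + \<beta> *\<^sub>R d2 j" for j
  have "vp (Suc q) c (\<alpha> + \<beta> * s) = vp (Suc q) e s" for s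
  proof -
    have "vp (Suc q) (\<lambda>j. if j = 0 then c 0 else 0) s = c 0" by (simp add: vp_Suc_shift)
    moreover have "vp (Suc q) d1 s = vp q d s"
      using vp_pad[of q "Suc q" d] by (simp add: d1_def[abs_def])
    moreover have "vp (Suc q) d2 s = s *\<^sub>R vp q d s" by (simp add: vp_Suc_shift d2_def)
    ultimately have "vp (Suc q) e s = c 0 + \<alpha> *\<^sub>R vp q d s + \<beta> *\<^sub>R s *\<^sub>R vp q d s"
      by (simp add: e_def[abs_def] vp_add vp_scale)
    then show ?thesis by (simp add: vp_Suc_shift d(2) scaleR_add_left)
  qed
  moreover have "e j \<in> S" if "j < Suc q" for j
    using that d(1) Suc.prems[of 0] subspace_0[OF S]
    by (auto simp: e_def d1_def d2_def split: nat.split intro!: subspace_add[OF S] subspace_scale[OF S])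
  ultimately show ?case by blast
qed

text \<open>Division of p - p(1) by 1 - s. In the induction the new top term contributes the
  geometric sum 1 + s + ... + s^q, so the top coefficient is subtracted from every coefficient of
  the quotient.\<close>

lemma vp_factor:
  "\<exists>w. \<forall>s. vp (Suc q) e s = vp (Suc q) e 1 + (1 - s) *\<^sub>R vp q w s"
proof (induction q)
  case 0
  then show ?case by (simp add: vp_Suc)
next
  case (Suc q)
  then obtain w where w: "\<And>s. vp (Suc q) e s = vp (Suc q) e 1 + (1 - s) *\<^sub>R vp q w s" by blast
  define v where "v j = (if j < q then w j else 0) - e (Suc q)" for j
  have "vp (Suc (Suc q)) e s = vp (Suc (Suc q)) e 1 + (1 - s) *\<^sub>R vp (Suc q) v s" for s
  proof -
    have g: "(1 - s) * (\<Sum>j<Suc q. s ^ j) = 1 - s ^ Suc q"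
      by (simp only: one_diff_power_eq)
    have "vp (Suc q) (\<lambda>j. e (Suc q)) s = (\<Sum>j<Suc q. s ^ j) *\<^sub>R e (Suc q)"
      by (simp only: vp_def scaleR_sum_left)
    then have "(1 - s) *\<^sub>R vp (Suc q) v s = (1 - s) *\<^sub>R vp q w s - (1 - s ^ Suc q) *\<^sub>R e (Suc q)"
      using vp_pad[of q "Suc q" w s] unfolding g[symmetric]
      by (simp add: v_def[abs_def] vp_diff scaleR_diff_right del: sum.lessThan_Suc)
    then show ?thesis
      by (simp only: vp_Suc[of "Suc q"] w[of s]) (simp add: scaleR_diff_left)
  qed
  then show ?case by blast
qed

lemma real_vp_zero_coeffs:
  fixes c :: "nat \<Rightarrow> real"
  assumes "\<And>s. s \<in> {0<..<1} \<Longrightarrow> vp q c s = 0" and "j < q"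
  shows "c j = 0"
proof -
  define n where "n = q - 1"
  have q: "{..<q} = {..n}" using assms(2) by (auto simp: n_def)
  have "{0<..<1} \<subseteq> {s. (\<Sum>i\<le>n. c i * s ^ i) = 0}"
    using assms(1) by (auto simp: vp_def q mult.commute)
  then have "infinite {s. (\<Sum>i\<le>n. c i * s ^ i) = 0}"
    by (rule infinite_super) (simp add: infinite_Ioo)
  then have "\<forall>i\<le>n. c i = 0" using polyfun_finite_roots[of c n] by blast
  then show ?thesis using assms(2) by (simp add: n_def)
qed

subsection \<open>Moment problems\<close>

text \<open>Bordering: solving the block of size n for the data and for minus the last column leaves
  one scalar equation for the new unknown, whose coefficient is the Schur complement.\<close>

lemma leading_blocks_solvable:
  fixes G :: "nat \<Rightarrow> nat \<Rightarrow> real"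
  assumes inj: "\<And>n c. (\<And>i. i < n \<Longrightarrow> (\<Sum>j<n. G i j * c j) = 0) \<Longrightarrow> (\<And>j. j < n \<Longrightarrow> c j = 0)"
  shows "\<exists>x. \<forall>i<n. (\<Sum>j<n. G i j * x j) = y i"
proof (induction n arbitrary: y)
  case 0
  then show ?case by simp
next
  case (Suc n)
  obtain z where z: "\<And>i. i < n \<Longrightarrow> (\<Sum>j<n. G i j * z j) = - G i n"
    using Suc[of "\<lambda>i. - G i n"] by blast
  obtain w where w: "\<And>i. i < n \<Longrightarrow> (\<Sum>j<n. G i j * w j) = y i"
    using Suc[of y] by blast
  define \<delta> where "\<delta> = (\<Sum>j<n. G n j * z j) + G n n"
  \<comment> \<open>If it vanished, (z, 1) would be a nonzero kernel vector of the block of size n +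
    1.\<close>
  have "\<delta> \<noteq> 0"
  proof
    assume "\<delta> = 0"
    then have "(\<Sum>j<Suc n. G i j * (if j < n then z j else 1)) = 0" if "i < Suc n" for i
      using that z by (cases "i = n") (auto simp: \<delta>_def less_Suc_eq)
    from inj[of "Suc n" "\<lambda>j. if j < n then z j else 1", OF this, of n] show False by simp
  qed
  define r where "r = (y n - (\<Sum>j<n. G n j * w j)) / \<delta>"
  define x where "x j = (if j < n then w j + r * z j else r)" for j
  have "(\<Sum>j<Suc n. G i j * x j) = y i" if "i < Suc n" for i
  proof -
    have e: "(\<Sum>j<Suc n. G i j * x j) = (\<Sum>j<n. G i j * w j) + r * ((\<Sum>j<n. G i j * z j) + G i n)"
      by (simp add: x_def algebra_simps sum.distrib sum_distrib_left)
    show ?thesis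
    proof (cases "i = n")
      case True
      then have "(\<Sum>j<Suc n. G i j * x j) = (\<Sum>j<n. G n j * w j) + r * \<delta>" using e by (simp add: \<delta>_def)
      then show ?thesis using True \<open>\<delta> \<noteq> 0\<close> by (simp add: r_def)
    next
      case False
      then show ?thesis using e z[of i] w[of i] that by simp
    qed
  qed
  then show ?case by blast
qed

text \<open>Three instances follow: the constant 1 for norms, \<open>s\<close> for the derivative
  estimate and \<open>1 - s\<close> for the projection that interpolates at 1. The constants
  constructed here come from the weight and the number of coefficients.\<close>

locale weight =
  fixes \<omega> :: "real \<Rightarrow> real"
  assumes cont: "continuous_on {0..1} \<omega>"
    and pos: "\<And>s. 0 < s \<Longrightarrow> s < 1 \<Longrightarrow> \<omega> s > 0"
    and nonneg: "\<And>s. s \<in> {0..1} \<Longrightarrow> \<omega> s \<ge> 0"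
begin

definition gram :: "nat \<Rightarrow> nat \<Rightarrow> real" where "gram i j = (LINT s|UI. \<omega> s * s ^ i * s ^ j)"

lemma gram_sym: "gram i j = gram j i" by (simp add: gram_def mult_ac)

lemma gram_vp: "(\<Sum>j<q. gram i j * c j) = (LINT s|UI. \<omega> s * s ^ i * vp q c s)" for c :: "nat \<Rightarrow> real"
proof -
  have "(LINT s|UI. \<omega> s * s ^ i * vp q c s) = (LINT s|UI. (\<Sum>j<q. \<omega> s * s ^ i * s ^ j * c j))"
    by (simp add: vp_def sum_distrib_left mult_ac)
  also have "\<dots> = (\<Sum>j<q. LINT s|UI. \<omega> s * s ^ i * s ^ j * c j)"
    by (intro Bochner_Integration.integral_sum integrable_UI continuous_intros cont)
  finally show ?thesis by (simp add: gram_def)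
qed

lemma gram_vp_inner: "x \<bullet> (\<Sum>j<q. gram i j *\<^sub>R c j) = (LINT s|UI. \<omega> s * s ^ i * (x \<bullet> vp q c s))"
  for c :: "nat \<Rightarrow> 'a::real_inner"
proof -
  have "x \<bullet> (\<Sum>j<q. gram i j *\<^sub>R c j) = (\<Sum>j<q. gram i j * (x \<bullet> c j))"
    by (simp add: inner_sum_right)
  also have "\<dots> = (LINT s|UI. \<omega> s * s ^ i * (x \<bullet> vp q c s))"
    by (simp only: gram_vp vp_inner)
  finally show ?thesis .
qed

lemma zero_if_weighted_integral_zero:
  assumes f: "continuous_on {0..1} f" and zero: "(LINT s|UI. \<omega> s * (f s)\<^sup>2) = 0"
    and s: "0 < s" "s < 1"
  shows "f s = (0::real)"
proof -
  have c: "continuous_on {0..1} (\<lambda>s. \<omega> s * (f s)\<^sup>2)" by (intro continuous_intros cont f)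
  have "integral {0..1} (\<lambda>s. \<omega> s * (f s)\<^sup>2) = 0"
    using lebesgue_integral_eq_integral[OF integrable_UI[OF c]] zero by simp
  moreover have "(\<lambda>s. \<omega> s * (f s)\<^sup>2) integrable_on {0..1}" using c by (rule integrable_continuous_real)
  ultimately have "((\<lambda>s. \<omega> s * (f s)\<^sup>2) has_integral 0) {0..1}" by (simp add: has_integral_integral)
  then have "\<omega> s * (f s)\<^sup>2 = 0"
    using has_integral_0_cbox_imp_0[of 0 1 "\<lambda>s. \<omega> s * (f s)\<^sup>2" s] c s nonneg by force
  then show ?thesis using pos[OF s] by simp
qed

text \<open>The quadratic form of the Gram matrix at \<open>c\<close> is the weighted squared norm
  of the polynomial with coefficients \<open>c\<close>.\<close>

lemma gram_inj:
  assumes "\<And>i. i < n \<Longrightarrow> (\<Sum>j<n. gram i j * c j) = 0" "j < n"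
  shows "c j = 0"
proof (rule real_vp_zero_coeffs[OF _ assms(2)])
  have "(LINT s|UI. \<omega> s * (vp n c s)\<^sup>2) = (LINT s|UI. (\<Sum>i<n. (\<omega> s * s ^ i * vp n c s) * c i))"
    by (intro Bochner_Integration.integral_cong) (auto simp: vp_def power2_eq_square sum_distrib_left sum_distrib_right mult_ac)
  also have "\<dots> = (\<Sum>i<n. (LINT s|UI. \<omega> s * s ^ i * vp n c s) * c i)"
    by (subst Bochner_Integration.integral_sum) (auto intro!: integrable_UI continuous_intros cont)
  also have "\<dots> = 0" using assms(1) by (simp add: gram_vp)
  finally show "vp n c s = 0" if "s \<in> {0<..<1}" for s
    using zero_if_weighted_integral_zero[OF continuous_on_vp[OF continuous_on_id]] that by auto
qed

lemma gram_inverse: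
  obtains K where "\<And>i k. i < n \<Longrightarrow> k < n \<Longrightarrow> (\<Sum>j<n. gram i j * K j k) = (if i = k then 1 else 0)"
proof -
  have "\<forall>k. \<exists>x. \<forall>i<n. (\<Sum>j<n. gram i j * x j) = (if i = k then 1 else 0)"
    by (intro allI leading_blocks_solvable) (rule gram_inj)
  then obtain X where "\<forall>k. \<forall>i<n. (\<Sum>j<n. gram i j * X k j) = (if i = k then 1 else 0)"
    by (auto dest: choice)
  then show thesis by (intro that[of "\<lambda>j k. X k j"]) auto
qed

text \<open>The transpose of a right inverse of a symmetric matrix is a left inverse. The scalar
  matrix \<open>K\<close> thus recovers vector coefficients from vector moments.\<close>

lemma coeff_from_moments:
  fixes c :: "nat \<Rightarrow> 'a::real_vector"
  assumes K: "\<And>i k. i < n \<Longrightarrow> k < n \<Longrightarrow> (\<Sum>j<n. gram i j * K j k) = (if i = k then 1 else 0)"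
    and k: "k < n"
  shows "c k = (\<Sum>i<n. K i k *\<^sub>R (\<Sum>j<n. gram i j *\<^sub>R c j))"
proof -
  have "(\<Sum>i<n. K i k *\<^sub>R (\<Sum>j<n. gram i j *\<^sub>R c j)) = (\<Sum>j<n. \<Sum>i<n. (gram j i * K i k) *\<^sub>R c j)"
    unfolding scaleR_sum_right by (subst sum.swap) (simp add: gram_sym mult.commute)
  also have "\<dots> = (\<Sum>j<n. (if j = k then 1 else 0) *\<^sub>R c j)"
    using K k by (simp add: scaleR_sum_left[symmetric])
  also have "\<dots> = c k" using k by (simp add: if_distrib[of "\<lambda>x. x *\<^sub>R _"] cong: if_cong)
  finally show ?thesis by simp
qed

lemma moments_solvable:
  fixes \<mu> :: "nat \<Rightarrow> 'a::real_vector"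
  assumes S: "subspace S" and mu: "\<And>i. i < n \<Longrightarrow> \<mu> i \<in> S"
  shows "\<exists>c. (\<forall>j<n. c j \<in> S) \<and> (\<forall>i<n. (\<Sum>j<n. gram i j *\<^sub>R c j) = \<mu> i)"
proof -
  obtain K where K: "\<And>i k. i < n \<Longrightarrow> k < n \<Longrightarrow> (\<Sum>j<n. gram i j * K j k) = (if i = k then 1 else 0)"
    using gram_inverse by blast
  define c where "c j = (\<Sum>k<n. K j k *\<^sub>R \<mu> k)" for j
  have "(\<Sum>j<n. gram i j *\<^sub>R c j) = \<mu> i" if "i < n" for i
  proof -
    have "(\<Sum>j<n. gram i j *\<^sub>R c j) = (\<Sum>k<n. \<Sum>j<n. (gram i j * K j k) *\<^sub>R \<mu> k)"
      unfolding c_def scaleR_sum_right by (subst sum.swap) simp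
    also have "\<dots> = (\<Sum>k<n. (if i = k then 1 else 0) *\<^sub>R \<mu> k)"
      using K that by (simp add: scaleR_sum_left[symmetric])
    also have "\<dots> = \<mu> i" using that by (simp add: if_distrib[of "\<lambda>x. x *\<^sub>R _"] cong: if_cong)
    finally show ?thesis .
  qed
  moreover have "c j \<in> S" for j
    unfolding c_def using mu by (intro subspace_sum[OF S] subspace_scale[OF S]) auto
  ultimately show ?thesis by blast
qed

lemma moments_bound:
  obtains M where "M \<ge> 0" "\<And>(c :: nat \<Rightarrow> 'a::real_normed_vector) A k.
     (\<And>i. i < n \<Longrightarrow> norm (\<Sum>j<n. gram i j *\<^sub>R c j) \<le> A) \<Longrightarrow> k < n \<Longrightarrow> norm (c k) \<le> M * A"
proof -
  obtain K where K: "\<And>i k. i < n \<Longrightarrow> k < n \<Longrightarrow> (\<Sum>j<n. gram i j * K j k) = (if i = k then 1 else 0)"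
    using gram_inverse by blast
  define M where "M = (\<Sum>k<n. \<Sum>i<n. \<bar>K i k\<bar>)"
  have "norm (c k) \<le> M * A"
    if *: "\<And>i. i < n \<Longrightarrow> norm (\<Sum>j<n. gram i j *\<^sub>R c j) \<le> A" and k: "k < n"
    for c :: "nat \<Rightarrow> 'a" and A k
  proof -
    have A: "A \<ge> 0" using order_trans[OF norm_ge_zero *[OF k]] .
    have ck: "c k = (\<Sum>i<n. K i k *\<^sub>R (\<Sum>j<n. gram i j *\<^sub>R c j))"
      by (rule coeff_from_moments[OF _ k]) (rule K)
    have "norm (c k) \<le> (\<Sum>i<n. norm (K i k *\<^sub>R (\<Sum>j<n. gram i j *\<^sub>R c j)))"
      by (subst ck) (rule norm_sum)
    also have "\<dots> \<le> (\<Sum>i<n. \<bar>K i k\<bar> * A)"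
      using * by (intro sum_mono) (auto intro!: mult_left_mono)
    also have "\<dots> = (\<Sum>i<n. \<bar>K i k\<bar>) * A" by (simp add: sum_distrib_right)
    also have "\<dots> \<le> M * A" unfolding M_def
      using k A by (intro mult_right_mono member_le_sum[of k "{..<n}" "\<lambda>k. \<Sum>i<n. \<bar>K i k\<bar>"] sum_nonneg) auto
    finally show ?thesis .
  qed
  moreover have "M \<ge> 0" unfolding M_def by (intro sum_nonneg) auto
  ultimately show thesis using that by blast
qed

text \<open>Each coefficient is the weighted moment of the polynomial against a fixed scalar
  polynomial \<xi>, dual to the monomials. Bounds for these scalar polynomials give norm equivalence
  in any inner product space.\<close>

lemma coeff_norm_bound:
  "\<exists>C>0. \<forall>(c :: nat \<Rightarrow> 'a::real_inner). \<forall>k<n. (norm (c k))\<^sup>2 \<le> C * (LINT s|UI. \<omega> s * (norm (vp n c s))\<^sup>2)"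
proof -
  obtain K where K: "\<And>i k. i < n \<Longrightarrow> k < n \<Longrightarrow> (\<Sum>j<n. gram i j * K j k) = (if i = k then 1 else 0)"
    using gram_inverse by blast
  define \<xi> where "\<xi> k s = vp n (\<lambda>i. K i k) s" for k s
  define W where "W s = (\<Sum>k<n. \<omega> s * (\<xi> k s)\<^sup>2)" for s
  have "continuous_on {0..1} W" unfolding W_def \<xi>_def by (intro continuous_intros cont)
  then obtain B where B: "B > 0" "\<And>s. s \<in> {0..1} \<Longrightarrow> norm (W s) \<le> B"
    using continuous_on_UI_bounded by blast
  have "(norm (c k))\<^sup>2 \<le> B * (LINT s|UI. \<omega> s * (norm (vp n c s))\<^sup>2)"
    if k: "k < n" for c :: "nat \<Rightarrow> 'a" and k
  proof -
    have "(norm (c k))\<^sup>2 = c k \<bullet> (\<Sum>i<n. K i k *\<^sub>R (\<Sum>j<n. gram i j *\<^sub>R c j))"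
      using coeff_from_moments[OF K k, of c] by (simp add: dot_square_norm)
    also have "\<dots> = (\<Sum>i<n. K i k * (LINT s|UI. \<omega> s * s ^ i * (c k \<bullet> vp n c s)))"
      by (subst inner_sum_right) (simp only: inner_scaleR_right gram_vp_inner)
    also have "\<dots> = (LINT s|UI. \<omega> s * \<xi> k s * (c k \<bullet> vp n c s))"
    proof -
      have "(LINT s|UI. \<omega> s * \<xi> k s * (c k \<bullet> vp n c s))
          = (LINT s|UI. (\<Sum>i<n. K i k * (\<omega> s * s ^ i * (c k \<bullet> vp n c s))))"
        by (intro Bochner_Integration.integral_cong)
          (auto simp: \<xi>_def vp_def[of n "\<lambda>i. K i k"] sum_distrib_left sum_distrib_right mult_ac)
      also have "\<dots> = (\<Sum>i<n. K i k * (LINT s|UI. \<omega> s * s ^ i * (c k \<bullet> vp n c s)))"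
        by (subst Bochner_Integration.integral_sum) (auto intro!: integrable_UI continuous_intros cont)
      finally show ?thesis by simp
    qed
    \<comment> \<open>Young's inequality with the constant \<open>B\<close> that dominates \<omega>
      \<xi>^2. The half of |c k|^2 that it produces is absorbed at the end.\<close>
    also have "\<dots> \<le> (LINT s|UI. (norm (c k))\<^sup>2 / 2 + B / 2 * (\<omega> s * (norm (vp n c s))\<^sup>2))"
    proof (rule integral_mono)
      show "integrable UI (\<lambda>s. \<omega> s * \<xi> k s * (c k \<bullet> vp n c s))"
        unfolding \<xi>_def by (intro integrable_UI continuous_intros cont)
      show "integrable UI (\<lambda>s. (norm (c k))\<^sup>2 / 2 + B / 2 * (\<omega> s * (norm (vp n c s))\<^sup>2))"
        by (intro integrable_UI continuous_intros cont)
      fix s assume "s \<in> space UI"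
      then have s: "s \<in> {0..1}" by simp
      let ?N = "norm (c k)" and ?v = "norm (vp n c s)"
      have "\<omega> s * (\<xi> k s)\<^sup>2 \<le> W s"
        unfolding W_def using k nonneg[OF s]
        by (intro member_le_sum[of k "{..<n}" "\<lambda>k. \<omega> s * (\<xi> k s)\<^sup>2"]) auto
      then have w: "\<omega> s * (\<xi> k s)\<^sup>2 \<le> B" using B(2)[OF s] by simp
      have "0 \<le> (\<xi> k s * ?N - B * ?v)\<^sup>2 / B" "0 \<le> (\<xi> k s * ?N + B * ?v)\<^sup>2 / B" using B(1) by auto
      then have "2 * (\<bar>\<xi> k s\<bar> * (?N * ?v)) \<le> (\<xi> k s)\<^sup>2 * ?N\<^sup>2 / B + B * ?v\<^sup>2"
        using B(1) by (cases "\<xi> k s \<ge> 0") (simp_all add: power2_eq_square field_simps)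
      then have "\<omega> s * (2 * (\<bar>\<xi> k s\<bar> * (?N * ?v))) \<le> \<omega> s * ((\<xi> k s)\<^sup>2 * ?N\<^sup>2 / B + B * ?v\<^sup>2)"
        using nonneg[OF s] by (rule mult_left_mono)
      moreover have "\<omega> s * (\<xi> k s)\<^sup>2 * (?N\<^sup>2 / B) \<le> B * (?N\<^sup>2 / B)"
        using w B(1) by (intro mult_right_mono) auto
      moreover have "\<xi> k s * (c k \<bullet> vp n c s) \<le> \<bar>\<xi> k s\<bar> * (?N * ?v)"
        using Cauchy_Schwarz_ineq2[of "c k" "vp n c s"]
        by - (rule order_trans[OF abs_ge_self], simp add: abs_mult mult_left_mono)
      then have "\<omega> s * (\<xi> k s * (c k \<bullet> vp n c s)) \<le> \<omega> s * (\<bar>\<xi> k s\<bar> * (?N * ?v))"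
        using nonneg[OF s] by (rule mult_left_mono)
      moreover have "\<omega> s * ((\<xi> k s)\<^sup>2 * ?N\<^sup>2 / B + B * ?v\<^sup>2) = \<omega> s * (\<xi> k s)\<^sup>2 * (?N\<^sup>2 / B) + B * (\<omega> s * ?v\<^sup>2)"
        by (simp add: algebra_simps)
      moreover have "B * (?N\<^sup>2 / B) = ?N\<^sup>2" using B(1) by simp
      moreover have "\<omega> s * (2 * (\<bar>\<xi> k s\<bar> * (?N * ?v))) = 2 * (\<omega> s * (\<bar>\<xi> k s\<bar> * (?N * ?v)))" by simp
      ultimately have "2 * (\<omega> s * (\<xi> k s * (c k \<bullet> vp n c s))) \<le> ?N\<^sup>2 + B * (\<omega> s * ?v\<^sup>2)" by linarith
      then show "\<omega> s * \<xi> k s * (c k \<bullet> vp n c s) \<le> ?N\<^sup>2 / 2 + B / 2 * (\<omega> s * ?v\<^sup>2)"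
        by (simp add: mult.assoc)
    qed
    also have "\<dots> = (norm (c k))\<^sup>2 / 2 + B / 2 * (LINT s|UI. \<omega> s * (norm (vp n c s))\<^sup>2)"
      by (subst Bochner_Integration.integral_add) (auto intro!: integrable_UI continuous_intros cont)
    finally show ?thesis by simp
  qed
  with B(1) show ?thesis by blast
qed

end

interpretation unit_weight: weight "\<lambda>s. 1" by standard auto
interpretation left_weight: weight "\<lambda>s. s" by standard auto
interpretation right_weight: weight "\<lambda>s. 1 - s" by standard (auto intro: continuous_intros)

text \<open>The vector-valued moment is the Riesz representer of its scalar components, so later
  arguments meet integrals of real functions only. Orthogonality to the complement puts it into
  \<open>S\<close>.\<close>

lemma continuous_moment:
  fixes \<phi> :: "real \<Rightarrow> 'a::{real_inner,complete_space}"
  assumes S: "hilbert_subspace S" and \<phi>: "continuous_on {0..1} \<phi>" "\<And>s. s \<in> {0..1} \<Longrightarrow> \<phi> s \<in> S"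
    and f: "continuous_on {0..1} f"
  shows "\<exists>\<mu>\<in>S. \<forall>x. x \<bullet> \<mu> = (LINT s|UI. f s * (x \<bullet> \<phi> s))"
proof -
  have "continuous_on {0..1} (\<lambda>s. f s *\<^sub>R \<phi> s)" by (intro continuous_intros f \<phi>)
  then obtain B where B: "\<And>s. s \<in> {0..1} \<Longrightarrow> norm (f s *\<^sub>R \<phi> s) \<le> B"
    using continuous_on_UI_bounded by blast
  have int: "integrable UI (\<lambda>s. f s * (x \<bullet> \<phi> s))" for x by (intro integrable_UI continuous_intros f \<phi>)
  have "bounded_linear (\<lambda>x. LINT s|UI. f s * (x \<bullet> \<phi> s))"
  proof (rule bounded_linear_intro[where K = B])
    show "(LINT s|UI. f s * ((x + y) \<bullet> \<phi> s)) = (LINT s|UI. f s * (x \<bullet> \<phi> s)) + (LINT s|UI. f s * (y \<bullet> \<phi> s))" for x y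
      by (simp add: inner_add_left distrib_left Bochner_Integration.integral_add[OF int int])
    show "(LINT s|UI. f s * ((c *\<^sub>R x) \<bullet> \<phi> s)) = c *\<^sub>R (LINT s|UI. f s * (x \<bullet> \<phi> s))" for c x
      by (simp add: mult.left_commute)
    show "norm (LINT s|UI. f s * (x \<bullet> \<phi> s)) \<le> norm x * B" for x
      unfolding real_norm_def
    proof (rule UI_bound_integral[OF int])
      fix s :: real assume s: "s \<in> {0..1}"
      have "\<bar>x \<bullet> (f s *\<^sub>R \<phi> s)\<bar> \<le> norm x * norm (f s *\<^sub>R \<phi> s)" by (rule Cauchy_Schwarz_ineq2)
      also have "\<dots> \<le> norm x * B" using B[OF s] by (rule mult_left_mono) simp
      finally show "\<bar>f s * (x \<bullet> \<phi> s)\<bar> \<le> norm x * B" by simp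
    qed
  qed
  then obtain \<mu> where \<mu>: "\<And>x. (LINT s|UI. f s * (x \<bullet> \<phi> s)) = \<mu> \<bullet> x" using riesz_representation by blast
  have "\<mu> \<in> S"
  proof (rule mem_if_orthogonal[OF S])
    fix x assume "\<forall>y\<in>S. x \<bullet> y = 0"
    then have "(LINT s|UI. f s * (x \<bullet> \<phi> s)) = (LINT s|UI. 0)"
      using \<phi>(2) by (intro Bochner_Integration.integral_cong) auto
    then show "x \<bullet> \<mu> = 0" using \<mu>[of x] by (simp add: inner_commute)
  qed
  with \<mu> show ?thesis by (metis inner_commute)
qed

lemma norm_le_by_inner: "norm v \<le> A" if "\<And>x. x \<bullet> v \<le> A * norm x" "A \<ge> 0" for v :: "'a::real_inner"
  using that(1)[of v] that(2) by - (rule le_if_square_le_mult, auto simp: dot_square_norm mult.commute)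

text \<open>The projection \<open>\<I>\<^sub>q\<close> on the reference cell, quasi-optimal with constant \<open>M\<close>.\<close>

definition endpoint_projection :: "nat \<Rightarrow> real \<Rightarrow> 'a::real_inner set \<Rightarrow> (real \<Rightarrow> 'a) \<Rightarrow> (nat \<Rightarrow> 'a) \<Rightarrow> bool" where
  "endpoint_projection q M S \<phi> z \<longleftrightarrow> (\<forall>j<q. z j \<in> S) \<and> vp q z 1 = \<phi> 1
     \<and> (\<forall>x i. i + 1 < q \<longrightarrow> (LINT s|UI. s ^ i * (x \<bullet> (\<phi> s - vp q z s))) = 0)
     \<and> (\<forall>m c A. m \<le> q \<longrightarrow> (\<forall>s\<in>{0..1}. norm (\<phi> s - vp m c s) \<le> A) \<longrightarrow>
           (\<forall>s\<in>{0..1}. norm (\<phi> s - vp q z s) \<le> M * A))"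

text \<open>Dividing the polynomial minus its value at \<open>1\<close> by
  \<open>1 - s\<close> turns the moment conditions into a Gram system for the weight \<open>1 - s\<close>.\<close>

lemma endpoint_projection_exists:
  "\<exists>M\<ge>0. \<forall>(S :: 'a::{real_inner,complete_space} set) \<phi>. hilbert_subspace S \<longrightarrow> continuous_on {0..1} \<phi> \<longrightarrow>
     (\<forall>s\<in>{0..1}. \<phi> s \<in> S) \<longrightarrow> (\<exists>z. endpoint_projection (Suc q) M S \<phi> z)"
proof -
  let ?g = right_weight.gram
  obtain M where M: "M \<ge> 0" "\<And>(c :: nat \<Rightarrow> 'a) A k.
     (\<And>i. i < q \<Longrightarrow> norm (\<Sum>j<q. ?g i j *\<^sub>R c j) \<le> A) \<Longrightarrow> k < q \<Longrightarrow> norm (c k) \<le> M * A"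
    using right_weight.moments_bound[where n = q and 'a = 'a] by blast
  \<comment> \<open>Triangle inequality through a competitor with error at most A: one A for the
    competitor, one for its defect at 1, and \<open>real q * M * 2\<close> times A for the quotient,
    whose moments are at most 2A.\<close>
  have "\<exists>z. endpoint_projection (Suc q) (2 + real q * M * 2) S \<phi> z"
    if S: "hilbert_subspace S" and \<phi>: "continuous_on {0..1} \<phi>" "\<And>s. s \<in> {0..1} \<Longrightarrow> \<phi> s \<in> S"
    for S :: "'a set" and \<phi>
  proof -
    have sub: "subspace S" using S by (simp add: hilbert_subspace_def)
    have "\<exists>\<mu>\<in>S. \<forall>x. x \<bullet> \<mu> = (LINT s|UI. s ^ i * (x \<bullet> (\<phi> s - \<phi> 1)))" for i
      using continuous_moment[OF S, of "\<lambda>s. \<phi> s - \<phi> 1" "\<lambda>s. s ^ i"] \<phi> subspace_diff[OF sub]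
      by (auto simp: continuous_intros)
    then obtain \<mu> where \<mu>: "\<And>i. \<mu> i \<in> S" "\<And>i x. x \<bullet> \<mu> i = (LINT s|UI. s ^ i * (x \<bullet> (\<phi> s - \<phi> 1)))" by metis
    obtain w where w: "\<And>j. j < q \<Longrightarrow> w j \<in> S" "\<And>i. i < q \<Longrightarrow> (\<Sum>j<q. ?g i j *\<^sub>R w j) = \<mu> i"
      using right_weight.moments_solvable[OF sub, of q \<mu>] \<mu>(1) by meson
    \<comment> \<open>Coefficients of \<phi>(1) + (1 - s) w(s), where w carries the moments of
      \<phi> - \<phi>(1).\<close>
    define z where "z j = (if j = 0 then \<phi> 1 else 0) + ((if j < q then w j else 0) - (case j of 0 \<Rightarrow> 0 | Suc i \<Rightarrow> w i))" for j
    have z: "vp (Suc q) z s = \<phi> 1 + (1 - s) *\<^sub>R vp q w s" for s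
    proof -
      have "vp (Suc q) (\<lambda>j. if j = 0 then \<phi> 1 else 0) s = \<phi> 1"
        "vp (Suc q) (case_nat 0 w) s = s *\<^sub>R vp q w s" by (simp_all add: vp_Suc_shift)
      then show ?thesis
        by (simp add: z_def[abs_def] vp_add vp_diff vp_pad scaleR_diff_left)
    qed
    have zS: "z j \<in> S" if "j < Suc q" for j
      using that w(1) \<phi>(2)[of 1] subspace_0[OF sub]
      by (auto simp: z_def split: nat.split intro!: subspace_add[OF sub] subspace_diff[OF sub] intro: subspace_neg[OF sub])
    have orth: "(LINT s|UI. s ^ i * (x \<bullet> (\<phi> s - vp (Suc q) z s))) = 0" if i: "i < q" for x i
    proof -
      have "(LINT s|UI. s ^ i * (x \<bullet> (\<phi> s - vp (Suc q) z s)))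
          = (LINT s|UI. s ^ i * (x \<bullet> (\<phi> s - \<phi> 1)) - (1 - s) * s ^ i * (x \<bullet> vp q w s))"
        by (intro Bochner_Integration.integral_cong) (auto simp: z algebra_simps inner_diff_right inner_add_right)
      also have "\<dots> = (LINT s|UI. s ^ i * (x \<bullet> (\<phi> s - \<phi> 1))) - (LINT s|UI. (1 - s) * s ^ i * (x \<bullet> vp q w s))"
        by (intro Bochner_Integration.integral_diff integrable_UI continuous_intros \<phi>)
      also have "(LINT s|UI. (1 - s) * s ^ i * (x \<bullet> vp q w s)) = x \<bullet> \<mu> i"
        using right_weight.gram_vp_inner[where c = w and q = q and i = i and x = x] w(2)[OF i] by simp
      finally show ?thesis by (simp add: \<mu>(2))
    qed
    have "norm (\<phi> s - vp (Suc q) z s) \<le> (2 + real q * M * 2) * A"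
      if m: "m \<le> Suc q" and A: "\<And>s. s \<in> {0..1} \<Longrightarrow> norm (\<phi> s - vp m c s) \<le> A" and s: "s \<in> {0..1}"
      for m c A s
    proof -
      define e where "e j = z j - (if j < m then c j else 0)" for j
      have e: "vp (Suc q) e s = vp (Suc q) z s - vp m c s" for s
        by (simp add: e_def[abs_def] vp_diff vp_pad[OF m])
      have e1: "norm (vp (Suc q) e 1) \<le> A" using A[of 1] by (simp add: e z)
      have A0: "A \<ge> 0" using e1 norm_ge_zero order_trans by blast
      obtain v where v: "\<And>s. vp (Suc q) e s = vp (Suc q) e 1 + (1 - s) *\<^sub>R vp q v s"
        using vp_factor by blast
      \<comment> \<open>The projection shares its moments with \<phi>, so \<phi> may replace it in
        the moments of the quotient. What remains is the competitor's error minus that error at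
        1.\<close>
      have "norm (\<Sum>j<q. ?g i j *\<^sub>R v j) \<le> 2 * A" if i: "i < q" for i
      proof (rule norm_le_by_inner)
        show "0 \<le> 2 * A" using A0 by simp
        fix x
        define \<rho> where "\<rho> s = \<phi> s - vp m c s - vp (Suc q) e 1" for s
        have c1: "continuous_on {0..1} (\<lambda>s. s ^ i * (x \<bullet> (\<phi> s - vp (Suc q) z s)))"
          and c2: "continuous_on {0..1} (\<lambda>s. (1 - s) * s ^ i * (x \<bullet> vp q v s))"
          and c3: "continuous_on {0..1} (\<lambda>s. s ^ i * (x \<bullet> \<rho> s))"
          unfolding \<rho>_def by (intro continuous_intros \<phi>)+
        have "x \<bullet> (\<Sum>j<q. ?g i j *\<^sub>R v j) = (LINT s|UI. (1 - s) * s ^ i * (x \<bullet> vp q v s))"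
          by (rule right_weight.gram_vp_inner)
        also have "\<dots> = (LINT s|UI. (1 - s) * s ^ i * (x \<bullet> vp q v s)) + (LINT s|UI. s ^ i * (x \<bullet> (\<phi> s - vp (Suc q) z s)))"
          by (simp add: orth[OF i])
        also have "\<dots> = (LINT s|UI. (1 - s) * s ^ i * (x \<bullet> vp q v s) + s ^ i * (x \<bullet> (\<phi> s - vp (Suc q) z s)))"
          by (intro Bochner_Integration.integral_add[symmetric] integrable_UI c1 c2)
        also have "\<dots> = (LINT s|UI. s ^ i * (x \<bullet> \<rho> s))"
        proof (rule Bochner_Integration.integral_cong[OF refl])
          fix s
          have "(1 - s) *\<^sub>R vp q v s + (\<phi> s - vp (Suc q) z s) = \<rho> s"
            using v[of s] e[of s] by (simp add: \<rho>_def algebra_simps)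
          then have r: "x \<bullet> \<rho> s = (1 - s) * (x \<bullet> vp q v s) + x \<bullet> (\<phi> s - vp (Suc q) z s)"
            by (metis inner_add_right inner_scaleR_right)
          show "(1 - s) * s ^ i * (x \<bullet> vp q v s) + s ^ i * (x \<bullet> (\<phi> s - vp (Suc q) z s)) = s ^ i * (x \<bullet> \<rho> s)"
            unfolding r by (simp add: algebra_simps)
        qed
        also have "\<bar>\<dots>\<bar> \<le> 2 * A * norm x"
        proof (rule UI_bound_integral[OF integrable_UI[OF c3]])
          fix s :: real assume s: "s \<in> {0..1}"
          have "\<bar>s ^ i\<bar> \<le> 1" using s by (auto simp: power_le_one_iff power_abs)
          moreover have "norm (\<rho> s) \<le> 2 * A"
            using norm_triangle_ineq4[of "\<phi> s - vp m c s" "vp (Suc q) e 1"] A[OF s] e1 by (simp add: \<rho>_def)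
          then have "\<bar>x \<bullet> \<rho> s\<bar> \<le> norm x * (2 * A)"
            using Cauchy_Schwarz_ineq2[of x "\<rho> s"] by (meson mult_left_mono norm_ge_zero order_trans)
          ultimately have "\<bar>s ^ i\<bar> * \<bar>x \<bullet> \<rho> s\<bar> \<le> 1 * (norm x * (2 * A))"
            by (intro mult_mono) auto
          then show "\<bar>s ^ i * (x \<bullet> \<rho> s)\<bar> \<le> 2 * A * norm x" by (simp add: abs_mult mult_ac)
        qed
        finally show "x \<bullet> (\<Sum>j<q. ?g i j *\<^sub>R v j) \<le> 2 * A * norm x" by simp
      qed
      then have "norm (vp q v s) \<le> real q * (M * (2 * A))"
        by (intro norm_vp_le[OF s] M(2)) auto
      then have "norm ((1 - s) *\<^sub>R vp q v s) \<le> 1 * (real q * (M * (2 * A)))"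
        using s unfolding norm_scaleR by (intro mult_mono) auto
      moreover have "norm (vp (Suc q) e s) \<le> norm (vp (Suc q) e 1) + norm ((1 - s) *\<^sub>R vp q v s)"
        unfolding v[of s] by (rule norm_triangle_ineq)
      moreover have "norm (\<phi> s - vp (Suc q) z s) \<le> norm (\<phi> s - vp m c s) + norm (vp (Suc q) e s)"
        using norm_triangle_ineq4[of "\<phi> s - vp m c s" "vp (Suc q) e s"] by (simp add: e)
      ultimately show ?thesis using A[OF s] e1 by (simp add: algebra_simps)
    qed
    moreover have "vp (Suc q) z 1 = \<phi> 1" by (simp add: z)
    ultimately have "endpoint_projection (Suc q) (2 + real q * M * 2) S \<phi> z"
      using zS orth unfolding endpoint_projection_def Suc_eq_plus1[symmetric] Suc_less_eq by blast
    then show ?thesis by blast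
  qed
  moreover have "2 + real q * M * 2 \<ge> 0" using M(1) by simp
  ultimately show ?thesis by blast
qed

text \<open>A polynomial vanishing at 1 is divisible by 1 - s, and the quotient has zero moments for
  the weight \<open>1 - s\<close>. This serves to identify the function selected in
  \<open>Iq\<close>.\<close>

lemma endpoint_moments_unique:
  fixes c :: "nat \<Rightarrow> real"
  assumes "vp (Suc q) c 1 = 0" "\<And>i. i < q \<Longrightarrow> (LINT s|UI. s ^ i * vp (Suc q) c s) = 0"
  shows "vp (Suc q) c s = 0"
proof -
  obtain w where w: "\<And>s. vp (Suc q) c s = (1 - s) *\<^sub>R vp q w s"
    using vp_factor[of q c] assms(1) by auto
  have "(\<Sum>j<q. right_weight.gram i j * w j) = 0" if "i < q" for i
    using assms(2)[OF that] right_weight.gram_vp[where q = q and i = i and c = w] w by (simp add: mult_ac)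
  then have "w j = 0" if "j < q" for j using right_weight.gram_inj that by blast
  then have "vp q w s = 0" using vp_cong[of q w "\<lambda>j. 0" s] by simp
  then show ?thesis by (simp add: w)
qed

section \<open>Energy estimates for the Galerkin equation on reference cells\<close>

lemma UI_mono:
  fixes f g :: "real \<Rightarrow> real"
  assumes "continuous_on {0..1} f" "continuous_on {0..1} g" "\<And>s. s \<in> {0..1} \<Longrightarrow> f s \<le> g s"
  shows "(LINT s|UI. f s) \<le> (LINT s|UI. g s)"
  using assms by (intro integral_mono integrable_UI) auto

lemma UI_nonneg:
  fixes f :: "real \<Rightarrow> real"
  assumes "\<And>s. s \<in> {0..1} \<Longrightarrow> 0 \<le> f s"
  shows "0 \<le> (LINT s|UI. f s)"
  using assms by (intro Bochner_Integration.integral_nonneg) auto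

lemma UI_add: "(LINT s|UI. f s + g s) = (LINT s|UI. f s) + (LINT s|UI. g s)"
  if "continuous_on {0..1} f" "continuous_on {0..1} g" for f g :: "real \<Rightarrow> real"
  using that by (intro Bochner_Integration.integral_add integrable_UI)

lemma UI_diff: "(LINT s|UI. f s - g s) = (LINT s|UI. f s) - (LINT s|UI. g s)"
  if "continuous_on {0..1} f" "continuous_on {0..1} g" for f g :: "real \<Rightarrow> real"
  using that by (intro Bochner_Integration.integral_diff integrable_UI)

lemma UI_linear_combination:
  fixes f g :: "real \<Rightarrow> real"
  assumes "continuous_on {0..1} f" "continuous_on {0..1} g"
  shows "(LINT s|UI. x * f s + y * g s + e) = x * (LINT s|UI. f s) + y * (LINT s|UI. g s) + e"
proof -
  have "(LINT s|UI. x * f s + y * g s + e) = (LINT s|UI. x * f s + y * g s) + (LINT s|UI. e)"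
    by (intro UI_add continuous_intros assms)
  also have "(LINT s|UI. x * f s + y * g s) = (LINT s|UI. x * f s) + (LINT s|UI. y * g s)"
    by (intro UI_add continuous_intros assms)
  finally show ?thesis by simp
qed

lemma young: "x * y \<le> e * x\<^sup>2 + y\<^sup>2 / (4 * e)" if "e > 0" for x y e :: real
proof -
  have "0 \<le> (2 * e * x - y)\<^sup>2 / (4 * e)" using that by simp
  also have "\<dots> = e * x\<^sup>2 + y\<^sup>2 / (4 * e) - x * y" using that by (simp add: power2_eq_square field_simps)
  finally show ?thesis by simp
qed

lemma square_add_le: "(x + y)\<^sup>2 \<le> 2 * x\<^sup>2 + 2 * y\<^sup>2" for x y :: real
  using zero_le_power2[of "x - y"] by (simp add: power2_sum power2_diff)

lemma integral_vd_inner_vp: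
  fixes c :: "nat \<Rightarrow> 'h::real_inner"
  shows "(LINT s|UI. vd q c s \<bullet> vp q c s) = ((norm (vp q c 1))\<^sup>2 - (norm (vp q c 0))\<^sup>2) / 2"
proof -
  have "((\<lambda>s. (vp q c s \<bullet> vp q c s) / 2) has_vector_derivative vd q c s \<bullet> vp q c s) (at s within {0..1})" for s
  proof -
    have "((\<lambda>s. vp q c s \<bullet> vp q c s) has_vector_derivative
        vp q c s \<bullet> vd q c s + vd q c s \<bullet> vp q c s) (at s within {0..1})"
      by (rule bounded_bilinear.has_vector_derivative[OF bounded_bilinear_inner
            vp_has_vector_derivative vp_has_vector_derivative])
    from has_vector_derivative_divide[OF this, of 2] show ?thesis by (simp add: inner_commute)
  qed
  then have "((\<lambda>s. vd q c s \<bullet> vp q c s) has_integral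
      (vp q c 1 \<bullet> vp q c 1) / 2 - (vp q c 0 \<bullet> vp q c 0) / 2) {0..1}"
    by (intro fundamental_theorem_of_calculus) auto
  moreover have "(LINT s|UI. vd q c s \<bullet> vp q c s) = integral {0..1} (\<lambda>s. vd q c s \<bullet> vp q c s)"
    by (intro lebesgue_integral_eq_integral integrable_UI continuous_intros) auto
  ultimately show ?thesis by (simp add: integral_unique dot_square_norm diff_divide_distrib)
qed

text \<open>The value 0 before the first cell turns the initial term of \<open>D_H\<close> into one
  more jump.\<close>

definition prev :: "(nat \<Rightarrow> 'a::zero) \<Rightarrow> nat \<Rightarrow> 'a" where
  "prev B n = (case n of 0 \<Rightarrow> 0 | Suc i \<Rightarrow> B i)"

text \<open>\<open>A n\<close> and \<open>B n\<close> stand for the values at the left and right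
  ends of a cell. By 2 (A - B, A) = |A|^2 - |B|^2 + |A - B|^2, applied with the preceding right end
  for B, the end values telescope.\<close>

lemma jump_energy:
  fixes A B :: "nat \<Rightarrow> 'h::real_inner"
  shows "(\<Sum>n<N. ((norm (B n))\<^sup>2 - (norm (A n))\<^sup>2) / 2 + (A n - prev B n) \<bullet> A n)
    = (\<Sum>n<N. (norm (A n - prev B n))\<^sup>2) / 2 + (norm (prev B N))\<^sup>2 / 2"
proof (induction N)
  case 0
  then show ?case by (simp add: prev_def)
next
  case (Suc N)
  have "(A N - prev B N) \<bullet> A N = (norm (A N))\<^sup>2 / 2 - (norm (prev B N))\<^sup>2 / 2 + (norm (A N - prev B N))\<^sup>2 / 2"
    by (simp add: dot_square_norm[symmetric] inner_diff_left inner_diff_right inner_commute field_simps)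
  moreover have "prev B (Suc N) = B N" by (simp add: prev_def)
  ultimately show ?case using Suc by (simp add: field_simps)
qed

text \<open>The constant of \<open>weighted_derivative\<close>: the direct contribution of u - I_q
  u, then that of \<theta> after its energy bound. The factor q^4 K stems from the inverse estimate
  for the test function.\<close>

definition derivative_const :: "real \<Rightarrow> real \<Rightarrow> real \<Rightarrow> nat \<Rightarrow> real" where
  "derivative_const \<gamma> \<Gamma> K q = \<Gamma> + \<Gamma> * (1 + real q ^ 4 * K / 2) * (\<Gamma>\<^sup>2 / \<gamma>\<^sup>2)"

text \<open>The first summand collects derivative and jump terms, which are paired in
  \<open>\<H>\<close> and so bring in the embedding bound; the second comes from the form
  \<open>a\<close>.\<close>

definition pressure_const :: "real \<Rightarrow> real \<Rightarrow> real \<Rightarrow> real \<Rightarrow> real \<Rightarrow> nat \<Rightarrow> real" where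
  "pressure_const \<gamma> \<Gamma> \<beta> \<kappa> K q =
     4 * (\<kappa> / \<beta>)\<^sup>2 * K * ((real q)\<^sup>2 * derivative_const \<gamma> \<Gamma> K q + \<Gamma>\<^sup>2 / \<gamma>) + 4 * (\<Gamma> / \<beta>)\<^sup>2 * (1 + \<Gamma>\<^sup>2 / \<gamma>\<^sup>2)"

lemma pressure_const_nonneg: "\<gamma> > 0 \<Longrightarrow> \<Gamma> > 0 \<Longrightarrow> K > 0 \<Longrightarrow> pressure_const \<gamma> \<Gamma> \<beta> \<kappa> K q \<ge> 0"
  by (simp add: pressure_const_def derivative_const_def)

text \<open>The error equation on reference cells, with all maps defined on whole types.
  \<open>\<eta> n\<close> is to be u - I_q u, \<open>c n\<close> holds the coefficients of \<theta>,
  \<open>z n\<close> those of the projected pressure and \<open>P n\<close> those of the discrete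
  one. The bound by \<open>K\<close> appears three times because one constant has to serve
  polynomials of three types.\<close>

locale cell_galerkin =
  fixes J :: "'u::real_inner \<Rightarrow> 'h::real_inner" and a :: "'u \<Rightarrow> 'u \<Rightarrow> real"
    and b :: "'u \<Rightarrow> 'q::real_inner \<Rightarrow> real" and V V2 :: "'u set" and Q :: "'q set"
    and L :: "'q \<Rightarrow> 'u"
    and \<gamma> \<Gamma> \<beta> \<kappa> K k :: real and q N :: nat
    and \<eta> :: "nat \<Rightarrow> real \<Rightarrow> 'u" and p :: "nat \<Rightarrow> real \<Rightarrow> 'q"
    and c :: "nat \<Rightarrow> nat \<Rightarrow> 'u" and z P :: "nat \<Rightarrow> nat \<Rightarrow> 'q"
  assumes bl_J: "bounded_linear J" and bb_a: "bounded_bilinear a" and bb_b: "bounded_bilinear b"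
    and norm_J: "\<And>x. norm (J x) \<le> \<kappa> * norm x"
    and a_le: "\<And>x y. \<bar>a x y\<bar> \<le> \<Gamma> * norm x * norm y"
    and a_ge: "\<And>v. v \<in> V \<Longrightarrow> \<gamma> * (norm v)\<^sup>2 \<le> a v v"
    and params: "\<gamma> > 0" "\<Gamma> > 0" "\<beta> > 0" "\<kappa> \<ge> 0" "0 < k" "k \<le> 1" "K > 0" "q > 0"
    and V: "subspace V" "V \<subseteq> V2" and V2: "subspace V2" and Q: "subspace Q"
    and b_V: "\<And>v r. v \<in> V \<Longrightarrow> r \<in> Q \<Longrightarrow> b v r = 0"
    and L_V2: "\<And>r. r \<in> Q \<Longrightarrow> L r \<in> V2" and norm_L: "\<And>r. r \<in> Q \<Longrightarrow> norm (L r) \<le> norm r / \<beta>"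
    and b_L: "\<And>r s. r \<in> Q \<Longrightarrow> s \<in> Q \<Longrightarrow> b (L r) s = r \<bullet> s" and lin_L: "linear_on Q L"
    and K_u: "\<And>(d :: nat \<Rightarrow> 'u) j. j < q \<Longrightarrow> (norm (d j))\<^sup>2 \<le> K * (LINT s|UI. (norm (vp q d s))\<^sup>2)"
    and K_h: "\<And>(d :: nat \<Rightarrow> 'h) j. j < q \<Longrightarrow> (norm (d j))\<^sup>2 \<le> K * (LINT s|UI. s * (norm (vp q d s))\<^sup>2)"
    and K_q: "\<And>(d :: nat \<Rightarrow> 'q) j. j < q \<Longrightarrow> (norm (d j))\<^sup>2 \<le> K * (LINT s|UI. (norm (vp q d s))\<^sup>2)"
    and cont_eta: "\<And>n. n < N \<Longrightarrow> continuous_on {0..1} (\<eta> n)"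
    and cont_p: "\<And>n. n < N \<Longrightarrow> continuous_on {0..1} (p n)"
    and p_Q: "\<And>n s. n < N \<Longrightarrow> s \<in> {0..1} \<Longrightarrow> p n s \<in> Q"
    and c_V: "\<And>n j. n < N \<Longrightarrow> j < q \<Longrightarrow> c n j \<in> V"
    and z_Q: "\<And>n j. n < N \<Longrightarrow> j < q \<Longrightarrow> z n j \<in> Q" and P_Q: "\<And>n j. n < N \<Longrightarrow> j < q \<Longrightarrow> P n j \<in> Q"
    and galerkin: "\<And>x. (\<And>n j. n < N \<Longrightarrow> j < q \<Longrightarrow> x n j \<in> V2) \<Longrightarrow>
      (\<Sum>n<N. (LINT s|UI. J (vd q (c n) s) \<bullet> J (vp q (x n) s))
          + (J (vp q (c n) 0) - prev (\<lambda>n. J (vp q (c n) 1)) n) \<bullet> J (vp q (x n) 0))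
      + k * (\<Sum>n<N. LINT s|UI. a (\<eta> n s + vp q (c n) s) (vp q (x n) s)
          + b (vp q (x n) s) (p n s - vp q (P n) s)) = 0"
begin

sublocale J: bounded_linear J by (rule bl_J)
sublocale a: bounded_bilinear a by (rule bb_a)
sublocale b: bounded_bilinear b by (rule bb_b)

abbreviation \<theta> :: "nat \<Rightarrow> real \<Rightarrow> 'u" where "\<theta> n \<equiv> vp q (c n)"
abbreviation jmp :: "nat \<Rightarrow> 'h" where "jmp n \<equiv> J (\<theta> n 0) - prev (\<lambda>n. J (\<theta> n 1)) n"

definition H where "H = k * (\<Sum>n<N. LINT s|UI. (norm (\<eta> n s))\<^sup>2)"
definition Th where "Th = k * (\<Sum>n<N. LINT s|UI. (norm (\<theta> n s))\<^sup>2)"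
definition Js where "Js = (\<Sum>n<N. (norm (jmp n))\<^sup>2)"
definition Pe where "Pe = k * (\<Sum>n<N. LINT s|UI. (norm (p n s - vp q (z n) s))\<^sup>2)"
text \<open>In the original time variable this is the integral of (t - t_(n-1)) |\<theta>'|^2 in the
  norm of \<open>\<H>\<close>, summed over the cells; weight and derivative compensate, so no power
  of \<open>k\<close> appears.\<close>

definition Sd where "Sd = (\<Sum>n<N. LINT s|UI. s * (norm (J (vd q (c n) s)))\<^sup>2)"

lemmas cont [continuous_intros] = a.continuous_on b.continuous_on J.continuous_on

lemma H_nonneg: "H \<ge> 0" unfolding H_def using params by (intro mult_nonneg_nonneg sum_nonneg UI_nonneg) auto

lemma energy: "Js + \<gamma> * Th \<le> \<Gamma>\<^sup>2 / \<gamma> * H"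
proof -
  have cell: "\<gamma> / 2 * (LINT s|UI. (norm (\<theta> n s))\<^sup>2) - \<Gamma>\<^sup>2 / (2 * \<gamma>) * (LINT s|UI. (norm (\<eta> n s))\<^sup>2)
      \<le> (LINT s|UI. a (\<eta> n s + \<theta> n s) (\<theta> n s) + b (\<theta> n s) (p n s - vp q (P n) s))" if n: "n < N" for n
  proof -
    have "(LINT s|UI. \<gamma> / 2 * (norm (\<theta> n s))\<^sup>2 - \<Gamma>\<^sup>2 / (2 * \<gamma>) * (norm (\<eta> n s))\<^sup>2)
      \<le> (LINT s|UI. a (\<eta> n s + \<theta> n s) (\<theta> n s) + b (\<theta> n s) (p n s - vp q (P n) s))"
    proof (rule UI_mono)
      fix s :: real assume s: "s \<in> {0..1}"
      have tV: "\<theta> n s \<in> V" using c_V n by (intro vp_mem V) auto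
      have "p n s - vp q (P n) s \<in> Q" using p_Q[OF n s] P_Q n by (intro subspace_diff[OF Q] vp_mem[OF Q]) auto
      then have "b (\<theta> n s) (p n s - vp q (P n) s) = 0" using b_V tV by blast
      moreover have "a (\<eta> n s + \<theta> n s) (\<theta> n s) = a (\<eta> n s) (\<theta> n s) + a (\<theta> n s) (\<theta> n s)" by (rule a.add_left)
      \<comment> \<open>Half of the coercivity is spent here, the other half is kept.\<close>
      moreover have "norm (\<theta> n s) * (\<Gamma> * norm (\<eta> n s)) \<le> \<gamma> / 2 * (norm (\<theta> n s))\<^sup>2 + (\<Gamma> * norm (\<eta> n s))\<^sup>2 / (4 * (\<gamma> / 2))"
        using params by (intro young) auto
      moreover have "(\<Gamma> * norm (\<eta> n s))\<^sup>2 / (4 * (\<gamma> / 2)) = \<Gamma>\<^sup>2 / (2 * \<gamma>) * (norm (\<eta> n s))\<^sup>2"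
        by (simp add: power_mult_distrib)
      moreover have "\<bar>a (\<eta> n s) (\<theta> n s)\<bar> \<le> norm (\<theta> n s) * (\<Gamma> * norm (\<eta> n s))"
        using a_le[of "\<eta> n s" "\<theta> n s"] by (simp add: mult_ac)
      moreover have "\<gamma> * (norm (\<theta> n s))\<^sup>2 = \<gamma> / 2 * (norm (\<theta> n s))\<^sup>2 + \<gamma> / 2 * (norm (\<theta> n s))\<^sup>2" by simp
      ultimately show "\<gamma> / 2 * (norm (\<theta> n s))\<^sup>2 - \<Gamma>\<^sup>2 / (2 * \<gamma>) * (norm (\<eta> n s))\<^sup>2
          \<le> a (\<eta> n s + \<theta> n s) (\<theta> n s) + b (\<theta> n s) (p n s - vp q (P n) s)"
        using a_ge[OF tV] by linarith
    qed (intro continuous_intros cont_eta[OF n] cont_p[OF n])+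
    then show ?thesis
      using params by (subst (asm) UI_diff) (auto intro!: continuous_intros cont_eta[OF n])
  qed
  have g: "(\<Sum>n<N. (LINT s|UI. J (vd q (c n) s) \<bullet> J (\<theta> n s)) + jmp n \<bullet> J (\<theta> n 0))
      + k * (\<Sum>n<N. LINT s|UI. a (\<eta> n s + \<theta> n s) (\<theta> n s) + b (\<theta> n s) (p n s - vp q (P n) s)) = 0"
    by (rule galerkin) (use c_V V in auto)
  have "(\<Sum>n<N. (LINT s|UI. J (vd q (c n) s) \<bullet> J (\<theta> n s)) + jmp n \<bullet> J (\<theta> n 0))
      = (\<Sum>n<N. ((norm (J (\<theta> n 1)))\<^sup>2 - (norm (J (\<theta> n 0)))\<^sup>2) / 2 + jmp n \<bullet> J (\<theta> n 0))"
    by (simp only: integral_vd_inner_vp vp_linear[OF J.linear_axioms] vd_linear[OF J.linear_axioms])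
  \<comment> \<open>The remaining term of \<open>jump_energy\<close>, half the squared final value,
    is nonnegative.\<close>
  also have "\<dots> \<ge> Js / 2" unfolding jump_energy Js_def by simp
  finally have 1: "Js / 2 \<le> (\<Sum>n<N. (LINT s|UI. J (vd q (c n) s) \<bullet> J (\<theta> n s)) + jmp n \<bullet> J (\<theta> n 0))" .
  have "(\<Sum>n<N. \<gamma> / 2 * (LINT s|UI. (norm (\<theta> n s))\<^sup>2) - \<Gamma>\<^sup>2 / (2 * \<gamma>) * (LINT s|UI. (norm (\<eta> n s))\<^sup>2))
      \<le> (\<Sum>n<N. LINT s|UI. a (\<eta> n s + \<theta> n s) (\<theta> n s) + b (\<theta> n s) (p n s - vp q (P n) s))"
    using cell by (intro sum_mono) auto
  then have "\<gamma> / 2 * (\<Sum>n<N. LINT s|UI. (norm (\<theta> n s))\<^sup>2) - \<Gamma>\<^sup>2 / (2 * \<gamma>) * (\<Sum>n<N. LINT s|UI. (norm (\<eta> n s))\<^sup>2)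
      \<le> (\<Sum>n<N. LINT s|UI. a (\<eta> n s + \<theta> n s) (\<theta> n s) + b (\<theta> n s) (p n s - vp q (P n) s))"
    by (simp only: sum_subtractf sum_distrib_left)
  from mult_left_mono[OF this, of k]
  have "\<gamma> / 2 * Th - \<Gamma>\<^sup>2 / (2 * \<gamma>) * H
      \<le> k * (\<Sum>n<N. LINT s|UI. a (\<eta> n s + \<theta> n s) (\<theta> n s) + b (\<theta> n s) (p n s - vp q (P n) s))"
    using params by (simp add: Th_def H_def right_diff_distrib mult.left_commute)
  with 1 g have "Js / 2 + \<gamma> / 2 * Th - \<Gamma>\<^sup>2 / (2 * \<gamma>) * H \<le> 0" by linarith
  then show ?thesis using params by (simp add: field_simps)
qed

lemma Th_le: "Th \<le> \<Gamma>\<^sup>2 / \<gamma>\<^sup>2 * H"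
proof -
  have "Js \<ge> 0" unfolding Js_def by (intro sum_nonneg) auto
  then have "\<gamma> * Th \<le> \<Gamma>\<^sup>2 / \<gamma> * H" using energy by linarith
  then show ?thesis using params by (simp add: field_simps power2_eq_square)
qed

lemma Js_le: "Js \<le> \<Gamma>\<^sup>2 / \<gamma> * H"
proof -
  have "\<gamma> * Th \<ge> 0" unfolding Th_def using params
    by (intro mult_nonneg_nonneg sum_nonneg UI_nonneg) auto
  then show ?thesis using energy by linarith
qed

abbreviation C2 where "C2 \<equiv> derivative_const \<gamma> \<Gamma> K q"
abbreviation C3 where "C3 \<equiv> pressure_const \<gamma> \<Gamma> \<beta> \<kappa> K q"

text \<open>The test function \<open>s \<theta>'\<close> vanishes at the left end of each cell, so the jumps do not contribute.\<close>

lemma weighted_derivative: "Sd \<le> C2 * H"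
proof -
  define x where "x n j = real j *\<^sub>R c n j" for n j
  have X: "vp q (x n) s = s *\<^sub>R vd q (c n) s" for n s by (simp add: x_def[abs_def] scaleR_vd)
  have xV: "x n j \<in> V" if "n < N" "j < q" for n j using that c_V by (simp add: x_def subspace_scale V)
  let ?T = "\<lambda>n. LINT s|UI. (norm (\<theta> n s))\<^sup>2" and ?E = "\<lambda>n. LINT s|UI. (norm (\<eta> n s))\<^sup>2"
  have cell: "- (\<Gamma> * ?E n + \<Gamma> * (1 + real q ^ 4 * K / 2) * ?T n)
      \<le> (LINT s|UI. a (\<eta> n s + \<theta> n s) (vp q (x n) s) + b (vp q (x n) s) (p n s - vp q (P n) s))" if n: "n < N" for n
  proof -
    have xn: "norm (x n j) \<le> real q * sqrt (K * ?T n)" if j: "j < q" for j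
    proof -
      have "norm (c n j) \<le> sqrt (K * ?T n)" using K_u[OF j] by (simp add: real_le_rsqrt)
      then have "real j * norm (c n j) \<le> real q * sqrt (K * ?T n)" using j by (intro mult_mono) auto
      then show ?thesis by (simp add: x_def)
    qed
    have Tn: "?T n \<ge> 0" by (rule UI_nonneg) simp
    \<comment> \<open>Inverse estimate through the coefficients: one factor q bounds the multipliers
      \<open>real j\<close>, one counts the terms, and squaring gives q^4.\<close>
    have Xn: "(norm (vp q (x n) s))\<^sup>2 \<le> real q ^ 4 * K * ?T n" if s: "s \<in> {0..1}" for s
    proof -
      have "norm (vp q (x n) s) \<le> real q * (real q * sqrt (K * ?T n))" by (rule norm_vp_le[OF s xn])
      from power_mono[OF this norm_ge_zero, of 2] show ?thesis
        using Tn params by (simp add: power_mult_distrib power2_eq_square power4_eq_xxxx mult_ac)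
    qed
    have "(LINT s|UI. - (\<Gamma> * (norm (\<eta> n s))\<^sup>2 + \<Gamma> * (norm (\<theta> n s))\<^sup>2 + \<Gamma> * (real q ^ 4 * K * ?T n / 2)))
      \<le> (LINT s|UI. a (\<eta> n s + \<theta> n s) (vp q (x n) s) + b (vp q (x n) s) (p n s - vp q (P n) s))"
    proof (rule UI_mono)
      fix s :: real assume s: "s \<in> {0..1}"
      have tV: "vp q (x n) s \<in> V" using xV n by (intro vp_mem V) auto
      have "p n s - vp q (P n) s \<in> Q" using p_Q[OF n s] P_Q n by (intro subspace_diff[OF Q] vp_mem[OF Q]) auto
      then have b0: "b (vp q (x n) s) (p n s - vp q (P n) s) = 0" using b_V tV by blast
      have "\<bar>a (\<eta> n s + \<theta> n s) (vp q (x n) s)\<bar> \<le> \<Gamma> * (norm (\<eta> n s + \<theta> n s) * norm (vp q (x n) s))"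
        using a_le by (simp add: mult.assoc)
      also have "\<dots> \<le> \<Gamma> * ((norm (\<eta> n s))\<^sup>2 + (norm (\<theta> n s))\<^sup>2 + real q ^ 4 * K * ?T n / 2)"
      proof (rule mult_left_mono)
        have "norm (\<eta> n s + \<theta> n s) * norm (vp q (x n) s)
            \<le> (norm (\<eta> n s + \<theta> n s))\<^sup>2 / 2 + (norm (vp q (x n) s))\<^sup>2 / 2"
          using young[of "1/2" "norm (\<eta> n s + \<theta> n s)" "norm (vp q (x n) s)"] by simp
        moreover have "(norm (\<eta> n s + \<theta> n s))\<^sup>2 \<le> 2 * (norm (\<eta> n s))\<^sup>2 + 2 * (norm (\<theta> n s))\<^sup>2"
          by (rule order_trans[OF power_mono[OF norm_triangle_ineq] square_add_le]) simp
        ultimately show "norm (\<eta> n s + \<theta> n s) * norm (vp q (x n) s)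
            \<le> (norm (\<eta> n s))\<^sup>2 + (norm (\<theta> n s))\<^sup>2 + real q ^ 4 * K * ?T n / 2"
          using Xn[OF s] by linarith
      qed (use params in simp)
      finally show "- (\<Gamma> * (norm (\<eta> n s))\<^sup>2 + \<Gamma> * (norm (\<theta> n s))\<^sup>2 + \<Gamma> * (real q ^ 4 * K * ?T n / 2))
        \<le> a (\<eta> n s + \<theta> n s) (vp q (x n) s) + b (vp q (x n) s) (p n s - vp q (P n) s)"
        unfolding b0 by (simp add: distrib_left)
    qed (intro continuous_intros cont_eta[OF n] cont_p[OF n])+
    moreover have "(LINT s|UI. - (\<Gamma> * (norm (\<eta> n s))\<^sup>2 + \<Gamma> * (norm (\<theta> n s))\<^sup>2 + \<Gamma> * (real q ^ 4 * K * ?T n / 2)))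
       = - (\<Gamma> * ?E n + \<Gamma> * (1 + real q ^ 4 * K / 2) * ?T n)"
      using UI_linear_combination[of "\<lambda>s. (norm (\<eta> n s))\<^sup>2" "\<lambda>s. (norm (\<theta> n s))\<^sup>2"
          "- \<Gamma>" "- \<Gamma>" "- (\<Gamma> * (real q ^ 4 * K * ?T n / 2))"]
      by (simp add: continuous_intros cont_eta[OF n] algebra_simps)
    ultimately show ?thesis by simp
  qed
  have g: "(\<Sum>n<N. (LINT s|UI. J (vd q (c n) s) \<bullet> J (vp q (x n) s)) + jmp n \<bullet> J (vp q (x n) 0))
      + k * (\<Sum>n<N. LINT s|UI. a (\<eta> n s + \<theta> n s) (vp q (x n) s) + b (vp q (x n) s) (p n s - vp q (P n) s)) = 0"
    by (rule galerkin) (use xV V in auto)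
  have "(\<Sum>n<N. (LINT s|UI. J (vd q (c n) s) \<bullet> J (vp q (x n) s)) + jmp n \<bullet> J (vp q (x n) 0)) = Sd"
    unfolding Sd_def by (simp add: X J.scaleR J.zero dot_square_norm)
  moreover have "(\<Sum>n<N. - (\<Gamma> * ?E n + \<Gamma> * (1 + real q ^ 4 * K / 2) * ?T n))
      \<le> (\<Sum>n<N. LINT s|UI. a (\<eta> n s + \<theta> n s) (vp q (x n) s) + b (vp q (x n) s) (p n s - vp q (P n) s))"
    using cell by (intro sum_mono) auto
  then have "- (\<Gamma> * (\<Sum>n<N. ?E n) + \<Gamma> * (1 + real q ^ 4 * K / 2) * (\<Sum>n<N. ?T n))
      \<le> (\<Sum>n<N. LINT s|UI. a (\<eta> n s + \<theta> n s) (vp q (x n) s) + b (vp q (x n) s) (p n s - vp q (P n) s))"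
    by (simp only: sum_negf sum.distrib sum_distrib_left)
  from mult_left_mono[OF this, of k]
  have "- (\<Gamma> * H + \<Gamma> * (1 + real q ^ 4 * K / 2) * Th)
      \<le> k * (\<Sum>n<N. LINT s|UI. a (\<eta> n s + \<theta> n s) (vp q (x n) s) + b (vp q (x n) s) (p n s - vp q (P n) s))"
    using params by (simp add: Th_def H_def algebra_simps)
  ultimately have "Sd \<le> \<Gamma> * H + \<Gamma> * (1 + real q ^ 4 * K / 2) * Th" using g by linarith
  also have "\<dots> \<le> \<Gamma> * H + \<Gamma> * (1 + real q ^ 4 * K / 2) * (\<Gamma>\<^sup>2 / \<gamma>\<^sup>2 * H)"
    using Th_le params by (intro add_left_mono mult_left_mono) auto
  also have "\<dots> = C2 * H" by (simp add: derivative_const_def algebra_simps)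
  finally show ?thesis .
qed

text \<open>Absorption with a fixed budget: the projection error of \<open>p\<close> and the form
  \<open>a\<close> each take a quarter of the squared pressure norm, derivatives and jumps an eighth
  each, and a quarter survives. The last two carry no factor \<open>k\<close>, so their Young
  inequalities use multiples of k/8 and leave 1/k on the other side.\<close>

lemma pressure: "k * (\<Sum>n<N. LINT s|UI. (norm (vp q (z n) s - vp q (P n) s))\<^sup>2) \<le> 2 * (C3 / k * H) + 4 * Pe"
proof -
  define r where "r n j = z n j - P n j" for n j
  define \<rho> where "\<rho> n s = vp q (r n) s" for n s
  define x where "x n j = L (r n j)" for n j
  define l where "l = \<kappa> / \<beta>"
  define g where "g = \<Gamma> / \<beta>"
  let ?T = "\<lambda>n. LINT s|UI. (norm (\<theta> n s))\<^sup>2" and ?E = "\<lambda>n. LINT s|UI. (norm (\<eta> n s))\<^sup>2"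
    and ?R = "\<lambda>n. LINT s|UI. (norm (\<rho> n s))\<^sup>2"
    and ?D = "\<lambda>n. LINT s|UI. s * (norm (J (vd q (c n) s)))\<^sup>2"
    and ?F = "\<lambda>n. LINT s|UI. (norm (p n s - vp q (z n) s))\<^sup>2"
  have rQ: "r n j \<in> Q" if "n < N" "j < q" for n j using that z_Q P_Q by (simp add: r_def subspace_diff Q)
  have xV2: "x n j \<in> V2" if "n < N" "j < q" for n j using L_V2[OF rQ[OF that]] by (simp add: x_def)
  have \<rho>Q: "\<rho> n s \<in> Q" if "n < N" for n s unfolding \<rho>_def using rQ that by (intro vp_mem Q)
  have X: "vp q (x n) s = L (\<rho> n s)" if "n < N" for n s
    using vp_linear_on[OF lin_L Q, of q "r n" s] rQ[OF that] by (simp add: x_def[abs_def] \<rho>_def)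
  have norm_X: "norm (vp q (x n) s) \<le> norm (\<rho> n s) / \<beta>" if "n < N" for n s
    using norm_L[OF \<rho>Q[OF that]] X[OF that] by simp
  have l0: "l \<ge> 0" and g0: "g > 0" using params by (simp_all add: l_def g_def)
  have norm_JX: "norm (J (vp q (x n) s)) \<le> l * norm (\<rho> n s)" if "n < N" for n s
  proof -
    have "norm (J (vp q (x n) s)) \<le> \<kappa> * (norm (\<rho> n s) / \<beta>)"
      using norm_J[of "vp q (x n) s"] norm_X[OF that, of s] params by (meson mult_left_mono order_trans)
    then show ?thesis by (simp add: l_def)
  qed
  note cts = continuous_intros cont_eta cont_p
  have b_part: "?R n - (?R n / 4 + ?F n) \<le> (LINT s|UI. b (vp q (x n) s) (p n s - vp q (P n) s))" if n: "n < N" for n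
  proof -
    have "(LINT s|UI. 3 / 4 * (norm (\<rho> n s))\<^sup>2 + - 1 * (norm (p n s - vp q (z n) s))\<^sup>2 + 0)
        \<le> (LINT s|UI. b (vp q (x n) s) (p n s - vp q (P n) s))"
    proof (rule UI_mono)
      fix s :: real assume s: "s \<in> {0..1}"
      let ?e = "p n s - vp q (z n) s"
      have pQ: "p n s - vp q (P n) s \<in> Q"
        using p_Q[OF n s] P_Q n by (intro subspace_diff[OF Q] vp_mem[OF Q]) auto
      have "p n s - vp q (P n) s = \<rho> n s + ?e"
        by (simp add: \<rho>_def r_def[abs_def] vp_diff)
      then have "\<rho> n s \<bullet> (p n s - vp q (P n) s) = \<rho> n s \<bullet> \<rho> n s + \<rho> n s \<bullet> ?e"
        by (simp only: inner_add_right)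
      then have "b (vp q (x n) s) (p n s - vp q (P n) s) = (norm (\<rho> n s))\<^sup>2 + \<rho> n s \<bullet> ?e"
        by (simp add: X[OF n] b_L[OF \<rho>Q[OF n] pQ] dot_square_norm)
      moreover have "\<bar>\<rho> n s \<bullet> ?e\<bar> \<le> norm (\<rho> n s) * norm ?e" by (rule Cauchy_Schwarz_ineq2)
      moreover have "norm (\<rho> n s) * norm ?e \<le> (norm (\<rho> n s))\<^sup>2 / 4 + (norm ?e)\<^sup>2"
        using young[of "1 / 4" "norm (\<rho> n s)" "norm ?e"] by simp
      ultimately show "3 / 4 * (norm (\<rho> n s))\<^sup>2 + - 1 * (norm ?e)\<^sup>2 + 0 \<le> b (vp q (x n) s) (p n s - vp q (P n) s)"
        by linarith
    qed (auto simp: \<rho>_def intro!: cts n)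
    moreover have "(LINT s|UI. 3 / 4 * (norm (\<rho> n s))\<^sup>2 + - 1 * (norm (p n s - vp q (z n) s))\<^sup>2 + 0) = 3 / 4 * ?R n + - 1 * ?F n + 0"
      unfolding \<rho>_def by (intro UI_linear_combination cts n)
    ultimately show ?thesis by linarith
  qed
  have a_part: "- (?R n / 4 + 2 * g\<^sup>2 * (?E n + ?T n)) \<le> (LINT s|UI. a (\<eta> n s + \<theta> n s) (vp q (x n) s))"
    if n: "n < N" for n
  proof -
    have "(LINT s|UI. - ((norm (\<rho> n s))\<^sup>2 / 4 + 2 * g\<^sup>2 * ((norm (\<eta> n s))\<^sup>2 + (norm (\<theta> n s))\<^sup>2)))
        \<le> (LINT s|UI. a (\<eta> n s + \<theta> n s) (vp q (x n) s))"
    proof (rule UI_mono)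
      fix s :: real assume s: "s \<in> {0..1}"
      let ?w = "norm (\<eta> n s + \<theta> n s)"
      have "\<bar>a (\<eta> n s + \<theta> n s) (vp q (x n) s)\<bar> \<le> \<Gamma> * ?w * norm (vp q (x n) s)" by (rule a_le)
      also have "\<dots> \<le> \<Gamma> * ?w * (norm (\<rho> n s) / \<beta>)" using norm_X[OF n] params by (intro mult_left_mono) auto
      also have "\<dots> = norm (\<rho> n s) * (g * ?w)" by (simp add: g_def)
      also have "\<dots> \<le> 1 / 4 * (norm (\<rho> n s))\<^sup>2 + (g * ?w)\<^sup>2 / (4 * (1 / 4))" by (rule young) simp
      also have "\<dots> = (norm (\<rho> n s))\<^sup>2 / 4 + g\<^sup>2 * ?w\<^sup>2" by (simp add: power_mult_distrib)
      also have "\<dots> \<le> (norm (\<rho> n s))\<^sup>2 / 4 + g\<^sup>2 * (2 * (norm (\<eta> n s))\<^sup>2 + 2 * (norm (\<theta> n s))\<^sup>2)"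
        by (intro add_left_mono mult_left_mono order_trans[OF power_mono[OF norm_triangle_ineq] square_add_le]) auto
      finally show "- ((norm (\<rho> n s))\<^sup>2 / 4 + 2 * g\<^sup>2 * ((norm (\<eta> n s))\<^sup>2 + (norm (\<theta> n s))\<^sup>2))
        \<le> a (\<eta> n s + \<theta> n s) (vp q (x n) s)" by (simp add: algebra_simps)
    qed (auto simp: \<rho>_def intro!: cts n)
    moreover have "(LINT s|UI. - ((norm (\<rho> n s))\<^sup>2 / 4 + 2 * g\<^sup>2 * ((norm (\<eta> n s))\<^sup>2 + (norm (\<theta> n s))\<^sup>2)))
        = - (?R n / 4 + 2 * g\<^sup>2 * (?E n + ?T n))"
    proof -
      have c: "continuous_on {0..1} (\<lambda>s. (norm (\<rho> n s))\<^sup>2)" "continuous_on {0..1} (\<lambda>s. (norm (\<eta> n s))\<^sup>2)"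
        "continuous_on {0..1} (\<lambda>s. (norm (\<theta> n s))\<^sup>2)"
        unfolding \<rho>_def by (intro cts n)+
      have "(LINT s|UI. - ((norm (\<rho> n s))\<^sup>2 / 4 + 2 * g\<^sup>2 * ((norm (\<eta> n s))\<^sup>2 + (norm (\<theta> n s))\<^sup>2)))
          = (LINT s|UI. - 1 / 4 * (norm (\<rho> n s))\<^sup>2 + - (2 * g\<^sup>2) * ((norm (\<eta> n s))\<^sup>2 + (norm (\<theta> n s))\<^sup>2) + 0)"
        by (intro Bochner_Integration.integral_cong) auto
      also have "\<dots> = - 1 / 4 * ?R n + - (2 * g\<^sup>2) * (LINT s|UI. (norm (\<eta> n s))\<^sup>2 + (norm (\<theta> n s))\<^sup>2) + 0"
        by (intro UI_linear_combination continuous_on_add c)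
      finally show ?thesis by (simp add: UI_add[OF c(2,3)])
    qed
    ultimately show ?thesis by simp
  qed
  have d_part: "- (k / 8 * ?R n + 2 * l\<^sup>2 / k * ((real q)\<^sup>2 * K * ?D n))
      \<le> (LINT s|UI. J (vd q (c n) s) \<bullet> J (vp q (x n) s))" if n: "n < N" for n
  proof -
    \<comment> \<open>The derivative padded by a zero top coefficient, so that the bound
      \<open>K_h\<close> for \<open>q\<close> coefficients and the weight \<open>s\<close> applies
      to it.\<close>
    define d where "d j = (if j < q - 1 then J (real (Suc j) *\<^sub>R c n (Suc j)) else 0)" for j
    have d: "J (vd q (c n) s) = vp q d s" for s
      unfolding d_def[abs_def] by (subst vp_pad) (simp_all add: vd_def vp_linear[OF J.linear_axioms])
    have D0: "?D n \<ge> 0" by (rule UI_nonneg) auto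
    have Jd: "(norm (J (vd q (c n) s)))\<^sup>2 \<le> (real q)\<^sup>2 * K * ?D n" if s: "s \<in> {0..1}" for s
    proof -
      have "norm (d j) \<le> sqrt (K * ?D n)" if "j < q" for j
        using K_h[OF that, of d] by (simp add: real_le_rsqrt d)
      from norm_vp_le[OF s this] have "norm (vp q d s) \<le> real q * sqrt (K * ?D n)" .
      from power_mono[OF this norm_ge_zero, of 2] show ?thesis
        using D0 params by (simp add: d power_mult_distrib)
    qed
    have "(LINT s|UI. - (k / 8 * (norm (\<rho> n s))\<^sup>2 + 2 * l\<^sup>2 / k * ((real q)\<^sup>2 * K * ?D n)))
      \<le> (LINT s|UI. J (vd q (c n) s) \<bullet> J (vp q (x n) s))"
    proof (rule UI_mono)
      fix s :: real assume s: "s \<in> {0..1}"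
      let ?w = "norm (J (vd q (c n) s))"
      have "\<bar>J (vd q (c n) s) \<bullet> J (vp q (x n) s)\<bar> \<le> ?w * norm (J (vp q (x n) s))" by (rule Cauchy_Schwarz_ineq2)
      also have "\<dots> \<le> ?w * (l * norm (\<rho> n s))" using norm_JX[OF n] by (intro mult_left_mono) auto
      also have "\<dots> = norm (\<rho> n s) * (l * ?w)" by simp
      also have "\<dots> \<le> k / 8 * (norm (\<rho> n s))\<^sup>2 + (l * ?w)\<^sup>2 / (4 * (k / 8))"
        using params by (intro young) auto
      also have "\<dots> = k / 8 * (norm (\<rho> n s))\<^sup>2 + 2 * l\<^sup>2 / k * ?w\<^sup>2" by (simp add: power_mult_distrib)
      also have "\<dots> \<le> k / 8 * (norm (\<rho> n s))\<^sup>2 + 2 * l\<^sup>2 / k * ((real q)\<^sup>2 * K * ?D n)"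
        using Jd[OF s] params by (intro add_left_mono mult_left_mono) auto
      finally show "- (k / 8 * (norm (\<rho> n s))\<^sup>2 + 2 * l\<^sup>2 / k * ((real q)\<^sup>2 * K * ?D n))
          \<le> J (vd q (c n) s) \<bullet> J (vp q (x n) s)" by linarith
    qed (auto simp: \<rho>_def intro!: cts n)
    moreover have "(LINT s|UI. - (k / 8 * (norm (\<rho> n s))\<^sup>2 + 2 * l\<^sup>2 / k * ((real q)\<^sup>2 * K * ?D n)))
        = - (k / 8 * ?R n + 2 * l\<^sup>2 / k * ((real q)\<^sup>2 * K * ?D n))"
      using UI_linear_combination[of "\<lambda>s. (norm (\<rho> n s))\<^sup>2" "\<lambda>s. (norm (\<rho> n s))\<^sup>2"
          "- (k / 8)" 0 "- (2 * l\<^sup>2 / k * ((real q)\<^sup>2 * K * ?D n))"]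
      by (simp add: \<rho>_def continuous_intros)
    ultimately show ?thesis by simp
  qed
  have j_part: "- (k / 8 * ?R n + 2 * l\<^sup>2 / k * (K * (norm (jmp n))\<^sup>2)) \<le> jmp n \<bullet> J (vp q (x n) 0)" if n: "n < N" for n
  proof -
    let ?w = "norm (jmp n)"
    \<comment> \<open>The value at the left end of the cell is the coefficient of index 0.\<close>
    have r0: "(norm (\<rho> n 0))\<^sup>2 \<le> K * ?R n"
      using K_q[of 0 "r n"] params by (simp add: \<rho>_def vp_at_0)
    have "\<bar>jmp n \<bullet> J (vp q (x n) 0)\<bar> \<le> ?w * norm (J (vp q (x n) 0))" by (rule Cauchy_Schwarz_ineq2)
    also have "\<dots> \<le> ?w * (l * norm (\<rho> n 0))" using norm_JX[OF n] by (intro mult_left_mono) auto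
    also have "\<dots> = norm (\<rho> n 0) * (l * ?w)" by simp
    also have "\<dots> \<le> k / (8 * K) * (norm (\<rho> n 0))\<^sup>2 + (l * ?w)\<^sup>2 / (4 * (k / (8 * K)))"
      using params by (intro young) auto
    also have "\<dots> \<le> k / (8 * K) * (K * ?R n) + (l * ?w)\<^sup>2 / (4 * (k / (8 * K)))"
      using r0 params by (intro add_right_mono mult_left_mono) auto
    also have "\<dots> = k / 8 * ?R n + 2 * l\<^sup>2 / k * (K * ?w\<^sup>2)"
      using params by (simp add: power_mult_distrib field_simps)
    finally show ?thesis by linarith
  qed
  have gal: "(\<Sum>n<N. (LINT s|UI. J (vd q (c n) s) \<bullet> J (vp q (x n) s)) + jmp n \<bullet> J (vp q (x n) 0))
      + k * (\<Sum>n<N. LINT s|UI. a (\<eta> n s + \<theta> n s) (vp q (x n) s) + b (vp q (x n) s) (p n s - vp q (P n) s)) = 0"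
    by (rule galerkin) (rule xV2)
  define R where "R = k * (\<Sum>n<N. ?R n)"
  have jump_sum: "(\<Sum>n<N. - (k / 4 * ?R n + 2 * l\<^sup>2 / k * (K * ((real q)\<^sup>2 * ?D n + (norm (jmp n))\<^sup>2))))
      \<le> (\<Sum>n<N. (LINT s|UI. J (vd q (c n) s) \<bullet> J (vp q (x n) s)) + jmp n \<bullet> J (vp q (x n) 0))"
  proof (rule sum_mono)
    fix n assume "n \<in> {..<N}"
    then show "- (k / 4 * ?R n + 2 * l\<^sup>2 / k * (K * ((real q)\<^sup>2 * ?D n + (norm (jmp n))\<^sup>2)))
      \<le> (LINT s|UI. J (vd q (c n) s) \<bullet> J (vp q (x n) s)) + jmp n \<bullet> J (vp q (x n) 0)"
      using d_part[of n] j_part[of n] by (simp add: distrib_left mult_ac)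
  qed
  have jump_eq: "(\<Sum>n<N. - (k / 4 * ?R n + 2 * l\<^sup>2 / k * (K * ((real q)\<^sup>2 * ?D n + (norm (jmp n))\<^sup>2))))
      = - (R / 4 + 2 * l\<^sup>2 / k * (K * ((real q)\<^sup>2 * Sd + Js)))"
  proof -
    have "(\<Sum>n<N. - (x * f n + w * (K * (y * g n + h n))))
        = - (x * (\<Sum>n<N. f n) + w * (K * (y * (\<Sum>n<N. g n) + (\<Sum>n<N. h n))))"
      for x w y :: real and f g h :: "nat \<Rightarrow> real"
      by (simp only: sum_negf sum.distrib sum_distrib_left[symmetric])
    note this[of "k / 4"]
    then show ?thesis by (simp only: R_def Sd_def Js_def)
  qed
  have "(\<Sum>n<N. ?R n - (?R n / 2 + ?F n + 2 * g\<^sup>2 * (?E n + ?T n)))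
      \<le> (\<Sum>n<N. LINT s|UI. a (\<eta> n s + \<theta> n s) (vp q (x n) s) + b (vp q (x n) s) (p n s - vp q (P n) s))"
  proof (rule sum_mono)
    fix n assume "n \<in> {..<N}"
    then have n: "n < N" by simp
    have "(LINT s|UI. a (\<eta> n s + \<theta> n s) (vp q (x n) s) + b (vp q (x n) s) (p n s - vp q (P n) s))
      = (LINT s|UI. a (\<eta> n s + \<theta> n s) (vp q (x n) s)) + (LINT s|UI. b (vp q (x n) s) (p n s - vp q (P n) s))"
      by (intro UI_add cts n)
    then show "?R n - (?R n / 2 + ?F n + 2 * g\<^sup>2 * (?E n + ?T n))
      \<le> (LINT s|UI. a (\<eta> n s + \<theta> n s) (vp q (x n) s) + b (vp q (x n) s) (p n s - vp q (P n) s))"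
      using a_part[OF n] b_part[OF n] by linarith
  qed
  moreover have "(\<Sum>n<N. f n - (f n / 2 + h n + x * (e n + t n)))
      = (\<Sum>n<N. f n) - ((\<Sum>n<N. f n) / 2 + (\<Sum>n<N. h n) + x * ((\<Sum>n<N. e n) + (\<Sum>n<N. t n)))"
    for x :: real and f h e t :: "nat \<Rightarrow> real"
    by (simp only: sum_subtractf sum.distrib sum_distrib_left[symmetric] sum_divide_distrib)
  ultimately have "(\<Sum>n<N. ?R n) - ((\<Sum>n<N. ?R n) / 2 + (\<Sum>n<N. ?F n) + 2 * g\<^sup>2 * ((\<Sum>n<N. ?E n) + (\<Sum>n<N. ?T n)))
      \<le> (\<Sum>n<N. LINT s|UI. a (\<eta> n s + \<theta> n s) (vp q (x n) s) + b (vp q (x n) s) (p n s - vp q (P n) s))"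
    by simp
  from mult_left_mono[OF this, of k]
  have AB: "R - (R / 2 + Pe + 2 * g\<^sup>2 * (H + Th))
      \<le> k * (\<Sum>n<N. LINT s|UI. a (\<eta> n s + \<theta> n s) (vp q (x n) s) + b (vp q (x n) s) (p n s - vp q (P n) s))"
    using params by (simp add: R_def Pe_def H_def Th_def right_diff_distrib distrib_left mult.left_commute)
  have "r / 4 - e \<le> x + y" if "s \<le> t" "s = - (r / 4 + x)" "r - (r / 2 + e + y) \<le> w" "t + w = 0" for r s t x y w e :: real
    using that by linarith
  from this[OF jump_sum jump_eq AB gal]
  have "R / 4 - Pe \<le> 2 * l\<^sup>2 / k * (K * ((real q)\<^sup>2 * Sd + Js)) + 2 * g\<^sup>2 * (H + Th)" .
  also have "\<dots> \<le> 2 * l\<^sup>2 / k * (K * ((real q)\<^sup>2 * (C2 * H) + \<Gamma>\<^sup>2 / \<gamma> * H)) + 2 * g\<^sup>2 * (H + \<Gamma>\<^sup>2 / \<gamma>\<^sup>2 * H)"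
    using weighted_derivative Js_le Th_le params by (intro add_mono mult_left_mono) auto
  also have "\<dots> \<le> 2 * l\<^sup>2 / k * (K * ((real q)\<^sup>2 * (C2 * H) + \<Gamma>\<^sup>2 / \<gamma> * H)) + 2 * g\<^sup>2 / k * (H + \<Gamma>\<^sup>2 / \<gamma>\<^sup>2 * H)"
  proof -
    \<comment> \<open>\<open>k \<le> 1\<close> merges the contribution of \<open>a\<close>, of order
      one, with those of order 1/k.\<close>
    have "2 * g\<^sup>2 \<le> 2 * g\<^sup>2 / k" using params g0 by (simp add: field_simps)
    then show ?thesis using H_nonneg params by (intro add_left_mono mult_right_mono) auto
  qed
  also have "\<dots> = C3 / k * H / 2" using params by (simp add: pressure_const_def l_def[symmetric] g_def[symmetric] field_simps)
  finally show ?thesis by (simp add: R_def \<rho>_def r_def[abs_def] vp_diff)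
qed

end

section \<open>Smooth test functions\<close>

text \<open>Recursion through the first derivative suits inductive closure proofs;
  \<open>smooth_upto_iff\<close> links it to the iterated \<open>deriv\<close> in
  \<open>test_functions\<close>.\<close>

fun smooth_upto :: "nat \<Rightarrow> (real \<Rightarrow> real) \<Rightarrow> bool" where
  "smooth_upto 0 f = True"
| "smooth_upto (Suc n) f = ((\<forall>x. f differentiable (at x)) \<and> smooth_upto n (deriv f))"

definition smooth :: "(real \<Rightarrow> real) \<Rightarrow> bool" where "smooth f \<longleftrightarrow> (\<forall>n. smooth_upto n f)"

lemma smooth_upto_iff: "smooth_upto n f \<longleftrightarrow> (\<forall>j<n. \<forall>x. (deriv ^^ j) f differentiable (at x))"
proof (induction n arbitrary: f)
  case (Suc n)
  show ?case
    by (simp only: smooth_upto.simps Suc All_less_Suc2) (simp add: funpow_swap1)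
qed simp

lemma smooth_iff: "smooth f \<longleftrightarrow> (\<forall>j x. (deriv ^^ j) f differentiable (at x))"
  unfolding smooth_def smooth_upto_iff by blast

lemma smooth_deriv: "smooth f \<Longrightarrow> smooth (deriv f)"
  unfolding smooth_def by (metis smooth_upto.simps(2))

lemma smooth_differentiable: "smooth f \<Longrightarrow> f differentiable (at x)"
  unfolding smooth_def by (metis smooth_upto.simps(2))

lemma smooth_DERIV: "smooth f \<Longrightarrow> (f has_real_derivative deriv f x) (at x)"
  using smooth_differentiable DERIV_deriv_iff_real_differentiable by blast

lemma smooth_continuous_on: "smooth f \<Longrightarrow> continuous_on S f"
  by (meson DERIV_isCont continuous_at_imp_continuous_on smooth_DERIV)

lemma smooth_if_deriv:
  assumes "\<And>x. (f has_real_derivative g x) (at x)" "smooth g"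
  shows "smooth f"
proof -
  have "deriv f = g" using assms(1) DERIV_imp_deriv by blast
  moreover have "f differentiable (at x)" for x
    using assms(1) real_differentiable_def by blast
  ultimately have "smooth_upto n f" for n using assms(2) by (cases n) (auto simp: smooth_def)
  then show ?thesis by (simp add: smooth_def)
qed

lemma smooth_upto_mono: "smooth_upto (Suc n) f \<Longrightarrow> smooth_upto n f"
  by (induction n arbitrary: f) auto

lemma smooth_upto_add: "smooth_upto n f \<Longrightarrow> smooth_upto n g \<Longrightarrow> smooth_upto n (\<lambda>x. f x + g x)"
proof (induction n arbitrary: f g)
  case (Suc n)
  have d: "(f has_real_derivative deriv f x) (at x)" "(g has_real_derivative deriv g x) (at x)" for x
    using Suc.prems DERIV_deriv_iff_real_differentiable by auto
  have "deriv (\<lambda>x. f x + g x) = (\<lambda>x. deriv f x + deriv g x)"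
    using DERIV_add[OF d] DERIV_imp_deriv by blast
  then show ?case using Suc by (auto intro: differentiable_add)
qed simp

lemma smooth_upto_mult: "smooth_upto n f \<Longrightarrow> smooth_upto n g \<Longrightarrow> smooth_upto n (\<lambda>x. f x * g x)"
proof (induction n arbitrary: f g)
  case (Suc n)
  have d: "(f has_real_derivative deriv f x) (at x)" "(g has_real_derivative deriv g x) (at x)" for x
    using Suc.prems DERIV_deriv_iff_real_differentiable by auto
  have "deriv (\<lambda>x. f x * g x) = (\<lambda>x. deriv f x * g x + deriv g x * f x)"
    using DERIV_mult[OF d] DERIV_imp_deriv by blast
  moreover have "smooth_upto n f" "smooth_upto n g" using Suc.prems smooth_upto_mono by blast+
  ultimately show ?case using Suc.prems
    by (auto intro!: differentiable_mult smooth_upto_add Suc.IH)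
qed simp

lemma smooth_add: "smooth f \<Longrightarrow> smooth g \<Longrightarrow> smooth (\<lambda>x. f x + g x)"
  by (simp add: smooth_def smooth_upto_add)

lemma smooth_mult: "smooth f \<Longrightarrow> smooth g \<Longrightarrow> smooth (\<lambda>x. f x * g x)"
  by (simp add: smooth_def smooth_upto_mult)

lemma smooth_const: "smooth (\<lambda>x. c)"
proof -
  have "smooth_upto n (\<lambda>x. c)" for n by (induction n arbitrary: c) auto
  then show ?thesis by (simp add: smooth_def)
qed

lemma smooth_affine:
  assumes "smooth f"
  shows "smooth (\<lambda>x. f (a * x + b))"
proof -
  have "smooth_upto n (\<lambda>x. f (a * x + b))" if "smooth f" for n f
    using that
  proof (induction n arbitrary: f)
    case (Suc n)
    have lin: "((\<lambda>x. a * x + b) has_real_derivative a) (at x)" for x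
      by (auto intro!: derivative_eq_intros)
    have d: "((\<lambda>x. f (a * x + b)) has_real_derivative a * deriv f (a * x + b)) (at x)" for x
      using DERIV_chain'[OF lin smooth_DERIV[OF Suc.prems], of x] by (simp only: mult.commute[of _ a])
    then have "deriv (\<lambda>x. f (a * x + b)) = (\<lambda>x. a * deriv f (a * x + b))"
      using DERIV_imp_deriv by blast
    moreover have "smooth_upto n (\<lambda>x. a * deriv f (a * x + b))"
      using smooth_upto_mult Suc.IH[OF smooth_deriv[OF Suc.prems]] smooth_const smooth_def by blast
    ultimately show ?case using d real_differentiable_def by auto
  qed simp
  then show ?thesis using assms by (simp add: smooth_def)
qed

text \<open>For a polynomial \<open>p\<close>, the function \<open>p(1/x) exp(-1/x)\<close> on the positive half line, extended by zero;
  this family is closed under differentiation.\<close>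

definition flat :: "real poly \<Rightarrow> real \<Rightarrow> real" where
  "flat p x = (if x > 0 then poly p (1 / x) * exp (- (1 / x)) else 0)"

lemma poly_exp_tendsto_0: "((\<lambda>y. poly p y * exp (- y)) \<longlongrightarrow> 0) at_top" for p :: "real poly"
proof -
  have "((\<lambda>y. \<Sum>i\<le>degree p. coeff p i * (y ^ i / exp y)) \<longlongrightarrow> (\<Sum>i\<le>degree p. coeff p i * 0)) at_top"
    by (intro tendsto_intros tendsto_power_div_exp_0)
  then show ?thesis
    by (simp add: poly_altdef exp_minus sum_distrib_right divide_inverse mult.assoc)
qed

text \<open>With y = 1/x one has dy/dx = -y^2, so p(y) exp(-y) differentiates to y^2 (p - p')(y)
  exp(-y). Only the origin needs a limit.\<close>

lemma flat_deriv: "(flat p has_real_derivative flat ([:0, 0, 1:] * (p - pderiv p)) x) (at x)"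
proof -
  consider "x < 0" | "x = 0" | "x > 0" by linarith
  then show ?thesis
  proof cases
    case 1
    have "((\<lambda>x. 0) has_real_derivative 0) (at x)" by simp
    moreover have "eventually (\<lambda>y. y < 0) (nhds x)" using 1 by (auto intro: eventually_nhds_in_open[of "{..<0}", simplified])
    then have "eventually (\<lambda>y. 0 = flat p y) (nhds x)" by (rule eventually_mono) (simp add: flat_def)
    ultimately have "(flat p has_real_derivative 0) (at x)"
      using DERIV_cong_ev[of x x "\<lambda>x. 0" "flat p" 0 0] by simp
    then show ?thesis using 1 by (simp add: flat_def)
  next
    case 2
    \<comment> \<open>The difference quotient at 0 from the right is again a member of the family,
      for the polynomial y p(y).\<close>
    have lim0: "((\<lambda>h. flat ([:0, 1:] * p) h) \<longlongrightarrow> 0) (at_right 0)"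
    proof (rule Lim_transform_eventually)
      show "((\<lambda>h. poly ([:0, 1:] * p) (inverse h) * exp (- inverse h)) \<longlongrightarrow> 0) (at_right 0)"
        by (rule filterlim_compose[OF poly_exp_tendsto_0 filterlim_inverse_at_top_right])
      show "eventually (\<lambda>h. poly ([:0, 1:] * p) (inverse h) * exp (- inverse h) = flat ([:0, 1:] * p) h) (at_right 0)"
        by (auto simp: eventually_at_filter flat_def divide_inverse)
    qed
    have "((\<lambda>h. (flat p (0 + h) - flat p 0) / h) \<longlongrightarrow> 0) (at 0)"
    proof (rule filterlim_split_at)
      show "((\<lambda>h. (flat p (0 + h) - flat p 0) / h) \<longlongrightarrow> 0) (at_left 0)"
        by (rule Lim_transform_eventually[OF tendsto_const]) (auto simp: eventually_at_filter flat_def)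
      show "((\<lambda>h. (flat p (0 + h) - flat p 0) / h) \<longlongrightarrow> 0) (at_right 0)"
        by (rule Lim_transform_eventually[OF lim0]) (auto simp: eventually_at_filter flat_def field_simps)
    qed
    then show ?thesis using 2 by (simp add: DERIV_def flat_def)
  next
    case 3
    have "((\<lambda>x. poly p (1 / x) * exp (- (1 / x))) has_real_derivative
        poly ([:0, 0, 1:] * (p - pderiv p)) (1 / x) * exp (- (1 / x))) (at x)"
      using 3 by (auto intro!: derivative_eq_intros DERIV_chain'[OF _ poly_DERIV] simp: field_simps power2_eq_square)
    moreover have "eventually (\<lambda>y. y > 0) (nhds x)" using 3 by (auto intro: eventually_nhds_in_open[of "{0<..}", simplified])
    then have "eventually (\<lambda>y. poly p (1 / y) * exp (- (1 / y)) = flat p y) (nhds x)" by (rule eventually_mono) (simp add: flat_def)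
    ultimately have "(flat p has_real_derivative
        poly ([:0, 0, 1:] * (p - pderiv p)) (1 / x) * exp (- (1 / x))) (at x)"
      using DERIV_cong_ev[of x x "\<lambda>y. poly p (1 / y) * exp (- (1 / y))" "flat p"] by simp
    then show ?thesis using 3 by (simp add: flat_def)
  qed
qed

lemma smooth_flat: "smooth (flat p)"
proof -
  have "smooth_upto n (flat p)" for n
  proof (induction n arbitrary: p)
    case (Suc n)
    have "deriv (flat p) = flat ([:0, 0, 1:] * (p - pderiv p))"
      using flat_deriv DERIV_imp_deriv by blast
    then show ?case using Suc flat_deriv real_differentiable_def by auto
  qed simp
  then show ?thesis by (simp add: smooth_def)
qed

text \<open>For positive \<open>\<alpha>\<close>, which acts as a steepness, it is positive exactly
  between \<open>c\<close> and \<open>d\<close>. As exp(-1/z) tends to 1 at infinity, growing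
  steepness drives it to the indicator of that interval.\<close>

definition bump :: "real \<Rightarrow> real \<Rightarrow> real \<Rightarrow> real \<Rightarrow> real" where
  "bump \<alpha> c d x = flat 1 (\<alpha> * (x - c)) * flat 1 (\<alpha> * (d - x))"

lemma smooth_bump: "smooth (bump \<alpha> c d)"
proof -
  have "smooth (\<lambda>x. flat 1 (\<alpha> * x + - (\<alpha> * c)) * flat 1 (- \<alpha> * x + \<alpha> * d))"
    by (intro smooth_mult smooth_affine smooth_flat)
  then show ?thesis by (simp add: bump_def[abs_def] algebra_simps)
qed

lemma bump_bounds: "0 \<le> bump \<alpha> c d x" "bump \<alpha> c d x \<le> 1"
  by (auto simp: bump_def flat_def intro!: mult_le_one)

lemma bump_outside: "\<alpha> > 0 \<Longrightarrow> x \<notin> {c<..<d} \<Longrightarrow> bump \<alpha> c d x = 0"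
  by (auto simp: bump_def flat_def zero_less_mult_iff)

lemma bump_inside: "\<alpha> > 0 \<Longrightarrow> x \<in> {c<..<d} \<Longrightarrow> bump \<alpha> c d x > 0"
  by (auto simp: bump_def flat_def)

lemma test_functions_iff:
  "\<phi> \<in> test_functions {0<..<T} \<longleftrightarrow> smooth \<phi> \<and> (\<exists>l h. 0 < l \<and> h < T \<and> (\<forall>x. x \<notin> {l..h} \<longrightarrow> \<phi> x = 0))"
proof
  assume a: "\<phi> \<in> test_functions {0<..<T}"
  then obtain K where K: "compact K" "K \<subseteq> {0<..<T}" "\<And>x. x \<notin> K \<Longrightarrow> \<phi> x = 0"
    by (auto simp: test_functions_def)
  have "\<exists>l h. 0 < l \<and> h < T \<and> K \<subseteq> {l..h}"
  proof (cases "K = {}")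
    case True
    then show ?thesis by (intro exI[of _ 1] exI[of _ "T - 1"]) auto
  next
    case False
    obtain l where "l \<in> K" "\<And>x. x \<in> K \<Longrightarrow> l \<le> x" using compact_attains_inf[OF K(1) False] by blast
    moreover obtain h where "h \<in> K" "\<And>x. x \<in> K \<Longrightarrow> x \<le> h" using compact_attains_sup[OF K(1) False] by blast
    ultimately show ?thesis using K(2) by (intro exI[of _ l] exI[of _ h]) auto
  qed
  then obtain l h where "0 < l" "h < T" "K \<subseteq> {l..h}" by blast
  then show "smooth \<phi> \<and> (\<exists>l h. 0 < l \<and> h < T \<and> (\<forall>x. x \<notin> {l..h} \<longrightarrow> \<phi> x = 0))"
    using a K(3) unfolding smooth_iff test_functions_def by blast
next
  assume a: "smooth \<phi> \<and> (\<exists>l h. 0 < l \<and> h < T \<and> (\<forall>x. x \<notin> {l..h} \<longrightarrow> \<phi> x = 0))"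
  then obtain l h where "0 < l" "h < T" "\<forall>x. x \<notin> {l..h} \<longrightarrow> \<phi> x = 0" by blast
  then show "\<phi> \<in> test_functions {0<..<T}" using a
    unfolding test_functions_def by (auto simp: smooth_iff intro!: exI[of _ "{l..h}"])
qed

lemma test_functions_deriv: "\<phi> \<in> test_functions I \<Longrightarrow> deriv \<phi> \<in> test_functions I"
proof -
  assume a: "\<phi> \<in> test_functions I"
  then obtain K where K: "compact K" "K \<subseteq> I" "\<And>x. x \<notin> K \<Longrightarrow> \<phi> x = 0"
    by (auto simp: test_functions_def)
  have "deriv \<phi> x = 0" if "x \<notin> K" for x
  proof -
    have "eventually (\<lambda>y. y \<in> - K) (nhds x)"
      using that K(1) by (intro eventually_nhds_in_open) (auto simp: compact_imp_closed)
    then have "eventually (\<lambda>y. 0 = \<phi> y) (nhds x)" by (rule eventually_mono) (simp add: K(3))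
    then have "(\<phi> has_real_derivative 0) (at x)"
      using DERIV_cong_ev[of x x "\<lambda>x. 0" \<phi> 0 0] by simp
    then show ?thesis by (rule DERIV_imp_deriv)
  qed
  moreover have "smooth (deriv \<phi>)" using a by (intro smooth_deriv) (simp add: smooth_iff test_functions_def)
  ultimately show ?thesis using K by (auto simp: test_functions_def smooth_iff)
qed

lemma test_functions_bounded:
  assumes "\<phi> \<in> test_functions {0<..<T}"
  obtains B where "B \<ge> 0" "\<And>x. \<bar>\<phi> x\<bar> \<le> B"
proof -
  from assms obtain l h where sm: "smooth \<phi>" and lh: "\<And>x. x \<notin> {l..h} \<Longrightarrow> \<phi> x = 0"
    unfolding test_functions_iff by blast
  have "compact (\<phi> ` {l..h})" by (intro compact_continuous_image smooth_continuous_on sm) auto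
  then have "bounded (\<phi> ` {l..h})" by (rule compact_imp_bounded)
  then obtain B where B: "B > 0" "\<And>x. x \<in> {l..h} \<Longrightarrow> \<bar>\<phi> x\<bar> \<le> B"
    unfolding bounded_pos by auto
  then have "\<bar>\<phi> x\<bar> \<le> B" for x using lh[of x] by (cases "x \<in> {l..h}") auto
  with B show thesis using that[of B] by simp
qed

lemma test_functions_measurable: "\<phi> \<in> test_functions {0<..<T} \<Longrightarrow> \<phi> \<in> borel_measurable (lebesgue_on S)"
  by (intro measurable_restrict_space1 measurable_completion)
    (simp add: test_functions_iff smooth_continuous_on borel_measurable_continuous_onI)

lemma bump_test: "\<alpha> > 0 \<Longrightarrow> 0 < c \<Longrightarrow> d < T \<Longrightarrow> bump \<alpha> c d \<in> test_functions {0<..<T}"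
  unfolding test_functions_iff
  by (intro conjI smooth_bump exI[of _ c] exI[of _ d]) (auto intro!: bump_outside)

section \<open>The fundamental lemma of the calculus of variations\<close>

text \<open>The positive and negative parts of \<open>h\<close> are densities of measures that agree
  and are finite on half-lines, hence everywhere; uniqueness of densities makes the two parts
  equal.\<close>

lemma AE_zero_if_tails_zero:
  fixes h :: "real \<Rightarrow> real"
  assumes h: "integrable lborel h" and tails: "\<And>x. (LINT t|lborel. indicator {x<..} t * h t) = 0"
  shows "AE t in lborel. h t = 0"
proof -
  let ?P = "density lborel (\<lambda>t. ennreal (h t))" and ?N = "density lborel (\<lambda>t. ennreal (- h t))"
  have [measurable]: "h \<in> borel_measurable lborel" using h by (rule borel_measurable_integrable)
  have ih: "integrable lborel (\<lambda>t. indicator A t * h t)" if "A \<in> sets borel" for A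
    using integrable_mult_indicator[of A lborel h] that h by simp
  have e: "emeasure ?P {x<..} = ennreal (LINT t|lborel. max 0 (indicator {x<..} t * h t))"
    "emeasure ?N {x<..} = ennreal (LINT t|lborel. max 0 (- (indicator {x<..} t * h t)))" for x
  proof -
    have "emeasure ?P {x<..} = (\<integral>\<^sup>+ t. ennreal (max 0 (indicator {x<..} t * h t)) \<partial>lborel)"
      by (subst emeasure_density) (auto intro!: nn_integral_cong simp: indicator_def max_def ennreal_neg split: if_splits)
    also have "\<dots> = ennreal (LINT t|lborel. max 0 (indicator {x<..} t * h t))"
      by (intro nn_integral_eq_integral integrable_max ih) auto
    finally show "emeasure ?P {x<..} = ennreal (LINT t|lborel. max 0 (indicator {x<..} t * h t))" .
    have "emeasure ?N {x<..} = (\<integral>\<^sup>+ t. ennreal (max 0 (- (indicator {x<..} t * h t))) \<partial>lborel)"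
      by (subst emeasure_density) (auto intro!: nn_integral_cong simp: indicator_def max_def ennreal_neg split: if_splits)
    also have "\<dots> = ennreal (LINT t|lborel. max 0 (- (indicator {x<..} t * h t)))"
      by (intro nn_integral_eq_integral integrable_max Bochner_Integration.integrable_minus ih) auto
    finally show "emeasure ?N {x<..} = ennreal (LINT t|lborel. max 0 (- (indicator {x<..} t * h t)))" .
  qed
  have eq: "(LINT t|lborel. max 0 (indicator {x<..} t * h t)) = (LINT t|lborel. max 0 (- (indicator {x<..} t * h t)))" for x
  proof -
    have "(LINT t|lborel. max 0 (indicator {x<..} t * h t)) - (LINT t|lborel. max 0 (- (indicator {x<..} t * h t)))
        = (LINT t|lborel. max 0 (indicator {x<..} t * h t) - max 0 (- (indicator {x<..} t * h t)))"
      by (intro Bochner_Integration.integral_diff[symmetric] integrable_max Bochner_Integration.integrable_minus ih) auto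
    also have "\<dots> = (LINT t|lborel. indicator {x<..} t * h t)"
      by (intro Bochner_Integration.integral_cong) (auto simp: max_def)
    finally show ?thesis by (simp add: tails)
  qed
  have "?P = ?N"
    by (rule measure_eqI_lessThan) (auto simp: e eq)
  then have "AE t in lborel. ennreal (h t) = ennreal (- h t)"
    by (subst (asm) sigma_finite_measure.density_unique_iff[OF sigma_finite_lborel]) auto
  then show ?thesis
  proof eventually_elim
    case (elim t)
    then show ?case
      by (cases "h t" "0 :: real" rule: linorder_cases) (auto simp: ennreal_neg ennreal_eq_0_iff)
  qed
qed

text \<open>Bumps with values in [0,1] approximate the indicator of a tail of the interval, so
  dominated convergence turns vanishing test integrals into vanishing tails.\<close>

lemma fundamental_lemma:
  fixes h :: "real \<Rightarrow> real"
  assumes h: "integrable (lebesgue_on {0<..<T}) h"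
    and zero: "\<And>\<phi>. \<phi> \<in> test_functions {0<..<T} \<Longrightarrow> (LINT t|lebesgue_on {0<..<T}. \<phi> t * h t) = 0"
  shows "AE t in lebesgue_on {0<..<T}. h t = 0"
proof -
  let ?I = "{0<..<T}"
  define g where "g t = indicator ?I t * h t" for t
  have gi: "integrable lebesgue g"
    using h unfolding g_def by (subst (asm) integrable_restrict_space) auto
  have tail: "(LINT t|lebesgue. indicator {x<..} t * g t) = 0" for x
  proof -
    define c where "c = max x 0"
    \<comment> \<open>Steepness n + 1 against a margin 1/(n + 1): the margin keeps the support
      compact, and the argument (n + 1)(t - c) - 1 still tends to infinity.\<close>
    define \<psi> where "\<psi> n = bump (real (Suc n)) (c + inverse (real (Suc n))) (T - inverse (real (Suc n)))" for n
    have \<psi>: "\<psi> n \<in> test_functions ?I" for n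
      unfolding \<psi>_def by (rule bump_test) (auto simp: c_def add_pos_pos add_nonneg_pos)
    have "(\<lambda>n. LINT t|lebesgue. \<psi> n t * g t) \<longlonglongrightarrow> (LINT t|lebesgue. indicator {c<..<T} t * g t)"
    proof (rule integral_dominated_convergence)
      show "integrable lebesgue (\<lambda>t. \<bar>g t\<bar>)" using gi by simp
      have "\<psi> n \<in> borel_measurable lebesgue" for n
        using test_functions_measurable[OF \<psi>, of n UNIV] by simp
      moreover have "g \<in> borel_measurable lebesgue" using gi by auto
      ultimately show "(\<lambda>t. \<psi> n t * g t) \<in> borel_measurable lebesgue" for n by measurable
      show "(\<lambda>t. indicator {c<..<T} t * g t) \<in> borel_measurable lebesgue"
        using gi by (intro borel_measurable_times borel_measurable_indicator) auto
      show "AE t in lebesgue. norm (\<psi> n t * g t) \<le> \<bar>g t\<bar>" for n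
        unfolding \<psi>_def by (intro AE_I2) (auto simp: abs_mult bump_bounds intro!: mult_left_le_one_le)
      show "AE t in lebesgue. (\<lambda>n. \<psi> n t * g t) \<longlonglongrightarrow> indicator {c<..<T} t * g t"
      proof (intro AE_I2 tendsto_mult_right)
        fix t
        show "(\<lambda>n. \<psi> n t) \<longlonglongrightarrow> indicator {c<..<T} t"
        proof (cases "t \<in> {c<..<T}")
          case False
          have "\<psi> n t = 0" for n unfolding \<psi>_def
          proof (rule bump_outside)
            have "t \<notin> {c + e<..<T - e}" if "e > 0" for e using that False by auto
            then show "t \<notin> {c + inverse (real (Suc n))<..<T - inverse (real (Suc n))}" by simp
          qed simp
          then show ?thesis using False by simp
        next
          case True
          have one: "(\<lambda>n. flat 1 (real (Suc n) * y - 1)) \<longlonglongrightarrow> 1" if "y > 0" for y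
          proof -
            have top: "filterlim (\<lambda>n. real (Suc n) * y - 1) at_top sequentially"
              using that by real_asymp
            have "((\<lambda>z. exp (- (1 / z :: real))) \<longlongrightarrow> exp (- 0)) at_top"
              by (intro tendsto_intros tendsto_divide_0[OF tendsto_const] filterlim_at_top_imp_at_infinity filterlim_ident)
            then have "((\<lambda>z. exp (- (1 / z :: real))) \<longlongrightarrow> 1) at_top" by simp
            then have "((\<lambda>z. flat 1 z) \<longlongrightarrow> 1) at_top"
              by (rule Lim_transform_eventually)
                (auto simp: flat_def intro: eventually_mono[OF eventually_gt_at_top[of 0]])
            then show ?thesis using top by (rule filterlim_compose)
          qed
          have "real (Suc n) * (t - (c + inverse (real (Suc n)))) = real (Suc n) * (t - c) - 1"
            "real (Suc n) * (T - inverse (real (Suc n)) - t) = real (Suc n) * (T - t) - 1" for n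
            by (simp_all add: field_simps)
          then have "\<psi> n t = flat 1 (real (Suc n) * (t - c) - 1) * flat 1 (real (Suc n) * (T - t) - 1)" for n
            unfolding \<psi>_def bump_def by presburger
          moreover have "(\<lambda>n. flat 1 (real (Suc n) * (t - c) - 1) * flat 1 (real (Suc n) * (T - t) - 1)) \<longlonglongrightarrow> 1 * 1"
            using True by (intro tendsto_mult one) auto
          ultimately show ?thesis using True by simp
        qed
      qed
    qed
    moreover have "(LINT t|lebesgue. \<psi> n t * g t) = 0" for n
    proof -
      have "(LINT t|lebesgue_on ?I. \<psi> n t * h t) = (LINT t|lebesgue. \<psi> n t * g t)"
        unfolding g_def by (subst integral_restrict_space) (auto intro!: Bochner_Integration.integral_cong simp: indicator_def)
      then show ?thesis using zero[OF \<psi>] by simp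
    qed
    ultimately have "(LINT t|lebesgue. indicator {c<..<T} t * g t) = 0" by (simp add: LIMSEQ_const_iff)
    moreover have "(\<lambda>t. indicator {c<..<T} t * g t) = (\<lambda>t. indicator {x<..} t * g t)"
      by (auto simp: g_def c_def indicator_def fun_eq_iff)
    ultimately show ?thesis by simp
  qed
  \<comment> \<open>The half-line argument concerns Borel functions, so \<open>g\<close> is replaced
    by a Borel version.\<close>
  obtain g' where g': "g' \<in> borel_measurable lborel" "AE t in lborel. g t = g' t"
    using completion_ex_borel_measurable_real[of g lborel] gi by auto
  have gg: "AE t in lebesgue. g t = g' t" using g'(2) by (rule AE_completion)
  have "integrable lebesgue g'"
    using gi gg g'(1) by (subst integrable_cong_AE[of g' lebesgue g]) (auto intro: measurable_completion)
  then have g'i: "integrable lborel g'" using g'(1) by (simp add: integrable_completion)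
  have "(LINT t|lborel. indicator {x<..} t * g' t) = 0" for x
  proof -
    have "(LINT t|lborel. indicator {x<..} t * g' t) = (LINT t|lebesgue. indicator {x<..} t * g' t)"
      using g'(1) by (intro integral_completion[symmetric] borel_measurable_times borel_measurable_indicator) auto
    also have "\<dots> = (LINT t|lebesgue. indicator {x<..} t * g t)"
    proof (rule integral_cong_AE)
      show "(\<lambda>t. indicator {x<..} t * g' t) \<in> borel_measurable lebesgue"
        using g'(1) by (intro borel_measurable_times borel_measurable_indicator) (auto intro: measurable_completion)
      show "(\<lambda>t. indicator {x<..} t * g t) \<in> borel_measurable lebesgue"
        using gi by (intro borel_measurable_times borel_measurable_indicator) auto
    qed (use gg in auto)
    finally show ?thesis using tail by simp
  qed
  from AE_zero_if_tails_zero[OF g'i this] have "AE t in lebesgue. g' t = 0" by (rule AE_completion)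
  with gg have "AE t in lebesgue. g t = 0" by eventually_elim simp
  then have "AE t in lebesgue. t \<in> ?I \<longrightarrow> h t = 0" by eventually_elim (auto simp: g_def indicator_def)
  then show ?thesis by (subst AE_restrict_space_iff) auto
qed

section \<open>Weak derivatives and absolutely continuous representatives\<close>

text \<open>Simple functions dominated by 2 |f| converge to \<open>f\<close> in L1 and their
  integrals form a Cauchy sequence, so completeness of the range provides the integral.\<close>

lemma integrable_if_norm_integrable:
  fixes f :: "'b \<Rightarrow> 'a::{real_normed_vector,complete_space,second_countable_topology}"
  assumes f: "f \<in> borel_measurable M" and n: "integrable M (\<lambda>x. norm (f x))"
  shows "integrable M f"
proof -
  note f [measurable]
  obtain s where s: "\<And>i. simple_function M (s i)"
    and lim: "\<And>x. x \<in> space M \<Longrightarrow> (\<lambda>i. s i x) \<longlonglongrightarrow> f x"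
    and bnd: "\<And>i x. x \<in> space M \<Longrightarrow> norm (s i x) \<le> 2 * norm (f x)"
    using borel_measurable_implies_sequence_metric[OF f, of 0] by (simp add: dist_norm) metis
  have fin: "(\<integral>\<^sup>+x. ennreal (2 * norm (f x)) \<partial>M) < \<infinity>"
    using n nn_integral_eq_integral[of M "\<lambda>x. 2 * norm (f x)"] by simp
  have simple: "Bochner_Integration.simple_bochner_integrable M (s i)" for i
  proof -
    have "(\<integral>\<^sup>+x. norm (s i x) \<partial>M) \<le> (\<integral>\<^sup>+x. ennreal (2 * norm (f x)) \<partial>M)"
      using bnd by (intro nn_integral_mono ennreal_leI) auto
    then have "(\<integral>\<^sup>+x. norm (s i x) \<partial>M) < \<infinity>" using fin by (rule le_less_trans)
    with s[of i] show ?thesis by (rule simple_bochner_integrableI_bounded)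
  qed
  have L1: "(\<lambda>i. \<integral>\<^sup>+x. norm (f x - s i x) \<partial>M) \<longlonglongrightarrow> 0"
    by (rule nn_integral_dominated_convergence_norm[where w = "\<lambda>x. 2 * norm (f x)"])
      (use s bnd lim fin in \<open>auto intro: borel_measurable_simple_function\<close>)
  define S where "S i = Bochner_Integration.simple_bochner_integral M (s i)" for i
  have "Cauchy S"
  proof (rule metric_CauchyI)
    fix e :: real assume e: "0 < e"
    then have "eventually (\<lambda>i. (\<integral>\<^sup>+x. norm (f x - s i x) \<partial>M) < ennreal (e / 2)) sequentially"
      using order_tendstoD(2)[OF L1] by simp
    then obtain m where m: "\<And>i. i \<ge> m \<Longrightarrow> (\<integral>\<^sup>+x. norm (f x - s i x) \<partial>M) < ennreal (e / 2)"
      unfolding eventually_sequentially by blast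
    have "dist (S i) (S j) < e" if "i \<ge> m" "j \<ge> m" for i j
    proof -
      have "ennreal (norm (S i - S j)) \<le> (\<integral>\<^sup>+x. norm (f x - s i x) \<partial>M) + (\<integral>\<^sup>+x. norm (f x - s j x) \<partial>M)"
        unfolding S_def by (rule simple_bochner_integral_bounded[OF f simple simple])
      also have "\<dots> < ennreal (e / 2) + ennreal (e / 2)" by (intro add_strict_mono m that)
      also have "\<dots> = ennreal e" using e by (simp flip: ennreal_plus)
      finally show ?thesis using e by (simp add: ennreal_less_iff dist_norm)
    qed
    then show "\<exists>m. \<forall>i\<ge>m. \<forall>j\<ge>m. dist (S i) (S j) < e" by blast
  qed
  then obtain x where "S \<longlonglongrightarrow> x" using Cauchy_convergent_iff convergent_def by blast
  then have "has_bochner_integral M f x"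
    unfolding S_def by (intro has_bochner_integral.intros[OF f simple L1])
  then show ?thesis by (rule integrable.intros)
qed

section \<open>Lebesgue integrals over open intervals as integrals over closed intervals, and
  integration by parts\<close>

lemma integrable_lebesgue_on_iff:
  "S \<in> sets lebesgue \<Longrightarrow> integrable (lebesgue_on S) h \<longleftrightarrow> h absolutely_integrable_on S"
  for h :: "real \<Rightarrow> real"
  by (subst integrable_restrict_space) (auto simp: set_integrable_def)

lemma absolutely_integrable_Ioo_iff:
  "h absolutely_integrable_on {a<..<b} \<longleftrightarrow> h absolutely_integrable_on {a..b}" for h :: "real \<Rightarrow> real"
  using absolutely_integrable_on_open_interval[where f = h and a = a and b = b] by (simp add: box_real)

lemma integrable_Ioo_iff:
  "integrable (lebesgue_on {a<..<b}) h \<longleftrightarrow> h absolutely_integrable_on {a..b}" for h :: "real \<Rightarrow> real"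
  by (simp add: integrable_lebesgue_on_iff absolutely_integrable_Ioo_iff)

lemma LINT_Ioo:
  fixes h :: "real \<Rightarrow> real"
  assumes "h absolutely_integrable_on {a..b}"
  shows "(LINT t|lebesgue_on {a<..<b}. h t) = integral {a..b} h"
  using assms lebesgue_integral_eq_integral[of "{a<..<b}" h]
  by (simp add: integrable_Ioo_iff integral_open_interval_real)

lemma integrable_Icc_iff:
  "integrable (lebesgue_on {a..b}) h \<longleftrightarrow> h absolutely_integrable_on {a..b}" for h :: "real \<Rightarrow> real"
  by (simp add: integrable_lebesgue_on_iff)

lemma LINT_Icc:
  fixes h :: "real \<Rightarrow> real"
  assumes "h absolutely_integrable_on {a..b}"
  shows "(LINT t|lebesgue_on {a..b}. h t) = integral {a..b} h"
  using assms by (intro lebesgue_integral_eq_integral) (simp_all add: integrable_Icc_iff)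

lemma absolutely_integrable_subinterval:
  "h absolutely_integrable_on {a..b} \<Longrightarrow> a \<le> c \<Longrightarrow> d \<le> b \<Longrightarrow> h absolutely_integrable_on {c..d}"
  for h :: "real \<Rightarrow> real"
  using absolutely_integrable_on_subinterval[where f = h and S = "{a..b}" and a = c and b = d] by (simp add: subset_iff)

lemma absolutely_integrable_continuous_mult:
  fixes f g :: "real \<Rightarrow> real"
  assumes f: "continuous_on {a..b} f" and g: "g absolutely_integrable_on {a..b}"
  shows "(\<lambda>x. f x * g x) absolutely_integrable_on {a..b}"
proof (rule absolutely_integrable_bounded_measurable_product_real[OF _ _ _ g])
  show "f \<in> borel_measurable (lebesgue_on {a..b})"
    using f by (intro continuous_imp_measurable_on_sets_lebesgue) auto
  show "bounded (f ` {a..b})"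
    using f by (intro compact_imp_bounded compact_continuous_image) auto
qed auto

lemma absolutely_integrable_continuous: "continuous_on {a..b} f \<Longrightarrow> f absolutely_integrable_on {a..b}"
  for f :: "real \<Rightarrow> real"
  by (rule absolutely_integrable_continuous_real)

text \<open>The increments of \<open>\<phi> W - \<integral> (\<phi>' W + \<phi> w)\<close> are of second order, so this function is constant.\<close>

lemma integral_by_parts_absolutely_continuous:
  fixes \<phi> W w :: "real \<Rightarrow> real"
  assumes ab: "a \<le> b" and w: "w absolutely_integrable_on {a..b}"
    and W: "\<And>s t. a \<le> s \<Longrightarrow> s \<le> t \<Longrightarrow> t \<le> b \<Longrightarrow> W t - W s = integral {s..t} w"
    and \<phi>: "\<And>x. (\<phi> has_real_derivative \<phi>' x) (at x)" and \<phi>': "continuous_on {a..b} \<phi>'"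
  shows "continuous_on {a..b} W"
    and "integral {a..b} (\<lambda>r. \<phi>' r * W r) + integral {a..b} (\<lambda>r. \<phi> r * w r) = \<phi> b * W b - \<phi> a * W a"
proof -
  have wi: "w integrable_on {a..b}" and wn: "(\<lambda>r. \<bar>w r\<bar>) integrable_on {a..b}"
    using w by (auto simp: absolutely_integrable_on_def)
  have sub: "f integrable_on {s..t}" if "f integrable_on {a..b}" "a \<le> s" "t \<le> b" for f :: "real \<Rightarrow> real" and s t
    using integrable_on_subinterval[OF that(1), of s t] that by auto
  have "continuous_on {a..b} (\<lambda>t. W a + integral {a..t} w)"
    by (intro continuous_intros indefinite_integral_continuous_1 wi)
  then show cW: "continuous_on {a..b} W"
  proof (rule continuous_on_eq)
    show "W a + integral {a..t} w = W t" if "t \<in> {a..b}" for t using W[of a t] that by simp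
  qed
  have c\<phi>: "continuous_on {a..b} \<phi>"
    using \<phi> by (meson DERIV_isCont continuous_at_imp_continuous_on)
  have "compact (\<phi>' ` {a..b})" by (intro compact_continuous_image \<phi>') auto
  then have "bounded (\<phi>' ` {a..b})" by (rule compact_imp_bounded)
  then obtain L where L: "L > 0" "\<And>x. a \<le> x \<Longrightarrow> x \<le> b \<Longrightarrow> \<bar>\<phi>' x\<bar> \<le> L" unfolding bounded_pos by auto
  have ftc: "(\<phi>' has_integral \<phi> t - \<phi> s) {s..t}" if "s \<le> t" for s t
    using that \<phi> by (intro fundamental_theorem_of_calculus)
      (auto simp: has_real_derivative_iff_has_vector_derivative intro: has_vector_derivative_at_within)
  have i1: "(\<lambda>r. \<phi>' r * W r) integrable_on {a..b}"
    by (intro integrable_continuous_real continuous_intros \<phi>' cW)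
  have i2: "(\<lambda>r. \<phi> r * w r) integrable_on {a..b}"
    using absolutely_integrable_continuous_mult[OF c\<phi> w] absolutely_integrable_on_def by blast
  define F where "F t = integral {a..t} (\<lambda>r. \<phi>' r * W r + \<phi> r * w r)" for t
  define G where "G t = \<phi> t * W t - F t" for t
  define A where "A t = integral {a..t} (\<lambda>r. \<bar>w r\<bar>)" for t
  have A_diff: "A t - A s = integral {s..t} (\<lambda>r. \<bar>w r\<bar>)" if "a \<le> s" "s \<le> t" "t \<le> b" for s t
    using Henstock_Kurzweil_Integration.integral_combine[OF that(1,2) sub[OF wn _ that(3)]] by (simp add: A_def)
  \<comment> \<open>\<open>\<phi>\<close> is frozen at the right end and \<open>W\<close> at the
    left end; each of the two errors is at most \<open>L\<close> times the step times the increment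
    of \<open>A\<close>, which bounds the variation of \<open>W\<close>.\<close>
  have incr: "\<bar>G t - G s\<bar> \<le> 2 * L * (t - s) * (A t - A s)" if st: "a \<le> s" "s \<le> t" "t \<le> b" for s t
  proof -
    have lip: "\<bar>\<phi> t - \<phi> r\<bar> \<le> L * (t - s)" if r: "s \<le> r" "r \<le> t" for r
    proof -
      have "norm (\<phi> t - \<phi> r) \<le> L * (t - r)"
        using has_integral_bound_real[OF _ _ ftc[OF r(2)], of L "{}"] L st r by (simp add: content_real)
      also have "\<dots> \<le> L * (t - s)" using r L(1) by (intro mult_left_mono) auto
      finally show ?thesis by simp
    qed
    have osc: "\<bar>W s - W r\<bar> \<le> A t - A s" if r: "s \<le> r" "r \<le> t" for r
    proof -
      have "\<bar>W r - W s\<bar> \<le> integral {s..r} (\<lambda>r. \<bar>w r\<bar>)"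
        using W[of s r] st r integral_norm_bound_integral[OF sub[OF wi, of s r] sub[OF wn, of s r]] by simp
      also have "\<dots> \<le> integral {s..t} (\<lambda>r. \<bar>w r\<bar>)"
        using st r by (intro integral_subset_le sub[OF wn]) auto
      finally show ?thesis using A_diff[OF st] by simp
    qed
    have i: "(\<lambda>r. \<phi>' r * W r + \<phi> r * w r) integrable_on {a..b}" by (intro integrable_add i1 i2)
    have F: "F t - F s = integral {s..t} (\<lambda>r. \<phi>' r * W r + \<phi> r * w r)"
      using Henstock_Kurzweil_Integration.integral_combine[OF st(1,2) sub[OF i _ st(3)]] by (simp add: F_def)
    have p1: "\<phi> t * (W t - W s) = integral {s..t} (\<lambda>r. \<phi> t * w r)" using W[OF st] by simp
    have p2: "(\<phi> t - \<phi> s) * W s = integral {s..t} (\<lambda>r. \<phi>' r * W s)"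
      using ftc[OF st(2)] by (simp add: integral_unique)
    have j1: "(\<lambda>r. \<phi> t * w r) integrable_on {s..t}" using sub[OF wi] st by (intro integrable_on_mult_right) auto
    have j2: "(\<lambda>r. \<phi>' r * W s) integrable_on {s..t}"
      using ftc[OF st(2)] by (intro integrable_on_mult_left) auto
    have j3: "(\<lambda>r. \<phi>' r * W r + \<phi> r * w r) integrable_on {s..t}" using sub[OF i] st by auto
    have "G t - G s = \<phi> t * (W t - W s) + (\<phi> t - \<phi> s) * W s - (F t - F s)"
      by (simp add: G_def algebra_simps)
    also have "\<dots> = integral {s..t} (\<lambda>r. \<phi> t * w r + \<phi>' r * W s - (\<phi>' r * W r + \<phi> r * w r))"
      unfolding F p1 p2 using j1 j2 j3 by (simp only: Henstock_Kurzweil_Integration.integral_diff Henstock_Kurzweil_Integration.integral_add integrable_add)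
    finally have "G t - G s = integral {s..t} (\<lambda>r. \<phi> t * w r + \<phi>' r * W s - (\<phi>' r * W r + \<phi> r * w r))" .
    moreover have "norm (integral {s..t} (\<lambda>r. \<phi> t * w r + \<phi>' r * W s - (\<phi>' r * W r + \<phi> r * w r)))
        \<le> integral {s..t} (\<lambda>r. L * (t - s) * \<bar>w r\<bar> + L * (A t - A s))"
    proof (rule integral_norm_bound_integral)
      show "(\<lambda>r. \<phi> t * w r + \<phi>' r * W s - (\<phi>' r * W r + \<phi> r * w r)) integrable_on {s..t}"
        by (intro integrable_diff integrable_add[OF j1 j2] j3)
      show "(\<lambda>r. L * (t - s) * \<bar>w r\<bar> + L * (A t - A s)) integrable_on {s..t}"
        using sub[OF wn] st by (intro integrable_add integrable_on_mult_right integrable_const_ivl) auto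
      fix r assume "r \<in> {s..t}"
      then have r: "s \<le> r" "r \<le> t" by auto
      have "\<phi> t * w r + \<phi>' r * W s - (\<phi>' r * W r + \<phi> r * w r) = (\<phi> t - \<phi> r) * w r + \<phi>' r * (W s - W r)"
        by (simp add: algebra_simps)
      also have "norm \<dots> \<le> \<bar>\<phi> t - \<phi> r\<bar> * \<bar>w r\<bar> + \<bar>\<phi>' r\<bar> * \<bar>W s - W r\<bar>"
        by (simp add: abs_mult[symmetric])
      also have "\<dots> \<le> L * (t - s) * \<bar>w r\<bar> + L * (A t - A s)"
        using lip[OF r] osc[OF r] L st r by (intro add_mono mult_mono) auto
      finally show "norm (\<phi> t * w r + \<phi>' r * W s - (\<phi>' r * W r + \<phi> r * w r)) \<le> L * (t - s) * \<bar>w r\<bar> + L * (A t - A s)" .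
    qed
    moreover have "integral {s..t} (\<lambda>r. L * (t - s) * \<bar>w r\<bar> + L * (A t - A s)) = 2 * L * (t - s) * (A t - A s)"
    proof -
      have "(\<lambda>r. \<bar>w r\<bar>) integrable_on {s..t}" using sub[OF wn] st by auto
      then have "integral {s..t} (\<lambda>r. L * (t - s) * \<bar>w r\<bar> + L * (A t - A s))
          = L * (t - s) * (A t - A s) + L * (A t - A s) * (t - s)"
        using st(2) A_diff[OF st] by (subst Henstock_Kurzweil_Integration.integral_add)
          (auto simp: content_real intro: integrable_on_mult_right)
      then show ?thesis by simp
    qed
    ultimately show ?thesis by simp
  qed
  have cA: "continuous_on {a..b} A" unfolding A_def by (intro indefinite_integral_continuous_1 wn)
  have "(G has_field_derivative 0) (at t within {a..b})" if t: "t \<in> {a..b}" for t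
    unfolding has_field_derivative_iff
  proof (rule Lim_null_comparison)
    \<comment> \<open>After division by the step only an increment of the continuous function
      \<open>A\<close> remains, so \<open>G\<close> has derivative 0 even where \<open>W\<close> is
      not differentiable.\<close>
    show "eventually (\<lambda>y. norm ((G y - G t) / (y - t)) \<le> 2 * L * \<bar>A y - A t\<bar>) (at t within {a..b})"
      unfolding eventually_at_filter
    proof (intro always_eventually allI impI)
      fix y assume y: "y \<noteq> t" "y \<in> {a..b}"
      have "\<bar>G y - G t\<bar> \<le> 2 * L * \<bar>A y - A t\<bar> * \<bar>y - t\<bar>"
      proof (cases "t \<le> y")
        case True
        have eq: "2 * L * (y - t) * (A y - A t) = 2 * L * (A y - A t) * (y - t)" by (simp only: mult_ac)
        have le: "\<bar>G y - G t\<bar> \<le> 2 * L * (A y - A t) * (y - t)"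
          using incr[of t y] True t y unfolding eq by auto
        have "A y - A t \<ge> 0"
          using A_diff[of t y] True t y by (simp add: Henstock_Kurzweil_Integration.integral_nonneg sub[OF wn])
        then show ?thesis using le True by simp
      next
        case False
        have eq: "2 * L * (t - y) * (A t - A y) = 2 * L * (A t - A y) * (t - y)" by (simp only: mult_ac)
        have le: "\<bar>G t - G y\<bar> \<le> 2 * L * (A t - A y) * (t - y)"
          using incr[of y t] False t y unfolding eq by auto
        have "A t - A y \<ge> 0"
          using A_diff[of y t] False t y by (simp add: Henstock_Kurzweil_Integration.integral_nonneg sub[OF wn])
        then show ?thesis using le False by (simp add: abs_minus_commute)
      qed
      then show "norm ((G y - G t) / (y - t)) \<le> 2 * L * \<bar>A y - A t\<bar>" using y(1) by (simp add: field_simps)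
    qed
    have "((\<lambda>y. A y - A t) \<longlongrightarrow> 0) (at t within {a..b})"
      using cA t by (intro LIM_zero) (auto simp: continuous_on_def)
    then have "((\<lambda>y. 2 * L * \<bar>A y - A t\<bar>) \<longlongrightarrow> 2 * L * \<bar>0\<bar>) (at t within {a..b})" by (intro tendsto_intros)
    then show "((\<lambda>y. 2 * L * \<bar>A y - A t\<bar>) \<longlongrightarrow> 0) (at t within {a..b})" by simp
  qed
  then obtain C where "\<And>t. t \<in> {a..b} \<Longrightarrow> G t = C"
    using has_field_derivative_zero_constant[of "{a..b}" G] by auto
  then have "G b = G a" using ab by simp
  moreover have "F b = integral {a..b} (\<lambda>r. \<phi>' r * W r) + integral {a..b} (\<lambda>r. \<phi> r * w r)"
    unfolding F_def by (rule Henstock_Kurzweil_Integration.integral_add[OF i1 i2])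
  moreover have "F a = 0" by (simp add: F_def)
  ultimately show "integral {a..b} (\<lambda>r. \<phi>' r * W r) + integral {a..b} (\<lambda>r. \<phi> r * w r) = \<phi> b * W b - \<phi> a * W a"
    by (simp add: G_def)
qed

text \<open>Mean zero is what makes the primitive vanish to the right of the support as well as to
  the left.\<close>

lemma test_function_primitive:
  assumes T: "T > 0" and g: "g \<in> test_functions {0<..<T}" and zero: "integral {0..T} g = 0"
  obtains \<phi> where "\<phi> \<in> test_functions {0<..<T}" "deriv \<phi> = g"
proof -
  obtain l h where sg: "smooth g" and lh: "0 < l" "h < T" "\<And>x. x \<notin> {l..h} \<Longrightarrow> g x = 0"
    using g unfolding test_functions_iff by blast
  have cg: "continuous_on S g" for S by (rule smooth_continuous_on[OF sg])
  have gi: "g integrable_on {x..y}" for x y by (intro integrable_continuous_real cg)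
  \<comment> \<open>The base point -1 lies to the left of the support, whose points are therefore
    interior to \<open>{-1..t + 1}\<close>.\<close>
  define \<phi> where "\<phi> t = integral {-1..t} g" for t
  have left: "\<phi> t = 0" if "t < l" for t
    unfolding \<phi>_def using that lh(3) by (subst Henstock_Kurzweil_Integration.integral_cong[where g = "\<lambda>_. 0"]) auto
  have right: "\<phi> t = 0" if "t > h" for t
  proof (cases "t < l")
    case False
    have *: "integral {-1..y} g = integral {-1..max t T} g" if "h < y" "y \<le> max t T" "-1 \<le> y" for y
    proof -
      have "integral {-1..y} g + integral {y..max t T} g = integral {-1..max t T} g"
        using that by (intro Henstock_Kurzweil_Integration.integral_combine gi) auto
      moreover have "integral {y..max t T} g = 0"
        using that lh(3) by (subst Henstock_Kurzweil_Integration.integral_cong[where g = "\<lambda>_. 0"]) auto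
      ultimately show ?thesis by simp
    qed
    have "integral {-1..0} g + integral {0..T} g = integral {-1..T} g"
      using T by (intro Henstock_Kurzweil_Integration.integral_combine gi) auto
    moreover have "integral {-1..0} g = 0" using left[OF lh(1)] by (simp add: \<phi>_def)
    ultimately have "integral {-1..T} g = 0" using zero by simp
    then show ?thesis using *[of t] *[of T] that lh False T by (simp add: \<phi>_def)
  qed (rule left)
  have d: "(\<phi> has_real_derivative g t) (at t)" for t
  proof (cases "t < l")
    case True
    have "eventually (\<lambda>y. y \<in> {..<l}) (nhds t)" using True by (intro eventually_nhds_in_open) auto
    then have "eventually (\<lambda>y. 0 = \<phi> y) (nhds t)" by (rule eventually_mono) (simp add: left)
    then have "(\<phi> has_real_derivative 0) (at t)"
      using DERIV_cong_ev[of t t "\<lambda>x. 0" \<phi> 0 0] by simp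
    then show ?thesis using lh(3)[of t] True by simp
  next
    case False
    have "(\<phi> has_real_derivative g t) (at t within {-1..t + 1})"
      unfolding \<phi>_def has_real_derivative_iff_has_vector_derivative
      by (rule integral_has_vector_derivative[OF cg]) (use False lh in auto)
    moreover have "at t within {-1..t + 1} = at t"
      using False lh(1) by (intro at_within_interior) (simp add: interior_atLeastAtMost_real)
    ultimately show ?thesis by simp
  qed
  have "smooth \<phi>" using d sg by (rule smooth_if_deriv)
  moreover have "\<phi> x = 0" if "x \<notin> {l..h}" for x using left[of x] right[of x] that by auto
  ultimately have "\<phi> \<in> test_functions {0<..<T}" unfolding test_functions_iff using lh(1,2) by blast
  moreover have "deriv \<phi> = g" using d DERIV_imp_deriv by blast
  ultimately show thesis by (rule that)
qed

lemma test_functions_lincomb: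
  assumes "f \<in> test_functions {0<..<T}" "g \<in> test_functions {0<..<T}"
  shows "(\<lambda>x. \<alpha> * f x + \<beta> * g x) \<in> test_functions {0<..<T}"
proof -
  obtain l h l' h' where a: "smooth f" "smooth g" "0 < l" "h < T" "0 < l'" "h' < T"
    "\<And>x. x \<notin> {l..h} \<Longrightarrow> f x = 0" "\<And>x. x \<notin> {l'..h'} \<Longrightarrow> g x = 0"
    using assms unfolding test_functions_iff by blast
  have "\<alpha> * f x + \<beta> * g x = 0" if "x \<notin> {min l l'..max h h'}" for x
  proof -
    have "x \<notin> {l..h}" "x \<notin> {l'..h'}" using that by auto
    then show ?thesis by (simp add: a(7,8))
  qed
  then show ?thesis unfolding test_functions_iff
    using a by (intro conjI smooth_add smooth_mult smooth_const exI[of _ "min l l'"] exI[of _ "max h h'"]) auto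
qed

lemma test_function_integrable_mult:
  assumes "\<phi> \<in> test_functions {0<..<T}" "h absolutely_integrable_on {0..T}"
  shows "(\<lambda>t. \<phi> t * h t) absolutely_integrable_on {0..T}"
  using assms by (intro absolutely_integrable_continuous_mult smooth_continuous_on) (auto simp: test_functions_iff)

text \<open>Subtracting a multiple of one fixed bump gives any test function mean zero, and then a
  primitive that is itself a test function. The constant is the mean of \<open>h\<close> weighted by
  that bump.\<close>

lemma du_bois_reymond:
  fixes h :: "real \<Rightarrow> real"
  assumes T: "T > 0" and h: "h absolutely_integrable_on {0..T}"
    and zero: "\<And>\<phi>. \<phi> \<in> test_functions {0<..<T} \<Longrightarrow> integral {0..T} (\<lambda>t. deriv \<phi> t * h t) = 0"
  obtains c where "AE t in lebesgue_on {0<..<T}. h t = c"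
proof -
  define r where "r = bump 1 (T / 3) (2 * T / 3)"
  have r: "r \<in> test_functions {0<..<T}" unfolding r_def using T by (intro bump_test) auto
  have cts: "continuous_on S f" if "f \<in> test_functions {0<..<T}" for f S
    using that by (intro smooth_continuous_on) (simp add: test_functions_iff)
  define \<mu> where "\<mu> = integral {0..T} r"
  have "\<mu> \<noteq> 0"
  proof
    assume "\<mu> = 0"
    moreover have "(r has_integral \<mu>) {0..T}"
      unfolding \<mu>_def by (intro integrable_integral integrable_continuous_real cts r)
    ultimately have "(r has_integral 0) {0..T}" by simp
    then have "r (T / 2) = 0"
      using has_integral_0_cbox_imp_0[of 0 T r "T / 2"] T cts[OF r] by (auto simp: r_def bump_bounds)
    moreover have "r (T / 2) > 0" unfolding r_def using T by (intro bump_inside) auto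
    ultimately show False by simp
  qed
  define c where "c = integral {0..T} (\<lambda>t. r t * h t) / \<mu>"
  have ch: "(\<lambda>t. h t - c) absolutely_integrable_on {0..T}"
    using set_integral_diff(1)[OF h absolutely_integrable_continuous[OF continuous_on_const]] .
  have "AE t in lebesgue_on {0<..<T}. h t - c = 0"
  proof (rule fundamental_lemma)
    show "integrable (lebesgue_on {0<..<T}) (\<lambda>t. h t - c)" using ch by (simp add: integrable_Ioo_iff)
    fix \<psi> assume \<psi>: "\<psi> \<in> test_functions {0<..<T}"
    define m where "m = integral {0..T} \<psi> / \<mu>"
    have g: "(\<lambda>t. 1 * \<psi> t + (- m) * r t) \<in> test_functions {0<..<T}" by (intro test_functions_lincomb \<psi> r)
    have i: "\<psi> integrable_on {0..T}" "r integrable_on {0..T}" by (intro integrable_continuous_real cts \<psi> r)+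
    have "integral {0..T} (\<lambda>t. 1 * \<psi> t + (- m) * r t) = integral {0..T} \<psi> - m * \<mu>"
      using i by (simp add: \<mu>_def Henstock_Kurzweil_Integration.integral_diff integrable_on_mult_right)
    also have "\<dots> = 0" using \<open>\<mu> \<noteq> 0\<close> by (simp add: m_def)
    finally obtain \<phi> where \<phi>: "\<phi> \<in> test_functions {0<..<T}" "deriv \<phi> = (\<lambda>t. 1 * \<psi> t + (- m) * r t)"
      using test_function_primitive[OF T g] by blast
    have j: "(\<lambda>t. \<psi> t * h t) integrable_on {0..T}" "(\<lambda>t. r t * h t) integrable_on {0..T}"
      using test_function_integrable_mult[OF \<psi> h] test_function_integrable_mult[OF r h]
      by (auto simp: absolutely_integrable_on_def)
    have "0 = integral {0..T} (\<lambda>t. \<psi> t * h t - m * (r t * h t))"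
      using zero[OF \<phi>(1)] by (simp add: \<phi>(2) algebra_simps)
    also have "\<dots> = integral {0..T} (\<lambda>t. \<psi> t * h t) - m * integral {0..T} (\<lambda>t. r t * h t)"
      using j by (simp add: Henstock_Kurzweil_Integration.integral_diff integrable_on_mult_right)
    also have "m * integral {0..T} (\<lambda>t. r t * h t) = integral {0..T} (\<lambda>t. \<psi> t * c)"
      using \<open>\<mu> \<noteq> 0\<close> by (simp add: m_def c_def)
    also have "integral {0..T} (\<lambda>t. \<psi> t * h t) - \<dots> = integral {0..T} (\<lambda>t. \<psi> t * h t - \<psi> t * c)"
      using j i by (simp add: Henstock_Kurzweil_Integration.integral_diff integrable_on_mult_left)
    finally have "integral {0..T} (\<lambda>t. \<psi> t * (h t - c)) = 0" by (simp add: right_diff_distrib)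
    then show "(LINT t|lebesgue_on {0<..<T}. \<psi> t * (h t - c)) = 0"
      by (simp add: LINT_Ioo test_function_integrable_mult[OF \<psi> ch])
  qed
  then show thesis using that by simp
qed

section \<open>Square-integrable functions, scalar components and weak derivatives\<close>

lemma norm_le_one_plus_square: "norm x \<le> 1 + (norm x)\<^sup>2" for x :: "'a::real_normed_vector"
  using zero_le_power2[of "norm x - 1"] by (simp add: power2_diff) (smt (verit) norm_ge_zero zero_le_power2)

lemma L2_integrable_norm:
  assumes "u \<in> L2 {a<..<b} S"
  shows "integrable (lebesgue_on {a<..<b}) (\<lambda>t. norm (u t))"
proof (rule Bochner_Integration.integrable_bound)
  have "integrable (lebesgue_on {a<..<b}) (\<lambda>t. 1 :: real)"
    by (simp add: integrable_Ioo_iff absolutely_integrable_continuous)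
  then show "integrable (lebesgue_on {a<..<b}) (\<lambda>t. 1 + (norm (u t))\<^sup>2)"
    using assms by (intro Bochner_Integration.integrable_add) (auto simp: L2_def)
  have [measurable]: "u \<in> borel_measurable (lebesgue_on {a<..<b})" using assms by (simp add: L2_def)
  show "(\<lambda>t. norm (u t)) \<in> borel_measurable (lebesgue_on {a<..<b})" by measurable
  show "AE t in lebesgue_on {a<..<b}. norm (norm (u t)) \<le> norm (1 + (norm (u t))\<^sup>2)"
    using norm_le_one_plus_square by (intro AE_I2) (simp add: add_nonneg_nonneg abs_of_nonneg)
qed

lemma L2_integrable: "u \<in> L2 {a<..<b} S \<Longrightarrow> integrable (lebesgue_on {a<..<b}) u"
  by (rule integrable_if_norm_integrable[OF _ L2_integrable_norm]) (auto simp: L2_def)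

lemma L2_absolutely_integrable:
  fixes F :: "'a::{real_inner,complete_space,second_countable_topology} \<Rightarrow> real"
  assumes "u \<in> L2 {a<..<b} S" "bounded_linear F"
  shows "(\<lambda>t. F (u t)) absolutely_integrable_on {a..b}"
  using integrable_bounded_linear[OF assms(2) L2_integrable[OF assms(1)]] by (simp add: integrable_Ioo_iff)

lemma L2_norm_absolutely_integrable:
  assumes "u \<in> L2 {a<..<b} S"
  shows "(\<lambda>t. norm (u t)) absolutely_integrable_on {a..b}"
  using L2_integrable_norm[OF assms] by (simp add: integrable_Ioo_iff)

lemma test_functions_deriv_power: "\<phi> \<in> test_functions I \<Longrightarrow> (deriv ^^ j) \<phi> \<in> test_functions I"
  by (induction j) (auto intro: test_functions_deriv)

lemma integrable_test_scaleR:
  assumes u: "u \<in> L2 {0<..<T} S" and \<phi>: "\<phi> \<in> test_functions {0<..<T}"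
  shows "integrable (lebesgue_on {0<..<T}) (\<lambda>t. \<phi> t *\<^sub>R u t)"
proof (rule integrable_if_norm_integrable)
  have [measurable]: "u \<in> borel_measurable (lebesgue_on {0<..<T})" using u by (simp add: L2_def)
  have [measurable]: "\<phi> \<in> borel_measurable (lebesgue_on {0<..<T})" using \<phi> by (rule test_functions_measurable)
  show "(\<lambda>t. \<phi> t *\<^sub>R u t) \<in> borel_measurable (lebesgue_on {0<..<T})" by measurable
  obtain B where B: "\<And>x. \<bar>\<phi> x\<bar> \<le> B" using test_functions_bounded[OF \<phi>] by blast
  show "integrable (lebesgue_on {0<..<T}) (\<lambda>t. norm (\<phi> t *\<^sub>R u t))"
  proof (rule Bochner_Integration.integrable_bound)
    show "integrable (lebesgue_on {0<..<T}) (\<lambda>t. B * norm (u t))" using L2_integrable_norm[OF u] by simp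
    show "AE t in lebesgue_on {0<..<T}. norm (norm (\<phi> t *\<^sub>R u t)) \<le> norm (B * norm (u t))"
      using B by (intro AE_I2) (auto simp: abs_mult intro!: mult_right_mono intro: order_trans[OF B abs_ge_self])
  qed measurable
qed

text \<open>A bounded functional commutes with the vector-valued integral, which turns weak
  derivatives into statements about real functions.\<close>

lemma weak_deriv_functional:
  fixes F :: "'a::{real_inner,complete_space,second_countable_topology} \<Rightarrow> real"
  assumes u: "u \<in> L2 {0<..<T} S" and w: "w \<in> L2 {0<..<T} S'" and d: "is_weak_deriv {0<..<T} j u w"
    and \<phi>: "\<phi> \<in> test_functions {0<..<T}" and F: "bounded_linear F"
  shows "integral {0..T} (\<lambda>t. (deriv ^^ j) \<phi> t * F (u t)) = (-1) ^ j * integral {0..T} (\<lambda>t. \<phi> t * F (w t))"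
proof -
  interpret F: bounded_linear F by fact
  let ?M = "lebesgue_on {0<..<T}"
  have d\<phi>: "(deriv ^^ j) \<phi> \<in> test_functions {0<..<T}" using \<phi> by (rule test_functions_deriv_power)
  have comm: "F (LINT t|?M. \<psi> t *\<^sub>R v t) = (LINT t|?M. \<psi> t * F (v t))"
    if "v \<in> L2 {0<..<T} R" "\<psi> \<in> test_functions {0<..<T}" for v \<psi> R
    by (subst integral_bounded_linear[OF F integrable_test_scaleR[OF that], symmetric]) (simp add: F.scaleR)
  have "F (LINT t|?M. (deriv ^^ j) \<phi> t *\<^sub>R u t) = F ((-1) ^ j *\<^sub>R (LINT t|?M. \<phi> t *\<^sub>R w t))"
    using d \<phi> by (simp add: is_weak_deriv_def)
  then have "(LINT t|?M. (deriv ^^ j) \<phi> t * F (u t)) = (-1) ^ j * (LINT t|?M. \<phi> t * F (w t))"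
    by (simp only: comm[OF u d\<phi>] comm[OF w \<phi>] F.scaleR real_scaleR_def)
  then show ?thesis
    by (simp add: LINT_Ioo test_function_integrable_mult[OF d\<phi> L2_absolutely_integrable[OF u F]]
        test_function_integrable_mult[OF \<phi> L2_absolutely_integrable[OF w F]])
qed

lemma AE_nonempty:
  assumes "AE t in lebesgue_on {0<..<T}. P t" "T > (0::real)"
  obtains t where "t \<in> {0<..<T}" "P t"
proof -
  have "\<exists>t\<in>{0<..<T}. P t"
  proof (rule ccontr)
    assume none: "\<not> ?thesis"
    have "AE t in lebesgue_on {0<..<T}. False"
      using assms(1) AE_space[of "lebesgue_on {0<..<T}"] by eventually_elim (use none in auto)
    then have "emeasure (lebesgue_on {0<..<T}) {t \<in> space (lebesgue_on {0<..<T}). True} = 0"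
      by (intro emeasure_eq_0_AE) simp
    moreover have "{t \<in> space (lebesgue_on {0<..<T}). True} = {0<..<T}" by auto
    ultimately have "emeasure (lebesgue_on {0<..<T}) {0<..<T} = 0" by simp
    then show False using assms(2) by (simp add: emeasure_restrict_space)
  qed
  then show thesis using that by blast
qed

lemma inner_determines:
  fixes v :: "'a::real_inner"
  assumes "\<And>X :: 'a set. open X \<Longrightarrow> X \<noteq> {} \<Longrightarrow> \<exists>d\<in>D. d \<in> X" "\<And>x. x \<in> D \<Longrightarrow> x \<bullet> v = 0"
  shows "v = 0"
proof (rule ccontr)
  assume "v \<noteq> 0"
  have "open {x. x \<bullet> v \<noteq> 0}" by (intro open_Collect_neq continuous_intros)
  moreover have "v \<in> {x. x \<bullet> v \<noteq> 0}" using \<open>v \<noteq> 0\<close> by simp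
  ultimately show False using assms by blast
qed

text \<open>Indefinite integrals tested with vectors, so that real integrals over closed intervals
  stand for the vector-valued one. A component that is not integrable has integral 0 by convention;
  integrability of \<open>w\<close> is stated separately.\<close>

definition primitive :: "real \<Rightarrow> (real \<Rightarrow> 'a::real_inner) \<Rightarrow> (real \<Rightarrow> 'a) \<Rightarrow> bool" where
  "primitive T d w \<longleftrightarrow> (\<forall>x s t. 0 \<le> s \<longrightarrow> s \<le> t \<longrightarrow> t \<le> T \<longrightarrow> x \<bullet> (d t - d s) = integral {s..t} (\<lambda>r. x \<bullet> w r))"

text \<open>\<open>W\<close> is the indefinite integral of \<open>w\<close>. Each component of u - W
  is constant almost everywhere by \<open>du_bois_reymond\<close>, with a null set depending on the
  component; a countable dense set of components yields a common null set.\<close>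

lemma absolutely_continuous_representative:
  fixes u w :: "real \<Rightarrow> 'a::{real_inner,complete_space,second_countable_topology}"
  assumes T: "T > 0" and u: "u \<in> L2 {0<..<T} UNIV" and w: "w \<in> L2 {0<..<T} UNIV"
    and weak: "is_weak_deriv {0<..<T} 1 u w"
  obtains d where "AE t in lebesgue_on {0<..<T}. d t = u t" "primitive T d w"
proof -
  let ?M = "lebesgue_on {0<..<T}"
  note inner_bl = bounded_linear_inner_right
  define W where "W t = (LINT r|?M. indicator {..t} r *\<^sub>R w r)" for t
  have mw [measurable]: "w \<in> borel_measurable ?M" using w by (simp add: L2_def)
  have wi: "(\<lambda>r. x \<bullet> w r) absolutely_integrable_on {0..T}" for x
    by (rule L2_absolutely_integrable[OF w inner_bl])
  have W: "x \<bullet> W t = integral {0..t} (\<lambda>r. x \<bullet> w r)" if t: "0 \<le> t" "t \<le> T" for x t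
  proof -
    have int: "integrable ?M (\<lambda>r. indicator {..t} r *\<^sub>R w r)"
    proof (rule integrable_if_norm_integrable)
      show "(\<lambda>r. indicator {..t} r *\<^sub>R w r) \<in> borel_measurable ?M"
        by (intro borel_measurable_scaleR mw borel_measurable_indicator') (auto simp: sets_restrict_space)
      from measurable_compose[OF this borel_measurable_norm]
      show "integrable ?M (\<lambda>r. norm (indicator {..t} r *\<^sub>R w r))"
        by (rule Bochner_Integration.integrable_bound[OF L2_integrable_norm[OF w]])
          (auto simp: indicator_def)
    qed
    have "x \<bullet> W t = (LINT r|?M. x \<bullet> (indicator {..t} r *\<^sub>R w r))"
      unfolding W_def by (rule integral_bounded_linear[OF inner_bl int, symmetric])
    also have "\<dots> = (LINT r|?M. (if r \<in> {..t} then x \<bullet> w r else 0))"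
      by (intro Bochner_Integration.integral_cong) (auto simp: indicator_def)
    also have "\<dots> = integral {0..T} (\<lambda>r. if r \<in> {..t} then x \<bullet> w r else 0)"
    proof (rule LINT_Ioo)
      have "(\<lambda>r. x \<bullet> w r) absolutely_integrable_on ({..t} \<inter> {0..T})"
        using t by (intro set_integrable_subset[OF wi]) auto
      then show "(\<lambda>r. if r \<in> {..t} then x \<bullet> w r else 0) absolutely_integrable_on {0..T}"
        by (simp add: set_integrable_def indicator_def if_distrib cong: if_cong) (auto elim: back_subst[where P = "integrable lebesgue"] simp: fun_eq_iff)
    qed
    also have "\<dots> = integral ({..t} \<inter> {0..T}) (\<lambda>r. x \<bullet> w r)"
      by (rule integral_restrict_Int)
    also have "{..t} \<inter> {0..T} = {0..t}" using t by auto
    finally show ?thesis .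
  qed
  have Wp: "primitive T W w" unfolding primitive_def
  proof (intro allI impI)
    fix x s t assume st: "0 \<le> s" "s \<le> t" "t \<le> T"
    have "(\<lambda>r. x \<bullet> w r) integrable_on {0..t}"
      using absolutely_integrable_subinterval[OF wi, of 0 t x] st by (auto simp: absolutely_integrable_on_def)
    from Henstock_Kurzweil_Integration.integral_combine[OF st(1,2) this]
    show "x \<bullet> (W t - W s) = integral {s..t} (\<lambda>r. x \<bullet> w r)" using st by (simp add: inner_diff_right W)
  qed
  have const: "\<exists>c. AE t in ?M. x \<bullet> (u t - W t) = c" for x
  proof -
    have xW: "x \<bullet> W t - x \<bullet> W s = integral {s..t} (\<lambda>r. x \<bullet> w r)" if "0 \<le> s" "s \<le> t" "t \<le> T" for s t
      using Wp that by (simp add: primitive_def inner_diff_right)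
    have one: "\<And>y. ((\<lambda>y. 1) has_real_derivative 0) (at y)" by simp
    have cW: "continuous_on {0..T} (\<lambda>t. x \<bullet> W t)"
      by (rule integral_by_parts_absolutely_continuous(1)[OF _ wi xW one]) (use T in auto)
    have iu: "(\<lambda>t. x \<bullet> u t) absolutely_integrable_on {0..T}" by (rule L2_absolutely_integrable[OF u inner_bl])
    have iW: "(\<lambda>t. x \<bullet> W t) absolutely_integrable_on {0..T}" by (rule absolutely_integrable_continuous[OF cW])
    have "(\<lambda>t. x \<bullet> (u t - W t)) absolutely_integrable_on {0..T}"
      using set_integral_diff(1)[OF iu iW] by (simp add: inner_diff_right)
    moreover have "integral {0..T} (\<lambda>t. deriv \<phi> t * (x \<bullet> (u t - W t))) = 0" if \<phi>: "\<phi> \<in> test_functions {0<..<T}" for \<phi>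
    proof -
      have sm: "smooth \<phi>" and out: "\<phi> 0 = 0" "\<phi> T = 0" using \<phi> unfolding test_functions_iff by force+
      have "integral {0..T} (\<lambda>t. deriv \<phi> t * (x \<bullet> u t)) = - integral {0..T} (\<lambda>t. \<phi> t * (x \<bullet> w t))"
        using weak_deriv_functional[OF u w weak \<phi> inner_bl] by simp
      moreover have "integral {0..T} (\<lambda>t. deriv \<phi> t * (x \<bullet> W t)) + integral {0..T} (\<lambda>t. \<phi> t * (x \<bullet> w t)) = 0"
        using integral_by_parts_absolutely_continuous(2)[OF _ wi xW smooth_DERIV[OF sm] smooth_continuous_on[OF smooth_deriv[OF sm]]] T
        by (simp add: out)
      moreover have "integral {0..T} (\<lambda>t. deriv \<phi> t * (x \<bullet> (u t - W t)))
          = integral {0..T} (\<lambda>t. deriv \<phi> t * (x \<bullet> u t)) - integral {0..T} (\<lambda>t. deriv \<phi> t * (x \<bullet> W t))"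
      proof -
        have "(\<lambda>t. deriv \<phi> t * (x \<bullet> u t)) integrable_on {0..T}" "(\<lambda>t. deriv \<phi> t * (x \<bullet> W t)) integrable_on {0..T}"
          using test_function_integrable_mult[OF test_functions_deriv[OF \<phi>] iu]
            test_function_integrable_mult[OF test_functions_deriv[OF \<phi>] iW]
          by (auto simp: absolutely_integrable_on_def)
        from Henstock_Kurzweil_Integration.integral_diff[OF this] show ?thesis
          by (simp add: inner_diff_right right_diff_distrib)
      qed
      ultimately show ?thesis by simp
    qed
    ultimately show ?thesis using du_bois_reymond[OF T] by blast
  qed
  then obtain c where c: "\<And>x. AE t in ?M. x \<bullet> (u t - W t) = c x"
    using choice[of "\<lambda>x c. AE t in ?M. x \<bullet> (u t - W t) = c"] by blast
  obtain D :: "'a set" where D: "countable D" "\<And>X. open X \<Longrightarrow> X \<noteq> {} \<Longrightarrow> \<exists>d\<in>D. d \<in> X"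
    using countable_dense_setE by blast
  have all: "AE t in ?M. \<forall>x\<in>D. x \<bullet> (u t - W t) = c x"
    using c D(1) by (simp add: AE_ball_countable)
  \<comment> \<open>One good time fixes all the constants at once: the constant vector is
    \<open>u t0 - W t0\<close>.\<close>
  obtain t0 where t0: "\<forall>x\<in>D. x \<bullet> (u t0 - W t0) = c x" using AE_nonempty[OF all T] by metis
  define d where "d t = W t + (u t0 - W t0)" for t
  have "AE t in ?M. d t = u t"
    using all
  proof eventually_elim
    case (elim t)
    have "(u t - W t) - (u t0 - W t0) = 0"
      by (rule inner_determines[OF D(2)]) (use elim t0 in \<open>simp_all add: inner_diff_right\<close>)
    then show ?case by (simp add: d_def algebra_simps)
  qed
  moreover have "primitive T d w" using Wp by (simp add: primitive_def d_def)
  ultimately show thesis by (rule that)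
qed

lemma primitive_norm_le:
  assumes p: "primitive T d w" and st: "0 \<le> s" "s \<le> t" "t \<le> T"
    and n: "(\<lambda>r. norm (w r)) integrable_on {s..t}"
  shows "norm (d t - d s) \<le> integral {s..t} (\<lambda>r. norm (w r))"
proof (rule norm_le_by_inner)
  show nonneg: "0 \<le> integral {s..t} (\<lambda>r. norm (w r))" by (simp add: Henstock_Kurzweil_Integration.integral_nonneg n)
  fix x
  have eq: "x \<bullet> (d t - d s) = integral {s..t} (\<lambda>r. x \<bullet> w r)" using p st by (simp add: primitive_def)
  show "x \<bullet> (d t - d s) \<le> integral {s..t} (\<lambda>r. norm (w r)) * norm x"
  proof (cases "(\<lambda>r. x \<bullet> w r) integrable_on {s..t}")
    case True
    have "integral {s..t} (\<lambda>r. x \<bullet> w r) \<le> integral {s..t} (\<lambda>r. norm (w r) * norm x)"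
      using True n by (intro integral_le integrable_on_mult_left) (auto simp: norm_cauchy_schwarz mult.commute)
    then show ?thesis by (simp add: eq)
  next
    case False
    then show ?thesis using nonneg by (simp add: eq not_integrable_integral)
  qed
qed

lemma integrable_on_subinterval_real:
  "f integrable_on {a..b} \<Longrightarrow> a \<le> c \<Longrightarrow> d \<le> b \<Longrightarrow> f integrable_on {c..d}"
  for f :: "real \<Rightarrow> real"
  using integrable_on_subinterval[of f "{a..b}" c d] by (simp add: subset_iff)

lemma primitive_continuous:
  assumes p: "primitive T d w" and n: "(\<lambda>r. norm (w r)) integrable_on {0..T}"
  shows "continuous_on {0..T} d"
proof -
  define A where "A t = integral {0..t} (\<lambda>r. norm (w r))" for t
  have cA: "continuous_on {0..T} A" unfolding A_def by (intro indefinite_integral_continuous_1 n)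
  have le: "norm (d t - d s) \<le> \<bar>A t - A s\<bar>" if "0 \<le> s" "s \<le> t" "t \<le> T" for s t
  proof -
    have "A s + integral {s..t} (\<lambda>r. norm (w r)) = A t"
      unfolding A_def using that
      by (intro Henstock_Kurzweil_Integration.integral_combine integrable_on_subinterval_real[OF n]) auto
    then show ?thesis
      using primitive_norm_le[OF p that integrable_on_subinterval_real[OF n]] that by simp
  qed
  show ?thesis unfolding continuous_on_def
  proof
    fix t assume t: "t \<in> {0..T}"
    have "((\<lambda>s. A s - A t) \<longlongrightarrow> 0) (at t within {0..T})"
      using cA t by (intro LIM_zero) (auto simp: continuous_on_def)
    then have a: "((\<lambda>s. \<bar>A s - A t\<bar>) \<longlongrightarrow> 0) (at t within {0..T})" by (rule tendsto_rabs_zero)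
    have "((\<lambda>s. d s - d t) \<longlongrightarrow> 0) (at t within {0..T})"
    proof (rule Lim_null_comparison[OF _ a])
      show "eventually (\<lambda>s. norm (d s - d t) \<le> \<bar>A s - A t\<bar>) (at t within {0..T})"
        unfolding eventually_at_filter
      proof (intro always_eventually allI impI)
        fix s assume "s \<noteq> t" "s \<in> {0..T}"
        then show "norm (d s - d t) \<le> \<bar>A s - A t\<bar>"
          using le[of s t] le[of t s] t by (cases "s \<le> t") (auto simp: norm_minus_commute abs_minus_commute)
      qed
    qed
    then show "(d \<longlongrightarrow> d t) (at t within {0..T})" by (rule LIM_zero_cancel)
  qed
qed

lemma AE_Ioo_integral_cong:
  fixes f g :: "real \<Rightarrow> real"
  assumes ae: "AE r in lebesgue_on {a<..<b}. f r = g r" and st: "a \<le> s" "t \<le> b"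
  shows "integral {s..t} f = integral {s..t} g"
proof -
  have "AE r in lebesgue. r \<in> {a<..<b} \<longrightarrow> f r = g r" using ae by (subst (asm) AE_restrict_space_iff) auto
  then obtain N where N: "negligible N" "\<And>r. r \<in> {a<..<b} \<Longrightarrow> r \<notin> N \<Longrightarrow> f r = g r"
    by (auto simp: eventually_ae_filter negligible_iff_null_sets)
  have "negligible (N \<union> {a, b})" using N(1) by (intro negligible_Un) auto
  then show ?thesis
    by (rule integral_spike) (use N(2) st in auto)
qed

lemma L2_UNIV: "u \<in> L2 I S \<Longrightarrow> u \<in> L2 I UNIV"
  by (simp add: L2_def)

lemma Hm_weak_deriv:
  assumes u: "u \<in> Hm I S m" and m: "1 \<le> m"
  shows "weak_deriv I m u \<in> L2 I UNIV \<and> is_weak_deriv I m u (weak_deriv I m u)"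
proof -
  have "m \<in> {1..m}" using m by simp
  then have "\<exists>w. w \<in> L2 I UNIV \<and> is_weak_deriv I m u w"
    using u L2_UNIV unfolding Hm_def by blast
  then show ?thesis unfolding weak_deriv_def by (rule someI_ex)
qed

text \<open>Testing the weak derivative of order j with \<open>deriv \<phi>\<close> shows that the
  next one is its own weak derivative, so every order below \<open>m\<close> has an absolutely
  continuous representative. Order \<open>m\<close> is merely in L2 and kept as it is.\<close>

lemma Hm_representatives:
  fixes u :: "real \<Rightarrow> 'a::{real_inner,complete_space,second_countable_topology}"
  assumes T: "T > 0" and u: "u \<in> Hm {0<..<T} S m" and m: "1 \<le> m"
  obtains D where "AE t in lebesgue_on {0<..<T}. D 0 t = u t"
    "\<And>j. j < m \<Longrightarrow> primitive T (D j) (D (Suc j))" "\<And>j. j < m \<Longrightarrow> continuous_on {0..T} (D j)"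
    "D m = weak_deriv {0<..<T} m u"
proof -
  let ?I = "{0<..<T}"
  \<comment> \<open>Both ends are prescribed: order 0 is \<open>u\<close> itself, and order
    \<open>m\<close> is the choice made in \<open>weak_deriv\<close>, whose norm appears in the
    estimate.\<close>
  have "\<exists>w. w \<in> L2 ?I UNIV \<and> is_weak_deriv ?I j u w \<and> (j = 0 \<longrightarrow> w = u) \<and> (j = m \<longrightarrow> w = weak_deriv ?I m u)" if jm: "j \<le> m" for j
  proof -
    consider "j = 0" | "j = m" "j \<noteq> 0" | "j \<in> {1..m}" "j \<noteq> m" "j \<noteq> 0"
      using jm by (cases "j = 0"; cases "j = m") auto
    then show ?thesis
    proof cases
      case 1
      then show ?thesis using u m by (intro exI[of _ u]) (auto simp: Hm_def L2_def is_weak_deriv_def)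
    next
      case 2
      then show ?thesis using Hm_weak_deriv[OF u m] by auto
    next
      case 3
      then obtain w where "w \<in> L2 ?I S" "is_weak_deriv ?I j u w" using u unfolding Hm_def by blast
      then show ?thesis using 3 L2_UNIV by blast
    qed
  qed
  then have "\<forall>j\<in>{..m}. \<exists>w. w \<in> L2 ?I UNIV \<and> is_weak_deriv ?I j u w \<and> (j = 0 \<longrightarrow> w = u) \<and> (j = m \<longrightarrow> w = weak_deriv ?I m u)"
    by simp
  from bchoice[OF this] obtain w where w': "\<And>j. j \<le> m \<Longrightarrow> w j \<in> L2 ?I UNIV \<and> is_weak_deriv ?I j u (w j)
      \<and> (j = 0 \<longrightarrow> w j = u) \<and> (j = m \<longrightarrow> w j = weak_deriv ?I m u)" by auto
  then have w: "\<And>j. j \<le> m \<Longrightarrow> w j \<in> L2 ?I UNIV" "\<And>j. j \<le> m \<Longrightarrow> is_weak_deriv ?I j u (w j)"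
    "w 0 = u" "w m = weak_deriv ?I m u" by auto
  have step: "is_weak_deriv ?I 1 (w j) (w (Suc j))" if j: "j < m" for j
    unfolding is_weak_deriv_def
  proof
    fix \<phi> assume \<phi>: "\<phi> \<in> test_functions ?I"
    let ?M = "lebesgue_on ?I"
    have "(LINT t|?M. (deriv ^^ j) (deriv \<phi>) t *\<^sub>R u t) = (-1) ^ j *\<^sub>R (LINT t|?M. deriv \<phi> t *\<^sub>R w j t)"
      using w(2)[of j] j test_functions_deriv[OF \<phi>] by (simp add: is_weak_deriv_def)
    moreover have "(LINT t|?M. (deriv ^^ Suc j) \<phi> t *\<^sub>R u t) = (-1) ^ Suc j *\<^sub>R (LINT t|?M. \<phi> t *\<^sub>R w (Suc j) t)"
      using w(2)[OF Suc_leI[OF j]] \<phi> unfolding is_weak_deriv_def by blast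
    moreover have "(deriv ^^ Suc j) \<phi> = (deriv ^^ j) (deriv \<phi>)" by (simp add: funpow_swap1)
    ultimately have "(-1) ^ j *\<^sub>R (LINT t|?M. deriv \<phi> t *\<^sub>R w j t) = (-1) ^ j *\<^sub>R ((-1) *\<^sub>R (LINT t|?M. \<phi> t *\<^sub>R w (Suc j) t))"
      by simp
    then show "(LINT t|?M. (deriv ^^ 1) \<phi> t *\<^sub>R w j t) = (-1) ^ 1 *\<^sub>R (LINT t|?M. \<phi> t *\<^sub>R w (Suc j) t)"
      by (simp only: scaleR_cancel_left) simp
  qed
  have "\<exists>d. (AE t in lebesgue_on ?I. d t = w j t) \<and> primitive T d (w (Suc j))" if j: "j < m" for j
    using absolutely_continuous_representative[OF T w(1)[OF less_imp_le[OF j]] w(1)[OF Suc_leI[OF j]] step[OF j]]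
    by blast
  then obtain d where d: "\<And>j. j < m \<Longrightarrow> AE t in lebesgue_on ?I. d j t = w j t"
    "\<And>j. j < m \<Longrightarrow> primitive T (d j) (w (Suc j))" by metis
  define D where "D j = (if j < m then d j else w j)" for j
  have D: "AE t in lebesgue_on ?I. D j t = w j t" for j
    unfolding D_def using d(1) by simp
  show thesis
  proof (rule that)
    show "AE t in lebesgue_on ?I. D 0 t = u t" using D[of 0] w(3) by simp
    show "primitive T (D j) (D (Suc j))" if "j < m" for j
      unfolding primitive_def
    proof (intro allI impI)
      fix x s t assume st: "0 \<le> s" "s \<le> t" "t \<le> T"
      have "AE r in lebesgue_on ?I. x \<bullet> w (Suc j) r = x \<bullet> D (Suc j) r"
        using D[of "Suc j"] by eventually_elim simp
      then have "integral {s..t} (\<lambda>r. x \<bullet> w (Suc j) r) = integral {s..t} (\<lambda>r. x \<bullet> D (Suc j) r)"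
        using st by (intro AE_Ioo_integral_cong)
      then show "x \<bullet> (D j t - D j s) = integral {s..t} (\<lambda>r. x \<bullet> D (Suc j) r)"
        using d(2)[OF that] st that by (simp add: primitive_def D_def)
    qed
    show "continuous_on {0..T} (D j)" if "j < m" for j
    proof -
      have "(\<lambda>r. norm (w (Suc j) r)) integrable_on {0..T}"
        using L2_norm_absolutely_integrable[OF w(1)] that by (simp add: absolutely_integrable_on_def)
      from primitive_continuous[OF d(2)[OF that] this] show ?thesis using that by (simp add: D_def)
    qed
    show "D m = weak_deriv ?I m u" using w(4) by (simp add: D_def)
  qed
qed

section \<open>Polynomial approximation on a cell\<close>

lemma primitive_diff:
  assumes "primitive T d w" "primitive T e v"
    and "\<And>x. (\<lambda>r. x \<bullet> w r) integrable_on {0..T}" "\<And>x. (\<lambda>r. x \<bullet> v r) integrable_on {0..T}"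
  shows "primitive T (\<lambda>t. d t - e t) (\<lambda>t. w t - v t)"
  unfolding primitive_def
proof (intro allI impI)
  fix x s t assume st: "0 \<le> s" "s \<le> t" "t \<le> T"
  have i: "(\<lambda>r. x \<bullet> w r) integrable_on {s..t}" "(\<lambda>r. x \<bullet> v r) integrable_on {s..t}"
    using integrable_on_subinterval_real[OF assms(3)] integrable_on_subinterval_real[OF assms(4)] st by auto
  have "x \<bullet> (d t - e t - (d s - e s)) = x \<bullet> (d t - d s) - x \<bullet> (e t - e s)" by (simp add: inner_diff_right)
  also have "\<dots> = integral {s..t} (\<lambda>r. x \<bullet> (w r - v r))"
    using assms(1,2) st Henstock_Kurzweil_Integration.integral_diff[OF i]
    by (simp add: primitive_def inner_diff_right)
  finally show "x \<bullet> (d t - e t - (d s - e s)) = integral {s..t} (\<lambda>r. x \<bullet> (w r - v r))" .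
qed

lemma primitive_vp: "primitive T (vp q c) (vd q c)"
  unfolding primitive_def
proof (intro allI impI)
  fix x s t assume st: "0 \<le> s" "s \<le> t" "t \<le> T"
  have "((\<lambda>r. x \<bullet> vd q c r) has_integral x \<bullet> vp q c t - x \<bullet> vp q c s) {s..t}"
    using st by (intro fundamental_theorem_of_calculus
        bounded_linear.has_vector_derivative[OF bounded_linear_inner_right vp_has_vector_derivative]) auto
  then show "x \<bullet> (vp q c t - vp q c s) = integral {s..t} (\<lambda>r. x \<bullet> vd q c r)"
    by (simp add: integral_unique inner_diff_right)
qed

text \<open>The polynomial is obtained by integrating one for the derivative and fixing the value at
  0. On the unit interval this integration does not increase the bound for the error.\<close>

lemma taylor_remainder:
  fixes E :: "nat \<Rightarrow> real \<Rightarrow> 'a::real_inner"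
  assumes "\<And>j. j \<le> m \<Longrightarrow> primitive 1 (E j) (E (Suc j))" "\<And>j. j \<le> m \<Longrightarrow> continuous_on {0..1} (E j)"
    and "(\<lambda>r. norm (E (Suc m) r)) integrable_on {0..1}"
  shows "\<exists>c. \<forall>s\<in>{0..1}. norm (E 0 s - vp (Suc m) c s) \<le> integral {0..1} (\<lambda>r. norm (E (Suc m) r))"
  using assms
proof (induction m arbitrary: E)
  case 0
  have "norm (E 0 s - vp (Suc 0) (\<lambda>_. E 0 0) s) \<le> integral {0..1} (\<lambda>r. norm (E (Suc 0) r))" if s: "s \<in> {0..1}" for s
  proof -
    have i: "(\<lambda>r. norm (E (Suc 0) r)) integrable_on {0..s}"
      using integrable_on_subinterval_real[OF "0.prems"(3)] s by auto
    have "norm (E 0 s - E 0 0) \<le> integral {0..s} (\<lambda>r. norm (E (Suc 0) r))"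
      using primitive_norm_le[OF "0.prems"(1)[of 0] _ _ _ i] s by auto
    also have "\<dots> \<le> integral {0..1} (\<lambda>r. norm (E (Suc 0) r))"
      using s i "0.prems"(3) by (intro integral_subset_le) auto
    finally show ?thesis by (simp add: vp_Suc)
  qed
  then show ?case by blast
next
  case (Suc m)
  define B where "B = integral {0..1} (\<lambda>r. norm (E (Suc (Suc m)) r))"
  have "\<exists>c. \<forall>s\<in>{0..1}. norm (E (Suc 0) s - vp (Suc m) c s) \<le> B"
    unfolding B_def by (rule Suc.IH[of "\<lambda>j. E (Suc j)"]) (use Suc.prems in auto)
  then obtain c' where c': "\<And>s. s \<in> {0..1} \<Longrightarrow> norm (E (Suc 0) s - vp (Suc m) c' s) \<le> B" by blast
  define c where "c j = (case j of 0 \<Rightarrow> E 0 0 | Suc i \<Rightarrow> inverse (real (Suc i)) *\<^sub>R c' i)" for j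
  have vd: "vd (Suc (Suc m)) c = vp (Suc m) c'" by (simp add: vd_def fun_eq_iff c_def)
  have cE: "continuous_on {0..1} (E (Suc 0))" using Suc.prems(2)[of "Suc 0"] by simp
  have p: "primitive 1 (\<lambda>t. E 0 t - vp (Suc (Suc m)) c t) (\<lambda>t. E (Suc 0) t - vp (Suc m) c' t)"
    using Suc.prems(1)[of 0] primitive_vp[of 1 "Suc (Suc m)" c] unfolding vd
    by (intro primitive_diff integrable_continuous_real continuous_intros cE) auto
  have "norm (E 0 s - vp (Suc (Suc m)) c s) \<le> B" if s: "s \<in> {0..1}" for s
  proof -
    have i: "(\<lambda>r. norm (E (Suc 0) r - vp (Suc m) c' r)) integrable_on {0..s}"
      using s by (intro integrable_continuous_real continuous_intros continuous_on_subset[OF cE]) auto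
    have B: "B \<ge> 0" using c'[of 0] by (meson atLeastAtMost_iff norm_ge_zero order_refl order_trans zero_le_one)
    have "norm (E 0 s - vp (Suc (Suc m)) c s - (E 0 0 - vp (Suc (Suc m)) c 0))
        \<le> integral {0..s} (\<lambda>r. norm (E (Suc 0) r - vp (Suc m) c' r))"
      by (rule primitive_norm_le[OF p _ _ _ i]) (use s in auto)
    also have "\<dots> \<le> integral {0..s} (\<lambda>r. B)"
      using c' s by (intro integral_le i) auto
    also have "\<dots> \<le> B" using s B by (simp add: mult_left_le_one_le)
    finally show ?thesis by (simp add: vp_at_0 c_def)
  qed
  then show ?case unfolding B_def by blast
qed

text \<open>The integral of (f - A)^2 is nonnegative, with \<open>A\<close> the mean of
  \<open>f\<close>.\<close>

lemma integral_square_le: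
  fixes f :: "real \<Rightarrow> real"
  assumes "f integrable_on {0..1}" "(\<lambda>r. (f r)\<^sup>2) integrable_on {0..1}"
  shows "(integral {0..1} f)\<^sup>2 \<le> integral {0..1} (\<lambda>r. (f r)\<^sup>2)"
proof -
  define A where "A = integral {0..1} f"
  have "0 \<le> integral {0..1} (\<lambda>r. (f r)\<^sup>2 - (2 * A * f r - A\<^sup>2))"
  proof (rule Henstock_Kurzweil_Integration.integral_nonneg)
    show "(\<lambda>r. (f r)\<^sup>2 - (2 * A * f r - A\<^sup>2)) integrable_on {0..1}"
      using assms by (intro integrable_diff integrable_on_mult_right integrable_const_ivl)
    show "0 \<le> (f r)\<^sup>2 - (2 * A * f r - A\<^sup>2)" for r
      using zero_le_power2[of "f r - A"] by (simp add: power2_diff algebra_simps)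
  qed
  also have "\<dots> = integral {0..1} (\<lambda>r. (f r)\<^sup>2) - integral {0..1} (\<lambda>r. 2 * A * f r - A\<^sup>2)"
    using assms by (intro Henstock_Kurzweil_Integration.integral_diff integrable_diff integrable_on_mult_right integrable_const_ivl)
  also have "integral {0..1} (\<lambda>r. 2 * A * f r - A\<^sup>2) = integral {0..1} (\<lambda>r. 2 * A * f r) - integral {0..1} (\<lambda>r::real. A\<^sup>2)"
    using assms by (intro Henstock_Kurzweil_Integration.integral_diff integrable_on_mult_right integrable_const_ivl)
  also have "\<dots> = 2 * A * A - A\<^sup>2" by (simp add: A_def)
  finally show ?thesis by (simp add: A_def power2_eq_square)
qed

lemma has_integral_affine:
  fixes f :: "real \<Rightarrow> real"
  assumes k: "k > 0" and f: "f integrable_on {a + k * s..a + k * t}" and st: "s \<le> t"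
  shows "((\<lambda>r. f (a + k * r)) has_integral (1 / k) * integral {a + k * s..a + k * t} f) {s..t}"
proof -
  have "(f has_integral integral {a + k * s..a + k * t} f) (cbox (a + k * s) (a + k * t))"
    using integrable_integral[OF f] by simp
  from has_integral_affinity[OF this, of k a]
  have h: "((\<lambda>x. f (k * x + a)) has_integral (1 / k) * integral {a + k * s..a + k * t} f)
      ((\<lambda>x. (1 / k) * x + - ((1 / k) * a)) ` {a + k * s..a + k * t})"
    using k by (simp add: divide_inverse abs_of_pos)
  have "(\<lambda>x. (1 / k) * x + - ((1 / k) * a)) ` {a + k * s..a + k * t} = {s..t}"
    using k st by (subst image_affinity_atLeastAtMost) (auto simp: field_simps)
  with h show ?thesis by (simp add: add.commute)
qed

lemma absolutely_integrable_affine: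
  fixes f :: "real \<Rightarrow> real"
  assumes "k > 0" "f absolutely_integrable_on {a + k * s..a + k * t}" "s \<le> t"
  shows "(\<lambda>r. f (a + k * r)) absolutely_integrable_on {s..t}"
    "integral {s..t} (\<lambda>r. f (a + k * r)) = (1 / k) * integral {a + k * s..a + k * t} f"
  using has_integral_affine[OF assms(1) _ assms(3), of f a] has_integral_affine[OF assms(1) _ assms(3), of "\<lambda>r. \<bar>f r\<bar>" a] assms(2)
  unfolding absolutely_integrable_on_def by (auto simp: integral_unique)

text \<open>The scaling \<open>E\<^sub>j(\<sigma>) = k\<^sup>j D\<^sub>j(a + k\<sigma>)\<close> turns the derivatives on a cell of length \<open>k\<close> into derivatives on
  the unit interval.\<close>

lemma cell_taylor:
  fixes D :: "nat \<Rightarrow> real \<Rightarrow> 'a::{real_inner,complete_space,second_countable_topology}"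
  assumes m: "1 \<le> m" and a: "0 \<le> a" "a + k \<le> T" "k > 0"
    and D: "\<And>j. j < m \<Longrightarrow> primitive T (D j) (D (Suc j))" "\<And>j. j < m \<Longrightarrow> continuous_on {0..T} (D j)"
    and Dm: "D m \<in> L2 {0<..<T} S"
  shows "\<exists>c. \<forall>s\<in>{0..1}. (norm (D 0 (a + k * s) - vp m c s))\<^sup>2
    \<le> k ^ (2 * m - 1) * integral {a..a + k} (\<lambda>r. (norm (D m r))\<^sup>2)"
proof -
  define E where "E j s = k ^ j *\<^sub>R D j (a + k * s)" for j s
  obtain m' where m': "m = Suc m'" using m by (cases m) auto
  have n1: "(\<lambda>r. norm (D m r)) absolutely_integrable_on {a..a + k}"
    using absolutely_integrable_subinterval[OF L2_norm_absolutely_integrable[OF Dm]] a by auto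
  have "(\<lambda>r. (norm (D m r))\<^sup>2) absolutely_integrable_on {0..T}"
    using Dm by (simp add: L2_def integrable_Ioo_iff)
  then have n2: "(\<lambda>r. (norm (D m r))\<^sup>2) absolutely_integrable_on {a..a + k}"
    using absolutely_integrable_subinterval a by auto
  have xm: "(\<lambda>r. x \<bullet> D m r) absolutely_integrable_on {0..T}" for x
    by (rule L2_absolutely_integrable[OF Dm bounded_linear_inner_right])
  have xj: "(\<lambda>r. x \<bullet> D j r) absolutely_integrable_on {0..T}" if "j \<le> m" for x j
  proof (cases "j = m")
    case False
    then show ?thesis using that by (intro absolutely_integrable_continuous continuous_intros D(2)) auto
  qed (use xm in simp)
  have sub: "{a..a + k} \<subseteq> {0..T}" using a by auto
  have prim: "primitive 1 (E j) (E (Suc j))" if j: "j < m" for j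
    unfolding primitive_def
  proof (intro allI impI)
    fix x :: 'a and s t :: real assume st: "0 \<le> s" "s \<le> t" "t \<le> 1"
    have "k * t \<le> k" "k * s \<le> k * t" "0 \<le> k * s"
      using st a(3) by (auto intro: mult_left_mono simp: mult_left_le)
    then have b: "0 \<le> a + k * s" "a + k * s \<le> a + k * t" "a + k * t \<le> T" using a by linarith+
    have i: "(\<lambda>r. x \<bullet> D (Suc j) r) absolutely_integrable_on {a + k * s..a + k * t}"
      using absolutely_integrable_subinterval[OF xj] j b by auto
    have "integral {s..t} (\<lambda>r. x \<bullet> E (Suc j) r) = k ^ Suc j * integral {s..t} (\<lambda>r. x \<bullet> D (Suc j) (a + k * r))"
      by (simp add: E_def)
    also have "\<dots> = k ^ j * (x \<bullet> (D j (a + k * t) - D j (a + k * s)))"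
      using absolutely_integrable_affine(2)[OF a(3) i st(2)] D(1)[OF j] b a(3) by (simp add: primitive_def)
    also have "\<dots> = x \<bullet> (E j t - E j s)" by (simp add: E_def inner_diff_right right_diff_distrib)
    finally show "x \<bullet> (E j t - E j s) = integral {s..t} (\<lambda>r. x \<bullet> E (Suc j) r)" by simp
  qed
  have cont: "continuous_on {0..1} (E j)" if j: "j < m" for j
  proof -
    have "continuous_on {0..1} (\<lambda>s. D j (a + k * s))"
    proof (rule continuous_on_compose2[OF D(2)[OF j]])
      show "(\<lambda>s. a + k * s) ` {0..1} \<subseteq> {0..T}"
      proof
        fix y assume "y \<in> (\<lambda>s. a + k * s) ` {0..1}"
        then obtain s where s: "s \<in> {0..1}" "y = a + k * s" by blast
        then have "k * s \<le> k * 1" "0 \<le> k * s" using a(3) by (auto intro: mult_left_mono)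
        then have "0 \<le> a + k * s" "a + k * s \<le> T" using a by linarith+
        then show "y \<in> {0..T}" using s(2) by simp
      qed
    qed (intro continuous_intros)
    then show ?thesis unfolding E_def by (intro continuous_intros)
  qed
  have n1': "(\<lambda>r. norm (D m (a + k * r))) absolutely_integrable_on {0..1}"
    and n2': "(\<lambda>r. (norm (D m (a + k * r)))\<^sup>2) absolutely_integrable_on {0..1}"
    and n2'': "integral {0..1} (\<lambda>r. (norm (D m (a + k * r)))\<^sup>2) = (1 / k) * integral {a..a + k} (\<lambda>r. (norm (D m r))\<^sup>2)"
    using absolutely_integrable_affine[where k = k and a = a and s = 0 and t = 1 and f = "\<lambda>r. norm (D m r)"] n1
      absolutely_integrable_affine[where k = k and a = a and s = 0 and t = 1 and f = "\<lambda>r. (norm (D m r))\<^sup>2"] n2 a(3) by auto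
  have nE: "norm (E m r) = k ^ m * norm (D m (a + k * r))" for r using a(3) by (simp add: E_def)
  have i1: "(\<lambda>r. norm (E m r)) integrable_on {0..1}"
    unfolding nE using n1' by (intro integrable_on_mult_right) (simp add: absolutely_integrable_on_def)
  have i2: "(\<lambda>r. (norm (E m r))\<^sup>2) integrable_on {0..1}"
    unfolding nE power_mult_distrib using n2' by (intro integrable_on_mult_right) (simp add: absolutely_integrable_on_def)
  have "\<exists>c. \<forall>s\<in>{0..1}. norm (E 0 s - vp (Suc m') c s) \<le> integral {0..1} (\<lambda>r. norm (E (Suc m') r))"
    by (rule taylor_remainder) (use prim cont i1 m' in auto)
  then obtain c where c: "\<And>s. s \<in> {0..1} \<Longrightarrow> norm (E 0 s - vp m c s) \<le> integral {0..1} (\<lambda>r. norm (E m r))"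
    unfolding m' by blast
  have "(norm (D 0 (a + k * s) - vp m c s))\<^sup>2 \<le> k ^ (2 * m - 1) * integral {a..a + k} (\<lambda>r. (norm (D m r))\<^sup>2)"
    if s: "s \<in> {0..1}" for s
  proof -
    have "(norm (D 0 (a + k * s) - vp m c s))\<^sup>2 \<le> (integral {0..1} (\<lambda>r. norm (E m r)))\<^sup>2"
      using c[OF s] by (intro power_mono) (auto simp: E_def)
    also have "\<dots> \<le> integral {0..1} (\<lambda>r. (norm (E m r))\<^sup>2)" by (rule integral_square_le[OF i1 i2])
    \<comment> \<open>The scaling of the derivative of order m contributes k^(2m), the change of
      variables 1/k.\<close>
    also have "\<dots> = (k ^ m)\<^sup>2 * ((1 / k) * integral {a..a + k} (\<lambda>r. (norm (D m r))\<^sup>2))"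
      unfolding nE power_mult_distrib by (simp add: n2'')
    also have "\<dots> = (k ^ m)\<^sup>2 * (1 / k) * integral {a..a + k} (\<lambda>r. (norm (D m r))\<^sup>2)" by simp
    also have "(k ^ m)\<^sup>2 * (1 / k) = k ^ (2 * m - 1)"
      using a(3) m by (simp add: power_mult[symmetric] power_diff mult.commute)
    finally show ?thesis .
  qed
  then show ?thesis by blast
qed

section \<open>Transfer to the reference cell\<close>

lemma AE_lebesgue_on_negligible:
  assumes "AE t in lebesgue_on {a<..<b}. P t"
  obtains N where "negligible N" "\<And>t::real. t \<in> {a<..<b} \<Longrightarrow> t \<notin> N \<Longrightarrow> P t"
proof -
  have "AE t in lebesgue. t \<in> {a<..<b} \<longrightarrow> P t" using assms by (subst (asm) AE_restrict_space_iff) auto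
  then show thesis using that by (auto simp: eventually_ae_filter negligible_iff_null_sets)
qed

lemma AE_dense:
  assumes "AE t in lebesgue_on {a<..<b}. P t" "a \<le> l" "l < r" "r \<le> (b::real)"
  shows "\<exists>t\<in>{l<..<r}. P t"
proof -
  obtain N where N: "negligible N" "\<And>t. t \<in> {a<..<b} \<Longrightarrow> t \<notin> N \<Longrightarrow> P t"
    using AE_lebesgue_on_negligible[OF assms(1)] by blast
  have "\<not> {l<..<r} \<subseteq> N"
  proof
    assume "{l<..<r} \<subseteq> N"
    then have "negligible {l<..<r}" using N(1) negligible_subset by blast
    then show False using assms(3) by (simp add: open_not_negligible)
  qed
  then obtain x where x: "x \<in> {l<..<r}" "x \<notin> N" by blast
  then have "x \<in> {a<..<b}" using assms(2,4) by auto
  with x N(2) show ?thesis by blast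
qed

text \<open>Identities that hold almost everywhere reach a node along a sequence of good times,
  where both sides have limits.\<close>

lemma AE_left_sequence:
  assumes ae: "AE t in lebesgue_on {a<..<b}. P t" and t: "a < t" "t \<le> (b::real)"
  obtains s where "\<And>n::nat. s n \<in> {a<..<t}" "\<And>n. P (s n)" "s \<longlonglongrightarrow> t"
proof -
  have "\<exists>s\<in>{max a (t - inverse (real (Suc n)))<..<t}. P s" for n
    using t by (intro AE_dense[OF ae]) (auto simp: max_def)
  then obtain s where s: "\<And>n. s n \<in> {max a (t - inverse (real (Suc n)))<..<t}" "\<And>n. P (s n)" by metis
  have "s \<longlonglongrightarrow> t"
  proof (rule real_tendsto_sandwich)
    show "eventually (\<lambda>n. t - inverse (real (Suc n)) \<le> s n) sequentially"
      using s(1) by (intro always_eventually allI) (simp add: less_imp_le)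
    show "eventually (\<lambda>n. s n \<le> t) sequentially"
      using s(1) by (intro always_eventually allI) (simp add: less_imp_le)
    show "(\<lambda>n. t - inverse (real (Suc n))) \<longlonglongrightarrow> t"
      using tendsto_diff[OF tendsto_const[of t] LIMSEQ_inverse_real_of_nat] by simp
  qed simp
  then show thesis using s that[of s] by auto
qed

lemma AE_right_sequence:
  assumes ae: "AE t in lebesgue_on {a<..<b}. P t" and ab: "a < (b::real)"
  obtains s where "\<And>n::nat. s n \<in> {a<..<b}" "\<And>n. P (s n)" "s \<longlonglongrightarrow> a"
proof -
  have "\<exists>s\<in>{a<..<min b (a + inverse (real (Suc n)))}. P s" for n
    using ab by (intro AE_dense[OF ae]) (auto simp: min_def)
  then obtain s where s: "\<And>n. s n \<in> {a<..<min b (a + inverse (real (Suc n)))}" "\<And>n. P (s n)" by metis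
  have "s \<longlonglongrightarrow> a"
  proof (rule real_tendsto_sandwich)
    show "eventually (\<lambda>n. s n \<le> a + inverse (real (Suc n))) sequentially"
      using s(1) by (intro always_eventually allI) (simp add: less_imp_le)
    show "eventually (\<lambda>n. a \<le> s n) sequentially"
      using s(1) by (intro always_eventually allI) (simp add: less_imp_le)
    show "(\<lambda>n. a + inverse (real (Suc n))) \<longlonglongrightarrow> a"
      using tendsto_add[OF tendsto_const[of a] LIMSEQ_inverse_real_of_nat] by simp
  qed simp
  then show thesis using s that[of s] by auto
qed

lemma continuous_on_sequence:
  assumes "continuous_on A d" "\<And>n. s n \<in> A" "s \<longlonglongrightarrow> t" "t \<in> A"
  shows "(\<lambda>n. d (s n)) \<longlonglongrightarrow> d t"
  by (rule continuous_on_tendsto_compose[OF assms(1,3,4)]) (simp add: assms(2))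

lemma continuous_in_closed_if_AE:
  fixes d :: "real \<Rightarrow> 'a::metric_space"
  assumes T: "0 < T" and cont: "continuous_on {0..T} d" and ae: "AE t in lebesgue_on {0<..<T}. d t \<in> S"
    and S: "closed S" and t: "t \<in> {0..T}"
  shows "d t \<in> S"
proof (cases "t = 0")
  case True
  obtain s where s: "\<And>n::nat. s n \<in> {0<..<T}" "\<And>n. d (s n) \<in> S" "s \<longlonglongrightarrow> 0"
    using AE_right_sequence[OF ae T] by blast
  have "(\<lambda>n. d (s n)) \<longlonglongrightarrow> d t"
    using s(1) T by (intro continuous_on_sequence[OF cont]) (auto simp: True less_imp_le intro: s(3))
  with S s(2) show ?thesis by (rule closed_sequentially)
next
  case False
  obtain s where s: "\<And>n::nat. s n \<in> {0<..<t}" "\<And>n. d (s n) \<in> S" "s \<longlonglongrightarrow> t"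
    using AE_left_sequence[OF ae, of t] False t by auto
  have "s n \<in> {0..T}" for n using s(1)[of n] t by auto
  then have "(\<lambda>n. d (s n)) \<longlonglongrightarrow> d t" by (intro continuous_on_sequence[OF cont] s(3) t)
  with S s(2) show ?thesis by (rule closed_sequentially)
qed

section \<open>Functionals, and functions with values in a dual space\<close>

lemma dual_norm_upper:
  assumes "subspace S" "F \<in> dual S" "v \<in> S"
  shows "\<bar>F v\<bar> \<le> dual_norm S F * norm v"
proof (cases "v = 0")
  case True
  have "F (0 *\<^sub>R 0) = 0 *\<^sub>R F 0" using assms unfolding dual_def linear_on_def using subspace_0 by blast
  then show ?thesis using True by simp
next
  case False
  obtain C where C: "\<And>v. v \<in> S \<Longrightarrow> \<bar>F v\<bar> \<le> C * norm v" using assms(2) by (auto simp: dual_def)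
  define w where "w = inverse (norm v) *\<^sub>R v"
  have w: "w \<in> {v\<in>S. norm v \<le> 1}" using assms False by (simp add: w_def subspace_scale)
  have "bdd_above ((\<lambda>v. \<bar>F v\<bar>) ` {v\<in>S. norm v \<le> 1})"
  proof (rule bdd_aboveI2)
    fix x assume "x \<in> {v\<in>S. norm v \<le> 1}"
    then show "\<bar>F x\<bar> \<le> \<bar>C\<bar> * 1" using C[of x]
      by (metis (mono_tags, lifting) abs_ge_self abs_ge_zero mem_Collect_eq mult_mono norm_ge_zero order_trans)
  qed
  then have "\<bar>F w\<bar> \<le> dual_norm S F" unfolding dual_norm_def using w by (rule cSUP_upper[rotated])
  moreover have "F w = inverse (norm v) * F v" using assms by (simp add: w_def dual_def linear_on_def)
  ultimately show ?thesis using False by (simp add: abs_mult field_simps)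
qed

lemma dual_diff:
  assumes "F \<in> dual S" "G \<in> dual S"
  shows "(\<lambda>v. F v - G v) \<in> dual S"
proof -
  obtain C C' where C: "\<And>v. v \<in> S \<Longrightarrow> \<bar>F v\<bar> \<le> C * norm v" "\<And>v. v \<in> S \<Longrightarrow> \<bar>G v\<bar> \<le> C' * norm v"
    using assms by (auto simp: dual_def)
  have "\<bar>F v - G v\<bar> \<le> (C + C') * norm v" if "v \<in> S" for v
    using C[OF that] by (simp add: distrib_right)
  moreover have "linear_on S (\<lambda>v. F v - G v)"
    using assms by (simp add: dual_def linear_on_def algebra_simps)
  ultimately show ?thesis unfolding dual_def by blast
qed

text \<open>Evaluation at \<open>v\<close> keeps simple functions measurable, and convergence in
  dual norm passes to evaluations. The exceptional null set is masked so that the convergence holds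
  at every time.\<close>

lemma L2_dual_absolutely_integrable:
  assumes S: "subspace S" and f: "f \<in> L2_dual {a<..<b} S" and v: "v \<in> S"
  shows "(\<lambda>t. f t v) absolutely_integrable_on {a..b}"
proof -
  let ?I = "{a<..<b}" let ?M = "lebesgue_on ?I"
  have fd: "\<And>t. t \<in> ?I \<Longrightarrow> f t \<in> dual S" and ni: "integrable ?M (\<lambda>t. (dual_norm S (f t))\<^sup>2)"
    using f by (auto simp: L2_dual_def)
  obtain s where s: "\<And>i. simple_function ?M (s i)" "\<And>i. s i ` ?I \<subseteq> dual S"
    and lim: "AE t in ?M. (\<lambda>i. dual_norm S (\<lambda>v. s i t v - f t v)) \<longlonglongrightarrow> 0"
    using f unfolding L2_dual_def dual_measurable_def by blast
  obtain N where N: "negligible N" "\<And>t. t \<in> ?I \<Longrightarrow> t \<notin> N \<Longrightarrow> (\<lambda>i. dual_norm S (\<lambda>v. s i t v - f t v)) \<longlonglongrightarrow> 0"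
    using AE_lebesgue_on_negligible[OF lim] by blast
  define h where "h t = (if t \<in> N then 0 else f t v)" for t
  define hs where "hs i t = indicator (- N) t * s i t v" for i t
  have "h \<in> borel_measurable ?M"
  proof (rule borel_measurable_LIMSEQ_real[where u = hs])
    show "hs i \<in> borel_measurable ?M" for i
      unfolding hs_def
    proof (rule borel_measurable_times)
      show "(\<lambda>t. s i t v) \<in> borel_measurable ?M"
        using simple_function_compose1[OF s(1)[of i], of "\<lambda>F. F v"] by (rule borel_measurable_simple_function)
      have "- N \<in> sets lebesgue" using sets.compl_sets[OF negligible_imp_sets[OF N(1)]] by (simp add: Compl_eq_Diff_UNIV)
      then show "indicator (- N) \<in> borel_measurable ?M"
        by (intro borel_measurable_indicator') (auto simp: sets_restrict_space)
    qed
    fix t assume "t \<in> space ?M"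
    then have t: "t \<in> ?I" by simp
    show "(\<lambda>i. hs i t) \<longlonglongrightarrow> h t"
    proof (cases "t \<in> N")
      case False
      have "(\<lambda>i. s i t v - f t v) \<longlonglongrightarrow> 0"
      proof (rule Lim_null_comparison)
        show "(\<lambda>i. dual_norm S (\<lambda>v. s i t v - f t v) * norm v) \<longlonglongrightarrow> 0"
          using tendsto_mult_left_zero[OF N(2)[OF t False]] by simp
        have "\<bar>s i t v - f t v\<bar> \<le> dual_norm S (\<lambda>v. s i t v - f t v) * norm v" for i
          using s(2)[of i] t by (intro dual_norm_upper[OF S _ v, of "\<lambda>v. s i t v - f t v"] dual_diff fd) auto
        then show "eventually (\<lambda>i. norm (s i t v - f t v) \<le> dual_norm S (\<lambda>v. s i t v - f t v) * norm v) sequentially"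
          by (intro always_eventually allI) simp
      qed
      then show ?thesis using False by (simp add: h_def hs_def LIM_zero_iff)
    qed (simp add: h_def hs_def)
  qed
  moreover have "norm (h t) \<le> norm ((1 + (dual_norm S (f t))\<^sup>2) * norm v)" if "t \<in> ?I" for t
  proof -
    have "dual_norm S (f t) \<le> 1 + (dual_norm S (f t))\<^sup>2"
      using zero_le_power2[of "dual_norm S (f t) - 1 / 2"] by (simp add: power2_diff power_divide)
    then have "dual_norm S (f t) * norm v \<le> (1 + (dual_norm S (f t))\<^sup>2) * norm v" by (intro mult_right_mono) auto
    then show ?thesis using dual_norm_upper[OF S fd[OF that] v] by (auto simp: h_def)
  qed
  moreover have "integrable ?M (\<lambda>t. (1 + (dual_norm S (f t))\<^sup>2) * norm v)"
    using ni by (intro integrable_mult_left Bochner_Integration.integrable_add)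
      (simp_all add: integrable_Ioo_iff absolutely_integrable_continuous)
  ultimately have "integrable ?M h"
    by (intro Bochner_Integration.integrable_bound[of ?M "\<lambda>t. (1 + (dual_norm S (f t))\<^sup>2) * norm v" h] AE_I2) auto
  then have "h absolutely_integrable_on {a..b}" by (simp add: integrable_Ioo_iff)
  then show ?thesis by (rule absolutely_integrable_spike[OF _ N(1)]) (simp add: h_def)
qed

text \<open>Every point of a half-open cell, its right end included, is a limit of points of the
  cell from the left, so the derivative taken within the cell is unambiguous.\<close>

lemma has_vector_derivative_within_Ioc_unique:
  fixes Y :: "real \<Rightarrow> 'a::real_normed_vector"
  assumes "(Y has_vector_derivative D) (at s within {a<..b})" "s \<in> {a<..b}"
  shows "vector_derivative Y (at s within {a<..b}) = D"
proof -
  have "s islimpt {a<..<s}" using assms(2) by (simp add: islimpt_greaterThanLessThan2)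
  then have "s islimpt {a<..b}" by (rule islimpt_subset) (use assms(2) in auto)
  then have "at s within {a<..b} \<noteq> bot" by (simp add: trivial_limit_within)
  then show ?thesis
    using vector_derivative_unique_within assms(1) vector_derivative_works by (metis differentiableI_vector)
qed

text \<open>Cells are numbered from 0 here: for n < N, \<open>cell t (Suc n)\<close> is the image of
  the unit interval without its left end under \<sigma> |-> n k + k \<sigma>.\<close>

locale uniform_grid =
  fixes T k :: real and N :: nat and t :: "nat \<Rightarrow> real"
  assumes k: "k > 0" and N: "N > 0" and T_eq: "T = real N * k" and t_eq: "\<And>n. n \<le> N \<Longrightarrow> t n = real n * k"
begin

lemma T_pos: "T > 0" using k N by (simp add: T_eq)

lemma cell_eq: "n < N \<Longrightarrow> cell t (Suc n) = {real n * k<..real n * k + k}"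
  by (simp add: cell_def t_eq algebra_simps)

lemma cell_point: "n < N \<Longrightarrow> \<sigma> \<in> {0<..1} \<Longrightarrow> real n * k + k * \<sigma> \<in> cell t (Suc n)"
  using k by (auto simp: cell_eq mult_left_le)

lemma cell_within: assumes "n < N" "\<sigma> \<in> {0..1}" shows "real n * k + k * \<sigma> \<in> {0..T}"
proof -
  have "real (Suc n) * k \<le> real N * k" using assms k by (intro mult_right_mono) auto
  moreover have "k * \<sigma> \<le> k" "0 \<le> k * \<sigma>" using assms k by (auto simp: mult_left_le)
  moreover have "0 \<le> real n * k" using k by simp
  ultimately show ?thesis unfolding T_eq by (auto simp: distrib_right)
qed

lemma cell_end: "n < N \<Longrightarrow> real n * k + k \<le> T" "0 \<le> real n * k"
  using cell_within[of n 1] k by auto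

lemma Pb_reference:
  assumes Y: "Y \<in> Pb q N t S" and S: "subspace S"
  obtains c where "\<And>n j. n < N \<Longrightarrow> j < q \<Longrightarrow> c n j \<in> S"
    "\<And>n \<sigma>. n < N \<Longrightarrow> \<sigma> \<in> {0<..1} \<Longrightarrow> Y (real n * k + k * \<sigma>) = vp q (c n) \<sigma>"
proof -
  have "\<exists>c. (\<forall>j<q. c j \<in> S) \<and> (\<forall>\<sigma>\<in>{0<..1}. Y (real n * k + k * \<sigma>) = vp q c \<sigma>)" if n: "n < N" for n
  proof -
    have "Suc n \<in> {1..N}" using n by simp
    then obtain e where e: "\<And>j. j < q \<Longrightarrow> e j \<in> S" "\<And>s. s \<in> cell t (Suc n) \<Longrightarrow> Y s = (\<Sum>j<q. s ^ j *\<^sub>R e j)"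
      using Y unfolding Pb_def by blast
    obtain d where "\<And>j. j < q \<Longrightarrow> d j \<in> S" "\<And>s. vp q e (real n * k + k * s) = vp q d s"
      using vp_affine[OF S, of q e "real n * k" k] e(1) by blast
    then show ?thesis using e(2) cell_point[OF n] by (intro exI[of _ d]) (auto simp: vp_def)
  qed
  then have "\<forall>n\<in>{..<N}. \<exists>c. (\<forall>j<q. c j \<in> S) \<and> (\<forall>\<sigma>\<in>{0<..1}. Y (real n * k + k * \<sigma>) = vp q c \<sigma>)" by simp
  from bchoice[OF this] obtain c where
    c: "\<forall>n\<in>{..<N}. (\<forall>j<q. c n j \<in> S) \<and> (\<forall>\<sigma>\<in>{0<..1}. Y (real n * k + k * \<sigma>) = vp q (c n) \<sigma>)" ..
  show thesis by (rule that[of c]) (use c in blast)+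
qed

lemma Pb_from_reference:
  fixes x :: "nat \<Rightarrow> nat \<Rightarrow> 'a::real_vector"
  assumes S: "subspace S" and x: "\<And>n j. n < N \<Longrightarrow> j < q \<Longrightarrow> x n j \<in> S"
  shows "\<exists>X\<in>Pb q N t S. \<forall>n<N. \<forall>\<sigma>\<in>{0<..1}. X (real n * k + k * \<sigma>) = vp q (x n) \<sigma>"
proof -
  \<comment> \<open>Cells are open on the left and closed on the right, hence ceiling minus
    one.\<close>
  define idx where "idx s = nat \<lceil>s / k\<rceil> - 1" for s
  define X where "X s = vp q (x (idx s)) ((s - real (idx s) * k) / k)" for s
  have idx: "idx s = n" if "s \<in> cell t (Suc n)" "n < N" for s n
  proof -
    have "real n < s / k" "s / k \<le> real n + 1" using that k by (auto simp: cell_eq field_simps)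
    then have "\<lceil>s / k\<rceil> = int n + 1" by (intro ceiling_unique) auto
    then show ?thesis by (simp add: idx_def)
  qed
  have "X \<in> Pb q N t S"
    unfolding Pb_def
  proof (intro CollectI ballI)
    fix n assume n: "n \<in> {1..N}"
    then obtain n' where n': "n = Suc n'" "n' < N" by (cases n) auto
    obtain d where d: "\<And>j. j < q \<Longrightarrow> d j \<in> S" "\<And>s. vp q (x n') (- real n' + (1 / k) * s) = vp q d s"
      using vp_affine[OF S, of q "x n'" "- real n'" "1 / k"] x[OF n'(2)] by blast
    have "X s = (\<Sum>j<q. s ^ j *\<^sub>R d j)" if "s \<in> cell t n" for s
    proof -
      have "X s = vp q (x n') (- real n' + (1 / k) * s)"
        using idx[of s n'] that n' k by (simp add: X_def diff_divide_distrib)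
      also have "\<dots> = (\<Sum>j<q. s ^ j *\<^sub>R d j)" using d(2)[of s] by (simp only: vp_def)
      finally show ?thesis .
    qed
    then show "\<exists>c. (\<forall>j<q. c j \<in> S) \<and> (\<forall>s\<in>cell t n. X s = (\<Sum>j<q. s ^ j *\<^sub>R c j))" using d(1) by blast
  qed
  moreover have "X (real n * k + k * \<sigma>) = vp q (x n) \<sigma>" if "n < N" "\<sigma> \<in> {0<..1}" for n \<sigma>
    using idx[OF cell_point[OF that] that(1)] k by (simp add: X_def)
  ultimately show ?thesis by blast
qed

text \<open>A change of variables; the exceptional set \<open>A\<close> lives in the original time
  because identities for the data hold almost everywhere there.\<close>

lemma integral_cell:
  fixes G :: "real \<Rightarrow> real"
  assumes G: "G absolutely_integrable_on {0..1}" and A: "negligible A"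
    and F: "\<And>\<sigma>. \<sigma> \<in> {0<..<1} \<Longrightarrow> \<alpha> + k * \<sigma> \<notin> A \<Longrightarrow> F (\<alpha> + k * \<sigma>) = G \<sigma>"
  shows "F absolutely_integrable_on {\<alpha>..\<alpha> + k}" "integral {\<alpha>..\<alpha> + k} F = k * integral {0..1} G"
proof -
  define F' where "F' s = G (- \<alpha> / k + (1 / k) * s)" for s
  have r: "- \<alpha> / k + (1 / k) * \<alpha> = 0" "- \<alpha> / k + (1 / k) * (\<alpha> + k) = 1" using k by (simp_all add: field_simps)
  have F': "F' absolutely_integrable_on {\<alpha>..\<alpha> + k}" "integral {\<alpha>..\<alpha> + k} F' = k * integral {0..1} G"
    using absolutely_integrable_affine[where k = "1 / k" and a = "- \<alpha> / k" and s = \<alpha> and t = "\<alpha> + k" and f = G, unfolded r] G k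
    by (simp_all add: F'_def[abs_def])
  have neg: "negligible (A \<union> {\<alpha>, \<alpha> + k})" using A by (intro negligible_Un) auto
  have eq: "F s = F' s" if s: "s \<in> {\<alpha>..\<alpha> + k} - (A \<union> {\<alpha>, \<alpha> + k})" for s
  proof -
    have "- \<alpha> / k + (1 / k) * s \<in> {0<..<1}" using s k by (auto simp: field_simps)
    moreover have "\<alpha> + k * (- \<alpha> / k + (1 / k) * s) = s" using k by (simp add: field_simps)
    ultimately show ?thesis using F[of "- \<alpha> / k + (1 / k) * s"] s by (simp add: F'_def)
  qed
  show "F absolutely_integrable_on {\<alpha>..\<alpha> + k}" by (rule absolutely_integrable_spike[OF F'(1) neg eq])
  show "integral {\<alpha>..\<alpha> + k} F = k * integral {0..1} G"
    unfolding F'(2)[symmetric] by (rule integral_spike[OF neg]) (simp add: eq)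
qed

lemma LINT_cell:
  fixes G :: "real \<Rightarrow> real"
  assumes n: "n < N" and G: "G absolutely_integrable_on {0..1}" and A: "negligible A"
    and F: "\<And>\<sigma>. \<sigma> \<in> {0<..<1} \<Longrightarrow> real n * k + k * \<sigma> \<notin> A \<Longrightarrow> F (real n * k + k * \<sigma>) = G \<sigma>"
  shows "integrable (lebesgue_on (cell t (Suc n))) F"
    "(LINT s|lebesgue_on (cell t (Suc n)). F s) = k * (LINT s|UI. G s)"
proof -
  let ?C = "{real n * k<..real n * k + k}"
  note c = integral_cell[OF G A F]
  have "F absolutely_integrable_on ?C"
    by (rule set_integrable_subset[OF c(1)]) auto
  then have i: "integrable (lebesgue_on ?C) F" by (simp add: integrable_lebesgue_on_iff)
  then show "integrable (lebesgue_on (cell t (Suc n))) F" by (simp add: cell_eq[OF n])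
  have "(LINT s|lebesgue_on ?C. F s) = integral ?C F"
    by (intro lebesgue_integral_eq_integral i) simp
  also have "\<dots> = integral {real n * k..real n * k + k} F"
  proof (rule integral_spike_set)
    show "negligible {s \<in> ?C - {real n * k..real n * k + k}. F s \<noteq> 0}" by (rule negligible_subset[of "{}"]) auto
    show "negligible {s \<in> {real n * k..real n * k + k} - ?C. F s \<noteq> 0}" by (rule negligible_subset[of "{real n * k}"]) auto
  qed
  finally show "(LINT s|lebesgue_on (cell t (Suc n)). F s) = k * (LINT s|UI. G s)"
    using c(2) LINT_Icc[OF G] by (simp add: cell_eq[OF n])
qed

lemma integral_cells:
  fixes G :: "nat \<Rightarrow> real \<Rightarrow> real"
  assumes G: "\<And>n. n < N \<Longrightarrow> integrable UI (G n)"
    and A: "negligible A"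
    and F: "\<And>n \<sigma>. n < N \<Longrightarrow> \<sigma> \<in> {0<..<1} \<Longrightarrow> real n * k + k * \<sigma> \<notin> A \<Longrightarrow> F (real n * k + k * \<sigma>) = G n \<sigma>"
  shows "F absolutely_integrable_on {0..T}" "(LINT s|lebesgue_on {0<..<T}. F s) = k * (\<Sum>n<N. LINT s|UI. G n s)"
proof -
  have "F absolutely_integrable_on {0..real M * k} \<and> integral {0..real M * k} F = k * (\<Sum>n<M. LINT s|UI. G n s)"
    if "M \<le> N" for M
    using that
  proof (induction M)
    case (Suc M)
    have G': "G M absolutely_integrable_on {0..1}" using G[of M] Suc.prems by (simp add: integrable_Icc_iff)
    note c = integral_cell[OF G' A F[of M]]
    have "F absolutely_integrable_on {real M * k..real M * k + k}"
      "integral {real M * k..real M * k + k} F = k * (LINT s|UI. G M s)"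
      using c Suc.prems LINT_Icc[OF G'] by simp_all
    moreover have "{0..real M * k + k} = {0..real M * k} \<union> {real M * k..real M * k + k}"
    proof -
      have "0 \<le> z" if "real M * k \<le> z" for z using that k by (rule_tac order_trans[rotated]) auto
      then show ?thesis using k by auto
    qed
    moreover have IH: "F absolutely_integrable_on {0..real M * k}" "integral {0..real M * k} F = k * (\<Sum>n<M. LINT s|UI. G n s)"
      using Suc by auto
    ultimately have ai: "F absolutely_integrable_on {0..real M * k + k}"
      by (simp add: set_integrable_Un)
    have "integral {0..real M * k} F + integral {real M * k..real M * k + k} F = integral {0..real M * k + k} F"
      using k ai by (intro Henstock_Kurzweil_Integration.integral_combine) (auto simp: absolutely_integrable_on_def)
    moreover have "real (Suc M) * k = real M * k + k" by (simp add: algebra_simps)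
    ultimately show ?case using ai IH c(2) Suc.prems LINT_Icc[OF G'] by (simp add: distrib_left)
  qed (use absolutely_integrable_on_null[of 0 0 F] in simp)
  from this[of N] show "F absolutely_integrable_on {0..T}" "(LINT s|lebesgue_on {0<..<T}. F s) = k * (\<Sum>n<N. LINT s|UI. G n s)"
    by (simp_all add: T_eq LINT_Ioo)
qed

lemma right_limit_reference:
  fixes Y :: "real \<Rightarrow> 'a::real_normed_vector"
  assumes n: "n < N" and Y: "\<And>\<sigma>. \<sigma> \<in> {0<..1} \<Longrightarrow> Y (real n * k + k * \<sigma>) = vp q c \<sigma>"
  shows "right_limit t Y n = vp q c 0"
proof -
  let ?g = "\<lambda>s. vp q c ((s - real n * k) / k)"
  have "continuous_on UNIV ?g" using k by (intro continuous_intros) auto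
  then have "(?g \<longlongrightarrow> ?g (real n * k)) (at (real n * k) within {real n * k<..})"
    by (meson UNIV_I continuous_on_def tendsto_within_subset top_greatest)
  then have "(Y \<longlongrightarrow> ?g (real n * k)) (at_right (real n * k))"
  proof (rule Lim_transform_eventually)
    have "eventually (\<lambda>s. s \<in> {real n * k<..<real n * k + k}) (at_right (real n * k))"
      using k by (intro eventually_at_right_real) auto
    then show "eventually (\<lambda>s. ?g s = Y s) (at_right (real n * k))"
    proof eventually_elim
      case (elim s)
      then have "(s - real n * k) / k \<in> {0<..1}" using k by (auto simp: field_simps)
      from Y[OF this] show ?case using k by simp
    qed
  qed
  then have "Lim (at_right (real n * k)) Y = ?g (real n * k)" by (intro tendsto_Lim) simp
  then show ?thesis using n by (simp add: right_limit_def t_eq)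
qed

text \<open>The factor 1/k from the derivative cancels the length of the cell, and the initial term
  becomes the jump from the value 0 of \<open>prev\<close>.\<close>

lemma D_H_reference:
  fixes Y X :: "real \<Rightarrow> 'h::real_inner"
  assumes Y: "\<And>n \<sigma>. n < N \<Longrightarrow> \<sigma> \<in> {0<..1} \<Longrightarrow> Y (real n * k + k * \<sigma>) = vp q (y n) \<sigma>"
    and X: "\<And>n \<sigma>. n < N \<Longrightarrow> \<sigma> \<in> {0<..1} \<Longrightarrow> X (real n * k + k * \<sigma>) = vp q (x n) \<sigma>"
  shows "D_H N t Y X = (\<Sum>n<N. (LINT s|UI. vd q (y n) s \<bullet> vp q (x n) s)
    + (vp q (y n) 0 - prev (\<lambda>n. vp q (y n) 1) n) \<bullet> vp q (x n) 0)"
proof -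
  have int: "(LINT s|lebesgue_on (cell t (Suc n)). vector_derivative Y (at s within cell t (Suc n)) \<bullet> X s)
      = (LINT s|UI. vd q (y n) s \<bullet> vp q (x n) s)" if n: "n < N" for n
  proof -
    let ?C = "{real n * k<..real n * k + k}" and ?\<alpha> = "real n * k"
    have der: "vector_derivative Y (at s within ?C) = (1 / k) *\<^sub>R vd q (y n) ((s - ?\<alpha>) / k)" if s: "s \<in> ?C" for s
    proof (rule has_vector_derivative_within_Ioc_unique[OF _ s])
      have "((\<lambda>s. (s - ?\<alpha>) / k) has_vector_derivative 1 / k) (at s within ?C)"
        using k by (auto intro!: derivative_eq_intros simp: has_real_derivative_iff_has_vector_derivative[symmetric])
      from vector_diff_chain_within[OF this vp_has_vector_derivative, of q "y n"]
      have "((\<lambda>s. vp q (y n) ((s - ?\<alpha>) / k)) has_vector_derivative (1 / k) *\<^sub>R vd q (y n) ((s - ?\<alpha>) / k)) (at s within ?C)"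
        by (simp add: comp_def)
      then show "(Y has_vector_derivative (1 / k) *\<^sub>R vd q (y n) ((s - ?\<alpha>) / k)) (at s within ?C)"
      proof (rule has_vector_derivative_transform[OF s, rotated])
        fix r assume "r \<in> ?C"
        then have "(r - ?\<alpha>) / k \<in> {0<..1}" using k by (auto simp: field_simps)
        from Y[OF n this] show "Y r = vp q (y n) ((r - ?\<alpha>) / k)" using k by simp
      qed
    qed
    define G where "G s = (1 / k) * (vd q (y n) s \<bullet> vp q (x n) s)" for s
    let ?F = "\<lambda>s. vector_derivative Y (at s within ?C) \<bullet> X s"
    have "continuous_on {0..1} G" unfolding G_def by (intro continuous_intros)
    then have Gi: "G absolutely_integrable_on {0..1}" by (rule absolutely_integrable_continuous)
    have FG: "?F (?\<alpha> + k * \<sigma>) = G \<sigma>" if "\<sigma> \<in> {0<..<1}" for \<sigma>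
    proof -
      have "?\<alpha> + k * \<sigma> \<in> ?C" using cell_point[OF n, of \<sigma>] that by (simp add: cell_eq[OF n])
      then show ?thesis using der[of "?\<alpha> + k * \<sigma>"] X[OF n, of \<sigma>] that k by (simp add: G_def)
    qed
    from LINT_cell(2)[OF n Gi negligible_empty FG]
    have "(LINT s|lebesgue_on (cell t (Suc n)). ?F s) = k * (LINT s|UI. G s)" .
    also have "\<dots> = (LINT s|UI. vd q (y n) s \<bullet> vp q (x n) s)" using k by (simp add: G_def)
    finally show ?thesis by (simp add: cell_eq[OF n])
  qed
  have ry: "right_limit t Y n = vp q (y n) 0" and rx: "right_limit t X n = vp q (x n) 0" if "n < N" for n
    using right_limit_reference[OF that Y[OF that]] right_limit_reference[OF that X[OF that]] by auto
  have left: "Y (t (Suc n)) = vp q (y n) 1" if "n < N" for n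
    using Y[OF that, of 1] that by (simp add: t_eq algebra_simps)
  obtain M where M: "N = Suc M" using N by (cases N) auto
  have "(\<Sum>n = 1..N. LINT s|lebesgue_on (cell t n). vector_derivative Y (at s within cell t n) \<bullet> X s)
      = (\<Sum>n<N. LINT s|UI. vd q (y n) s \<bullet> vp q (x n) s)"
    using int by (simp add: sum.atLeast1_atMost_eq)
  moreover have "(\<Sum>n = 1..N - 1. jump t Y n \<bullet> right_limit t X n) + right_limit t Y 0 \<bullet> right_limit t X 0
      = (\<Sum>n<N. (vp q (y n) 0 - prev (\<lambda>n. vp q (y n) 1) n) \<bullet> vp q (x n) 0)"
  proof -
    have "(\<Sum>n = 1..N - 1. jump t Y n \<bullet> right_limit t X n)
        = (\<Sum>n<M. (vp q (y (Suc n)) 0 - vp q (y n) 1) \<bullet> vp q (x (Suc n)) 0)"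
      using ry rx left by (simp add: M sum.atLeast1_atMost_eq jump_def)
    then show ?thesis using ry[of 0] rx[of 0]
      by (simp add: M sum.lessThan_Suc_shift prev_def del: sum.lessThan_Suc)
  qed
  ultimately show ?thesis by (simp add: D_H_def sum.distrib)
qed

end

text \<open>Only the value at the right end and the moments up to degree
  \<open>q - 2\<close> of the continuous function enter, and these are shared by its projection \<open>\<I>\<^sub>q\<close>.\<close>

lemma cell_integral_by_parts:
  fixes d w :: "real \<Rightarrow> 'u::{real_inner,complete_space}"
  assumes prim: "primitive T d w" and w: "\<And>x. (\<lambda>r. x \<bullet> w r) absolutely_integrable_on {0..T}"
    and a: "0 \<le> a" "a + k \<le> T" "k > 0"
    and z1: "vp q z 1 = d (a + k)"
    and moments: "\<And>x i. i + 1 < q \<Longrightarrow> (LINT s|UI. s ^ i * (x \<bullet> (d (a + k * s) - vp q z s))) = 0"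
    and cont: "continuous_on {0..1} (\<lambda>s. d (a + k * s))"
    and B: "bounded_bilinear (B :: 'u \<Rightarrow> 'u \<Rightarrow> real)" and q: "q > 0"
  shows "integrable UI (\<lambda>s. B (w (a + k * s)) (vp q x s))"
    "k * (LINT s|UI. B (w (a + k * s)) (vp q x s))
      = (LINT s|UI. B (vd q z s) (vp q x s)) + B (vp q z 0 - d a) (vp q x 0)"
proof -
  interpret B: bounded_bilinear B by fact
  define e where "e s = d (a + k * s) - vp q z s" for s
  \<comment> \<open>Expanding the test polynomial and representing each functional
    \<open>B v (x j)\<close> of \<open>v\<close> by Riesz reduces the claim to real functions
    multiplied by s^j.\<close>
  have "\<exists>y. \<forall>v. B v (x j) = y \<bullet> v" for j
    using riesz_representation[OF B.bounded_linear_left] by metis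
  then obtain y where y: "\<And>j v. B v (x j) = y j \<bullet> v" by metis
  have sub: "(\<lambda>r. y j \<bullet> w r) absolutely_integrable_on {a + k * s..a + k * t}" if "0 \<le> s" "s \<le> t" "t \<le> 1" for j s t
  proof -
    have "k * t \<le> k * 1" "0 \<le> k * s" using that a(3) by (auto intro: mult_left_mono)
    then show ?thesis using a by (intro absolutely_integrable_subinterval[OF w]) linarith+
  qed
  have wi: "(\<lambda>s. k * (y j \<bullet> w (a + k * s)) - y j \<bullet> vd q z s) absolutely_integrable_on {0..1}"
    and wi': "(\<lambda>s. y j \<bullet> w (a + k * s)) absolutely_integrable_on {0..1}" for j
  proof -
    show 1: "(\<lambda>s. y j \<bullet> w (a + k * s)) absolutely_integrable_on {0..1}"
      using absolutely_integrable_affine(1)[OF a(3) sub[of 0 1 j]] by simp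
    show "(\<lambda>s. k * (y j \<bullet> w (a + k * s)) - y j \<bullet> vd q z s) absolutely_integrable_on {0..1}"
      by (intro set_integral_diff(1) absolutely_integrable_continuous_mult[OF continuous_on_const 1]
          absolutely_integrable_continuous continuous_intros)
  qed
  have W: "y j \<bullet> e t - y j \<bullet> e s = integral {s..t} (\<lambda>r. k * (y j \<bullet> w (a + k * r)) - y j \<bullet> vd q z r)"
    if st: "0 \<le> s" "s \<le> t" "t \<le> 1" for j s t
  proof -
    have "k * t \<le> k * 1" "0 \<le> k * s" "k * s \<le> k * t" using st a(3) by (auto intro: mult_left_mono)
    then have b: "0 \<le> a + k * s" "a + k * s \<le> a + k * t" "a + k * t \<le> T" using a by linarith+
    note h = absolutely_integrable_affine[OF a(3) sub[OF st] st(2), of j]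
    have i2: "(\<lambda>r. y j \<bullet> vd q z r) integrable_on {s..t}" by (intro integrable_continuous_real continuous_intros)
    have i1: "(\<lambda>r. k * (y j \<bullet> w (a + k * r))) integrable_on {s..t}"
      using h(1) by (intro integrable_on_mult_right) (simp add: absolutely_integrable_on_def)
    have "integral {s..t} (\<lambda>r. k * (y j \<bullet> w (a + k * r)) - y j \<bullet> vd q z r)
        = k * integral {s..t} (\<lambda>r. y j \<bullet> w (a + k * r)) - integral {s..t} (\<lambda>r. y j \<bullet> vd q z r)"
      using Henstock_Kurzweil_Integration.integral_diff[OF i1 i2] by simp
    also have "k * integral {s..t} (\<lambda>r. y j \<bullet> w (a + k * r)) = y j \<bullet> (d (a + k * t) - d (a + k * s))"
      using h(2) prim b a(3) by (simp add: primitive_def)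
    also have "integral {s..t} (\<lambda>r. y j \<bullet> vd q z r) = y j \<bullet> (vp q z t - vp q z s)"
      using primitive_vp[of 1 q z] st by (simp add: primitive_def)
    finally show ?thesis by (simp add: e_def inner_diff_right)
  qed
  have ce: "continuous_on {0..1} e" unfolding e_def by (intro continuous_intros cont)
  \<comment> \<open>By parts against s^j: the error vanishes at 1 and its moment of degree j - 1
    vanishes, so a boundary term at 0 is left. It is nonzero at most for j = 0, where
    \<open>0 ^ 0 = 1\<close>.\<close>
  have trm: "integral {0..1} (\<lambda>s. s ^ j * (k * (y j \<bullet> w (a + k * s)) - y j \<bullet> vd q z s)) = - (0 ^ j * (y j \<bullet> e 0))"
    if j: "j < q" for j
  proof -
    have "((\<lambda>s. s ^ j) has_real_derivative real j * s ^ (j - 1)) (at s)" for s :: real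
      by (auto intro!: derivative_eq_intros)
    then have "integral {0..1} (\<lambda>s. real j * s ^ (j - 1) * (y j \<bullet> e s))
        + integral {0..1} (\<lambda>s. s ^ j * (k * (y j \<bullet> w (a + k * s)) - y j \<bullet> vd q z s))
        = 1 ^ j * (y j \<bullet> e 1) - 0 ^ j * (y j \<bullet> e 0)"
      by (intro integral_by_parts_absolutely_continuous(2)[OF _ wi W]) (auto intro!: continuous_intros)
    moreover have "integral {0..1} (\<lambda>s. real j * s ^ (j - 1) * (y j \<bullet> e s)) = 0"
    proof (cases j)
      case (Suc i)
      have "(\<lambda>s. s ^ i * (y j \<bullet> e s)) absolutely_integrable_on {0..1}"
        by (intro absolutely_integrable_continuous continuous_intros ce)
      then have "integral {0..1} (\<lambda>s. s ^ i * (y j \<bullet> e s)) = 0"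
        using moments[of i "y j"] j Suc by (simp add: LINT_Icc e_def)
      then show ?thesis using Suc by (simp add: mult.assoc)
    qed simp
    moreover have "e 1 = 0" using z1 by (simp add: e_def)
    ultimately show ?thesis by simp
  qed
  have ti: "integrable UI (\<lambda>s. s ^ j * (y j \<bullet> w (a + k * s)))" for j
    unfolding integrable_Icc_iff by (intro absolutely_integrable_continuous_mult wi' continuous_intros)
  have ti2: "integrable UI (\<lambda>s. s ^ j * (y j \<bullet> vd q z s))" for j by (intro integrable_UI continuous_intros)
  have expand: "B v (vp q x s) = (\<Sum>j<q. s ^ j * (y j \<bullet> v))" for v s
    by (simp add: vp_def B.sum_right B.scaleR_right y)
  show "integrable UI (\<lambda>s. B (w (a + k * s)) (vp q x s))"
    unfolding expand by (intro Bochner_Integration.integrable_sum ti)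
  have "k * (LINT s|UI. B (w (a + k * s)) (vp q x s)) - (LINT s|UI. B (vd q z s) (vp q x s))
      = (\<Sum>j<q. k * (LINT s|UI. s ^ j * (y j \<bullet> w (a + k * s))) - (LINT s|UI. s ^ j * (y j \<bullet> vd q z s)))"
    unfolding expand by (simp only: Bochner_Integration.integral_sum[OF ti] Bochner_Integration.integral_sum[OF ti2]
        sum_distrib_left sum_subtractf)
  also have "\<dots> = (\<Sum>j<q. - (0 ^ j * (y j \<bullet> e 0)))"
  proof (rule sum.cong[OF refl])
    fix j assume "j \<in> {..<q}"
    have "k * (LINT s|UI. s ^ j * (y j \<bullet> w (a + k * s))) - (LINT s|UI. s ^ j * (y j \<bullet> vd q z s))
        = (LINT s|UI. k * (s ^ j * (y j \<bullet> w (a + k * s))) - s ^ j * (y j \<bullet> vd q z s))"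
      using ti[of j] ti2[of j] by (subst Bochner_Integration.integral_diff) auto
    also have "\<dots> = (LINT s|UI. s ^ j * (k * (y j \<bullet> w (a + k * s)) - y j \<bullet> vd q z s))"
      by (intro Bochner_Integration.integral_cong) (auto simp: algebra_simps)
    also have "\<dots> = integral {0..1} (\<lambda>s. s ^ j * (k * (y j \<bullet> w (a + k * s)) - y j \<bullet> vd q z s))"
      by (intro LINT_Icc absolutely_integrable_continuous_mult wi continuous_intros)
    finally show "k * (LINT s|UI. s ^ j * (y j \<bullet> w (a + k * s))) - (LINT s|UI. s ^ j * (y j \<bullet> vd q z s)) = - (0 ^ j * (y j \<bullet> e 0))"
      using trm \<open>j \<in> {..<q}\<close> by simp
  qed
  also have "\<dots> = - B (e 0) (vp q x 0)" by (simp add: expand sum_negf)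
  finally show "k * (LINT s|UI. B (w (a + k * s)) (vp q x s))
      = (LINT s|UI. B (vd q z s) (vp q x s)) + B (vp q z 0 - d a) (vp q x 0)"
    by (simp add: e_def B.diff_left)
qed

section \<open>The mixed setting\<close>

lemma ker_form_subspace:
  assumes b: "bilinear_on S R b" and S: "subspace S"
  shows "subspace (ker_form S R b)"
proof -
  have add: "b (x + y) r = b x r + b y r" and scale: "b (c *\<^sub>R x) r = c * b x r"
    if "x \<in> S" "y \<in> S" "r \<in> R" for x y r c
    using b that by (simp_all add: bilinear_on_def linear_on_def)
  have "b 0 r = 0" if "r \<in> R" for r
    using scale[OF subspace_0[OF S] subspace_0[OF S] that, of 0] by simp
  then show ?thesis
    unfolding subspace_def ker_form_def
    using add scale subspace_0[OF S] by (auto simp: subspace_add[OF S] subspace_scale[OF S])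
qed

text \<open>The kernel is an intersection of \<open>S\<close> with zero sets of the continuous
  extension of the form.\<close>

lemma ker_form_hilbert:
  fixes b :: "'a::{real_inner,complete_space} \<Rightarrow> 'b::{real_inner,complete_space} \<Rightarrow> real"
  assumes b: "continuous_bilinear_on S R b" and S: "hilbert_subspace S" and R: "hilbert_subspace R"
  shows "hilbert_subspace (ker_form S R b)"
proof -
  have bil: "bilinear_on S R b" using b by (simp add: continuous_bilinear_on_def)
  obtain C where "\<And>u r. u \<in> S \<Longrightarrow> r \<in> R \<Longrightarrow> \<bar>b u r\<bar> \<le> C * norm u * norm r"
    using b unfolding continuous_bilinear_on_def by blast
  then interpret B: bounded_bilinear "\<lambda>x y. b (orth_proj S x) (orth_proj R y)"
    by (rule bounded_bilinear_extension[OF S R bil])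
  have "ker_form S R b = S \<inter> (\<Inter>r\<in>R. {x. b (orth_proj S x) (orth_proj R r) = 0})"
    by (auto simp: ker_form_def orth_proj_id[OF S] orth_proj_id[OF R])
  moreover have "closed (S \<inter> (\<Inter>r\<in>R. {x. b (orth_proj S x) (orth_proj R r) = 0}))"
    using S unfolding hilbert_subspace_def
    by (intro closed_Int closed_INT ballI closed_Collect_eq B.continuous_on continuous_intros) auto
  ultimately have "closed (ker_form S R b)" by simp
  then show ?thesis
    using S bil by (simp add: hilbert_subspace_def ker_form_subspace)
qed

context mixed_setting
begin

abbreviation V2 where "V2 \<equiv> ker_form \<U> \<Q>\<^sub>2 b2"
abbreviation V where "V \<equiv> ker_form \<U> (\<Q>\<^sub>1 \<times> \<Q>\<^sub>2) (b_sum b1 b2)"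

text \<open>Composition with orthogonal projections extends the embedding and the forms to the ambient types.\<close>

definition J where "J x = \<iota> (orth_proj \<U> x)"
definition aa where "aa x y = a (orth_proj \<U> x) (orth_proj \<U> y)"
definition bb where "bb x r = b1 (orth_proj \<U> x) (orth_proj \<Q>\<^sub>1 r)"
definition bs where "bs x r = b_sum b1 b2 (orth_proj \<U> x) r"

lemma sub: "subspace \<U>" "subspace \<Q>\<^sub>1" "subspace \<Q>\<^sub>2"
  using hilbert by (auto simp: hilbert_subspace_def)

lemma bil: "bilinear_on \<U> \<Q>\<^sub>1 b1" "bilinear_on \<U> \<Q>\<^sub>2 b2"
  using b1 b2 by (auto simp: continuous_bilinear_on_def)

lemma J_eq: "x \<in> \<U> \<Longrightarrow> J x = \<iota> x" by (simp add: J_def orth_proj_id[OF hilbert(1)])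
lemma aa_eq: "x \<in> \<U> \<Longrightarrow> y \<in> \<U> \<Longrightarrow> aa x y = a x y" by (simp add: aa_def orth_proj_id[OF hilbert(1)])
lemma bb_eq: "x \<in> \<U> \<Longrightarrow> r \<in> \<Q>\<^sub>1 \<Longrightarrow> bb x r = b1 x r"
  by (simp add: bb_def orth_proj_id[OF hilbert(1)] orth_proj_id[OF hilbert(3)])
lemma bs_eq: "x \<in> \<U> \<Longrightarrow> bs x r = b_sum b1 b2 x r" by (simp add: bs_def orth_proj_id[OF hilbert(1)])

lemma bounded_linear_J: "bounded_linear J"
  unfolding J_def[abs_def]
  by (rule bounded_linear_extension[OF hilbert(1) embedding_linear embedding_bound])

lemma norm_J_le: "norm (J x) \<le> \<bar>\<kappa>\<bar> * norm x"
proof -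
  have "norm (J x) \<le> \<kappa> * norm (orth_proj \<U> x)"
    unfolding J_def by (rule embedding_bound) (rule orth_proj_in[OF hilbert(1)])
  also have "\<dots> \<le> \<bar>\<kappa>\<bar> * norm (orth_proj \<U> x)" by (intro mult_right_mono) auto
  also have "\<dots> \<le> \<bar>\<kappa>\<bar> * norm x" by (intro mult_left_mono norm_orth_proj_le[OF hilbert(1)]) auto
  finally show ?thesis .
qed

lemma bounded_bilinear_aa: "bounded_bilinear aa"
  unfolding aa_def[abs_def] by (rule bounded_bilinear_extension[OF hilbert(1,1) a_bilinear a_bounded])

lemma aa_le: "\<bar>aa x y\<bar> \<le> \<Gamma> * norm x * norm y"
proof -
  have "\<bar>aa x y\<bar> \<le> \<Gamma> * norm (orth_proj \<U> x) * norm (orth_proj \<U> y)"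
    unfolding aa_def by (intro a_bounded orth_proj_in[OF hilbert(1)])
  also have "\<dots> \<le> \<Gamma> * norm x * norm y"
    using norm_orth_proj_le[OF hilbert(1)] Gamma_pos by (intro mult_mono) auto
  finally show ?thesis .
qed

lemma bounded_bilinear_bb: "bounded_bilinear bb"
proof -
  obtain C where "\<And>u r. u \<in> \<U> \<Longrightarrow> r \<in> \<Q>\<^sub>1 \<Longrightarrow> \<bar>b1 u r\<bar> \<le> C * norm u * norm r"
    using b1 unfolding continuous_bilinear_on_def by blast
  then show ?thesis unfolding bb_def[abs_def] by (rule bounded_bilinear_extension[OF hilbert(1,3) bil(1)])
qed

lemma bounded_linear_bs:
  assumes r: "r \<in> \<Q>\<^sub>1 \<times> \<Q>\<^sub>2"
  shows "bounded_linear (\<lambda>x. bs x r)"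
proof -
  obtain C where C: "\<And>u r. u \<in> \<U> \<Longrightarrow> r \<in> \<Q>\<^sub>1 \<Longrightarrow> \<bar>b1 u r\<bar> \<le> C * norm u * norm r"
    using b1 unfolding continuous_bilinear_on_def by blast
  obtain C' where C': "\<And>u r. u \<in> \<U> \<Longrightarrow> r \<in> \<Q>\<^sub>2 \<Longrightarrow> \<bar>b2 u r\<bar> \<le> C' * norm u * norm r"
    using b2 unfolding continuous_bilinear_on_def by blast
  have "norm (b_sum b1 b2 v r) \<le> (C * norm (fst r) + C' * norm (snd r)) * norm v" if "v \<in> \<U>" for v
    using C[OF that, of "fst r"] C'[OF that, of "snd r"] r by (auto simp: b_sum_def algebra_simps)
  moreover have "linear_on \<U> (\<lambda>v. b_sum b1 b2 v r)"
    using bil r by (auto simp: b_sum_def bilinear_on_def linear_on_def algebra_simps)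
  ultimately show ?thesis unfolding bs_def[abs_def] by (intro bounded_linear_extension[OF hilbert(1)])
qed

lemma b_sum_dual: "x \<in> \<U> \<Longrightarrow> b_sum b1 b2 x \<in> dual (\<Q>\<^sub>1 \<times> \<Q>\<^sub>2)"
proof -
  assume x: "x \<in> \<U>"
  obtain C where C: "\<And>u r. u \<in> \<U> \<Longrightarrow> r \<in> \<Q>\<^sub>1 \<Longrightarrow> \<bar>b1 u r\<bar> \<le> C * norm u * norm r"
    using b1 unfolding continuous_bilinear_on_def by blast
  obtain C' where C': "\<And>u r. u \<in> \<U> \<Longrightarrow> r \<in> \<Q>\<^sub>2 \<Longrightarrow> \<bar>b2 u r\<bar> \<le> C' * norm u * norm r"
    using b2 unfolding continuous_bilinear_on_def by blast
  have "\<bar>b_sum b1 b2 x r\<bar> \<le> ((\<bar>C\<bar> + \<bar>C'\<bar>) * norm x) * norm r" if r: "r \<in> \<Q>\<^sub>1 \<times> \<Q>\<^sub>2" for r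
  proof -
    have "\<bar>b1 x (fst r)\<bar> \<le> \<bar>C\<bar> * norm x * norm r"
    proof -
      have "\<bar>b1 x (fst r)\<bar> \<le> C * norm x * norm (fst r)" using C[OF x] r by auto
      also have "\<dots> \<le> \<bar>C\<bar> * norm x * norm r" by (intro mult_mono) (use norm_fst_le[of "fst r" "snd r"] in auto)
      finally show ?thesis .
    qed
    moreover have "\<bar>b2 x (snd r)\<bar> \<le> \<bar>C'\<bar> * norm x * norm r"
    proof -
      have "\<bar>b2 x (snd r)\<bar> \<le> C' * norm x * norm (snd r)" using C'[OF x] r by auto
      also have "\<dots> \<le> \<bar>C'\<bar> * norm x * norm r" by (intro mult_mono) (use norm_snd_le[of "snd r" "fst r"] in auto)
      finally show ?thesis .
    qed
    ultimately show ?thesis by (simp add: b_sum_def distrib_right)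
  qed
  moreover have "linear_on (\<Q>\<^sub>1 \<times> \<Q>\<^sub>2) (b_sum b1 b2 x)"
    using bil x by (auto simp: b_sum_def bilinear_on_def linear_on_def algebra_simps)
  ultimately show ?thesis unfolding dual_def by blast
qed

lemma b_zero: "x \<in> \<U> \<Longrightarrow> b1 x 0 = 0" "x \<in> \<U> \<Longrightarrow> b2 x 0 = 0"
proof -
  assume x: "x \<in> \<U>"
  have "b1 x (0 *\<^sub>R 0) = 0 *\<^sub>R b1 x 0" "b2 x (0 *\<^sub>R 0) = 0 *\<^sub>R b2 x 0"
    using bil x subspace_0[OF sub(2)] subspace_0[OF sub(3)] unfolding bilinear_on_def linear_on_def by blast+
  then show "b1 x 0 = 0" "b2 x 0 = 0" by auto
qed

text \<open>Testing with (r, 0) and (0, r) separates the two constraints.\<close>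

lemma V_iff: "v \<in> V \<longleftrightarrow> v \<in> V2 \<and> (\<forall>r\<in>\<Q>\<^sub>1. b1 v r = 0)"
proof
  assume v: "v \<in> V"
  then have vU: "v \<in> \<U>" and z: "\<And>r1 r2. r1 \<in> \<Q>\<^sub>1 \<Longrightarrow> r2 \<in> \<Q>\<^sub>2 \<Longrightarrow> b1 v r1 + b2 v r2 = 0"
    by (auto simp: ker_form_def b_sum_def)
  show "v \<in> V2 \<and> (\<forall>r\<in>\<Q>\<^sub>1. b1 v r = 0)"
    using z[OF _ subspace_0[OF sub(3)]] z[OF subspace_0[OF sub(2)]] vU by (auto simp: ker_form_def b_zero)
qed (auto simp: ker_form_def b_sum_def)

lemma V2_hilbert: "hilbert_subspace V2" by (rule ker_form_hilbert[OF b2 hilbert(1,4)])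

lemma V2_subspace: "subspace V2" using V2_hilbert by (simp add: hilbert_subspace_def)

lemma V2_U: "v \<in> V2 \<Longrightarrow> v \<in> \<U>" by (simp add: ker_form_def)

lemma V_subspace: "subspace V"
proof (rule ker_form_subspace[OF _ sub(1)])
  show "bilinear_on \<U> (\<Q>\<^sub>1 \<times> \<Q>\<^sub>2) (b_sum b1 b2)"
    using bil by (auto simp: b_sum_def bilinear_on_def linear_on_def algebra_simps)
qed

text \<open>Surjectivity of \<open>B\<close> provides a lift of the functional
  \<open>r1 \<bullet> fst r\<close>: it annihilates \<open>\<Q>\<^sub>2\<close> and pairs with
  \<open>r1\<close> to a nonzero number. The supremum in the inf-sup condition thus runs over a
  nonempty set.\<close>

lemma V2_nontrivial: obtains v where "v \<in> V2" "v \<noteq> 0"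
proof -
  obtain r1 where r1: "r1 \<in> \<Q>\<^sub>1" "r1 \<noteq> 0" using Q1_nontrivial subspace_0[OF sub(2)] by auto
  have "(\<lambda>r. r1 \<bullet> fst r) \<in> dual (\<Q>\<^sub>1 \<times> \<Q>\<^sub>2)"
  proof -
    have "\<bar>r1 \<bullet> fst r\<bar> \<le> norm r1 * norm r" for r :: "'q1 \<times> 'q2"
      using Cauchy_Schwarz_ineq2[of r1 "fst r"] norm_fst_le[of "fst r" "snd r"] unfolding prod.collapse by (meson mult_left_mono norm_ge_zero order_trans)
    then have "\<exists>C. \<forall>r\<in>\<Q>\<^sub>1 \<times> \<Q>\<^sub>2. \<bar>r1 \<bullet> fst r\<bar> \<le> C * norm r" by blast
    then show ?thesis unfolding dual_def by (simp add: linear_on_def inner_add_right)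
  qed
  then obtain x where x: "x \<in> \<U>" "\<And>r. r \<in> \<Q>\<^sub>1 \<times> \<Q>\<^sub>2 \<Longrightarrow> b_sum b1 b2 x r = r1 \<bullet> fst r"
    using B_surjective by blast
  have "b2 x r2 = 0" if "r2 \<in> \<Q>\<^sub>2" for r2
    using x(2)[of "(0, r2)"] x(1) that subspace_0[OF sub(2)] by (simp add: b_sum_def b_zero)
  then have "x \<in> V2" using x(1) by (simp add: ker_form_def)
  moreover have "b1 x r1 = r1 \<bullet> r1" using x(2)[of "(r1, 0)"] x(1) r1 subspace_0[OF sub(3)] by (simp add: b_sum_def b_zero)
  then have "x \<noteq> 0"
    using r1 bil(1) subspace_0[OF sub(1)] unfolding bilinear_on_def linear_on_def
    by (metis inner_eq_zero_iff real_scaleR_def scaleR_zero_left)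
  ultimately show thesis by (rule that)
qed

text \<open>Real suprema and infima carry information only for bounded nonempty sets; the continuity
  bound of \<open>b1\<close> and \<open>V2_nontrivial\<close> ensure this.\<close>

lemma inf_sup_V2:
  assumes r: "r \<in> \<Q>\<^sub>1" and M: "\<And>v. v \<in> V2 \<Longrightarrow> bb v r \<le> M * norm v"
  shows "\<beta> * norm r \<le> M"
proof -
  obtain v0 where v0: "v0 \<in> V2" "v0 \<noteq> 0" by (rule V2_nontrivial)
  have M': "b1 v r \<le> M * norm v" if "v \<in> V2" for v using M[OF that] bb_eq[OF V2_U[OF that] r] by simp
  show ?thesis
  proof (cases "r = 0")
    case True
    have "0 \<le> M * norm v0" using M'[OF v0(1)] True b_zero V2_U[OF v0(1)] by simp
    then show ?thesis using v0(2) True by (simp add: zero_le_mult_iff)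
  next
    case False
    obtain C where C: "\<And>u r. u \<in> \<U> \<Longrightarrow> r \<in> \<Q>\<^sub>1 \<Longrightarrow> \<bar>b1 u r\<bar> \<le> C * norm u * norm r"
      using b1 unfolding continuous_bilinear_on_def by blast
    define S where "S r = (SUP v\<in>V2 - {0}. b1 v r / (norm v * norm r))" for r
    have quot: "\<bar>b1 v r / (norm v * norm r)\<bar> \<le> C" if "v \<in> V2 - {0}" "r \<in> \<Q>\<^sub>1 - {0}" for v r
      using C[of v r] that V2_U by (simp add: field_simps abs_mult)
    have lower: "- C \<le> S r" if "r \<in> \<Q>\<^sub>1 - {0}" for r
    proof -
      have "b1 v0 r / (norm v0 * norm r) \<le> S r"
        unfolding S_def using abs_le_D1[OF quot[OF _ that]] v0
        by (intro cSUP_upper bdd_aboveI2[where M = C]) auto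
      moreover have "- C \<le> b1 v0 r / (norm v0 * norm r)" using abs_le_D2[OF quot[OF _ that, of v0]] v0 by simp
      ultimately show ?thesis by simp
    qed
    have "\<beta> \<le> (INF r\<in>\<Q>\<^sub>1 - {0}. S r)" using inf_sup by (simp add: S_def)
    also have "\<dots> \<le> S r"
      using r False lower by (intro cINF_lower bdd_belowI2[where m = "- C"]) auto
    also have "\<dots> \<le> M / norm r"
      unfolding S_def
    proof (rule cSUP_least)
      show "V2 - {0} \<noteq> {}" using v0 by auto
      fix v assume "v \<in> V2 - {0}"
      then show "b1 v r / (norm v * norm r) \<le> M / norm r"
        using M'[of v] False by (simp add: field_simps)
    qed
    finally show ?thesis using False by (simp add: field_simps)
  qed
qed

end

text \<open>\<open>d\<close> and \<open>pd\<close> are continuous representatives of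
  \<open>u\<close> and \<open>p\<close>, \<open>w\<close> is the derivative of \<open>d\<close>, and
  \<open>z n\<close> holds the coefficients of I_q u on a reference cell. \<open>cU\<close> and
  \<open>cP\<close> describe the discrete solution in the same way.\<close>

locale discrete_mixed = mixed_setting \<U> \<H> \<Q>\<^sub>1 \<Q>\<^sub>2 \<iota> a b1 b2 \<gamma> \<Gamma> \<beta> \<kappa> + uniform_grid T k N t
  for \<U> :: "'u::{real_inner, complete_space, second_countable_topology} set"
    and \<H> :: "'h::{real_inner, complete_space, second_countable_topology} set"
    and \<Q>\<^sub>1 :: "'q1::{real_inner, complete_space, second_countable_topology} set"
    and \<Q>\<^sub>2 :: "'q2::{real_inner, complete_space, second_countable_topology} set"
    and \<iota> a b1 b2 \<gamma> \<Gamma> \<beta> \<kappa> T k N t +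
  fixes f g u0 u p q U P d w pd z cU cP
  assumes MP: "MP_solution \<U> \<H> \<Q>\<^sub>1 \<Q>\<^sub>2 \<iota> a b1 b2 T f g u0 u p"
    and g_cont: "g \<in> L2c_dual T N t (\<Q>\<^sub>1 \<times> \<Q>\<^sub>2)"
    and DMP: "DMP_solution \<U> \<Q>\<^sub>1 \<Q>\<^sub>2 \<iota> a b1 b2 T q N t f g u0 U P"
    and q: "q > 0"
    and d_u: "AE t in lebesgue_on {0<..<T}. d t = u t" and d_cont: "continuous_on {0..T} d"
    and d_prim: "primitive T d w"
    and w_int: "\<And>x. (\<lambda>r. x \<bullet> w r) absolutely_integrable_on {0..T}"
    and pd_p: "AE t in lebesgue_on {0<..<T}. pd t = p t" and pd_cont: "continuous_on {0..T} pd"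
    and z_U: "\<And>n j. n < N \<Longrightarrow> j < q \<Longrightarrow> z n j \<in> \<U>"
    and z_end: "\<And>n. n < N \<Longrightarrow> vp q (z n) 1 = d (real n * k + k)"
    and z_moments: "\<And>n x i. n < N \<Longrightarrow> i + 1 < q \<Longrightarrow>
      (LINT s|UI. s ^ i * (x \<bullet> (d (real n * k + k * s) - vp q (z n) s))) = 0"
    and cU_U: "\<And>n j. n < N \<Longrightarrow> j < q \<Longrightarrow> cU n j \<in> \<U>"
    and U_eq: "\<And>n \<sigma>. n < N \<Longrightarrow> \<sigma> \<in> {0<..1} \<Longrightarrow> U (real n * k + k * \<sigma>) = vp q (cU n) \<sigma>"
    and cP_Q: "\<And>n j. n < N \<Longrightarrow> j < q \<Longrightarrow> cP n j \<in> \<Q>\<^sub>1"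
    and P_eq: "\<And>n \<sigma>. n < N \<Longrightarrow> \<sigma> \<in> {0<..1} \<Longrightarrow> P (real n * k + k * \<sigma>) = vp q (cP n) \<sigma>"
begin

lemma u_U: "s \<in> {0<..<T} \<Longrightarrow> u s \<in> \<U>" and p_Q: "s \<in> {0<..<T} \<Longrightarrow> p s \<in> \<Q>\<^sub>1"
  using MP by (auto simp: MP_solution_def Let_def W1_def L2_def)

lemma pd_Q: "s \<in> {0..T} \<Longrightarrow> pd s \<in> \<Q>\<^sub>1"
proof (rule continuous_in_closed_if_AE[OF T_pos pd_cont])
  show "AE t in lebesgue_on {0<..<T}. pd t \<in> \<Q>\<^sub>1"
    using pd_p AE_space[of "lebesgue_on {0<..<T}"] by eventually_elim (use p_Q in auto)
  show "closed \<Q>\<^sub>1" using hilbert by (simp add: hilbert_subspace_def)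
qed

lemma functional_by_parts:
  assumes F: "bounded_linear F" and \<phi>: "\<phi> \<in> test_functions {0<..<T}"
  shows "(\<lambda>r. F (w r)) absolutely_integrable_on {0..T}"
    "integral {0..T} (\<lambda>r. deriv \<phi> r * F (d r)) = - integral {0..T} (\<lambda>r. \<phi> r * F (w r))"
proof -
  obtain y where y: "\<And>x. F x = y \<bullet> x" using riesz_representation[OF F] by blast
  have sm: "smooth \<phi>" and out: "\<phi> 0 = 0" "\<phi> T = 0" using \<phi> unfolding test_functions_iff by force+
  show wi: "(\<lambda>r. F (w r)) absolutely_integrable_on {0..T}" unfolding y by (rule w_int)
  have W: "F (d t) - F (d s) = integral {s..t} (\<lambda>r. F (w r))" if "0 \<le> s" "s \<le> t" "t \<le> T" for s t
    using d_prim that unfolding y by (simp add: primitive_def inner_diff_right)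
  show "integral {0..T} (\<lambda>r. deriv \<phi> r * F (d r)) = - integral {0..T} (\<lambda>r. \<phi> r * F (w r))"
    using integral_by_parts_absolutely_continuous(2)[OF _ wi W smooth_DERIV[OF sm] smooth_continuous_on[OF smooth_deriv[OF sm]]] T_pos
    by (simp add: out)
qed

lemma bounded_linear_inner_J: "bounded_linear (\<lambda>x. J x \<bullet> J v)"
  using bounded_linear_compose[OF bounded_linear_inner_left bounded_linear_J] .

text \<open>The weak derivative of \<open>u\<close> in the dual of \<open>V2\<close> agrees with
  \<open>w\<close> acting through \<open>\<H>\<close>, by the fundamental lemma for each
  \<open>v\<close>. The null set depends on \<open>v\<close>; later, finitely many coefficient
  vectors are tested.\<close>

lemma f_eq:
  assumes v: "v \<in> V2"
  shows "AE s in lebesgue_on {0<..<T}. f s v = J (w s) \<bullet> J v + aa (d s) v + bb v (pd s)"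
proof -
  let ?I = "{0<..<T}"
  obtain u' where u': "u' \<in> L2_dual ?I V2"
    "is_weak_deriv_dual ?I V2 (\<lambda>t. H_functional \<iota> (\<iota> (u t))) u'"
    "AE t in lebesgue_on ?I. \<forall>v\<in>V2. u' t v + a (u t) v + b1 v (p t) = f t v"
    using MP unfolding MP_solution_def Let_def by blast
  have u'i: "(\<lambda>s. u' s v) absolutely_integrable_on {0..T}"
    by (rule L2_dual_absolutely_integrable[OF V2_subspace u'(1) v])
  note F = bounded_linear_inner_J[of v]
  \<comment> \<open>The bump merely serves as some test function with which to instantiate
    \<open>functional_by_parts\<close>.\<close>
  have wi: "(\<lambda>s. J (w s) \<bullet> J v) absolutely_integrable_on {0..T}"
    using functional_by_parts(1)[OF F] bump_test[of 1 1 0 T] T_pos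
      functional_by_parts(1)[OF F bump_test[of 1 "T / 3" "2 * T / 3" T]] by simp
  have di: "(\<lambda>s. J (d s) \<bullet> J v) absolutely_integrable_on {0..T}"
    by (intro absolutely_integrable_continuous bounded_linear.continuous_on[OF F] d_cont)
  have "AE s in lebesgue_on ?I. u' s v - J (w s) \<bullet> J v = 0"
  proof (rule fundamental_lemma)
    have diff: "(\<lambda>s. u' s v - J (w s) \<bullet> J v) absolutely_integrable_on {0..T}"
      by (rule set_integral_diff(1)[OF u'i wi])
    then show "integrable (lebesgue_on ?I) (\<lambda>s. u' s v - J (w s) \<bullet> J v)" by (simp add: integrable_Ioo_iff)
    fix \<phi> assume \<phi>: "\<phi> \<in> test_functions ?I"
    note d\<phi> = test_functions_deriv[OF \<phi>]
    have ae: "AE s in lebesgue_on ?I. deriv \<phi> s * H_functional \<iota> (\<iota> (u s)) v = deriv \<phi> s * (J (d s) \<bullet> J v)"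
      using d_u AE_space[of "lebesgue_on ?I"]
      by eventually_elim (use u_U v V2_U in \<open>auto simp: H_functional_def J_eq\<close>)
    obtain A where A: "negligible A" "\<And>s. s \<in> ?I \<Longrightarrow> s \<notin> A \<Longrightarrow>
        deriv \<phi> s * H_functional \<iota> (\<iota> (u s)) v = deriv \<phi> s * (J (d s) \<bullet> J v)"
      using AE_lebesgue_on_negligible[OF ae] by blast
    have i1: "(\<lambda>s. deriv \<phi> s * (J (d s) \<bullet> J v)) absolutely_integrable_on {0..T}"
      by (rule test_function_integrable_mult[OF d\<phi> di])
    have neg: "negligible (A \<union> {0, T})" using A(1) by (intro negligible_Un) auto
    have i2: "(\<lambda>s. deriv \<phi> s * H_functional \<iota> (\<iota> (u s)) v) absolutely_integrable_on {0..T}"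
      by (rule absolutely_integrable_spike[OF i1 neg]) (use A(2) in auto)
    have "(LINT s|lebesgue_on ?I. deriv \<phi> s * H_functional \<iota> (\<iota> (u s)) v) = integral {0..T} (\<lambda>s. deriv \<phi> s * (J (d s) \<bullet> J v))"
      unfolding LINT_Ioo[OF i2] by (rule AE_Ioo_integral_cong[OF ae]) auto
    then have "integral {0..T} (\<lambda>s. deriv \<phi> s * (J (d s) \<bullet> J v)) = - integral {0..T} (\<lambda>s. \<phi> s * u' s v)"
      using u'(2) \<phi> v LINT_Ioo[OF test_function_integrable_mult[OF \<phi> u'i]]
      unfolding is_weak_deriv_dual_def by simp
    moreover have j: "(\<lambda>s. \<phi> s * u' s v) integrable_on {0..T}" "(\<lambda>s. \<phi> s * (J (w s) \<bullet> J v)) integrable_on {0..T}"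
      using test_function_integrable_mult[OF \<phi> u'i] test_function_integrable_mult[OF \<phi> wi]
      by (auto simp: absolutely_integrable_on_def)
    ultimately have "integral {0..T} (\<lambda>s. \<phi> s * (u' s v - J (w s) \<bullet> J v)) = 0"
      using functional_by_parts(2)[OF F \<phi>] Henstock_Kurzweil_Integration.integral_diff[OF j]
      by (simp add: right_diff_distrib)
    then show "(LINT s|lebesgue_on ?I. \<phi> s * (u' s v - J (w s) \<bullet> J v)) = 0"
      by (simp add: LINT_Ioo test_function_integrable_mult[OF \<phi> diff])
  qed
  with u'(3) d_u pd_p AE_space[of "lebesgue_on ?I"] show ?thesis
  proof eventually_elim
    case (elim s)
    have "u' s v + a (u s) v + b1 v (p s) = f s v" using elim(1) v by blast
    then have fs: "f s v = u' s v + a (d s) v + b1 v (pd s)" using elim by simp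
    have "d s \<in> \<U>" "pd s \<in> \<Q>\<^sub>1" "u' s v = J (w s) \<bullet> J v" using elim u_U p_Q by auto
    with fs show ?case using V2_U[OF v] by (simp add: aa_eq bb_eq)
  qed
qed

text \<open>The initial value is prescribed in the dual of \<open>V2\<close>. Continuity in dual
  norm on one side and continuity of \<open>d\<close> on the other meet along good times tending to
  0.\<close>

lemma u0_eq:
  assumes v: "v \<in> V2"
  shows "u0 \<bullet> \<iota> v = J (d 0) \<bullet> J v"
proof -
  obtain y where y: "\<And>t. t \<in> {0..T} \<Longrightarrow> y t \<in> dual V2"
    "\<And>t. t \<in> {0..T} \<Longrightarrow> ((\<lambda>s. dual_norm V2 (\<lambda>v. y s v - y t v)) \<longlongrightarrow> 0) (at t within {0..T})"
    "AE t in lebesgue_on {0<..<T}. \<forall>v\<in>V2. y t v = H_functional \<iota> (\<iota> (u t)) v"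
    "\<And>v. v \<in> V2 \<Longrightarrow> y 0 v = H_functional \<iota> u0 v"
    using MP unfolding MP_solution_def Let_def initial_value_def by blast
  have ae: "AE s in lebesgue_on {0<..<T}. y s v = J (d s) \<bullet> J v"
    using y(3) d_u AE_space[of "lebesgue_on {0<..<T}"]
    by eventually_elim (use u_U v V2_U in \<open>auto simp: H_functional_def J_eq\<close>)
  obtain s where s: "\<And>n::nat. s n \<in> {0<..<T}" "\<And>n. y (s n) v = J (d (s n)) \<bullet> J v" "s \<longlonglongrightarrow> 0"
    using AE_right_sequence[OF ae T_pos] by blast
  have s': "s n \<in> {0..T}" for n using s(1)[of n] by auto
  have "(\<lambda>n. J (d (s n)) \<bullet> J v) \<longlonglongrightarrow> J (d 0) \<bullet> J v"
    using T_pos by (intro bounded_linear.tendsto[OF bounded_linear_inner_J] continuous_on_sequence[OF d_cont s' s(3)]) auto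
  moreover have "(\<lambda>n. y (s n) v - y 0 v) \<longlonglongrightarrow> 0"
  proof (rule Lim_null_comparison)
    have "filterlim s (at 0 within {0..T}) sequentially"
      unfolding filterlim_at using s(1,3) s' by (auto intro!: always_eventually simp: less_imp_neq[symmetric] dest: less_imp_neq)
    then have "(\<lambda>n. dual_norm V2 (\<lambda>v. y (s n) v - y 0 v)) \<longlonglongrightarrow> 0"
      using T_pos by (intro filterlim_compose[OF y(2)]) auto
    then show "(\<lambda>n. dual_norm V2 (\<lambda>v. y (s n) v - y 0 v) * norm v) \<longlonglongrightarrow> 0" by (rule tendsto_mult_left_zero)
    have "\<bar>y (s n) v - y 0 v\<bar> \<le> dual_norm V2 (\<lambda>v. y (s n) v - y 0 v) * norm v" for n
      using T_pos s' by (intro dual_norm_upper[OF V2_subspace _ v, of "\<lambda>v. y (s n) v - y 0 v"] dual_diff y(1)) auto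
    then show "eventually (\<lambda>n. norm (y (s n) v - y 0 v) \<le> dual_norm V2 (\<lambda>v. y (s n) v - y 0 v) * norm v) sequentially"
      by (intro always_eventually allI) simp
  qed
  then have "(\<lambda>n. y (s n) v) \<longlonglongrightarrow> y 0 v" by (simp add: LIM_zero_iff)
  ultimately have "y 0 v = J (d 0) \<bullet> J v" using LIMSEQ_unique s(2) by force
  then show ?thesis using y(4)[OF v] by (simp add: H_functional_def)
qed

text \<open>At a node, \<open>g\<close> is its own limit from the left in dual norm, and this limit
  is compared with the continuous \<open>d\<close> along good times.\<close>

lemma g_eq:
  assumes r: "r \<in> \<Q>\<^sub>1 \<times> \<Q>\<^sub>2"
  shows "AE s in lebesgue_on {0<..<T}. g s r = bs (d s) r"
    and "n < N \<Longrightarrow> g (t (Suc n)) r = bs (d (real n * k + k)) r"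
proof -
  have "AE s in lebesgue_on {0<..<T}. \<forall>r\<in>\<Q>\<^sub>1 \<times> \<Q>\<^sub>2. b_sum b1 b2 (u s) r = g s r"
    using MP unfolding MP_solution_def Let_def by blast
  then show ae: "AE s in lebesgue_on {0<..<T}. g s r = bs (d s) r"
    using d_u AE_space[of "lebesgue_on {0<..<T}"]
    by eventually_elim (use u_U r in \<open>auto simp: bs_eq\<close>)
  assume n: "n < N"
  let ?\<tau> = "real n * k + k"
  have \<tau>: "t (Suc n) = ?\<tau>" "0 < ?\<tau>" "?\<tau> \<le> T" using n k cell_end(1)[OF n] by (auto simp: t_eq algebra_simps add_pos_nonneg)
  have Q: "subspace (\<Q>\<^sub>1 \<times> \<Q>\<^sub>2)" by (intro subspace_Times sub)
  have gd: "\<And>s. s \<in> {0<..<T} \<Longrightarrow> g s \<in> dual (\<Q>\<^sub>1 \<times> \<Q>\<^sub>2)" "g ?\<tau> \<in> dual (\<Q>\<^sub>1 \<times> \<Q>\<^sub>2)"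
    and lim: "((\<lambda>s. dual_norm (\<Q>\<^sub>1 \<times> \<Q>\<^sub>2) (\<lambda>r. g s r - g ?\<tau> r)) \<longlongrightarrow> 0) (at_left ?\<tau>)"
    using g_cont n \<tau>(1) by (auto simp: L2c_dual_def L2_dual_def dest!: bspec[where x = "Suc n"])
  obtain s where s: "\<And>n::nat. s n \<in> {0<..<?\<tau>}" "\<And>n. g (s n) r = bs (d (s n)) r" "s \<longlonglongrightarrow> ?\<tau>"
    using AE_left_sequence[OF ae \<tau>(2,3)] by blast
  have s': "s n \<in> {0..T}" "s n \<in> {0<..<T}" for n using s(1)[of n] \<tau> by auto
  have "(\<lambda>n. bs (d (s n)) r) \<longlonglongrightarrow> bs (d ?\<tau>) r"
    using \<tau> by (intro bounded_linear.tendsto[OF bounded_linear_bs[OF r]] continuous_on_sequence[OF d_cont s'(1) s(3)]) auto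
  moreover have "(\<lambda>n. g (s n) r - g ?\<tau> r) \<longlonglongrightarrow> 0"
  proof (rule Lim_null_comparison)
    have "filterlim s (at_left ?\<tau>) sequentially"
      unfolding filterlim_at using s(1,3) by (auto intro!: always_eventually dest: less_imp_neq)
    from filterlim_compose[OF lim this]
    show "(\<lambda>n. dual_norm (\<Q>\<^sub>1 \<times> \<Q>\<^sub>2) (\<lambda>r. g (s n) r - g ?\<tau> r) * norm r) \<longlonglongrightarrow> 0" by (rule tendsto_mult_left_zero)
    have "\<bar>g (s n) r - g ?\<tau> r\<bar> \<le> dual_norm (\<Q>\<^sub>1 \<times> \<Q>\<^sub>2) (\<lambda>r. g (s n) r - g ?\<tau> r) * norm r" for n
      by (intro dual_norm_upper[OF Q _ r, of "\<lambda>r. g (s n) r - g ?\<tau> r"] dual_diff gd s'(2))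
    then show "eventually (\<lambda>n. norm (g (s n) r - g ?\<tau> r) \<le> dual_norm (\<Q>\<^sub>1 \<times> \<Q>\<^sub>2) (\<lambda>r. g (s n) r - g ?\<tau> r) * norm r) sequentially"
      by (intro always_eventually allI) simp
  qed
  then have "(\<lambda>n. g (s n) r) \<longlonglongrightarrow> g ?\<tau> r" by (simp add: LIM_zero_iff)
  ultimately show "g (t (Suc n)) r = bs (d ?\<tau>) r" using LIMSEQ_unique s(2) \<tau>(1) by force
qed

end

lemma vd_diff: "vd q (\<lambda>j. c j - d j) s = vd q c s - vd q d s"
  by (simp add: vd_def scaleR_diff_right vp_diff)

lemma poly_as_vp: "degree \<psi> < n \<Longrightarrow> poly \<psi> s = vp n (coeff \<psi>) s" for \<psi> :: "real poly"
proof -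
  assume "degree \<psi> < n"
  then have "vp n (coeff \<psi>) s = (\<Sum>i\<le>degree \<psi>. s ^ i * coeff \<psi> i)"
    unfolding vp_def by (intro sum.mono_neutral_cong_right) (auto simp: coeff_eq_0)
  then show ?thesis by (simp add: poly_altdef mult.commute)
qed

section \<open>The discrete constraint and the error equation\<close>

context discrete_mixed
begin

abbreviation Q where "Q \<equiv> \<Q>\<^sub>1 \<times> \<Q>\<^sub>2"
abbreviation \<phi> where "\<phi> n s \<equiv> d (real n * k + k * s)"

lemma phi_cont: "n < N \<Longrightarrow> continuous_on {0..1} (\<phi> n)"
  by (rule continuous_on_compose2[OF d_cont]) (auto intro!: continuous_intros cell_within[of n, simplified])

lemma pd_cell_cont: "n < N \<Longrightarrow> continuous_on {0..1} (\<lambda>s. pd (real n * k + k * s))"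
  by (rule continuous_on_compose2[OF pd_cont]) (auto intro!: continuous_intros cell_within[of n, simplified])

lemma z_mem: "n < N \<Longrightarrow> vp q (z n) s \<in> \<U>" and cU_mem: "n < N \<Longrightarrow> vp q (cU n) s \<in> \<U>"
  and cP_mem: "n < N \<Longrightarrow> vp q (cP n) s \<in> \<Q>\<^sub>1"
  by (intro vp_mem sub z_U cU_U cP_Q; simp)+

lemma Q_sub: "subspace Q" by (intro subspace_Times sub)

lemma bs_cont: "r \<in> Q \<Longrightarrow> continuous_on A h \<Longrightarrow> continuous_on A (\<lambda>s. bs (h s) r)"
  by (rule bounded_linear.continuous_on[OF bounded_linear_bs])

lemma bs_vp: "r \<in> Q \<Longrightarrow> bs (vp q c s) r = vp q (\<lambda>j. bs (c j) r) s"
  by (rule vp_linear[OF bounded_linear.linear[OF bounded_linear_bs]])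

lemma cell_interior: assumes "n < N" "\<sigma> \<in> {0<..<1}" shows "real n * k + k * \<sigma> \<in> {0<..<T}"
proof -
  have "0 < k * \<sigma>" "k * \<sigma> < k * 1" using assms(2) k by (auto simp del: mult_1_right)
  then have "0 < real n * k + k * \<sigma>" "real n * k + k * \<sigma> < T"
    using cell_end(1)[OF assms(1)] cell_end(2)[of n] by linarith+
  then show ?thesis by simp
qed

lemma g_cell_integral:
  assumes r: "r \<in> Q" and n: "n < N" and G: "\<And>\<sigma>. \<sigma> \<in> {0<..1} \<Longrightarrow> G (real n * k + k * \<sigma>) = vp q e \<sigma>"
    and h: "continuous_on {0..1} h" "\<And>\<sigma>. H (real n * k + k * \<sigma>) = h \<sigma>"
  shows "(LINT s|lebesgue_on (cell t (Suc n)). (G s - g s r) * H s)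
    = k * (LINT s|UI. (vp q e s - bs (\<phi> n s) r) * h s)"
proof -
  obtain A where A: "negligible A" "\<And>s. s \<in> {0<..<T} \<Longrightarrow> s \<notin> A \<Longrightarrow> g s r = bs (d s) r"
    using AE_lebesgue_on_negligible[OF g_eq(1)[OF r]] by blast
  show ?thesis
  proof (rule LINT_cell(2)[OF n _ A(1)])
    show "(\<lambda>s. (vp q e s - bs (\<phi> n s) r) * h s) absolutely_integrable_on {0..1}"
      by (intro absolutely_integrable_continuous continuous_intros bs_cont r phi_cont n h)
    fix \<sigma> :: real assume \<sigma>: "\<sigma> \<in> {0<..<1}" "real n * k + k * \<sigma> \<notin> A"
    from A(2)[OF cell_interior[OF n \<sigma>(1)] \<sigma>(2)] show "(G (real n * k + k * \<sigma>) - g (real n * k + k * \<sigma>) r) * H (real n * k + k * \<sigma>)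
        = (vp q e \<sigma> - bs (\<phi> n \<sigma>) r) * h \<sigma>"
      using G[of \<sigma>] \<sigma>(1) h(2) by simp
  qed
qed

text \<open>\<open>B\<close> applied to the projection of \<open>u\<close> has the end values and
  moments required of I_q g, so the choice in \<open>Iq\<close> is not vacuous.\<close>

lemma z_is_Iq: "\<exists>G. is_Iq q N t Q g G"
proof -
  obtain Z where Z: "Z \<in> Pb q N t \<U>" "\<And>n \<sigma>. n < N \<Longrightarrow> \<sigma> \<in> {0<..1} \<Longrightarrow> Z (real n * k + k * \<sigma>) = vp q (z n) \<sigma>"
    using Pb_from_reference[where x = z and q = q, OF sub(1) z_U] by blast
  define G where "G s r = bs (Z s) r" for s r
  have "G \<in> Pb_dual q N t Q"
    unfolding Pb_dual_def
  proof (intro CollectI ballI)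
    fix n assume "n \<in> {1..N}"
    then obtain c where c: "\<And>j. j < q \<Longrightarrow> c j \<in> \<U>" "\<And>s. s \<in> cell t n \<Longrightarrow> Z s = vp q c s"
      using Z(1) unfolding Pb_def vp_def by blast
    have "G s r = (\<Sum>j<q. s ^ j * b_sum b1 b2 (c j) r)" if "s \<in> cell t n" "r \<in> Q" for s r
    proof -
      have "G s r = vp q (\<lambda>j. bs (c j) r) s" by (simp only: G_def c(2)[OF that(1)] bs_vp[OF that(2)])
      then show ?thesis using c(1) by (simp add: vp_def bs_eq)
    qed
    then show "\<exists>c. (\<forall>j<q. c j \<in> dual Q) \<and> (\<forall>s\<in>cell t n. \<forall>r\<in>Q. G s r = (\<Sum>j<q. s ^ j * c j r))"
      using b_sum_dual c(1) by (intro exI[of _ "\<lambda>j. b_sum b1 b2 (c j)"]) auto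
  qed
  moreover have "G (t n) r = g (t n) r \<and> (\<forall>\<psi>. degree \<psi> + 2 \<le> q \<longrightarrow> (LINT s|lebesgue_on (cell t n). (G s r - g s r) * poly \<psi> s) = 0)"
    if n: "n \<in> {1..N}" and r: "r \<in> Q" for n r
  proof -
    obtain m where m: "n = Suc m" "m < N" using n by (cases n) auto
    have Zr: "G (real m * k + k * \<sigma>) r = vp q (\<lambda>j. bs (z m j) r) \<sigma>" if "\<sigma> \<in> {0<..1}" for \<sigma>
      using Z(2)[OF m(2) that] by (simp add: G_def bs_vp r)
    have "t n = real m * k + k * 1" using m by (simp add: t_eq algebra_simps)
    then have "G (t n) r = bs (vp q (z m) 1) r" using Zr[of 1] by (simp add: bs_vp r)
    then have "G (t n) r = g (t n) r" using z_end[OF m(2)] g_eq(2)[OF r m(2)] m(1) by simp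
    moreover have "(LINT s|lebesgue_on (cell t n). (G s r - g s r) * poly \<psi> s) = 0" if "degree \<psi> + 2 \<le> q" for \<psi>
    proof -
      have "degree \<psi> < q - 1" using that by simp
      then obtain e where e: "\<And>s. poly \<psi> (real m * k + k * s) = vp (q - 1) e s"
        using vp_affine[OF subspace_UNIV, of "q - 1" "coeff \<psi>" "real m * k" k] poly_as_vp[of \<psi> "q - 1"] by auto
      obtain y where y: "\<And>x. bs x r = y \<bullet> x" using riesz_representation[OF bounded_linear_bs[OF r]] by blast
      have "(LINT s|lebesgue_on (cell t n). (G s r - g s r) * poly \<psi> s)
          = k * (LINT s|UI. (vp q (\<lambda>j. bs (z m j) r) s - bs (\<phi> m s) r) * vp (q - 1) e s)"
        unfolding m(1)
        by (rule g_cell_integral[where G = "\<lambda>s. G s r" and H = "poly \<psi>", OF r m(2) _ _ e])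
          (use Zr in \<open>auto intro!: continuous_intros continuous_on_vp[OF continuous_on_id]\<close>)
      also have "(LINT s|UI. (vp q (\<lambda>j. bs (z m j) r) s - bs (\<phi> m s) r) * vp (q - 1) e s)
          = (LINT s|UI. (\<Sum>i<q - 1. - e i * (s ^ i * (y \<bullet> (\<phi> m s - vp q (z m) s)))))"
      proof (rule Bochner_Integration.integral_cong[OF refl])
        fix s
        have "vp q (\<lambda>j. bs (z m j) r) s - bs (\<phi> m s) r = - (y \<bullet> (\<phi> m s - vp q (z m) s))"
          by (simp add: y inner_diff_right vp_inner)
        moreover have "- X * vp (q - 1) e s = (\<Sum>i<q - 1. - e i * (s ^ i * X))" for X :: real
          by (simp add: vp_def sum_distrib_left sum_negf mult_ac)
        ultimately show "(vp q (\<lambda>j. bs (z m j) r) s - bs (\<phi> m s) r) * vp (q - 1) e s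
            = (\<Sum>i<q - 1. - e i * (s ^ i * (y \<bullet> (\<phi> m s - vp q (z m) s))))" by (simp only:)
      qed
      also have "\<dots> = (\<Sum>i<q - 1. - e i * (LINT s|UI. s ^ i * (y \<bullet> (\<phi> m s - vp q (z m) s))))"
        by (subst Bochner_Integration.integral_sum) (auto intro!: integrable_UI continuous_intros phi_cont m)
      also have "\<dots> = 0" using z_moments[OF m(2)] by simp
      finally show ?thesis by simp
    qed
    ultimately show ?thesis by blast
  qed
  ultimately have "is_Iq q N t Q g G" unfolding is_Iq_def by blast
  then show ?thesis by blast
qed

text \<open>For fixed \<open>r\<close> both sides are scalar polynomials with the same end value and
  moments, and \<open>endpoint_moments_unique\<close> applies to their difference.\<close>

lemma Iq_eq:
  assumes n: "n < N" and \<sigma>: "\<sigma> \<in> {0<..1}" and r: "r \<in> Q"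
  shows "Iq q N t Q g (real n * k + k * \<sigma>) r = bs (vp q (z n) \<sigma>) r"
proof -
  define G where "G = Iq q N t Q g"
  have G: "is_Iq q N t Q g G" unfolding G_def Iq_def by (rule someI_ex[OF z_is_Iq])
  have nN: "Suc n \<in> {1..N}" using n by simp
  obtain c where c: "\<And>s r. s \<in> cell t (Suc n) \<Longrightarrow> r \<in> Q \<Longrightarrow> G s r = vp q (\<lambda>j. c j r) s"
    using G nN unfolding is_Iq_def Pb_dual_def vp_def by fastforce
  obtain e where e: "\<And>s. vp q (\<lambda>j. c j r) (real n * k + k * s) = vp q e s"
    using vp_affine[OF subspace_UNIV, of q "\<lambda>j. c j r" "real n * k" k] by auto
  have Ge: "G (real n * k + k * s) r = vp q e s" if "s \<in> {0<..1}" for s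
    using c[OF cell_point[OF n that] r] e by simp
  obtain y where y: "\<And>x. bs x r = y \<bullet> x" using riesz_representation[OF bounded_linear_bs[OF r]] by blast
  define \<delta> where "\<delta> j = e j - bs (z n j) r" for j
  have \<delta>: "vp q \<delta> s = vp q e s - bs (vp q (z n) s) r" for s by (simp add: \<delta>_def[abs_def] vp_diff bs_vp r)
  have end': "vp q \<delta> 1 = 0"
  proof -
    have "t (Suc n) = real n * k + k * 1" using n by (simp add: t_eq algebra_simps)
    moreover have "G (t (Suc n)) r = g (t (Suc n)) r" using G nN r unfolding is_Iq_def by blast
    ultimately have "vp q e 1 = g (t (Suc n)) r" using Ge[of 1] by simp
    then show ?thesis by (simp add: \<delta> z_end[OF n] g_eq(2)[OF r n])
  qed
  have mom: "(LINT s|UI. s ^ i * vp q \<delta> s) = 0" if i: "i + 1 < q" for i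
  proof -
    \<comment> \<open>The polynomial in t that becomes s^i in the reference variable.\<close>
    define \<psi> where "\<psi> = [:- real n, 1 / k:] ^ i"
    have "degree \<psi> \<le> i" unfolding \<psi>_def using degree_power_le[of "[:- real n, 1 / k:]" i] k by simp
    then have "degree \<psi> + 2 \<le> q" using i by simp
    then have "(LINT s|lebesgue_on (cell t (Suc n)). (G s r - g s r) * poly \<psi> s) = 0"
      using G nN r unfolding is_Iq_def by blast
    moreover have "poly \<psi> (real n * k + k * s) = s ^ i" for s using k by (simp add: \<psi>_def field_simps)
    ultimately have "k * (LINT s|UI. (vp q e s - bs (\<phi> n s) r) * s ^ i) = 0"
      using g_cell_integral[OF r n Ge, of "\<lambda>s. s ^ i" "poly \<psi>"] by (simp add: continuous_intros)
    then have "(LINT s|UI. (vp q e s - bs (\<phi> n s) r) * s ^ i) = 0" using k by simp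
    moreover have "(LINT s|UI. (vp q e s - bs (\<phi> n s) r) * s ^ i) + (LINT s|UI. s ^ i * (y \<bullet> (\<phi> n s - vp q (z n) s)))
        = (LINT s|UI. (vp q e s - bs (\<phi> n s) r) * s ^ i + s ^ i * (y \<bullet> (\<phi> n s - vp q (z n) s)))"
      by (intro UI_add[symmetric] continuous_intros bs_cont r phi_cont n)
    moreover have "(vp q e s - bs (\<phi> n s) r) * s ^ i + s ^ i * (y \<bullet> (\<phi> n s - vp q (z n) s)) = s ^ i * vp q \<delta> s" for s
      by (simp add: \<delta> y inner_diff_right algebra_simps)
    ultimately show ?thesis using z_moments[OF n i, of y] by simp
  qed
  obtain q' where q': "q = Suc q'" using q by (cases q) auto
  have "vp q \<delta> \<sigma> = 0"
    using endpoint_moments_unique[of q' \<delta> \<sigma>] end' mom unfolding q' by simp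
  then show ?thesis using Ge[OF \<sigma>] by (simp add: \<delta> G_def)
qed

text \<open>The constraint is tested with the defect itself: on one cell \<open>R\<close> is the
  scalar defect for a fixed \<open>r\<close> times \<open>r\<close>, and 0 on the others, so the
  squared defect integrates to 0. A polynomial that vanishes has zero coefficients.\<close>

lemma theta_V:
  assumes n: "n < N" and j: "j < q"
  shows "z n j - cU n j \<in> V"
proof -
  have "bs (z n j - cU n j) r = 0" if r: "r \<in> Q" for r
  proof -
    define e where "e j = bs (cU n j - z n j) r" for j
    have e: "vp q e s = bs (vp q (cU n) s) r - bs (vp q (z n) s) r" for s
      unfolding e_def[abs_def] using r
      by (simp add: bs_vp[OF r, symmetric] vp_diff linear_diff[OF bounded_linear.linear[OF bounded_linear_bs[OF r]]])
    obtain R where R: "R \<in> Pb q N t Q"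
      "\<And>m \<sigma>. m < N \<Longrightarrow> \<sigma> \<in> {0<..1} \<Longrightarrow> R (real m * k + k * \<sigma>) = vp q (\<lambda>j. if m = n then e j *\<^sub>R r else 0) \<sigma>"
    proof -
      have "\<exists>R\<in>Pb q N t Q. \<forall>m<N. \<forall>\<sigma>\<in>{0<..1}. R (real m * k + k * \<sigma>) = vp q (\<lambda>j. if m = n then e j *\<^sub>R r else 0) \<sigma>"
        using subspace_scale[OF Q_sub r] subspace_0[OF Q_sub] by (intro Pb_from_reference[OF Q_sub]) simp
      then show thesis using that by blast
    qed
    have Rn: "vp q (\<lambda>j. if m = n then e j *\<^sub>R r else 0) s = (if m = n then vp q e s *\<^sub>R r else 0)" for m s
      by (simp add: vp_def scaleR_sum_left)
    have lin: "b_sum b1 b2 x (c *\<^sub>R r) = c * b_sum b1 b2 x r" if "x \<in> \<U>" for x c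
    proof -
      have "linear_on Q (b_sum b1 b2 x)" using b_sum_dual[OF that] by (simp only: dual_def mem_Collect_eq)
      then show ?thesis using r unfolding linear_on_def real_scaleR_def by blast
    qed
    have zero: "b_sum b1 b2 x 0 = 0" if "x \<in> \<U>" for x using that by (simp add: b_sum_def b_zero)
    have eq: "(LINT s|lebesgue_on {0<..<T}. b_sum b1 b2 (U s) (R s)) = (LINT s|lebesgue_on {0<..<T}. Iq q N t Q g s (R s))"
      using DMP R(1) unfolding DMP_solution_def Let_def by blast
    have "(LINT s|lebesgue_on {0<..<T}. b_sum b1 b2 (U s) (R s))
        = k * (\<Sum>m<N. LINT s|UI. (if m = n then vp q e s * bs (vp q (cU n) s) r else 0))"
    proof (rule integral_cells(2)[OF _ negligible_empty])
      show "integrable UI (\<lambda>s. if m = n then vp q e s * bs (vp q (cU n) s) r else 0)" for m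
        by (cases "m = n") (auto intro!: integrable_UI continuous_intros bs_cont r)
      show "b_sum b1 b2 (U (real m * k + k * \<sigma>)) (R (real m * k + k * \<sigma>)) = (if m = n then vp q e \<sigma> * bs (vp q (cU n) \<sigma>) r else 0)"
        if "m < N" "\<sigma> \<in> {0<..<1}" for m \<sigma>
      proof -
        have "R (real m * k + k * \<sigma>) = (if m = n then vp q e \<sigma> *\<^sub>R r else 0)" using R(2)[of m \<sigma>] that by (simp add: Rn)
        then show ?thesis using that U_eq[of m \<sigma>] cU_mem[of m \<sigma>] by (cases "m = n") (simp_all add: lin zero bs_eq)
      qed
    qed
    moreover have "(LINT s|lebesgue_on {0<..<T}. Iq q N t Q g s (R s))
        = k * (\<Sum>m<N. LINT s|UI. (if m = n then vp q e s * bs (vp q (z n) s) r else 0))"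
    proof (rule integral_cells(2)[OF _ negligible_empty])
      show "integrable UI (\<lambda>s. if m = n then vp q e s * bs (vp q (z n) s) r else 0)" for m
        by (cases "m = n") (auto intro!: integrable_UI continuous_intros bs_cont r)
      show "Iq q N t Q g (real m * k + k * \<sigma>) (R (real m * k + k * \<sigma>)) = (if m = n then vp q e \<sigma> * bs (vp q (z n) \<sigma>) r else 0)"
        if m: "m < N" and \<sigma>: "\<sigma> \<in> {0<..<1}" for m \<sigma>
      proof -
        have s: "R (real m * k + k * \<sigma>) = (if m = n then vp q e \<sigma> *\<^sub>R r else 0)" using R(2)[of m \<sigma>] m \<sigma> by (simp add: Rn)
        then have "R (real m * k + k * \<sigma>) \<in> Q" using r by (auto simp: subspace_scale[OF Q_sub] subspace_0[OF Q_sub])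
        from Iq_eq[OF m _ this, of \<sigma>] \<sigma> show ?thesis
          using z_mem[OF m, of \<sigma>] s by (cases "m = n") (simp_all add: bs_eq lin zero)
      qed
    qed
    ultimately have "k * (\<Sum>m<N. LINT s|UI. (if m = n then vp q e s * bs (vp q (cU n) s) r else 0))
        = k * (\<Sum>m<N. LINT s|UI. (if m = n then vp q e s * bs (vp q (z n) s) r else 0))" using eq by argo
    moreover have "(\<Sum>m<N. LINT s|UI. (if m = n then h s else 0)) = (LINT s|UI. h s)" for h :: "real \<Rightarrow> real"
    proof -
      have "(LINT s|UI. (if m = n then h s else 0)) = (if m = n then (LINT s|UI. h s) else 0)" for m by simp
      then show ?thesis using n by simp
    qed
    ultimately have "(LINT s|UI. vp q e s * bs (vp q (cU n) s) r) = (LINT s|UI. vp q e s * bs (vp q (z n) s) r)"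
      using k by simp
    moreover have "(LINT s|UI. vp q e s * bs (vp q (cU n) s) r - vp q e s * bs (vp q (z n) s) r)
        = (LINT s|UI. vp q e s * bs (vp q (cU n) s) r) - (LINT s|UI. vp q e s * bs (vp q (z n) s) r)"
      by (intro UI_diff continuous_intros bs_cont r)
    moreover have "vp q e s * bs (vp q (cU n) s) r - vp q e s * bs (vp q (z n) s) r = 1 * (vp q e s)\<^sup>2" for s
      by (simp add: e power2_eq_square algebra_simps)
    ultimately have "(LINT s|UI. 1 * (vp q e s)\<^sup>2) = 0" by simp
    then have "vp q e s = 0" if "s \<in> {0<..<1}" for s
      using unit_weight.zero_if_weighted_integral_zero[OF continuous_on_vp[OF continuous_on_id], of q e s] that by auto
    then have "e j = 0" using j by (rule real_vp_zero_coeffs)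
    then show ?thesis
      using linear_diff[OF bounded_linear.linear[OF bounded_linear_bs[OF r]]] by (simp add: e_def)
  qed
  moreover have "z n j - cU n j \<in> \<U>" using z_U[OF n j] cU_U[OF n j] by (simp add: subspace_diff[OF sub(1)])
  ultimately show ?thesis by (auto simp: ker_form_def bs_eq)
qed

text \<open>Subtracts the discrete equation from \<open>f_eq\<close> integrated over the cells,
  after \<open>cell_integral_by_parts\<close> has rewritten the integrals of \<open>w\<close> as
  derivative and jump terms of the projection.\<close>

lemma galerkin_error:
  assumes x: "\<And>n j. n < N \<Longrightarrow> j < q \<Longrightarrow> x n j \<in> V2"
  shows "(\<Sum>n<N. (LINT s|UI. J (vd q (\<lambda>j. z n j - cU n j) s) \<bullet> J (vp q (x n) s))
        + (J (vp q (\<lambda>j. z n j - cU n j) 0) - prev (\<lambda>n. J (vp q (\<lambda>j. z n j - cU n j) 1)) n) \<bullet> J (vp q (x n) 0))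
    + k * (\<Sum>n<N. LINT s|UI. aa (\<phi> n s - vp q (z n) s + vp q (\<lambda>j. z n j - cU n j) s) (vp q (x n) s)
        + bb (vp q (x n) s) (pd (real n * k + k * s) - vp q (cP n) s)) = 0"
proof -
  interpret J: bounded_linear J by (rule bounded_linear_J)
  interpret aa: bounded_bilinear aa by (rule bounded_bilinear_aa)
  interpret bb: bounded_bilinear bb by (rule bounded_bilinear_bb)
  note J_lin = J.linear_axioms
  obtain X where X: "X \<in> Pb q N t V2" "\<And>n \<sigma>. n < N \<Longrightarrow> \<sigma> \<in> {0<..1} \<Longrightarrow> X (real n * k + k * \<sigma>) = vp q (x n) \<sigma>"
    using Pb_from_reference[where x = x and q = q, OF V2_subspace x] by blast
  have xV: "vp q (x n) s \<in> V2" if "n < N" for n s using x that by (intro vp_mem V2_subspace) auto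
  have xU: "vp q (x n) s \<in> \<U>" if "n < N" for n s using V2_U[OF xV[OF that]] .
  have DJ: "D_H N t (\<lambda>s. \<iota> (U s)) (\<lambda>s. \<iota> (X s)) = (\<Sum>n<N. (LINT s|UI. J (vd q (cU n) s) \<bullet> J (vp q (x n) s))
      + (J (vp q (cU n) 0) - prev (\<lambda>n. J (vp q (cU n) 1)) n) \<bullet> J (vp q (x n) 0))"
    unfolding vp_linear[OF J_lin] vd_linear[OF J_lin]
    by (rule D_H_reference) (use U_eq X(2) cU_mem xU in \<open>simp_all add: vp_linear[OF J_lin, symmetric] J_eq\<close>)
  have A: "(LINT s|lebesgue_on {0<..<T}. a (U s) (X s)) = k * (\<Sum>n<N. LINT s|UI. aa (vp q (cU n) s) (vp q (x n) s))"
  proof (rule integral_cells(2)[OF _ negligible_empty])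
    show "integrable UI (\<lambda>s. aa (vp q (cU n) s) (vp q (x n) s))" for n
      by (intro integrable_UI aa.continuous_on continuous_intros)
  qed (use U_eq X(2) cU_mem xU in \<open>auto simp: aa_eq\<close>)
  have B: "(LINT s|lebesgue_on {0<..<T}. b1 (X s) (P s)) = k * (\<Sum>n<N. LINT s|UI. bb (vp q (x n) s) (vp q (cP n) s))"
  proof (rule integral_cells(2)[OF _ negligible_empty])
    show "integrable UI (\<lambda>s. bb (vp q (x n) s) (vp q (cP n) s))" for n
      by (intro integrable_UI bb.continuous_on continuous_intros)
  qed (use P_eq X(2) cP_mem xU in \<open>auto simp: bb_eq\<close>)
  let ?pd = "\<lambda>n s. pd (real n * k + k * s)"
  have bbJ: "bounded_bilinear (\<lambda>u v. J u \<bullet> J v)"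
    using bounded_bilinear.comp[OF bounded_bilinear_inner bounded_linear_J bounded_linear_J] .
  have parts: "integrable UI (\<lambda>s. J (w (real n * k + k * s)) \<bullet> J (vp q (x n) s))"
    "k * (LINT s|UI. J (w (real n * k + k * s)) \<bullet> J (vp q (x n) s))
      = (LINT s|UI. J (vd q (z n) s) \<bullet> J (vp q (x n) s)) + J (vp q (z n) 0 - d (real n * k)) \<bullet> J (vp q (x n) 0)" if n: "n < N" for n
    using cell_integral_by_parts[where B = "\<lambda>u v. J u \<bullet> J v" and x = "x n", OF d_prim w_int cell_end(2) cell_end(1)[OF n] k z_end[OF n] z_moments[OF n] phi_cont[OF n] bbJ q]
    by auto
  \<comment> \<open>The test function has finitely many coefficients, so one null set serves all
    instances of \<open>f_eq\<close>.\<close>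
  have "\<exists>A. negligible A \<and> (\<forall>n<N. \<forall>j<q. \<forall>s\<in>{0<..<T} - A. f s (x n j) = J (w s) \<bullet> J (x n j) + aa (d s) (x n j) + bb (x n j) (pd s))"
  proof -
    have "AE s in lebesgue_on {0<..<T}. \<forall>n\<in>{..<N}. \<forall>j\<in>{..<q}. f s (x n j) = J (w s) \<bullet> J (x n j) + aa (d s) (x n j) + bb (x n j) (pd s)"
      using f_eq x by (intro AE_finite_allI) auto
    from AE_lebesgue_on_negligible[OF this] show ?thesis by (metis DiffE lessThan_iff)
  qed
  then obtain A' where A': "negligible A'" "\<And>n j s. n < N \<Longrightarrow> j < q \<Longrightarrow> s \<in> {0<..<T} \<Longrightarrow> s \<notin> A' \<Longrightarrow>
      f s (x n j) = J (w s) \<bullet> J (x n j) + aa (d s) (x n j) + bb (x n j) (pd s)" by blast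
  have fd: "f s \<in> dual V2" if "s \<in> {0<..<T}" for s
    using MP that by (auto simp: MP_solution_def Let_def L2_dual_def)
  have i3: "integrable UI (\<lambda>s. aa (\<phi> n s) (vp q (x n) s))" "integrable UI (\<lambda>s. bb (vp q (x n) s) (?pd n s))" if "n < N" for n
    using that by (auto intro!: integrable_UI aa.continuous_on bb.continuous_on continuous_intros phi_cont pd_cell_cont)
  have F: "(LINT s|lebesgue_on {0<..<T}. f s (X s)) = k * (\<Sum>n<N. LINT s|UI.
      J (w (real n * k + k * s)) \<bullet> J (vp q (x n) s) + aa (\<phi> n s) (vp q (x n) s) + bb (vp q (x n) s) (?pd n s))"
  proof (rule integral_cells(2)[OF _ A'(1)])
    show "integrable UI (\<lambda>s. J (w (real n * k + k * s)) \<bullet> J (vp q (x n) s) + aa (\<phi> n s) (vp q (x n) s) + bb (vp q (x n) s) (?pd n s))"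
      if "n < N" for n by (intro Bochner_Integration.integrable_add parts i3 that)
    fix n \<sigma> assume n: "n < N" and \<sigma>: "\<sigma> \<in> {0<..<(1::real)}" and nA: "real n * k + k * \<sigma> \<notin> A'"
    let ?s = "real n * k + k * \<sigma>"
    note s = cell_interior[OF n \<sigma>]
    have "f ?s (X ?s) = vp q (\<lambda>j. f ?s (x n j)) \<sigma>"
      using X(2)[OF n, of \<sigma>] \<sigma> vp_linear_on[OF _ V2_subspace, of "f ?s" q "x n" \<sigma>] fd[OF s] x[OF n] by (simp add: dual_def)
    also have "\<dots> = vp q (\<lambda>j. J (w ?s) \<bullet> J (x n j) + aa (d ?s) (x n j) + bb (x n j) (pd ?s)) \<sigma>"
      using A'(2)[OF n _ s nA] by (intro vp_cong) auto
    also have "\<dots> = J (w ?s) \<bullet> J (vp q (x n) \<sigma>) + aa (d ?s) (vp q (x n) \<sigma>) + bb (vp q (x n) \<sigma>) (pd ?s)"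
      by (rule vp_linear[symmetric]) (auto intro!: linearI simp: J.add J.scaleR inner_add_right aa.add_right aa.scaleR_right
          bb.add_left bb.scaleR_left algebra_simps)
    finally show "f ?s (X ?s) = J (w ?s) \<bullet> J (vp q (x n) \<sigma>) + aa (d ?s) (vp q (x n) \<sigma>) + bb (vp q (x n) \<sigma>) (pd ?s)" .
  qed
  have r0: "right_limit t (\<lambda>s. \<iota> (X s)) 0 = J (vp q (x 0) 0)"
  proof -
    have "right_limit t (\<lambda>s. \<iota> (X s)) 0 = vp q (\<lambda>j. J (x 0 j)) 0"
      by (rule right_limit_reference[OF N]) (use X(2)[OF N] xU[OF N] in \<open>simp add: vp_linear[OF J_lin, symmetric] J_eq\<close>)
    then show ?thesis by (simp add: vp_linear[OF J_lin])
  qed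
  have u0: "u0 \<bullet> J (vp q (x 0) 0) = J (d 0) \<bullet> J (vp q (x 0) 0)"
    using u0_eq[OF xV[OF N]] J_eq[OF xU[OF N]] by simp
  have main: "K_form \<iota> a T N t U X + (LINT s|lebesgue_on {0<..<T}. b1 (X s) (P s))
      = (LINT s|lebesgue_on {0<..<T}. f s (X s)) + u0 \<bullet> right_limit t (\<lambda>s. \<iota> (X s)) 0"
    using DMP X(1) unfolding DMP_solution_def Let_def by blast
  \<comment> \<open>At an inner node the previous cell of the projection ends in the value of
    \<open>d\<close>. On the first cell \<open>prev\<close> supplies 0 instead, and the missing term
    is the one that \<open>u0\<close> contributes to the discrete equation.\<close>
  have jump_z: "(J (vp q (z n) 0) - prev (\<lambda>n. J (vp q (z n) 1)) n) \<bullet> J (vp q (x n) 0)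
      = J (vp q (z n) 0 - d (real n * k)) \<bullet> J (vp q (x n) 0) + (if n = 0 then J (d 0) \<bullet> J (vp q (x 0) 0) else 0)" if n: "n < N" for n
  proof (cases n)
    case 0
    then show ?thesis by (simp add: prev_def J.diff inner_diff_left)
  next
    case (Suc m)
    then have "vp q (z m) 1 = d (real n * k)" using z_end[of m] n by (simp add: algebra_simps)
    then show ?thesis using Suc by (simp add: prev_def J.diff)
  qed
  define E where "E y n = (LINT s|UI. J (vd q (y n) s) \<bullet> J (vp q (x n) s))
      + (J (vp q (y n) 0) - prev (\<lambda>n. J (vp q (y n) 1)) n) \<bullet> J (vp q (x n) 0)" for y n
  define W where "W n = (LINT s|UI. J (w (real n * k + k * s)) \<bullet> J (vp q (x n) s))" for n
  define FF where "FF n = (LINT s|UI. J (w (real n * k + k * s)) \<bullet> J (vp q (x n) s) + aa (\<phi> n s) (vp q (x n) s) + bb (vp q (x n) s) (?pd n s))" for n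
  define AA where "AA n = (LINT s|UI. aa (vp q (cU n) s) (vp q (x n) s))" for n
  define BB where "BB n = (LINT s|UI. bb (vp q (x n) s) (vp q (cP n) s))" for n
  have sum_W: "k * (\<Sum>n<N. W n)
      + J (d 0) \<bullet> J (vp q (x 0) 0) = (\<Sum>n<N. E z n)"
  proof -
    have "(\<Sum>n<N. E z n) = (\<Sum>n<N. k * (LINT s|UI. J (w (real n * k + k * s)) \<bullet> J (vp q (x n) s))
        + (if n = 0 then J (d 0) \<bullet> J (vp q (x 0) 0) else 0))"
      using parts(2) jump_z by (intro sum.cong) (auto simp: E_def)
    then show ?thesis using N by (simp add: sum.distrib W_def sum_distrib_left)
  qed
  have diff: "E (\<lambda>n j. z n j - cU n j) n = E z n - E cU n" for n
  proof -
    have "(LINT s|UI. J (vd q (z n) s) \<bullet> J (vp q (x n) s) - J (vd q (cU n) s) \<bullet> J (vp q (x n) s))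
        = (LINT s|UI. J (vd q (z n) s) \<bullet> J (vp q (x n) s)) - (LINT s|UI. J (vd q (cU n) s) \<bullet> J (vp q (x n) s))"
      by (intro UI_diff continuous_intros J.continuous_on)
    moreover have pr: "prev (\<lambda>n. J (vp q (\<lambda>j. z n j - cU n j) 1)) n = prev (\<lambda>n. J (vp q (z n) 1)) n - prev (\<lambda>n. J (vp q (cU n) 1)) n"
      by (cases n) (simp_all add: prev_def vp_diff J.diff)
    ultimately show ?thesis
      unfolding E_def pr by (simp add: vd_diff vp_diff J.diff inner_diff_left)
  qed
  have cell: "(LINT s|UI. aa (\<phi> n s - vp q (z n) s + vp q (\<lambda>j. z n j - cU n j) s) (vp q (x n) s) + bb (vp q (x n) s) (?pd n s - vp q (cP n) s))
      = FF n - W n - AA n - BB n" if n: "n < N" for n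
  proof -
    have i: "integrable UI (\<lambda>s. aa (vp q (cU n) s) (vp q (x n) s))" "integrable UI (\<lambda>s. bb (vp q (x n) s) (vp q (cP n) s))"
      by (intro integrable_UI aa.continuous_on bb.continuous_on continuous_intros)+
    have "aa (\<phi> n s - vp q (z n) s + vp q (\<lambda>j. z n j - cU n j) s) (vp q (x n) s) + bb (vp q (x n) s) (?pd n s - vp q (cP n) s)
        = aa (\<phi> n s) (vp q (x n) s) + bb (vp q (x n) s) (?pd n s) - aa (vp q (cU n) s) (vp q (x n) s) - bb (vp q (x n) s) (vp q (cP n) s)" for s
      by (simp add: vp_diff aa.diff_left bb.diff_right)
    then show ?thesis using i i3[OF n] parts(1)[OF n] by (simp add: FF_def W_def AA_def BB_def)
  qed
  have "(\<Sum>n<N. E cU n) + k * (\<Sum>n<N. AA n) + k * (\<Sum>n<N. BB n) = k * (\<Sum>n<N. FF n) + J (d 0) \<bullet> J (vp q (x 0) 0)"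
    using main unfolding K_form_def DJ A B F r0 u0 by (simp only: E_def AA_def BB_def FF_def)
  moreover have "(\<Sum>n<N. E (\<lambda>n j. z n j - cU n j) n) = (\<Sum>n<N. E z n) - (\<Sum>n<N. E cU n)"
    by (simp add: diff sum_subtractf)
  moreover have "k * (\<Sum>n<N. FF n - W n - AA n - BB n)
      = k * (\<Sum>n<N. FF n) - k * (\<Sum>n<N. W n) - k * (\<Sum>n<N. AA n) - k * (\<Sum>n<N. BB n)"
    by (simp only: sum_subtractf right_diff_distrib)
  ultimately have "(\<Sum>n<N. E (\<lambda>n j. z n j - cU n j) n) + k * (\<Sum>n<N. FF n - W n - AA n - BB n) = 0"
    using sum_W by linarith
  then show ?thesis using cell by (simp add: E_def)
qed

end

section \<open>The pressure error\<close>

context uniform_grid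
begin

lemma sum_cells_mono:
  fixes e :: "nat \<Rightarrow> real \<Rightarrow> 'x::real_normed_vector"
  assumes "\<And>n. n < N \<Longrightarrow> continuous_on {0..1} (e n)"
    and "\<And>n s. n < N \<Longrightarrow> s \<in> {0..1} \<Longrightarrow> (norm (e n s))\<^sup>2 \<le> E n"
  shows "k * (\<Sum>n<N. LINT s|UI. (norm (e n s))\<^sup>2) \<le> k * (\<Sum>n<N. E n)"
proof (intro mult_left_mono sum_mono)
  fix n assume "n \<in> {..<N}"
  then have "(LINT s|UI. (norm (e n s))\<^sup>2) \<le> (LINT s|UI. E n)"
    using assms by (intro UI_mono) (auto intro!: continuous_intros)
  then show "(LINT s|UI. (norm (e n s))\<^sup>2) \<le> E n" by simp
qed (use k in simp)

lemma sum_integral_cells: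
  fixes F :: "real \<Rightarrow> real"
  assumes F: "F absolutely_integrable_on {0..T}"
  shows "(\<Sum>n<N. integral {real n * k..real n * k + k} F) = integral {0..T} F"
proof -
  have "(\<Sum>n<M. integral {real n * k..real n * k + k} F) = integral {0..real M * k} F" if "M \<le> N" for M
    using that
  proof (induction M)
    case (Suc M)
    have e: "real (Suc M) * k = real M * k + k" by (simp add: algebra_simps)
    have "F absolutely_integrable_on {0..real M * k + k}"
      using absolutely_integrable_subinterval[OF F, of 0 "real M * k + k"] cell_end[of M] Suc.prems by simp
    then have "integral {0..real M * k} F + integral {real M * k..real M * k + k} F = integral {0..real M * k + k} F"
      using k by (intro Henstock_Kurzweil_Integration.integral_combine) (auto simp: absolutely_integrable_on_def)
    then show ?case using Suc e by simp
  qed simp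
  then show ?thesis by (simp add: T_eq)
qed

end

context discrete_mixed
begin

lemma pressure_error:
  fixes zp :: "nat \<Rightarrow> nat \<Rightarrow> 'q1" and Iu Ip :: "nat \<Rightarrow> real"
  assumes k1: "k \<le> 1" and K: "K > 0"
    and K_u: "\<And>(d :: nat \<Rightarrow> 'u) j. j < q \<Longrightarrow> (norm (d j))\<^sup>2 \<le> K * (LINT s|UI. (norm (vp q d s))\<^sup>2)"
    and K_h: "\<And>(d :: nat \<Rightarrow> 'h) j. j < q \<Longrightarrow> (norm (d j))\<^sup>2 \<le> K * (LINT s|UI. s * (norm (vp q d s))\<^sup>2)"
    and K_q: "\<And>(d :: nat \<Rightarrow> 'q1) j. j < q \<Longrightarrow> (norm (d j))\<^sup>2 \<le> K * (LINT s|UI. (norm (vp q d s))\<^sup>2)"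
    and zp_Q: "\<And>n j. n < N \<Longrightarrow> j < q \<Longrightarrow> zp n j \<in> \<Q>\<^sub>1"
    and u_err: "\<And>n s. n < N \<Longrightarrow> s \<in> {0..1} \<Longrightarrow> (norm (\<phi> n s - vp q (z n) s))\<^sup>2 \<le> Iu n"
    and p_err: "\<And>n s. n < N \<Longrightarrow> s \<in> {0..1} \<Longrightarrow> (norm (pd (real n * k + k * s) - vp q (zp n) s))\<^sup>2 \<le> Ip n"
  shows "(LINT s|lebesgue_on {0<..<T}. (norm (p s - P s))\<^sup>2)
    \<le> 10 * (k * (\<Sum>n<N. Ip n)) + 4 * (pressure_const \<gamma> \<Gamma> \<beta> \<bar>\<kappa>\<bar> K q / k * (k * (\<Sum>n<N. Iu n)))"
proof -
  let ?pd = "\<lambda>n s. pd (real n * k + k * s)" and ?C = "pressure_const \<gamma> \<Gamma> \<beta> \<bar>\<kappa>\<bar> K q"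
  obtain L where L: "\<And>r. r \<in> \<Q>\<^sub>1 \<Longrightarrow> L r \<in> V2" "\<And>r. r \<in> \<Q>\<^sub>1 \<Longrightarrow> norm (L r) \<le> norm r / \<beta>"
    "\<And>r s. r \<in> \<Q>\<^sub>1 \<Longrightarrow> s \<in> \<Q>\<^sub>1 \<Longrightarrow> bb (L r) s = r \<bullet> s" "linear_on \<Q>\<^sub>1 L"
    by (rule inf_sup_lifting[OF V2_hilbert hilbert(3) bounded_bilinear_bb beta_pos inf_sup_V2]) blast+
  have V: "V \<subseteq> V2" "\<And>v r. v \<in> V \<Longrightarrow> r \<in> \<Q>\<^sub>1 \<Longrightarrow> bb v r = 0" "\<And>v. v \<in> V \<Longrightarrow> \<gamma> * (norm v)\<^sup>2 \<le> aa v v"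
    using V_iff V2_U a_coercive by (auto simp: bb_eq aa_eq)
  have eta: "continuous_on {0..1} (\<lambda>s. \<phi> n s - vp q (z n) s)" if "n < N" for n
    using phi_cont[OF that] by (intro continuous_intros)
  have pd_in: "?pd n s \<in> \<Q>\<^sub>1" if "n < N" "s \<in> {0..1}" for n s
    by (intro pd_Q cell_within that)
  \<comment> \<open>The absolute value makes the embedding bound nonnegative, as the abstract
    estimate demands.\<close>
  interpret cell_galerkin J aa bb V V2 \<Q>\<^sub>1 L \<gamma> \<Gamma> \<beta> "\<bar>\<kappa>\<bar>" K k q N
      "\<lambda>n s. \<phi> n s - vp q (z n) s" ?pd "\<lambda>n j. z n j - cU n j" zp cP
    by (rule cell_galerkin.intro)
      (fact bounded_linear_J bounded_bilinear_aa bounded_bilinear_bb norm_J_le aa_le V gamma_pos Gamma_pos beta_pos k k1 K q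
          V_subspace V2_subspace sub L K_u K_h K_q eta pd_cell_cont pd_in theta_V zp_Q cP_Q galerkin_error abs_ge_zero)+
  obtain A where A: "negligible A" "\<And>s. s \<in> {0<..<T} \<Longrightarrow> s \<notin> A \<Longrightarrow> pd s = p s"
    using AE_lebesgue_on_negligible[OF pd_p] by blast
  have "(LINT s|lebesgue_on {0<..<T}. (norm (p s - P s))\<^sup>2) = k * (\<Sum>n<N. LINT s|UI. (norm (?pd n s - vp q (cP n) s))\<^sup>2)"
  proof (rule integral_cells(2)[OF _ A(1)])
    show "integrable UI (\<lambda>s. (norm (?pd n s - vp q (cP n) s))\<^sup>2)" if "n < N" for n
      using pd_cell_cont[OF that] by (intro integrable_UI continuous_intros)
    show "(norm (p (real n * k + k * \<sigma>) - P (real n * k + k * \<sigma>)))\<^sup>2 = (norm (?pd n \<sigma> - vp q (cP n) \<sigma>))\<^sup>2"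
      if "n < N" "\<sigma> \<in> {0<..<1}" "real n * k + k * \<sigma> \<notin> A" for n \<sigma>
      using A(2)[OF cell_interior[OF that(1,2)] that(3)] P_eq[OF that(1), of \<sigma>] that(2) by simp
  qed
  also have "\<dots> \<le> k * (\<Sum>n<N. 2 * Ip n + 2 * (LINT s|UI. (norm (vp q (zp n) s - vp q (cP n) s))\<^sup>2))"
  proof (intro mult_left_mono sum_mono)
    fix n assume "n \<in> {..<N}"
    then have n: "n < N" by simp
    have "(LINT s|UI. (norm (?pd n s - vp q (cP n) s))\<^sup>2) \<le> (LINT s|UI. 2 * Ip n + 2 * (norm (vp q (zp n) s - vp q (cP n) s))\<^sup>2)"
    proof (rule UI_mono)
      fix s :: real assume s: "s \<in> {0..1}"
      have "norm (?pd n s - vp q (cP n) s) \<le> norm (?pd n s - vp q (zp n) s) + norm (vp q (zp n) s - vp q (cP n) s)"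
        using norm_triangle_ineq[of "?pd n s - vp q (zp n) s" "vp q (zp n) s - vp q (cP n) s"] by simp
      from order_trans[OF power_mono[OF this norm_ge_zero] square_add_le]
      show "(norm (?pd n s - vp q (cP n) s))\<^sup>2 \<le> 2 * Ip n + 2 * (norm (vp q (zp n) s - vp q (cP n) s))\<^sup>2"
        using p_err[OF n s] by simp
    qed (use pd_cell_cont[OF n] in \<open>auto intro!: continuous_intros\<close>)
    also have "\<dots> = 2 * Ip n + 2 * (LINT s|UI. (norm (vp q (zp n) s - vp q (cP n) s))\<^sup>2)"
      by (subst UI_add) (auto intro!: continuous_intros)
    finally show "(LINT s|UI. (norm (?pd n s - vp q (cP n) s))\<^sup>2)
      \<le> 2 * Ip n + 2 * (LINT s|UI. (norm (vp q (zp n) s - vp q (cP n) s))\<^sup>2)" .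
  qed (use k in simp)
  also have "\<dots> = 2 * (k * (\<Sum>n<N. Ip n)) + 2 * (k * (\<Sum>n<N. LINT s|UI. (norm (vp q (zp n) s - vp q (cP n) s))\<^sup>2))"
    by (simp add: sum.distrib sum_distrib_left[symmetric] distrib_left)
  \<comment> \<open>Splitting at the projection contributes 2, and 2 times the 4 of
    \<open>pressure\<close> raises it to 10; 2 times 2 is the final factor 4.\<close>
  also have "\<dots> \<le> 2 * (k * (\<Sum>n<N. Ip n)) + 2 * (2 * (?C / k * H) + 4 * Pe)"
    using pressure by simp
  also have "\<dots> \<le> 10 * (k * (\<Sum>n<N. Ip n)) + 4 * (?C / k * (k * (\<Sum>n<N. Iu n)))"
  proof -
    have "?C / k * H \<le> ?C / k * (k * (\<Sum>n<N. Iu n))"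
    proof (rule mult_left_mono)
      show "H \<le> k * (\<Sum>n<N. Iu n)" unfolding H_def using u_err by (intro sum_cells_mono eta)
    qed (use pressure_const_nonneg[OF gamma_pos Gamma_pos K] k in simp)
    moreover have "Pe \<le> k * (\<Sum>n<N. Ip n)"
      unfolding Pe_def using p_err pd_cell_cont by (intro sum_cells_mono) (auto intro!: continuous_intros)
    moreover have "2 * y + 2 * (2 * c + 4 * e) \<le> 10 * y + 4 * x" if "c \<le> x" "e \<le> y" for c e x y :: real
      using that by (simp add: distrib_left)
    ultimately show ?thesis by blast
  qed
  finally show ?thesis .
qed

end

lemma uniform_grid_if_time_grid:
  assumes g: "time_grid T N t" and k: "\<forall>n\<in>{1..N}. t n - t (n - 1) = k"
  shows "uniform_grid T k N t"
proof
  show N: "N > 0" using g by (simp add: time_grid_def)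
  show eq: "t n = real n * k" if "n \<le> N" for n
    using that
  proof (induction n)
    case (Suc n)
    have "t (Suc n) - t n = k" using k Suc.prems by (auto dest: bspec[where x = "Suc n"])
    then show ?case using Suc by (simp add: algebra_simps)
  qed (use g in \<open>simp add: time_grid_def\<close>)
  show "k > 0" using g k N by (auto simp: time_grid_def dest!: bspec[where x = 1])
  show "T = real N * k" using g eq[of N] by (simp add: time_grid_def)
qed

lemma L2_norm_square:
  assumes "u \<in> L2 {0<..<T} S"
  shows "(L2_norm {0<..<T} u)\<^sup>2 = integral {0..T} (\<lambda>t. (norm (u t))\<^sup>2)"
    "(\<lambda>t. (norm (u t))\<^sup>2) absolutely_integrable_on {0..T}"
proof -
  show i: "(\<lambda>t. (norm (u t))\<^sup>2) absolutely_integrable_on {0..T}"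
    using assms by (simp add: L2_def integrable_Ioo_iff)
  have "(LINT t|lebesgue_on {0<..<T}. (norm (u t))\<^sup>2) \<ge> 0" by simp
  then show "(L2_norm {0<..<T} u)\<^sup>2 = integral {0..T} (\<lambda>t. (norm (u t))\<^sup>2)"
    by (simp add: L2_norm_def LINT_Ioo[OF i])
qed

text \<open>The Taylor polynomial has \<open>m\<close> coefficients and \<open>m \<le> q\<close>, so
  it is an admissible competitor in the quasi-optimality of the projection.\<close>

lemma (in uniform_grid) cell_approximation:
  fixes u :: "real \<Rightarrow> 'a::{real_inner,complete_space,second_countable_topology}"
  assumes u: "u \<in> Hm {0<..<T} S m" and S: "hilbert_subspace S" and m: "1 \<le> m" "m \<le> q" and M: "M \<ge> 0"
    and proj: "\<forall>S \<phi>. hilbert_subspace S \<longrightarrow> continuous_on {0..1} \<phi> \<longrightarrow> (\<forall>s\<in>{0..1}. \<phi> s \<in> S) \<longrightarrow>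
      (\<exists>z :: nat \<Rightarrow> 'a. endpoint_projection q M S \<phi> z)"
  obtains d w z where "AE t in lebesgue_on {0<..<T}. d t = u t" "continuous_on {0..T} d" "primitive T d w"
    "\<And>x. (\<lambda>r. x \<bullet> w r) absolutely_integrable_on {0..T}"
    "\<And>n. n < N \<Longrightarrow> endpoint_projection q M S (\<lambda>s. d (real n * k + k * s)) (z n)"
    "\<And>n s. n < N \<Longrightarrow> s \<in> {0..1} \<Longrightarrow> (norm (d (real n * k + k * s) - vp q (z n) s))\<^sup>2
      \<le> M\<^sup>2 * (k ^ (2 * m - 1) * integral {real n * k..real n * k + k} (\<lambda>t. (norm (weak_deriv {0<..<T} m u t))\<^sup>2))"
proof -
  obtain D where D: "AE t in lebesgue_on {0<..<T}. D 0 t = u t"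
    "\<And>j. j < m \<Longrightarrow> primitive T (D j) (D (Suc j))" "\<And>j. j < m \<Longrightarrow> continuous_on {0..T} (D j)"
    "D m = weak_deriv {0<..<T} m u"
    by (rule Hm_representatives[OF T_pos u m(1)]) blast
  have Dm: "D m \<in> L2 {0<..<T} UNIV" using Hm_weak_deriv[OF u m(1)] D(4) by simp
  have cont: "continuous_on {0..T} (D 0)" using D(3) m by simp
  have D_S: "D 0 s \<in> S" if "s \<in> {0..T}" for s
  proof (rule continuous_in_closed_if_AE[OF T_pos cont _ _ that])
    show "AE t in lebesgue_on {0<..<T}. D 0 t \<in> S"
      using D(1) AE_space[of "lebesgue_on {0<..<T}"] by eventually_elim (use u in \<open>auto simp: Hm_def L2_def\<close>)
  qed (use S in \<open>simp add: hilbert_subspace_def\<close>)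
  have w: "(\<lambda>r. x \<bullet> D 1 r) absolutely_integrable_on {0..T}" for x
  proof (cases "m = 1")
    case True
    then show ?thesis using L2_absolutely_integrable[OF Dm bounded_linear_inner_right] by simp
  next
    case False
    then have "continuous_on {0..T} (D 1)" using D(3) m by simp
    then show ?thesis by (intro absolutely_integrable_continuous_real continuous_intros)
  qed
  have "\<exists>z. endpoint_projection q M S (\<lambda>s. D 0 (real n * k + k * s)) z \<and> (\<forall>s\<in>{0..1}. (norm (D 0 (real n * k + k * s) - vp q z s))\<^sup>2
      \<le> M\<^sup>2 * (k ^ (2 * m - 1) * integral {real n * k..real n * k + k} (\<lambda>t. (norm (D m t))\<^sup>2)))" if n: "n < N" for n
  proof -
    let ?\<phi> = "\<lambda>s. D 0 (real n * k + k * s)"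
      and ?E = "k ^ (2 * m - 1) * integral {real n * k..real n * k + k} (\<lambda>t. (norm (D m t))\<^sup>2)"
    have c: "continuous_on {0..1} ?\<phi>"
      by (rule continuous_on_compose2[OF cont]) (use n in \<open>auto intro!: continuous_intros cell_within[of n, simplified]\<close>)
    have "\<forall>s\<in>{0..1}. ?\<phi> s \<in> S" using D_S cell_within[OF n] by blast
    with proj c S obtain z where z: "endpoint_projection q M S ?\<phi> z" by blast
    have "0 \<le> real n * k" "real n * k + k \<le> T" using k cell_end(1)[OF n] by auto
    from cell_taylor[OF m(1) this k D(2,3) Dm]
    obtain e where e: "\<And>s. s \<in> {0..1} \<Longrightarrow> (norm (?\<phi> s - vp m e s))\<^sup>2 \<le> ?E" by blast
    have E: "?E \<ge> 0" using e[of 0] by (simp add: order_trans[OF zero_le_power2])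
    have "norm (?\<phi> s - vp q z s) \<le> M * sqrt ?E" if "s \<in> {0..1}" for s
    proof -
      have "\<forall>s\<in>{0..1}. norm (?\<phi> s - vp m e s) \<le> sqrt ?E" using e real_le_rsqrt by blast
      then show ?thesis using z m(2) that unfolding endpoint_projection_def by blast
    qed
    then have "(norm (?\<phi> s - vp q z s))\<^sup>2 \<le> (M * sqrt ?E)\<^sup>2" if "s \<in> {0..1}" for s
      using that by (intro power_mono) auto
    then show ?thesis using z E by (auto simp: power_mult_distrib)
  qed
  then have "\<forall>n\<in>{..<N}. \<exists>z. endpoint_projection q M S (\<lambda>s. D 0 (real n * k + k * s)) z \<and> (\<forall>s\<in>{0..1}. (norm (D 0 (real n * k + k * s) - vp q z s))\<^sup>2
      \<le> M\<^sup>2 * (k ^ (2 * m - 1) * integral {real n * k..real n * k + k} (\<lambda>t. (norm (D m t))\<^sup>2)))" by simp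
  from bchoice[OF this] obtain z where "\<forall>n\<in>{..<N}. endpoint_projection q M S (\<lambda>s. D 0 (real n * k + k * s)) (z n)
      \<and> (\<forall>s\<in>{0..1}. (norm (D 0 (real n * k + k * s) - vp q (z n) s))\<^sup>2
      \<le> M\<^sup>2 * (k ^ (2 * m - 1) * integral {real n * k..real n * k + k} (\<lambda>t. (norm (D m t))\<^sup>2)))" ..
  moreover have "primitive T (D 0) (D 1)" using D(2)[of 0] m by simp
  ultimately show thesis using D(4) by (intro that[OF D(1) cont _ w, of z]) auto
qed

text \<open>The outer factor \<open>k\<close> raises the exponent 2m - 1 to 2m. For the contribution
  of \<open>u\<close> to the pressure this gain is lost again to the factor 1/k.\<close>

lemma (in uniform_grid) sum_cell_errors:
  assumes "w \<in> L2 {0<..<T} S" "1 \<le> m"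
  shows "k * (\<Sum>n<N. M * (k ^ (2 * m - 1) * integral {real n * k..real n * k + k} (\<lambda>t. (norm (w t))\<^sup>2)))
    = M * (k ^ (2 * m) * (L2_norm {0<..<T} w)\<^sup>2)"
proof -
  have "k ^ (2 * m) = k * k ^ (2 * m - 1)" using assms(2) by (simp add: power_Suc[symmetric] del: power_Suc)
  then show ?thesis
    using sum_integral_cells[OF L2_norm_square(2)[OF assms(1)]] L2_norm_square(1)[OF assms(1)]
    by (simp add: sum_distrib_left[symmetric])
qed

text \<open>The squares of k^(m-1/2) and k^(1/2) are k^(2m-1) and k, and a sum of squares of
  nonnegative numbers is at most the square of their sum.\<close>

lemma power_half_weights:
  assumes k: "k > 0" and m: "1 \<le> m" and x: "x \<ge> 0" and y: "y \<ge> 0" and C: "C1 \<ge> 0" "C2 \<ge> 0"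
    and le: "E \<le> C1 * (k ^ (2 * m) * y\<^sup>2) + C2 * (k ^ (2 * m - 1) * x\<^sup>2)"
  shows "sqrt E \<le> sqrt (C1 + C2) * k powr (real m - 1 / 2) * (x + k powr (1 / 2) * y)"
proof (rule real_le_lsqrt)
  let ?a = "k powr (real m - 1 / 2)" and ?h = "k powr (1 / 2)"
  have a: "?a\<^sup>2 = k ^ (2 * m - 1)"
  proof -
    have "?a\<^sup>2 = k powr (real (2 * m - 1))" using m by (simp add: power2_eq_square powr_add[symmetric] of_nat_diff)
    then show ?thesis using k by (simp only: powr_realpow)
  qed
  have h: "?h\<^sup>2 = k" using k by (simp add: power2_eq_square powr_add[symmetric])
  have "k ^ (2 * m) = k ^ (2 * m - 1) * k" using m by (simp add: power_Suc2[symmetric] del: power_Suc)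
  then have "E \<le> C1 * (?a\<^sup>2 * (?h\<^sup>2 * y\<^sup>2)) + C2 * (?a\<^sup>2 * x\<^sup>2)" using le by (simp add: a h mult.assoc)
  also have "\<dots> \<le> (C1 + C2) * (?a\<^sup>2 * (?h\<^sup>2 * y\<^sup>2)) + (C1 + C2) * (?a\<^sup>2 * x\<^sup>2)"
    using C by (intro add_mono mult_right_mono) auto
  also have "\<dots> \<le> (C1 + C2) * (?a\<^sup>2 * (x + ?h * y)\<^sup>2)"
  proof -
    have "?h\<^sup>2 * y\<^sup>2 + x\<^sup>2 \<le> (x + ?h * y)\<^sup>2" using x y by (simp add: power2_sum power_mult_distrib)
    then have "(C1 + C2) * (?a\<^sup>2 * (?h\<^sup>2 * y\<^sup>2 + x\<^sup>2)) \<le> (C1 + C2) * (?a\<^sup>2 * (x + ?h * y)\<^sup>2)"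
      using C by (intro mult_left_mono) auto
    then show ?thesis by (simp add: distrib_left)
  qed
  also have "\<dots> = (sqrt (C1 + C2) * ?a * (x + ?h * y))\<^sup>2" using C by (simp add: power_mult_distrib)
  finally show "E \<le> (sqrt (C1 + C2) * ?a * (x + ?h * y))\<^sup>2" .
  show "0 \<le> sqrt (C1 + C2) * ?a * (x + ?h * y)" using x y C by simp
qed

theorem theorem5p4:
  fixes q :: nat and \<gamma> \<Gamma> \<beta> \<kappa> :: real
  assumes "q \<ge> 1"
  shows "\<exists>c::real.
    \<forall>(\<U> :: 'u::{real_inner, complete_space, second_countable_topology} set)
     (\<H> :: 'h::{real_inner, complete_space, second_countable_topology} set)
     (\<Q>\<^sub>1 :: 'q1::{real_inner, complete_space, second_countable_topology} set)
     (\<Q>\<^sub>2 :: 'q2::{real_inner, complete_space, second_countable_topology} set)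
     \<iota> a b1 b2 T f g u0 u p N t k U P m.
      mixed_setting \<U> \<H> \<Q>\<^sub>1 \<Q>\<^sub>2 \<iota> a b1 b2 \<gamma> \<Gamma> \<beta> \<kappa> \<longrightarrow>
      time_grid T N t \<longrightarrow>
      (\<forall>n\<in>{1..N}. t n - t (n - 1) = k) \<longrightarrow> k \<le> 1 \<longrightarrow>
      MP_solution \<U> \<H> \<Q>\<^sub>1 \<Q>\<^sub>2 \<iota> a b1 b2 T f g u0 u p \<longrightarrow>
      g \<in> L2c_dual T N t (\<Q>\<^sub>1 \<times> \<Q>\<^sub>2) \<longrightarrow>
      DMP_solution \<U> \<Q>\<^sub>1 \<Q>\<^sub>2 \<iota> a b1 b2 T q N t f g u0 U P \<longrightarrow>
      1 \<le> m \<longrightarrow> m \<le> q \<longrightarrow>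
      u \<in> Hm {0<..<T} \<U> m \<longrightarrow> p \<in> Hm {0<..<T} \<Q>\<^sub>1 m \<longrightarrow>
      L2_norm {0<..<T} (\<lambda>s. p s - P s)
      \<le> c * k powr (real m - 1 / 2)
          * (L2_norm {0<..<T} (weak_deriv {0<..<T} m u)
             + k powr (1 / 2) * L2_norm {0<..<T} (weak_deriv {0<..<T} m p))"
proof -
  \<comment> \<open>All constants of projection and norm equivalence are fixed before the spaces,
    the grid and the data; they come from \<open>q\<close> and the ambient types.\<close>
  obtain Mu where Mu: "Mu \<ge> 0" "\<forall>(S :: 'u set) \<phi>. hilbert_subspace S \<longrightarrow> continuous_on {0..1} \<phi> \<longrightarrow>
     (\<forall>s\<in>{0..1}. \<phi> s \<in> S) \<longrightarrow> (\<exists>z. endpoint_projection q Mu S \<phi> z)"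
    using endpoint_projection_exists[where q = "q - 1" and 'a = 'u] assms by auto
  obtain Mp where Mp: "Mp \<ge> 0" "\<forall>(S :: 'q1 set) \<phi>. hilbert_subspace S \<longrightarrow> continuous_on {0..1} \<phi> \<longrightarrow>
     (\<forall>s\<in>{0..1}. \<phi> s \<in> S) \<longrightarrow> (\<exists>z. endpoint_projection q Mp S \<phi> z)"
    using endpoint_projection_exists[where q = "q - 1" and 'a = 'q1] assms by auto
  obtain Ku where Ku: "Ku > 0" "\<And>(d :: nat \<Rightarrow> 'u) j. j < q \<Longrightarrow> (norm (d j))\<^sup>2 \<le> Ku * (LINT s|UI. (norm (vp q d s))\<^sup>2)"
    using unit_weight.coeff_norm_bound[where n = q and 'a = 'u] by auto
  obtain Kh where Kh: "Kh > 0" "\<And>(d :: nat \<Rightarrow> 'h) j. j < q \<Longrightarrow> (norm (d j))\<^sup>2 \<le> Kh * (LINT s|UI. s * (norm (vp q d s))\<^sup>2)"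
    using left_weight.coeff_norm_bound[where n = q and 'a = 'h] by auto
  obtain Kq where Kq: "Kq > 0" "\<And>(d :: nat \<Rightarrow> 'q1) j. j < q \<Longrightarrow> (norm (d j))\<^sup>2 \<le> Kq * (LINT s|UI. (norm (vp q d s))\<^sup>2)"
    using unit_weight.coeff_norm_bound[where n = q and 'a = 'q1] by auto
  \<comment> \<open>The sum dominates each of the three constants, so one \<open>K\<close> fits the
    abstract estimate.\<close>
  define K where "K = Ku + Kh + Kq"
  have K: "K > 0" "Ku \<le> K" "Kh \<le> K" "Kq \<le> K" using Ku(1) Kh(1) Kq(1) by (auto simp: K_def)
  have K_u: "(norm (d j))\<^sup>2 \<le> K * (LINT s|UI. (norm (vp q d s))\<^sup>2)" if "j < q" for d :: "nat \<Rightarrow> 'u" and j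
    using Ku(2)[OF that, of d] mult_right_mono[OF K(2), of "LINT s|UI. (norm (vp q d s))\<^sup>2"] by simp
  have K_q: "(norm (d j))\<^sup>2 \<le> K * (LINT s|UI. (norm (vp q d s))\<^sup>2)" if "j < q" for d :: "nat \<Rightarrow> 'q1" and j
    using Kq(2)[OF that, of d] mult_right_mono[OF K(4), of "LINT s|UI. (norm (vp q d s))\<^sup>2"] by simp
  have K_h: "(norm (d j))\<^sup>2 \<le> K * (LINT s|UI. s * (norm (vp q d s))\<^sup>2)" if "j < q" for d :: "nat \<Rightarrow> 'h" and j
  proof -
    have "(LINT s|UI. s * (norm (vp q d s))\<^sup>2) \<ge> 0" by (rule integral_nonneg_AE) (auto intro!: AE_I2)
    then show ?thesis using Kh(2)[OF that, of d] mult_right_mono[OF K(3), of "LINT s|UI. s * (norm (vp q d s))\<^sup>2"] by simp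
  qed
  let ?C = "pressure_const \<gamma> \<Gamma> \<beta> \<bar>\<kappa>\<bar> K q"
  show ?thesis
  proof (rule exI[of _ "sqrt (10 * Mp\<^sup>2 + 4 * ?C * Mu\<^sup>2)"], intro allI impI)
    fix \<U> :: "'u set" and \<H> :: "'h set" and \<Q>\<^sub>1 :: "'q1 set" and \<Q>\<^sub>2 :: "'q2 set"
      and \<iota> a b1 b2 T f g u0 u p N t k U P m
    assume setting: "mixed_setting \<U> \<H> \<Q>\<^sub>1 \<Q>\<^sub>2 \<iota> a b1 b2 \<gamma> \<Gamma> \<beta> \<kappa>" and grid: "time_grid T N t"
      and step: "\<forall>n\<in>{1..N}. t n - t (n - 1) = k" and k1: "k \<le> 1"
      and MP: "MP_solution \<U> \<H> \<Q>\<^sub>1 \<Q>\<^sub>2 \<iota> a b1 b2 T f g u0 u p"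
      and g: "g \<in> L2c_dual T N t (\<Q>\<^sub>1 \<times> \<Q>\<^sub>2)"
      and DMP: "DMP_solution \<U> \<Q>\<^sub>1 \<Q>\<^sub>2 \<iota> a b1 b2 T q N t f g u0 U P"
      and m: "1 \<le> m" "m \<le> q" and u: "u \<in> Hm {0<..<T} \<U> m" and p: "p \<in> Hm {0<..<T} \<Q>\<^sub>1 m"
    interpret S: mixed_setting \<U> \<H> \<Q>\<^sub>1 \<Q>\<^sub>2 \<iota> a b1 b2 \<gamma> \<Gamma> \<beta> \<kappa> by (fact setting)
    interpret G: uniform_grid T k N t by (rule uniform_grid_if_time_grid[OF grid step])
    let ?Iu = "\<lambda>n. Mu\<^sup>2 * (k ^ (2 * m - 1) * integral {real n * k..real n * k + k} (\<lambda>t. (norm (weak_deriv {0<..<T} m u t))\<^sup>2))"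
      and ?Ip = "\<lambda>n. Mp\<^sup>2 * (k ^ (2 * m - 1) * integral {real n * k..real n * k + k} (\<lambda>t. (norm (weak_deriv {0<..<T} m p t))\<^sup>2))"
    obtain d w z where d: "AE t in lebesgue_on {0<..<T}. d t = u t" "continuous_on {0..T} d" "primitive T d w"
      "\<And>x. (\<lambda>r. x \<bullet> w r) absolutely_integrable_on {0..T}"
      and z: "\<And>n. n < N \<Longrightarrow> endpoint_projection q Mu \<U> (\<lambda>s. d (real n * k + k * s)) (z n)"
      and u_err: "\<And>n s. n < N \<Longrightarrow> s \<in> {0..1} \<Longrightarrow> (norm (d (real n * k + k * s) - vp q (z n) s))\<^sup>2 \<le> ?Iu n"
      by (rule G.cell_approximation[OF u S.hilbert(1) m Mu]) blast
    obtain pd wp zp where pd: "AE t in lebesgue_on {0<..<T}. pd t = p t" "continuous_on {0..T} pd" "primitive T pd wp"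
      and zp: "\<And>n. n < N \<Longrightarrow> endpoint_projection q Mp \<Q>\<^sub>1 (\<lambda>s. pd (real n * k + k * s)) (zp n)"
      and p_err: "\<And>n s. n < N \<Longrightarrow> s \<in> {0..1} \<Longrightarrow> (norm (pd (real n * k + k * s) - vp q (zp n) s))\<^sup>2 \<le> ?Ip n"
      by (rule G.cell_approximation[OF p S.hilbert(3) m Mp]) blast
    have UP: "U \<in> Pb q N t \<U>" "P \<in> Pb q N t \<Q>\<^sub>1" using DMP by (auto simp: DMP_solution_def Let_def)
    obtain cU where cU: "\<And>n j. n < N \<Longrightarrow> j < q \<Longrightarrow> cU n j \<in> \<U>"
      "\<And>n \<sigma>. n < N \<Longrightarrow> \<sigma> \<in> {0<..1} \<Longrightarrow> U (real n * k + k * \<sigma>) = vp q (cU n) \<sigma>"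
      by (rule G.Pb_reference[OF UP(1) S.sub(1)]) blast
    obtain cP where cP: "\<And>n j. n < N \<Longrightarrow> j < q \<Longrightarrow> cP n j \<in> \<Q>\<^sub>1"
      "\<And>n \<sigma>. n < N \<Longrightarrow> \<sigma> \<in> {0<..1} \<Longrightarrow> P (real n * k + k * \<sigma>) = vp q (cP n) \<sigma>"
      by (rule G.Pb_reference[OF UP(2) S.sub(2)]) blast
    interpret E: discrete_mixed \<U> \<H> \<Q>\<^sub>1 \<Q>\<^sub>2 \<iota> a b1 b2 \<gamma> \<Gamma> \<beta> \<kappa> T k N t f g u0 u p q U P d w pd z cU cP
    proof (rule discrete_mixed.intro[OF setting G.uniform_grid_axioms], rule discrete_mixed_axioms.intro)
      show "q > 0" using assms by simp
      show "\<And>n j. n < N \<Longrightarrow> j < q \<Longrightarrow> z n j \<in> \<U>" "\<And>n. n < N \<Longrightarrow> vp q (z n) 1 = d (real n * k + k)"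
        "\<And>n x i. n < N \<Longrightarrow> i + 1 < q \<Longrightarrow> (LINT s|UI. s ^ i * (x \<bullet> (d (real n * k + k * s) - vp q (z n) s))) = 0"
        using z by (auto simp: endpoint_projection_def)
    qed (fact MP g DMP d pd cU cP)+
    have "(LINT s|lebesgue_on {0<..<T}. (norm (p s - P s))\<^sup>2)
      \<le> 10 * (k * (\<Sum>n<N. ?Ip n)) + 4 * (?C / k * (k * (\<Sum>n<N. ?Iu n)))"
      by (rule E.pressure_error[OF k1 K(1) K_u K_h K_q _ u_err p_err]) (use zp in \<open>auto simp: endpoint_projection_def\<close>)
    also have "\<dots> = 10 * Mp\<^sup>2 * (k ^ (2 * m) * (L2_norm {0<..<T} (weak_deriv {0<..<T} m p))\<^sup>2)
      + 4 * ?C * Mu\<^sup>2 * (k ^ (2 * m - 1) * (L2_norm {0<..<T} (weak_deriv {0<..<T} m u))\<^sup>2)"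
    proof -
      have "k ^ (2 * m) = k * k ^ (2 * m - 1)" using m by (simp add: power_Suc[symmetric] del: power_Suc)
      then show ?thesis
        using G.sum_cell_errors[OF conjunct1[OF Hm_weak_deriv[OF u m(1)]] m(1), of "Mu\<^sup>2"]
          G.sum_cell_errors[OF conjunct1[OF Hm_weak_deriv[OF p m(1)]] m(1), of "Mp\<^sup>2"] G.k
        by simp
    qed
    finally show "L2_norm {0<..<T} (\<lambda>s. p s - P s)
      \<le> sqrt (10 * Mp\<^sup>2 + 4 * ?C * Mu\<^sup>2) * k powr (real m - 1 / 2)
          * (L2_norm {0<..<T} (weak_deriv {0<..<T} m u)
             + k powr (1 / 2) * L2_norm {0<..<T} (weak_deriv {0<..<T} m p))"
      unfolding L2_norm_def[of _ "\<lambda>s. p s - P s"]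
      by (intro power_half_weights) (use G.k m pressure_const_nonneg[OF S.gamma_pos S.Gamma_pos K(1)] in \<open>auto simp: L2_norm_def\<close>)
  qed
qed

end
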